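(* Locally integrally equivalent number fields need not be locally isomorphic: there exist number fields $K_1$ and $K_2$ with a common Galois closure $L$ over $\mathbf{Q}$ such that $\mathrm{Gal}(L/K_1)$ and $\mathrm{Gal}(L/K_2)$ are locally integrally equivalent subgroups of $\mathrm{Gal}(L/\mathbf{Q})$, but $K_1$ and $K_2$ are not locally isomorphic.
   Context: For a finite group $G$, a subgroup $H\le G$ and a commutative ring $R$, $R[H\backslash G]$ denotes the permutation module: the free $R$-module with basis the set of right cosets of $H$ in $G$, with the $R$-linear extension of the right action of $G$ on cosets. Subgroups $H_1,H_2\le G$ are locally integrally equivalent if $\mathbf{Z}_p[H_1\backslash G]\simeq \mathbf{Z}_p[H_2\backslash G]$ as $\mathbf{Z}_p[G]$-modules for every prime $p$, where $\mathbf{Z}_p$ is the ring of $p$-adic integers. Two number fields $K_1$ and $K_2$ are locally isomorphic if there is a bijection between the places of $K_1$ and the places of $K_2$ such that the completions at corresponding places are isomorphic (both as topological rings and as $\mathbf{Q}_p$-algebras); equivalently, $K_1\otimes_{\mathbf{Q}}\mathbf{Q}_p\simeq K_2\otimes_{\mathbf{Q}}\mathbf{Q}_p$ for all $p\le\infty$ (with $\mathbf{Q}_\infty=\mathbf{R}$). *)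

theory Defs
  imports
    "HOL-Analysis.Analysis"
    "HOL-Algebra.Algebra"
    "HOL-Algebra.Algebraic_Closure_Type"
begin

section \<open>Number fields and Galois groups\<close>

text \<open>Every number field embeds into the complex numbers, so number fields are taken to be
  subfields of \<open>\<complex>\<close>, viewed as subsets of the carrier of the following ring.\<close>

abbreviation complex_ring :: "complex ring" where
  "complex_ring \<equiv> ring_of_type_algebra"

definition number_field :: "complex set \<Rightarrow> bool" where
  "number_field K \<longleftrightarrow> subfield K complex_ring \<and> ring.finite_dimension complex_ring \<rat> K"

text \<open>The group \<open>Gal(L/K)\<close> as a group of bijections of \<open>L\<close> under composition. The library set
  \<open>Bij L\<close> only contains functions that are \<open>undefined\<close> outside \<open>L\<close>, so an automorphism of
  \<open>L\<close> is represented by exactly one function.\<close>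

definition galois_group :: "complex set \<Rightarrow> complex set \<Rightarrow> (complex \<Rightarrow> complex) monoid" where
  "galois_group L K = BijGroup L \<lparr>carrier :=
     {\<sigma> \<in> Bij L. \<sigma> \<in> ring_hom (complex_ring\<lparr>carrier := L\<rparr>) (complex_ring\<lparr>carrier := L\<rparr>) \<and>
                 (\<forall>x\<in>K. \<sigma> x = x)}\<rparr>"

definition galois_over_Q :: "complex set \<Rightarrow> bool" where
  "galois_over_Q L \<longleftrightarrow> number_field L \<and>
     {x \<in> L. \<forall>\<sigma>\<in>carrier (galois_group L \<rat>). \<sigma> x = x} = \<rat>"

definition galois_closure :: "complex set \<Rightarrow> complex set \<Rightarrow> bool" where
  "galois_closure K L \<longleftrightarrow> galois_over_Q L \<and> K \<subseteq> L \<and>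
     (\<forall>M. galois_over_Q M \<and> K \<subseteq> M \<longrightarrow> L \<subseteq> M)"

section \<open>The ring of \<open>p\<close>-adic integers\<close>

text \<open>The inverse limit of the rings \<open>\<int>/p\<^sup>n\<int>\<close>: an element is a compatible sequence of residues,
  each given by its representative in \<open>{0..<p^n}\<close>.\<close>

definition padic_int :: "nat \<Rightarrow> (nat \<Rightarrow> int) ring" where
  "padic_int p = \<lparr>
     carrier = {x. \<forall>n. x n \<in> {0..<int p ^ n} \<and> x (Suc n) mod int p ^ n = x n},
     monoid.mult = (\<lambda>x y n. (x n * y n) mod int p ^ n),
     monoid.one = (\<lambda>n. 1 mod int p ^ n),
     ring.zero = (\<lambda>n. 0),
     ring.add = (\<lambda>x y n. (x n + y n) mod int p ^ n)\<rparr>"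

section \<open>Permutation modules\<close>

text \<open>\<open>R[H\G]\<close>: the function \<open>x\<close> stands for the formal sum of the \<open>x C \<cdot> C\<close> over the right
  cosets \<open>C\<close>; this is the free module on the cosets when there are finitely many of them. The fields
  \<open>mult\<close> and \<open>one\<close> are inherited by the module record from rings and carry no meaning here.\<close>

definition perm_module ::
  "('r, 'm) ring_scheme \<Rightarrow> ('g, 'n) monoid_scheme \<Rightarrow> 'g set \<Rightarrow> ('r, 'g set \<Rightarrow> 'r) module" where
  "perm_module R G H = \<lparr>
     carrier = (rcosets\<^bsub>G\<^esub> H) \<rightarrow>\<^sub>E carrier R,
     monoid.mult = undefined,
     monoid.one = undefined,
     ring.zero = (\<lambda>C\<in>rcosets\<^bsub>G\<^esub> H. \<zero>\<^bsub>R\<^esub>),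
     ring.add = (\<lambda>x y. \<lambda>C\<in>rcosets\<^bsub>G\<^esub> H. x C \<oplus>\<^bsub>R\<^esub> y C),
     module.smult = (\<lambda>a x. \<lambda>C\<in>rcosets\<^bsub>G\<^esub> H. a \<otimes>\<^bsub>R\<^esub> x C)\<rparr>"

text \<open>The basis element \<open>C\<close> is sent by \<open>g\<close> to \<open>C g\<close>, so the coefficient of \<open>x g\<close> at \<open>C\<close> is the
  coefficient of \<open>x\<close> at \<open>C g\<inverse>\<close>.\<close>

definition perm_action ::
  "('g, 'n) monoid_scheme \<Rightarrow> 'g set \<Rightarrow> ('g set \<Rightarrow> 'r) \<Rightarrow> 'g \<Rightarrow> ('g set \<Rightarrow> 'r)" where
  "perm_action G H x g = (\<lambda>C\<in>rcosets\<^bsub>G\<^esub> H. x (C #>\<^bsub>G\<^esub> inv\<^bsub>G\<^esub> g))"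

text \<open>An isomorphism of \<open>R[G]\<close>-modules is a bijective \<open>R\<close>-linear map commuting with \<open>G\<close>.\<close>

definition perm_modules_isomorphic ::
  "('r, 'm) ring_scheme \<Rightarrow> ('g, 'n) monoid_scheme \<Rightarrow> 'g set \<Rightarrow> 'g set \<Rightarrow> bool" where
  "perm_modules_isomorphic R G H1 H2 \<longleftrightarrow>
     (let M1 = perm_module R G H1; M2 = perm_module R G H2 in
      \<exists>T. bij_betw T (carrier M1) (carrier M2) \<and>
          (\<forall>x\<in>carrier M1. \<forall>y\<in>carrier M1. T (x \<oplus>\<^bsub>M1\<^esub> y) = T x \<oplus>\<^bsub>M2\<^esub> T y) \<and>
          (\<forall>a\<in>carrier R. \<forall>x\<in>carrier M1. T (a \<odot>\<^bsub>M1\<^esub> x) = a \<odot>\<^bsub>M2\<^esub> T x) \<and>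
          (\<forall>g\<in>carrier G. \<forall>x\<in>carrier M1.
             T (perm_action G H1 x g) = perm_action G H2 (T x) g))"

definition locally_integrally_equivalent ::
  "('g, 'n) monoid_scheme \<Rightarrow> 'g set \<Rightarrow> 'g set \<Rightarrow> bool" where
  "locally_integrally_equivalent G H1 H2 \<longleftrightarrow>
     subgroup H1 G \<and> subgroup H2 G \<and>
     (\<forall>p::nat. Factorial_Ring.prime p \<longrightarrow> perm_modules_isomorphic (padic_int p) G H1 H2)"

section \<open>Places and completions\<close>

text \<open>The value \<open>0\<close> outside \<open>K\<close> makes an absolute value on \<open>K\<close> a unique function, and makes
  \<open>\<lambda>x y. v (x - y)\<close> satisfy the library locale \<open>Metric_space K\<close>, whose nonnegativity and
  symmetry axioms are not relativized to \<open>K\<close>.\<close>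

definition absolute_value :: "complex set \<Rightarrow> (complex \<Rightarrow> real) \<Rightarrow> bool" where
  "absolute_value K v \<longleftrightarrow>
     (\<forall>x. x \<notin> K \<longrightarrow> v x = 0) \<and>
     (\<forall>x\<in>K. v x \<ge> 0 \<and> (v x = 0 \<longleftrightarrow> x = 0)) \<and>
     (\<forall>x\<in>K. \<forall>y\<in>K. v (x * y) = v x * v y) \<and>
     (\<forall>x\<in>K. \<forall>y\<in>K. v (x + y) \<le> v x + v y)"

definition nontrivial_absolute_values :: "complex set \<Rightarrow> (complex \<Rightarrow> real) set" where
  "nontrivial_absolute_values K = {v. absolute_value K v \<and> (\<exists>x\<in>K. x \<noteq> 0 \<and> v x \<noteq> 1)}"

definition equivalent_absolute_values ::
  "complex set \<Rightarrow> ((complex \<Rightarrow> real) \<times> (complex \<Rightarrow> real)) set" where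
  "equivalent_absolute_values K =
     {(v, w). v \<in> nontrivial_absolute_values K \<and> w \<in> nontrivial_absolute_values K \<and>
              (\<exists>s>0. \<forall>x\<in>K. w x = v x powr s)}"

definition places :: "complex set \<Rightarrow> (complex \<Rightarrow> real) set set" where
  "places K = nontrivial_absolute_values K // equivalent_absolute_values K"

definition cauchy_ring :: "complex set \<Rightarrow> (complex \<Rightarrow> real) \<Rightarrow> (nat \<Rightarrow> complex) ring" where
  "cauchy_ring K v = \<lparr>
     carrier = {s. Metric_space.MCauchy K (\<lambda>x y. v (x - y)) s},
     monoid.mult = (\<lambda>s t n. s n * t n),
     monoid.one = (\<lambda>n. 1),
     ring.zero = (\<lambda>n. 0),
     ring.add = (\<lambda>s t n. s n + t n)\<rparr>"

definition null_sequences :: "complex set \<Rightarrow> (complex \<Rightarrow> real) \<Rightarrow> (nat \<Rightarrow> complex) set" where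
  "null_sequences K v = {s \<in> carrier (cauchy_ring K v). (\<lambda>n. v (s n)) \<longlonglongrightarrow> 0}"

definition completion_ring :: "complex set \<Rightarrow> (complex \<Rightarrow> real) \<Rightarrow> (nat \<Rightarrow> complex) set ring" where
  "completion_ring K v = cauchy_ring K v Quot null_sequences K v"

definition completion_class ::
  "complex set \<Rightarrow> (complex \<Rightarrow> real) \<Rightarrow> (nat \<Rightarrow> complex) \<Rightarrow> (nat \<Rightarrow> complex) set" where
  "completion_class K v s = null_sequences K v +>\<^bsub>cauchy_ring K v\<^esub> s"

definition completion_dist ::
  "complex set \<Rightarrow> (complex \<Rightarrow> real) \<Rightarrow> (nat \<Rightarrow> complex) set \<Rightarrow> (nat \<Rightarrow> complex) set \<Rightarrow> real" where
  "completion_dist K v A B =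
     (if A \<in> carrier (completion_ring K v) \<and> B \<in> carrier (completion_ring K v)
      then THE r. \<exists>s\<in>A. \<exists>t\<in>B. (\<lambda>n. v (s n - t n)) \<longlonglongrightarrow> r
      else 0)"

definition completion_topology ::
  "complex set \<Rightarrow> (complex \<Rightarrow> real) \<Rightarrow> (nat \<Rightarrow> complex) set topology" where
  "completion_topology K v =
     Metric_space.mtopology (carrier (completion_ring K v)) (completion_dist K v)"

text \<open>The last two conjuncts say that \<open>f\<close> is an isomorphism of \<open>\<rat>\<^sub>p\<close>-algebras for the same
  \<open>p \<le> \<infinity>\<close> on both sides. Elements of \<open>\<rat>\<^sub>p\<close> are limits of sequences of rational numbers that are
  Cauchy for the restriction of \<open>v\<close>; the structure map from \<open>\<rat>\<^sub>p\<close> into the completion takes such a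
  sequence to its class. (Both conjuncts hold automatically for isomorphisms of topological rings.)\<close>

definition completions_isomorphic ::
  "complex set \<Rightarrow> (complex \<Rightarrow> real) \<Rightarrow> complex set \<Rightarrow> (complex \<Rightarrow> real) \<Rightarrow> bool" where
  "completions_isomorphic K v L w \<longleftrightarrow>
     (\<exists>f \<in> ring_iso (completion_ring K v) (completion_ring L w).
        homeomorphic_map (completion_topology K v) (completion_topology L w) f \<and>
        (\<forall>s. range s \<subseteq> \<rat> \<longrightarrow> (s \<in> carrier (cauchy_ring K v) \<longleftrightarrow> s \<in> carrier (cauchy_ring L w))) \<and>
        (\<forall>s \<in> carrier (cauchy_ring K v). range s \<subseteq> \<rat> \<longrightarrow>
           f (completion_class K v s) = completion_class L w s))"

text \<open>Equivalent absolute values have the same Cauchy and null sequences, so the choice of the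
  representatives \<open>v\<close> and \<open>w\<close> of the places is immaterial.\<close>

definition locally_isomorphic :: "complex set \<Rightarrow> complex set \<Rightarrow> bool" where
  "locally_isomorphic K1 K2 \<longleftrightarrow>
     (\<exists>\<phi>. bij_betw \<phi> (places K1) (places K2) \<and>
          (\<forall>P\<in>places K1. \<exists>v\<in>P. \<exists>w\<in>\<phi> P. completions_isomorphic K1 v K2 w))"

end

theory Submission
  imports Defs
begin

text \<open>Let \<open>\<theta>\<close> be the root \<open>r\<^sub>0 + r\<^sub>1 + r\<^sub>2\<close> of \<open>x\<^sup>4 + 6 x\<^sup>2 - 8 x - 3\<close>, where \<open>r\<^sub>j\<close> is a square root of
  \<open>\<omega>\<^sup>j t - 1\<close> with \<open>t\<^sup>3 = 2\<close>, \<open>\<omega>\<^sup>2 + \<omega> + 1 = 0\<close> and \<open>r\<^sub>0 r\<^sub>1 r\<^sub>2 = 1\<close>. Both fields are generated over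
  \<open>E = \<rat>(\<surd>7, \<surd>19, \<surd>((\<surd>19 + 4) \<surd>7), \<theta>)\<close> by a square root: \<open>K1 = E(\<surd>(\<theta> (\<surd>7 - 2)))\<close> and
  \<open>K2 = E(\<surd>(\<theta> (-\<surd>7 - 2)))\<close>. Their common Galois closure has degree 768.

  In its Galois group the stabilizers are \<open>\<langle>c, s, z\<rangle>\<close> and \<open>\<langle>c, s e, z\<rangle>\<close> with \<open>e\<close> a central involution.
  An element \<open>T\<close> of the integral group ring commuting with \<open>c\<close> and \<open>z\<close> and with \<open>T s = s e T\<close> induces
  a homomorphism between the permutation modules, and an element \<open>S\<close> of the same kind with
  \<open>T S = S T = m\<close> makes it an isomorphism over \<open>\<int>\<^sub>p\<close> for \<open>p\<close> prime to \<open>m\<close>. One such pair lives in the group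
  ring of a quaternion subgroup and has \<open>m = 3\<close>, another one in that of a subgroup of exponent 2
  and has \<open>m = 16\<close>, so every prime is covered.

  Since \<open>K1\<close> embeds into \<open>\<rat>\<^sub>3\<close>, a local isomorphism would give a place of \<open>K2\<close> with completion \<open>\<rat>\<^sub>3\<close>.
  The generators of \<open>K2\<close> would then satisfy their defining equations in \<open>\<int>\<^sub>3\<close>, but these have no
  solution modulo 9.\<close>

subsection \<open>Subfields of the complex numbers\<close>

text \<open>The elements \<open>i, j, k, c, s\<close> generate a copy of GL(2,3), in which
  \<open><c, s>\<close> and \<open><c, s e>\<close> are the stabilizers of a vector and of a
  covector. The pair built from \<open>i + j + k\<close> multiplies to 3, so it says nothing at the
  prime 3; there further automorphisms have to help. \<open>u\<close> conjugates \<open>s\<close> to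
  \<open>s e\<close> but takes \<open>z\<close> to \<open>z a\<close>; \<open>w\<close> commutes
  with \<open>z\<close> but takes \<open>s\<close> to \<open>s a\<close>. No single element does
  everything, yet each part of the group algebra cut out by the signs of \<open>e\<close> and
  \<open>a\<close> has its own conjugating element: 1 where e = 1, \<open>u\<close> where e = -1 and
  a = 1, \<open>w\<close> where e = a = -1. The operator with square 16 is 4 times the sum of these
  elements, each multiplied by the idempotent of its part. The radicands are chosen to produce these
  commutators. As \<open>sqrt_7 - 2\<close> and \<open>sqrt_19 + 4\<close> have norm -3, the
  quotients of conjugate radicals involve \<open>sqrt_m3\<close>, which \<open>s\<close> negates;
  the factor \<open>sqrt_7\<close> in the radicand of \<open>zz\<close> brings in
  \<open>sqrt_m7\<close>, which \<open>z\<close> negates.\<close>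

abbreviation csubfield :: "complex set \<Rightarrow> bool" where
  "csubfield F \<equiv> subfield F complex_ring"

lemma complex_ring_simps [simp]:
  "carrier complex_ring = UNIV" "x \<otimes>\<^bsub>complex_ring\<^esub> y = x * y" "x \<oplus>\<^bsub>complex_ring\<^esub> y = x + y"
  "\<one>\<^bsub>complex_ring\<^esub> = 1" "\<zero>\<^bsub>complex_ring\<^esub> = 0"
  by (simp_all add: ring_of_type_algebra_def)

lemma field_complex_ring: "field complex_ring"
  by (rule field_from_type_algebra)

lemma domain_complex_ring: "domain complex_ring"
  using field_complex_ring by (simp add: field_def)

lemma ring_complex_ring: "ring complex_ring"
  by (rule ring_from_type_algebra)

lemma complex_ring_pow [simp]: "x [^]\<^bsub>complex_ring\<^esub> (n::nat) = x ^ n"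
proof -
  interpret ring complex_ring by (rule ring_complex_ring)
  show ?thesis by (induction n) (simp_all add: mult.commute)
qed

lemma complex_ring_a_inv [simp]: "\<ominus>\<^bsub>complex_ring\<^esub> x = - x"
proof -
  interpret ring complex_ring by (rule ring_complex_ring)
  show ?thesis by (rule minus_equality) simp_all
qed

lemma complex_ring_m_inv: "x \<noteq> 0 \<Longrightarrow> inv\<^bsub>complex_ring\<^esub> x = inverse x"
proof -
  assume x: "x \<noteq> 0"
  interpret field complex_ring by (rule field_complex_ring)
  show ?thesis using x by (intro comm_inv_char) simp_all
qed

lemma csubfieldI:
  assumes "1 \<in> F" "\<And>x. x \<in> F \<Longrightarrow> - x \<in> F" "\<And>x y. x \<in> F \<Longrightarrow> y \<in> F \<Longrightarrow> x * y \<in> F"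
    "\<And>x y. x \<in> F \<Longrightarrow> y \<in> F \<Longrightarrow> x + y \<in> F" "\<And>x. x \<in> F \<Longrightarrow> x \<noteq> 0 \<Longrightarrow> inverse x \<in> F"
  shows "csubfield F"
proof -
  interpret field complex_ring by (rule field_complex_ring)
  show ?thesis
    by (rule subfieldI', rule subringI) (use assms in \<open>auto simp: complex_ring_m_inv\<close>)
qed

lemma csubfield_basic:
  assumes "csubfield F"
  shows "0 \<in> F" "1 \<in> F" "x \<in> F \<Longrightarrow> - x \<in> F" "x \<in> F \<Longrightarrow> y \<in> F \<Longrightarrow> x * y \<in> F"
    "x \<in> F \<Longrightarrow> y \<in> F \<Longrightarrow> x + y \<in> F"
proof -
  have s: "subring F complex_ring" using assms subfieldE(1) subcring.axioms(1) by blast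
  show "0 \<in> F" "1 \<in> F" "x \<in> F \<Longrightarrow> - x \<in> F" "x \<in> F \<Longrightarrow> y \<in> F \<Longrightarrow> x * y \<in> F"
    "x \<in> F \<Longrightarrow> y \<in> F \<Longrightarrow> x + y \<in> F"
    using subringE[OF s] by simp_all
qed

lemma csubfield_inverse: "csubfield F \<Longrightarrow> x \<in> F \<Longrightarrow> inverse x \<in> F"
proof -
  assume F: "csubfield F" and x: "x \<in> F"
  interpret field complex_ring by (rule field_complex_ring)
  show ?thesis
    using subfield_m_inv(1)[OF F, of x] x complex_ring_m_inv[of x] csubfield_basic(1)[OF F]
    by (cases "x = 0") auto
qed

lemma csubfield_diff: "csubfield F \<Longrightarrow> x \<in> F \<Longrightarrow> y \<in> F \<Longrightarrow> x - y \<in> F"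
  using csubfield_basic(3,5)[of F] by (metis add_uminus_conv_diff)

lemma csubfield_divide: "csubfield F \<Longrightarrow> x \<in> F \<Longrightarrow> y \<in> F \<Longrightarrow> x / y \<in> F"
  by (simp add: divide_inverse csubfield_basic csubfield_inverse)

lemma csubfield_of_nat: "csubfield F \<Longrightarrow> of_nat n \<in> F"
  by (induction n) (simp_all add: csubfield_basic)

lemma csubfield_of_int: "csubfield F \<Longrightarrow> of_int n \<in> F"
  by (cases n) (simp_all add: csubfield_basic csubfield_of_nat del: of_nat_Suc)

lemma csubfield_numeral: "csubfield F \<Longrightarrow> numeral n \<in> F"
  using csubfield_of_nat[of F "numeral n"] by simp

lemma csubfield_power: "csubfield F \<Longrightarrow> x \<in> F \<Longrightarrow> x ^ n \<in> F"
  by (induction n) (simp_all add: csubfield_basic)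

lemma csubfield_sum: "csubfield F \<Longrightarrow> (\<And>i. i \<in> A \<Longrightarrow> f i \<in> F) \<Longrightarrow> sum f A \<in> F"
  by (induction A rule: infinite_finite_induct) (simp_all add: csubfield_basic)

lemmas csubfield_closed = csubfield_basic csubfield_inverse csubfield_diff csubfield_divide
  csubfield_of_nat csubfield_of_int csubfield_numeral csubfield_power

lemma csubfield_Rats: "csubfield \<rat>"
  by (rule csubfieldI) auto

lemma Rats_subset_csubfield:
  assumes "csubfield F" shows "\<rat> \<subseteq> F"
proof
  fix x :: complex assume "x \<in> \<rat>"
  then obtain a b :: int where "x = of_int a / of_int b"
    by (metis Rats_cases' )
  then show "x \<in> F" using assms by (simp add: csubfield_closed)
qed

subsection \<open>Adjoining an element\<close>

text \<open>Only values of polynomials are taken: for algebraic \<open>x\<close> these already form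
  a field, and a homomorphism can be extended by applying it to the coefficients.\<close>

definition adjoin :: "complex set \<Rightarrow> complex \<Rightarrow> complex set" where
  "adjoin F x = {poly p x |p. \<forall>i. poly.coeff p i \<in> F}"

text \<open>Bridge to the algebra library, where \<open>simple_extension\<close> is generated by
  Horner steps \<open>k1 * x + k2\<close>; hence both inclusions are inductions that peel off one
  coefficient.\<close>

lemma adjoin_eq_simple_extension:
  assumes F: "csubfield F"
  shows "adjoin F x = ring.simple_extension complex_ring F x"
proof -
  interpret ring complex_ring by (rule ring_complex_ring)
  have "poly p x \<in> simple_extension F x" if "\<forall>i. poly.coeff p i \<in> F" for p
    using that
  proof (induction p)
    case (pCons k p)
    have "poly.coeff p i \<in> F" for i
      using spec[OF pCons.prems, of "Suc i"] by simp
    then have "poly p x \<in> simple_extension F x" using pCons.IH by simp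
    moreover have "k \<in> F" using spec[OF pCons.prems, of 0] by simp
    ultimately have "poly p x * x + k \<in> simple_extension F x"
      using simple_extension.lin[of "poly p x" F x k] by simp
    then show ?case by (simp add: algebra_simps)
  qed (use simple_extension.zero[of F x] in simp)
  moreover have "z \<in> adjoin F x" if "z \<in> simple_extension F x" for z
    using that
  proof induction
    case zero
    then show ?case
      using csubfield_basic(1)[OF F] by (auto simp: adjoin_def intro!: exI[of _ 0])
  next
    case (lin k1 k2)
    then obtain p where p: "k1 = poly p x" "\<forall>i. poly.coeff p i \<in> F" by (auto simp: adjoin_def)
    have "poly.coeff (pCons k2 p) i \<in> F" for i
      using p lin by (cases i) auto
    then show ?case
      unfolding adjoin_def by (intro CollectI exI[of _ "pCons k2 p"]) (simp add: p mult.commute)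
  qed
  ultimately show ?thesis unfolding adjoin_def by blast
qed

lemma adjoin_base: "csubfield F \<Longrightarrow> a \<in> F \<Longrightarrow> a \<in> adjoin F x"
  unfolding adjoin_def
  by (intro CollectI exI[of _ "[:a:]"]) (auto simp: coeff_pCons csubfield_basic split: nat.splits)

lemma adjoin_self: "csubfield F \<Longrightarrow> x \<in> adjoin F x"
  unfolding adjoin_def
  by (intro CollectI exI[of _ "[:0, 1:]"]) (auto simp: coeff_pCons csubfield_basic split: nat.splits)

lemma adjoin_least:
  assumes "csubfield M" "F \<subseteq> M" "x \<in> M"
  shows "adjoin F x \<subseteq> M"
proof -
  have "poly p x \<in> M" if "\<forall>i. poly.coeff p i \<in> F" for p
    unfolding poly_altdef using that assms
    by (intro csubfield_sum csubfield_closed) auto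
  then show ?thesis by (auto simp: adjoin_def)
qed

text \<open>The coefficient list runs from the highest degree downwards, so the leading 1 makes it a
  nonzero polynomial over \<open>F\<close> with root \<open>x\<close>; algebraicity of
  \<open>x\<close> then yields both conclusions.\<close>

lemma adjoin_algebraic:
  assumes F: "csubfield F" and cs: "set cs \<subseteq> F" and x: "ring.eval complex_ring (1 # cs) x = 0"
  shows "csubfield (adjoin F x)"
    and "ring.finite_dimension complex_ring F (adjoin F x)"
proof -
  interpret domain complex_ring by (rule domain_complex_ring)
  have "1 # cs \<in> carrier (F [X]\<^bsub>complex_ring\<^esub>)"
    using cs csubfield_basic(2)[OF F] by (simp add: univ_poly_def polynomial_def)
  then have alg: "(algebraic over F) x"
    by (rule algebraicI) (use x in simp_all)
  show "csubfield (adjoin F x)"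
    using simple_extension_is_subfield[OF F, of x] alg adjoin_eq_simple_extension[OF F] by simp
  show "finite_dimension F (adjoin F x)"
    using finite_dimension_simple_extension[OF F, of x] alg adjoin_eq_simple_extension[OF F] by simp
qed

lemma number_field_Rats: "number_field \<rat>"
proof -
  interpret ring complex_ring by (rule ring_complex_ring)
  show ?thesis
    using csubfield_Rats dimension_one[OF csubfield_Rats] finite_dimensionI
    unfolding number_field_def by blast
qed

lemma number_field_adjoin:
  assumes F: "number_field F" and cs: "set cs \<subseteq> F" and x: "ring.eval complex_ring (1 # cs) x = 0"
  shows "number_field (adjoin F x)"
proof -
  interpret ring complex_ring by (rule ring_complex_ring)
  have sf: "csubfield F" using F by (simp add: number_field_def)
  show ?thesis
    using adjoin_algebraic[OF sf cs x] F telescopic_base_dim(1)[OF csubfield_Rats sf]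
    unfolding number_field_def by blast
qed

lemma number_field_adjoin_sqrt:
  assumes F: "number_field F" and x: "x ^ 2 \<in> F"
  shows "number_field (adjoin F x)"
proof (rule number_field_adjoin[OF F, of "[0, - (x * x)]"])
  interpret ring complex_ring by (rule ring_complex_ring)
  have sf: "csubfield F" using F by (simp add: number_field_def)
  show "set [0, - (x * x)] \<subseteq> F" using x sf by (auto simp: csubfield_basic power2_eq_square)
  show "eval [1, 0, - (x * x)] x = 0"
    by (simp add: power2_eq_square)
qed

lemma csubfield_number_field: "number_field F \<Longrightarrow> csubfield F"
  by (simp add: number_field_def)

subsection \<open>Extension of homomorphisms\<close>

text \<open>The target is a general commutative ring because the same extension lemmas serve the
  automorphisms of complex fields and, later, the embedding of \<open>K1\<close> into the 3-adic
  numbers. Apart from \<open>\<sigma> 1 = 1\<close>, the conditions only concern elements of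
  \<open>F\<close>.\<close>

definition hom_on :: "complex set \<Rightarrow> (complex \<Rightarrow> 'b::comm_ring_1) \<Rightarrow> bool" where
  "hom_on F \<sigma> \<longleftrightarrow> \<sigma> 1 = 1 \<and>
     (\<forall>x\<in>F. \<forall>y\<in>F. \<sigma> (x + y) = \<sigma> x + \<sigma> y \<and> \<sigma> (x * y) = \<sigma> x * \<sigma> y)"

context
  fixes F :: "complex set" and \<sigma> :: "complex \<Rightarrow> 'b::comm_ring_1"
  assumes F: "csubfield F" and hom: "hom_on F \<sigma>"
begin

lemma hom_on_one: "\<sigma> 1 = 1"
  and hom_on_add: "x \<in> F \<Longrightarrow> y \<in> F \<Longrightarrow> \<sigma> (x + y) = \<sigma> x + \<sigma> y"
  and hom_on_mult: "x \<in> F \<Longrightarrow> y \<in> F \<Longrightarrow> \<sigma> (x * y) = \<sigma> x * \<sigma> y"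
  using hom by (auto simp: hom_on_def)

lemma hom_on_zero: "\<sigma> 0 = 0"
  using hom_on_add[of 0 0] csubfield_basic(1)[OF F] by simp

lemma hom_on_minus: "x \<in> F \<Longrightarrow> \<sigma> (- x) = - \<sigma> x"
  using hom_on_add[of x "- x"] csubfield_basic(3)[OF F] hom_on_zero by (simp add: eq_neg_iff_add_eq_0 add.commute)

lemma hom_on_diff: "x \<in> F \<Longrightarrow> y \<in> F \<Longrightarrow> \<sigma> (x - y) = \<sigma> x - \<sigma> y"
  using hom_on_add[of x "- y"] hom_on_minus[of y] csubfield_basic(3)[OF F] by simp

lemma hom_on_power: "x \<in> F \<Longrightarrow> \<sigma> (x ^ n) = \<sigma> x ^ n"
  by (induction n) (simp_all add: hom_on_one hom_on_mult csubfield_power[OF F])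

lemma hom_on_of_nat: "\<sigma> (of_nat n) = of_nat n"
  by (induction n) (simp_all add: hom_on_one hom_on_zero hom_on_add csubfield_closed[OF F])

lemma hom_on_numeral: "\<sigma> (numeral n) = numeral n"
  using hom_on_of_nat[of "numeral n"] by simp

lemma hom_on_of_int: "\<sigma> (of_int n) = of_int n"
  by (cases n)
    (simp_all add: hom_on_minus hom_on_of_nat csubfield_closed[OF F] del: of_nat_Suc)

lemma hom_on_sum: "(\<And>i. i \<in> A \<Longrightarrow> f i \<in> F) \<Longrightarrow> \<sigma> (sum f A) = (\<Sum>i\<in>A. \<sigma> (f i))"
  by (induction A rule: infinite_finite_induct)
    (simp_all add: hom_on_zero hom_on_add csubfield_sum[OF F])

text \<open>The hypothesis is exactly the well-definedness of sending \<open>poly p x\<close> to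
  \<open>poly (map_poly \<sigma> p) y\<close>, so no minimal polynomial has to be formed.\<close>

lemma hom_extend:
  assumes spec: "\<And>p. \<forall>i. poly.coeff p i \<in> F \<Longrightarrow> poly p x = 0 \<Longrightarrow> poly (map_poly \<sigma> p) y = 0"
  obtains \<tau> where "hom_on (adjoin F x) \<tau>" "\<And>a. a \<in> F \<Longrightarrow> \<tau> a = \<sigma> a" "\<tau> x = y"
proof -
  define P where "P = {p. \<forall>i. poly.coeff p i \<in> F}"
  \<comment> \<open>Any polynomial representing \<open>z\<close> will do: two of them differ by a
    relation of \<open>x\<close>, which \<open>y\<close> inherits.\<close>
  define \<tau> where "\<tau> z = poly (map_poly \<sigma> (SOME p. p \<in> P \<and> poly p x = z)) y" for z
  note coeff_map = coeff_map_poly[of \<sigma>, OF hom_on_zero]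
  have map_add: "map_poly \<sigma> (p + q) = map_poly \<sigma> p + map_poly \<sigma> q" if "p \<in> P" "q \<in> P" for p q
    using that by (intro poly_eqI) (auto simp: coeff_map hom_on_add P_def)
  have map_minus: "map_poly \<sigma> (- p) = - map_poly \<sigma> p" if "p \<in> P" for p
    using that by (intro poly_eqI) (auto simp: coeff_map hom_on_minus P_def)
  have map_mult: "map_poly \<sigma> (p * q) = map_poly \<sigma> p * map_poly \<sigma> q" if "p \<in> P" "q \<in> P" for p q
    using that
    by (intro poly_eqI)
      (auto simp: coeff_map hom_on_mult P_def coeff_mult hom_on_sum csubfield_closed[OF F])
  have P_add: "p + q \<in> P" if "p \<in> P" "q \<in> P" for p q
    using that by (auto simp: P_def csubfield_closed[OF F])
  have P_minus: "- p \<in> P" if "p \<in> P" for p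
    using that by (auto simp: P_def csubfield_closed[OF F])
  have P_mult: "p * q \<in> P" if "p \<in> P" "q \<in> P" for p q
    using that by (auto simp: P_def coeff_mult csubfield_closed[OF F] intro!: csubfield_sum[OF F])
  have \<tau>: "\<tau> (poly p x) = poly (map_poly \<sigma> p) y" if p: "p \<in> P" for p
  proof -
    define q where "q = (SOME q. q \<in> P \<and> poly q x = poly p x)"
    have q: "q \<in> P" "poly q x = poly p x"
      using someI[of "\<lambda>q. q \<in> P \<and> poly q x = poly p x" p] p by (auto simp: q_def)
    have "poly (map_poly \<sigma> (q + - p)) y = 0"
      using P_add[OF q(1) P_minus[OF p]] q by (intro spec) (auto simp: P_def)
    moreover have "map_poly \<sigma> (q + - p) = map_poly \<sigma> q - map_poly \<sigma> p"
      using map_add[OF q(1) P_minus[OF p]] map_minus[OF p] by simp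
    ultimately show ?thesis by (simp add: \<tau>_def q_def)
  qed
  show thesis
  proof (rule that[of \<tau>])
    have const: "[:a:] \<in> P" if "a \<in> F" for a
      using that by (auto simp: P_def coeff_pCons csubfield_closed[OF F] split: nat.splits)
    show "\<tau> a = \<sigma> a" if "a \<in> F" for a
      using \<tau>[OF const[OF that]] hom_on_zero by (cases "a = 0") (simp_all add: map_poly_pCons)
    then have "\<tau> 1 = 1" using csubfield_basic(2)[OF F] hom_on_one by simp
    moreover have "adjoin F x = (\<lambda>p. poly p x) ` P"
      by (auto simp: adjoin_def P_def)
    moreover have "\<tau> (poly p x + poly q x) = \<tau> (poly p x) + \<tau> (poly q x)"
       "\<tau> (poly p x * poly q x) = \<tau> (poly p x) * \<tau> (poly q x)" if "p \<in> P" "q \<in> P" for p q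
      using \<tau>[of "p + q"] \<tau>[of "p * q"] \<tau>[of p] \<tau>[of q] that
      by (simp_all add: P_add P_mult map_add map_mult)
    ultimately show "hom_on (adjoin F x) \<tau>" unfolding hom_on_def by auto
    have "[:0, 1:] \<in> P"
      by (auto simp: P_def coeff_pCons csubfield_closed[OF F] split: nat.splits)
    from \<tau>[OF this] show "\<tau> x = y"
      using hom_on_zero hom_on_one by (simp add: map_poly_pCons)
  qed
qed

text \<open>Division by the monic relation, carried out in parallel for \<open>x\<close> and for its
  prospective image \<open>y\<close>: the same coefficients \<open>b\<close> must serve on both
  sides.\<close>

lemma monic_reduce:
  assumes n: "n > 0" and a: "\<And>i. i < n \<Longrightarrow> a i \<in> F" and x: "x ^ n = (\<Sum>i<n. a i * x ^ i)"
    and y: "y ^ n = (\<Sum>i<n. \<sigma> (a i) * y ^ i)" and p: "\<forall>i. poly.coeff p i \<in> F"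
  shows "\<exists>b. (\<forall>i<n. b i \<in> F) \<and> poly p x = (\<Sum>i<n. b i * x ^ i) \<and>
    poly (map_poly \<sigma> p) y = (\<Sum>i<n. \<sigma> (b i) * y ^ i)"
  using p
proof (induction p)
  case 0
  show ?case by (rule exI[of _ "\<lambda>_. 0"]) (simp add: csubfield_closed[OF F] hom_on_zero)
next
  case (pCons k p)
  have "\<forall>i. poly.coeff p i \<in> F" using spec[OF pCons.prems, of "Suc _"] by simp
  then obtain b where b: "\<And>i. i < n \<Longrightarrow> b i \<in> F" and px: "poly p x = (\<Sum>i<n. b i * x ^ i)"
    and py: "poly (map_poly \<sigma> p) y = (\<Sum>i<n. \<sigma> (b i) * y ^ i)" using pCons.IH by blast
  have k: "k \<in> F" using spec[OF pCons.prems, of 0] by simp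
  obtain m where m: "n = Suc m" using n by (cases n) auto
  \<comment> \<open>Multiplication by \<open>x\<close> shifts the coefficients; the overflowing top
    one, \<open>b m\<close> with \<open>m = n - 1\<close>, is fed back through the relation for
    \<open>x ^ n\<close>.\<close>
  define d where "d i = (if i = 0 then k else b (i - 1)) + b m * a i" for i
  have dF: "d i \<in> F" if "i < n" for i
    using that k b a m by (auto simp: d_def csubfield_closed[OF F])
  have shift: "c + z * (\<Sum>i<n. f i * z ^ i) = (\<Sum>i<n. (if i = 0 then c else f (i - 1)) * z ^ i) + f m * z ^ n"
    for c z :: "'c::comm_ring_1" and f
  proof -
    have "z * (\<Sum>i<n. f i * z ^ i) = (\<Sum>i<n. f i * z ^ Suc i)"
      by (simp add: sum_distrib_left mult_ac)
    also have "c + \<dots> = (\<Sum>i<Suc n. (if i = 0 then c else f (i - 1)) * z ^ i)"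
      by (subst sum.lessThan_Suc_shift) simp
    finally show ?thesis by (simp add: m)
  qed
  have "poly (pCons k p) x = (\<Sum>i<n. d i * x ^ i)"
    unfolding poly_pCons px shift
    by (simp add: x d_def sum_distrib_left sum.distrib algebra_simps)
  moreover have "poly (map_poly \<sigma> (pCons k p)) y = (\<Sum>i<n. \<sigma> (d i) * y ^ i)"
  proof -
    have \<sigma>d: "\<sigma> (d i) = (if i = 0 then \<sigma> k else \<sigma> (b (i - 1))) + \<sigma> (b m) * \<sigma> (a i)" if "i < n" for i
      using that k b a m by (auto simp: d_def hom_on_add hom_on_mult csubfield_closed[OF F])
    have "poly (map_poly \<sigma> (pCons k p)) y = \<sigma> k + y * poly (map_poly \<sigma> p) y"
      by (simp add: map_poly_pCons hom_on_zero)
    also have "\<dots> = (\<Sum>i<n. (if i = 0 then \<sigma> k else \<sigma> (b (i - 1))) * y ^ i) + \<sigma> (b m) * y ^ n"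
      unfolding py by (rule shift)
    also have "\<dots> = (\<Sum>i<n. \<sigma> (d i) * y ^ i)"
      by (simp add: y \<sigma>d sum_distrib_left sum.distrib algebra_simps)
    finally show ?thesis .
  qed
  ultimately show ?case using dF by blast
qed

text \<open>Independence of the powers below \<open>n\<close> says that the monic relation is the
  minimal polynomial; every other relation of \<open>x\<close> then reduces to zero coefficients and
  so holds for \<open>y\<close> too.\<close>

lemma hom_extend_monic:
  assumes n: "n > 0" and a: "\<And>i. i < n \<Longrightarrow> a i \<in> F" and x: "x ^ n = (\<Sum>i<n. a i * x ^ i)"
    and y: "y ^ n = (\<Sum>i<n. \<sigma> (a i) * y ^ i)"
    and indep: "\<And>b i. (\<And>i. i < n \<Longrightarrow> b i \<in> F) \<Longrightarrow> (\<Sum>i<n. b i * x ^ i) = 0 \<Longrightarrow> i < n \<Longrightarrow> b i = 0"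
  obtains \<tau> where "hom_on (adjoin F x) \<tau>" "\<And>a. a \<in> F \<Longrightarrow> \<tau> a = \<sigma> a" "\<tau> x = y"
proof (rule hom_extend[of x y])
  fix p assume p: "\<forall>i. poly.coeff p i \<in> F" and 0: "poly p x = 0"
  obtain b where b: "\<And>i. i < n \<Longrightarrow> b i \<in> F" "poly p x = (\<Sum>i<n. b i * x ^ i)"
    "poly (map_poly \<sigma> p) y = (\<Sum>i<n. \<sigma> (b i) * y ^ i)"
    using monic_reduce[OF n a x y p] by blast
  have "b i = 0" if "i < n" for i
    using indep[of b i] that b 0 by simp
  then show "poly (map_poly \<sigma> p) y = 0"
    unfolding b(3) by (simp add: hom_on_zero)
qed (use that in blast)

lemma hom_extend_sqrt:
  assumes "x ^ 2 \<in> F" "x \<notin> F" "y ^ 2 = \<sigma> (x ^ 2)"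
  obtains \<tau> where "hom_on (adjoin F x) \<tau>" "\<And>a. a \<in> F \<Longrightarrow> \<tau> a = \<sigma> a" "\<tau> x = y"
proof (rule hom_extend_monic[of 2 "\<lambda>i. if i = 0 then x ^ 2 else 0" x y])
  have sum2: "(\<Sum>i<2. f i) = f 0 + f (Suc 0)" for f :: "nat \<Rightarrow> 'c::comm_monoid_add"
    by (simp add: numeral_2_eq_2)
  show "x ^ 2 = (\<Sum>i<2. (if i = 0 then x ^ 2 else 0) * x ^ i)" by (simp add: sum2)
  show "y ^ 2 = (\<Sum>i<2. \<sigma> (if i = 0 then x ^ 2 else 0) * y ^ i)"
    using assms by (simp add: sum2 hom_on_zero)
  fix b and i :: nat
  assume b: "\<And>i. i < 2 \<Longrightarrow> b i \<in> F" and 0: "(\<Sum>i<2. b i * x ^ i) = 0" and i: "i < 2"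
  have b01: "b 0 \<in> F" "b 1 \<in> F" using b by simp_all
  have "b 0 = - b 1 * x" using 0 by (simp add: sum2 eq_neg_iff_add_eq_0)
  then have "b 1 = 0"
    using b01 assms(2) csubfield_divide[OF F, of "b 0" "- b 1"] csubfield_closed(3)[OF F, of "b 1"]
    by (cases "b 1 = 0") auto
  then show "b i = 0" using \<open>b 0 = - b 1 * x\<close> i by (auto simp: less_2_cases_iff)
qed (use assms that csubfield_basic(1)[OF F] in auto)

end

lemma hom_on_id: "hom_on F (\<lambda>x. x)"
  by (simp add: hom_on_def)

lemma adjoin_elim:
  assumes F: "csubfield F"
    and n: "n > 0" and a: "\<And>i. i < n \<Longrightarrow> a i \<in> F" and x: "x ^ n = (\<Sum>i<n. a i * x ^ i)"
    and z: "z \<in> adjoin F x"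
  obtains b where "\<And>i. i < n \<Longrightarrow> b i \<in> F" "z = (\<Sum>i<n. b i * x ^ i)"
proof -
  obtain p where "z = poly p x" "\<forall>i. poly.coeff p i \<in> F" using z by (auto simp: adjoin_def)
  with monic_reduce[OF F hom_on_id n a x x] that show thesis by blast
qed

lemma adjoin_sqrt_elim:
  assumes F: "csubfield F" and x: "x ^ 2 \<in> F" and z: "z \<in> adjoin F x"
  obtains b c where "b \<in> F" "c \<in> F" "z = b + c * x"
proof (rule adjoin_elim[OF F, of 2 "\<lambda>i. if i = 0 then x ^ 2 else 0" x z])
  fix b assume b: "\<And>i. i < 2 \<Longrightarrow> b i \<in> F" and z: "z = (\<Sum>i<2. b i * x ^ i)"
  show thesis
    by (rule that[of "b 0" "b 1"]) (use b z in \<open>simp_all add: numeral_2_eq_2\<close>)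
qed (use x z csubfield_basic(1)[OF F] in \<open>simp_all add: numeral_2_eq_2\<close>)

section \<open>Homomorphisms between subfields of the complex numbers\<close>

lemma hom_on_inverse:
  fixes \<sigma> :: "complex \<Rightarrow> complex"
  assumes F: "csubfield F" and hom: "hom_on F \<sigma>" and x: "x \<in> F"
  shows "\<sigma> (inverse x) = inverse (\<sigma> x)"
proof (cases "x = 0")
  case False
  have "\<sigma> x * \<sigma> (inverse x) = 1"
    using hom_on_mult[OF F hom x csubfield_inverse[OF F x]] hom_on_one[OF F hom] False by simp
  then show ?thesis by (metis inverse_unique)
qed (simp add: hom_on_zero[OF F hom])

lemma hom_on_divide:
  fixes \<sigma> :: "complex \<Rightarrow> complex"
  assumes F: "csubfield F" and hom: "hom_on F \<sigma>" and "x \<in> F" "y \<in> F"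
  shows "\<sigma> (x / y) = \<sigma> x / \<sigma> y"
  using assms by (simp add: divide_inverse hom_on_mult[OF F hom] hom_on_inverse[OF F hom] csubfield_inverse)

lemma hom_on_inj:
  fixes \<sigma> :: "complex \<Rightarrow> complex"
  assumes F: "csubfield F" and hom: "hom_on F \<sigma>"
  shows "inj_on \<sigma> F"
proof (rule inj_onI)
  fix x y assume xy: "x \<in> F" "y \<in> F" "\<sigma> x = \<sigma> y"
  show "x = y"
  proof (rule ccontr)
    assume "x \<noteq> y"
    then have "(x - y) * inverse (x - y) = 1" by simp
    then have "\<sigma> (x - y) * \<sigma> (inverse (x - y)) = 1"
      using xy hom_on_mult[OF F hom, of "x - y" "inverse (x - y)"] hom_on_one[OF F hom]
      by (simp add: csubfield_closed[OF F])
    then show False using xy by (simp add: hom_on_diff[OF F hom])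
  qed
qed

lemma hom_on_subset: "hom_on F \<sigma> \<Longrightarrow> E \<subseteq> F \<Longrightarrow> hom_on E \<sigma>"
  by (auto simp: hom_on_def)

lemma hom_on_compose:
  "hom_on F \<tau> \<Longrightarrow> hom_on M \<sigma> \<Longrightarrow> \<tau> ` F \<subseteq> M \<Longrightarrow> hom_on F (\<lambda>x. \<sigma> (\<tau> x))"
  by (auto simp: hom_on_def image_subset_iff)

lemma hom_on_Rats:
  fixes \<sigma> :: "complex \<Rightarrow> complex"
  assumes F: "csubfield F" and hom: "hom_on F \<sigma>" and x: "x \<in> \<rat>"
  shows "\<sigma> x = x"
proof -
  obtain a b :: int where "x = of_int a / of_int b" using x by (metis Rats_cases')
  then show ?thesis
    by (simp add: hom_on_divide[OF F hom] hom_on_of_int[OF F hom] csubfield_closed[OF F])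
qed

lemma hom_on_poly:
  fixes \<sigma> :: "complex \<Rightarrow> 'b::comm_ring_1"
  assumes F: "csubfield F" "hom_on F \<sigma>" and M: "csubfield M" "hom_on M \<sigma>" "F \<subseteq> M" "x \<in> M"
    and p: "\<forall>i. poly.coeff p i \<in> F"
  shows "\<sigma> (poly p x) = (\<Sum>i\<le>Polynomial.degree p. \<sigma> (poly.coeff p i) * \<sigma> x ^ i)"
proof -
  have "poly.coeff p i \<in> M" for i using p M(3) by blast
  then show ?thesis
    unfolding poly_altdef using M(4)
    by (subst hom_on_sum[OF M(1,2)])
      (auto simp: hom_on_mult[OF M(1,2)] hom_on_power[OF M(1,2)] csubfield_closed[OF M(1)])
qed

lemma hom_on_adjoin_cong:
  fixes \<sigma> \<tau> :: "complex \<Rightarrow> 'b::comm_ring_1"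
  assumes F: "csubfield F" and F': "F' = adjoin F x" "csubfield F'"
    and hom: "hom_on F' \<sigma>" "hom_on F' \<tau>"
    and eq: "\<And>a. a \<in> F \<Longrightarrow> \<sigma> a = \<tau> a" "\<sigma> x = \<tau> x" and z: "z \<in> F'"
  shows "\<sigma> z = \<tau> z"
proof -
  obtain p where p: "z = poly p x" "\<forall>i. poly.coeff p i \<in> F" using z F' by (auto simp: adjoin_def)
  have sub: "F \<subseteq> F'" and x: "x \<in> F'" using adjoin_base[OF F] adjoin_self[OF F] F' by auto
  show ?thesis
    using p(2) unfolding p(1)
    by (simp add: hom_on_poly[OF F hom_on_subset[OF hom(1) sub] F'(2) hom(1) sub x]
      hom_on_poly[OF F hom_on_subset[OF hom(2) sub] F'(2) hom(2) sub x] eq)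
qed

lemma hom_on_adjoin_image:
  fixes \<sigma> :: "complex \<Rightarrow> complex"
  assumes F: "csubfield F" and F': "F' = adjoin F x" "csubfield F'" and hom: "hom_on F' \<sigma>"
    and M: "csubfield M" "\<sigma> ` F \<subseteq> M" "\<sigma> x \<in> M"
  shows "\<sigma> ` F' \<subseteq> M"
proof
  fix z assume "z \<in> \<sigma> ` F'"
  then obtain p where p: "z = \<sigma> (poly p x)" "\<forall>i. poly.coeff p i \<in> F" using F' by (auto simp: adjoin_def)
  have sub: "F \<subseteq> F'" and x: "x \<in> F'" using adjoin_base[OF F] adjoin_self[OF F] F' by auto
  show "z \<in> M"
    using p M unfolding p(1)
    by (subst hom_on_poly[OF F hom_on_subset[OF hom sub] F'(2) hom sub x])
      (auto intro!: csubfield_sum csubfield_closed)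
qed

text \<open>In the square of \<open>p + q * x\<close> the cross term \<open>2 * p * q * x\<close>
  must lie in \<open>F\<close> although \<open>x\<close> does not, so \<open>p\<close> or
  \<open>q\<close> vanishes. This quadratic case of Kummer theory is what lets nonsquare statements
  climb the tower.\<close>

lemma sqrt_in_adjoin_sqrt:
  assumes F: "csubfield F" and x: "x ^ 2 \<in> F" "x \<notin> F" and y: "y \<in> adjoin F x" "y ^ 2 \<in> F"
  shows "y \<in> F \<or> (\<exists>q\<in>F. y = q * x)"
proof -
  obtain p q where pq: "p \<in> F" "q \<in> F" "y = p + q * x" using adjoin_sqrt_elim[OF F x(1) y(1)] .
  have "2 * p * q * x = y ^ 2 - p ^ 2 - q ^ 2 * x ^ 2" by (simp add: pq power2_eq_square algebra_simps)
  then have "2 * p * q * x \<in> F" using pq x y by (simp add: csubfield_closed[OF F])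
  then have "p * q = 0"
    using x(2) pq csubfield_divide[OF F, of "2 * p * q * x" "2 * p * q"]
    by (cases "p * q = 0") (auto simp: csubfield_closed[OF F])
  then show ?thesis using pq by auto
qed

subsection \<open>The cubic field\<close>

definition cbrt2 :: complex where "cbrt2 = of_real (root 3 2)"

lemma cbrt2_cube: "cbrt2 ^ 3 = 2"
  unfolding cbrt2_def by (simp flip: of_real_power)

text \<open>For nonzero \<open>b\<close> the exponents of 2 on the two sides differ modulo
  3.\<close>

lemma cube_eq_2_cube_int:
  fixes a b :: int
  assumes "a ^ 3 = 2 * b ^ 3"
  shows "b = 0"
proof (rule ccontr)
  assume b: "b \<noteq> 0"
  then have a: "a \<noteq> 0" using assms by auto
  have p2: "Factorial_Ring.prime (2::int)" by simp
  have "multiplicity 2 (a ^ 3) = 3 * multiplicity 2 a"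
    using a p2 by (simp add: prime_elem_multiplicity_power_distrib)
  moreover have "multiplicity 2 (2 * b ^ 3) = 1 + 3 * multiplicity 2 b"
    using b p2 by (simp add: prime_elem_multiplicity_mult_distrib prime_elem_multiplicity_power_distrib)
  ultimately have "3 * multiplicity 2 a = 1 + 3 * multiplicity 2 b" using assms by simp
  then show False by presburger
qed

lemma cube_eq_2_cube_Rats:
  fixes a b :: complex
  assumes "a \<in> \<rat>" "b \<in> \<rat>" "a ^ 3 = 2 * b ^ 3"
  shows "b = 0"
proof -
  obtain m n k l :: int where a: "a = of_int m / of_int n" "n > 0" and b: "b = of_int k / of_int l" "l > 0"
    using assms by (metis Rats_cases')
  have "(of_int (m * l) :: complex) ^ 3 = 2 * of_int (k * n) ^ 3"
    using assms(3) a b by (simp add: field_simps)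
  then have "of_int ((m * l) ^ 3) = (of_int (2 * (k * n) ^ 3) :: complex)"
    by simp
  then have "(m * l) ^ 3 = 2 * (k * n) ^ 3" by (simp only: of_int_eq_iff)
  then have "k * n = 0" by (rule cube_eq_2_cube_int)
  then show ?thesis using a b by simp
qed

lemma cbrt2_independent:
  assumes "a \<in> \<rat>" "b \<in> \<rat>" "c \<in> \<rat>" and 0: "a + b * cbrt2 + c * cbrt2 ^ 2 = 0"
  shows "a = 0 \<and> b = 0 \<and> c = 0"
proof -
  let ?t = cbrt2
  have t3: "?t * ?t ^ 2 = 2" using cbrt2_cube by (simp add: power3_eq_cube power2_eq_square mult.assoc)
  \<comment> \<open>Multiplying the relation by \<open>b - c * ?t\<close> removes the quadratic
    term; irrationality of the cube root then makes both remaining coefficients vanish.\<close>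
  have "(b ^ 2 - a * c) * ?t = 2 * c ^ 2 - a * b"
  proof -
    have "(b ^ 2 - a * c) * ?t - (2 * c ^ 2 - a * b)
      = (b - c * ?t) * (a + b * ?t + c * ?t ^ 2) + c ^ 2 * (?t * ?t ^ 2 - 2)"
      by (simp add: power2_eq_square algebra_simps)
    then show ?thesis by (simp add: 0 t3)
  qed
  moreover have "?t \<notin> \<rat>"
    using cube_eq_2_cube_Rats[of ?t 1] cbrt2_cube by auto
  moreover have "(2 * c ^ 2 - a * b) / (b ^ 2 - a * c) \<in> \<rat>" using assms by simp
  ultimately have 1: "b ^ 2 = a * c"
    by (metis eq_iff_diff_eq_0 nonzero_mult_div_cancel_left)
  then have 2: "2 * c ^ 2 = a * b" using \<open>(b ^ 2 - a * c) * ?t = 2 * c ^ 2 - a * b\<close> by simp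
  have "b ^ 3 = b * (a * c)" using 1 by (simp add: power3_eq_cube power2_eq_square)
  also have "\<dots> = 2 * c ^ 3" using 2 by (simp add: power3_eq_cube power2_eq_square)
  finally have "b ^ 3 = 2 * c ^ 3" .
  then have "c = 0" using cube_eq_2_cube_Rats assms by blast
  with 1 0 show ?thesis by simp
qed

text \<open>The equations compare the coefficients of \<open>1, t, t ^ 2\<close> in
  \<open>(A + B t + C t ^ 2) ^ 2 = k D ^ 2 (t - 1)\<close>, where \<open>t ^ 3 = 2\<close>. Parity
  forces \<open>D\<close>, \<open>A\<close>, \<open>B\<close> and then \<open>C\<close> to be even,
  and halving all four preserves the equations: infinite descent on \<open>D\<close>.\<close>

lemma square_descent:
  fixes A B C D k :: int
  assumes k: "odd k" and "A ^ 2 + 4 * B * C = - (k * D ^ 2)" "2 * A * B + 2 * C ^ 2 = k * D ^ 2"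
    "B ^ 2 + 2 * A * C = 0"
  shows "D = 0"
  using assms(2-4)
proof (induction "nat \<bar>D\<bar>" arbitrary: A B C D rule: less_induct)
  case less
  note eqs = less.prems
  have "even (k * D ^ 2)" using eqs(2) by (metis dvd_add dvd_triv_left mult.assoc)
  then have D: "even D" using k by simp
  have "A ^ 2 = - (k * D ^ 2) - 4 * B * C" using eqs(1) by simp
  then have "even (A ^ 2)" using D by simp
  then have A: "even A" by simp
  have "B ^ 2 = - (2 * A * C)" using eqs(3) by simp
  then have "even (B ^ 2)" by simp
  then have B: "even B" by simp
  obtain a b d where abd: "A = 2 * a" "B = 2 * b" "D = 2 * d" using A B D by (elim evenE)
  have "2 * C ^ 2 = k * D ^ 2 - 2 * A * B" using eqs(2) by simp
  then have "C ^ 2 = 2 * (k * d ^ 2 - 2 * a * b)" by (simp add: abd power2_eq_square algebra_simps)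
  then have "even (C ^ 2)" by simp
  then obtain c where c: "C = 2 * c" by auto
  show ?case
  proof (rule ccontr)
    assume "D \<noteq> 0"
    then have "nat \<bar>d\<bar> < nat \<bar>D\<bar>" using abd by auto
    moreover have "a ^ 2 + 4 * b * c = - (k * d ^ 2)" "2 * a * b + 2 * c ^ 2 = k * d ^ 2"
      "b ^ 2 + 2 * a * c = 0"
      using eqs unfolding abd c by (simp_all add: power2_eq_square algebra_simps)
    ultimately have "d = 0" by (rule less.hyps)
    then show False using \<open>D \<noteq> 0\<close> abd by simp
  qed
qed

lemma Rats_common_denominator:
  assumes "a \<in> \<rat>" "b \<in> \<rat>" "c \<in> (\<rat> :: complex set)"
  obtains A B C D :: int where "D \<noteq> 0" "a = of_int A / of_int D" "b = of_int B / of_int D"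
    "c = of_int C / of_int D"
proof -
  obtain a1 a2 b1 b2 c1 c2 :: int where "a = of_int a1 / of_int a2" "a2 > 0"
    "b = of_int b1 / of_int b2" "b2 > 0" "c = of_int c1 / of_int c2" "c2 > 0"
    using assms by (metis Rats_cases')
  then show thesis
    by (intro that[of "a2 * b2 * c2" "a1 * b2 * c2" "b1 * a2 * c2" "c1 * a2 * b2"]) auto
qed

text \<open>An invariant that can be carried up quadratic steps. For \<open>e = 0\<close> the set
  \<open>S\<close> bounds the odd integers, modulo rational squares, that are squares in
  \<open>F\<close>; the exclusion of \<open>e = 1\<close> says that no odd integer multiple of
  \<open>cbrt2 - 1\<close> is a square in \<open>F\<close>. Oddness is what the descent at 2 relies
  on.\<close>

definition square_classes :: "complex set \<Rightarrow> int set \<Rightarrow> bool" where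
  "square_classes F S \<longleftrightarrow> (\<forall>y\<in>F. \<forall>e b. odd b \<longrightarrow> e \<le> 1 \<longrightarrow> y ^ 2 = (cbrt2 - 1) ^ e * of_int b \<longrightarrow>
     e = (0::nat) \<and> (\<exists>s\<in>S. \<exists>q\<in>(\<rat>::complex set). of_int b = q ^ 2 * of_int s))"

lemma sum3: "(\<Sum>i<(3::nat). f i) = f 0 + f 1 + f 2"
  by (simp add: eval_nat_numeral)

lemma cbrt2_relation: "cbrt2 ^ 3 = (\<Sum>i<3. (if i = 0 then 2 else 0) * cbrt2 ^ i)"
  by (simp add: sum3 cbrt2_cube)

lemma square_classes_cbrt2: "square_classes (adjoin \<rat> cbrt2) {1}"
  unfolding square_classes_def
proof (intro ballI allI impI)
  fix y :: complex and e :: nat and k :: int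
  assume y: "y \<in> adjoin \<rat> cbrt2" and k: "odd k" and e: "e \<le> 1"
    and sq: "y ^ 2 = (cbrt2 - 1) ^ e * of_int k"
  let ?t = cbrt2
  obtain f where f: "\<And>i. i < 3 \<Longrightarrow> f i \<in> \<rat>" "y = (\<Sum>i<3. f i * ?t ^ i)"
    by (rule adjoin_elim[OF csubfield_Rats _ _ cbrt2_relation y]) auto
  define a b c where "a = f 0" and "b = f 1" and "c = f 2"
  have abc: "a \<in> \<rat>" "b \<in> \<rat>" "c \<in> \<rat>" and y_eq: "y = a + b * ?t + c * ?t ^ 2"
    using f by (auto simp: a_def b_def c_def sum3)
  have t3: "?t ^ 3 = 2" by (rule cbrt2_cube)
  have y2: "y ^ 2 = (a ^ 2 + 4 * b * c) + (2 * a * b + 2 * c ^ 2) * ?t + (b ^ 2 + 2 * a * c) * ?t ^ 2"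
  proof -
    have "y ^ 2 - ((a ^ 2 + 4 * b * c) + (2 * a * b + 2 * c ^ 2) * ?t + (b ^ 2 + 2 * a * c) * ?t ^ 2)
      = (c ^ 2 * ?t + 2 * b * c) * (?t ^ 3 - 2)"
      unfolding y_eq by (simp add: power2_eq_square power3_eq_cube algebra_simps)
    then show ?thesis by (simp add: t3)
  qed
  from e consider "e = 0" | "e = 1" by linarith
  then show "e = 0 \<and> (\<exists>s\<in>{1}. \<exists>q\<in>(\<rat>::complex set). of_int k = q ^ 2 * of_int s)"
  proof cases
    case 1
    have "(a ^ 2 + 4 * b * c - of_int k) + (2 * a * b + 2 * c ^ 2) * ?t + (b ^ 2 + 2 * a * c) * ?t ^ 2 = 0"
      using y2 sq 1 by simp
    then have eqs: "a ^ 2 + 4 * b * c = of_int k" "2 * a * b + 2 * c ^ 2 = 0" "b ^ 2 + 2 * a * c = 0"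
      using cbrt2_independent[of "a ^ 2 + 4 * b * c - of_int k" "2 * a * b + 2 * c ^ 2" "b ^ 2 + 2 * a * c"] abc
      by auto
    \<comment> \<open>The combination in which the terms \<open>a * b * c\<close> cancel; it reduces
      the vanishing of \<open>b\<close> and \<open>c\<close> to the irrationality of the cube root
      of 2.\<close>
    have "b ^ 3 - 2 * c ^ 3 = b * (b ^ 2 + 2 * a * c) - c * (2 * a * b + 2 * c ^ 2)"
      by (simp add: power2_eq_square power3_eq_cube algebra_simps)
    then have "b ^ 3 = 2 * c ^ 3" using eqs(2,3) by simp
    then have "c = 0" using cube_eq_2_cube_Rats abc by blast
    then have "of_int k = a ^ 2" using eqs by simp
    then show ?thesis using 1 abc by auto
  next
    case 2
    have "(a ^ 2 + 4 * b * c + of_int k) + (2 * a * b + 2 * c ^ 2 - of_int k) * ?t + (b ^ 2 + 2 * a * c) * ?t ^ 2 = 0"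
      using y2 sq 2 by (simp add: algebra_simps)
    then have eqs: "a ^ 2 + 4 * b * c = - of_int k" "2 * a * b + 2 * c ^ 2 = of_int k" "b ^ 2 + 2 * a * c = 0"
      using cbrt2_independent[of "a ^ 2 + 4 * b * c + of_int k" "2 * a * b + 2 * c ^ 2 - of_int k" "b ^ 2 + 2 * a * c"] abc
      by (auto simp: add_eq_0_iff2)
    obtain A B C D :: int where D: "D \<noteq> 0" and ABC: "a = of_int A / of_int D" "b = of_int B / of_int D"
      "c = of_int C / of_int D" using Rats_common_denominator[OF abc] .
    have "of_int (A ^ 2 + 4 * B * C) = (of_int (- (k * D ^ 2)) :: complex)"
      "of_int (2 * A * B + 2 * C ^ 2) = (of_int (k * D ^ 2) :: complex)"
      "of_int (B ^ 2 + 2 * A * C) = (of_int 0 :: complex)"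
      using eqs D unfolding ABC by (simp_all add: field_simps power2_eq_square)
    then have "A ^ 2 + 4 * B * C = - (k * D ^ 2)" "2 * A * B + 2 * C ^ 2 = k * D ^ 2"
      "B ^ 2 + 2 * A * C = 0" by (simp_all only: of_int_eq_iff)
    then have "D = 0" by (rule square_descent[OF k])
    with D show ?thesis by simp
  qed
qed

text \<open>A square root of an element of \<open>F\<close> that lies in \<open>F(x)\<close> is in
  \<open>F\<close> or in \<open>F x\<close>. In the second case multiplication by \<open>x\<close>
  moves it into \<open>F\<close> and replaces \<open>b\<close> by \<open>b * d\<close>, still odd;
  so the admissible classes are those of \<open>S\<close> and their multiples by
  \<open>d\<close>.\<close>

lemma square_classes_adjoin:
  assumes F: "csubfield F" "cbrt2 \<in> F" and S: "square_classes F S" and d: "odd d" "x ^ 2 = of_int d"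
    and x: "x \<notin> F"
  shows "square_classes (adjoin F x) (S \<union> (\<lambda>s. d * s) ` S)"
  unfolding square_classes_def
proof (intro ballI allI impI)
  fix y :: complex and e :: nat and b :: int
  assume y: "y \<in> adjoin F x" and b: "odd b" and e: "e \<le> 1"
    and sq: "y ^ 2 = (cbrt2 - 1) ^ e * of_int b"
  have x2: "x ^ 2 \<in> F" using F d by (simp add: csubfield_closed)
  have "y ^ 2 \<in> F" using F sq by (simp add: csubfield_closed)
  then consider "y \<in> F" | q where "q \<in> F" "y = q * x"
    using sqrt_in_adjoin_sqrt[OF F(1) x2 x y] by blast
  then show "e = 0 \<and> (\<exists>s\<in>S \<union> (\<lambda>s. d * s) ` S. \<exists>q\<in>(\<rat>::complex set). of_int b = q ^ 2 * of_int s)"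
  proof cases
    case 1
    then show ?thesis using S b e sq unfolding square_classes_def by blast
  next
    case 2
    have "(q * of_int d) ^ 2 = y ^ 2 * x ^ 2"
      using 2 d by (simp add: power_mult_distrib power2_eq_square)
    also have "\<dots> = (cbrt2 - 1) ^ e * of_int (b * d)" using sq d by simp
    finally have "e = 0 \<and> (\<exists>s\<in>S. \<exists>q\<in>(\<rat>::complex set). of_int (b * d) = q ^ 2 * of_int s)"
      using S b d(1) e 2(1) F(1) unfolding square_classes_def
      by (metis csubfield_basic(4) csubfield_of_int even_mult_iff)
    then obtain s r where "e = 0" "s \<in> S" "r \<in> \<rat>" and eq: "of_int b * of_int d = r ^ 2 * (of_int s :: complex)"
      by auto
    moreover have "of_int b = (r / of_int d) ^ 2 * (of_int (d * s) :: complex)"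
      using eq d(1) by (auto simp: field_simps power2_eq_square)
    ultimately show ?thesis by (metis Rats_divide Rats_of_int UnCI image_eqI)
  qed
qed

lemma Rats_square_int:
  assumes "q \<in> \<rat>" "of_int m = (q::complex) ^ 2"
  shows "\<exists>n. m = n ^ 2"
proof -
  obtain r :: rat where r: "q = of_rat r" using assms by (auto elim: Rats_cases)
  have "(of_rat (of_int m) :: complex) = of_rat (r ^ 2)" using assms r by (simp add: of_rat_power)
  then have m: "of_int m = r ^ 2" by (simp only: of_rat_eq_iff)
  obtain a b where ab: "quotient_of r = (a, b)" by force
  have b: "b > 0" "coprime a b" "r = of_int a / of_int b"
    using ab quotient_of_denom_pos quotient_of_coprime quotient_of_div by blast+
  have "of_int (m * b ^ 2) = (of_int (a ^ 2) :: rat)" using m b by (simp add: field_simps)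
  then have "m * b ^ 2 = a ^ 2" by (simp only: of_int_eq_iff)
  then have "b ^ 2 dvd a ^ 2" by (metis dvd_triv_right)
  then have "b dvd a" by simp
  then have "b = 1" using b coprime_common_divisor[of a b b] by simp
  then show ?thesis using \<open>m * b ^ 2 = a ^ 2\<close> by auto
qed

lemma not_in_of_square_classes:
  assumes S: "square_classes F S" and d: "odd d" "x ^ 2 = of_int d"
    and ns: "\<And>s n. s \<in> S \<Longrightarrow> d * s \<noteq> n ^ 2"
  shows "x \<notin> F"
proof
  assume "x \<in> F"
  moreover have "x ^ 2 = (cbrt2 - 1) ^ 0 * of_int d" using d by simp
  ultimately obtain s q where s: "s \<in> S" "q \<in> \<rat>" and q: "of_int d = q ^ 2 * (of_int s :: complex)"
    using S d(1) unfolding square_classes_def by (metis zero_le)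
  have "of_int (d * s) = (q * of_int s) ^ 2" by (simp add: q power2_eq_square)
  then show False using Rats_square_int[of "q * of_int s" "d * s"] s ns[of s] by auto
qed

lemma nonsquare_between: "k ^ 2 < m \<Longrightarrow> m < (k + 1) ^ 2 \<Longrightarrow> 0 \<le> k \<Longrightarrow> m \<noteq> (n::int) ^ 2"
proof
  assume a: "k ^ 2 < m" "m < (k + 1) ^ 2" "0 \<le> k" "m = n ^ 2"
  then have "k ^ 2 < \<bar>n\<bar> ^ 2" "\<bar>n\<bar> ^ 2 < (k + 1) ^ 2" by simp_all
  then have "k < \<bar>n\<bar>" "\<bar>n\<bar> < k + 1"
    using a(3) power_less_imp_less_base[of k 2 "\<bar>n\<bar>"] power_less_imp_less_base[of "\<bar>n\<bar>" 2 "k + 1"]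
    by simp_all
  then show False by simp
qed

lemma nonsquare_negative: "m < 0 \<Longrightarrow> m \<noteq> (n::int) ^ 2"
  using zero_le_power2[of n] by linarith

subsection \<open>The tower of fields\<close>

definition sqrt_m3 :: complex where "sqrt_m3 = csqrt (-3)"
definition sqrt_7 :: complex where "sqrt_7 = csqrt 7"
definition sqrt_19 :: complex where "sqrt_19 = csqrt 19"
definition sqrt_m7 :: complex where "sqrt_m7 = csqrt (-7)"
definition omega :: complex where "omega = (sqrt_m3 - 1) / 2"
definition rad0 :: complex where "rad0 = csqrt (cbrt2 - 1)"
definition rad1 :: complex where "rad1 = csqrt (omega * cbrt2 - 1)"
text \<open>A quotient rather than a third \<open>csqrt\<close>: the product of the three roots has
  to be exactly 1. With product -1 the linear term of the quartic of \<open>theta\<close> would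
  change its sign.\<close>

definition rad2 :: complex where "rad2 = 1 / (rad0 * rad1)"
definition theta :: complex where "theta = rad0 + rad1 + rad2"
definition mu :: complex where "mu = sqrt_7 - 2"
definition lam :: complex where "lam = sqrt_19 + 4"
definition yy :: complex where "yy = csqrt (theta * mu)"
definition zz :: complex where "zz = csqrt (lam * sqrt_7)"

lemma sqrt_squares:
  "sqrt_m3 ^ 2 = -3" "sqrt_7 ^ 2 = 7" "sqrt_19 ^ 2 = 19" "sqrt_m7 ^ 2 = -7"
  "rad0 ^ 2 = cbrt2 - 1" "rad1 ^ 2 = omega * cbrt2 - 1" "yy ^ 2 = theta * mu" "zz ^ 2 = lam * sqrt_7"
  unfolding sqrt_m3_def sqrt_7_def sqrt_19_def sqrt_m7_def rad0_def rad1_def yy_def zz_def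
  by (rule power2_csqrt)+

lemma omega_square: "omega ^ 2 = - 1 - omega"
proof -
  have "omega ^ 2 + omega + 1 = (sqrt_m3 ^ 2 + 3) / 4"
    by (simp add: omega_def power2_eq_square field_simps)
  then have "omega ^ 2 + omega + 1 = 0" by (simp add: sqrt_squares)
  then show ?thesis by (simp add: eq_neg_iff_add_eq_0 eq_diff_eq add.assoc)
qed

lemma omega_sum: "1 + omega + omega ^ 2 = 0"
  by (simp add: omega_square)

lemma omega_cube: "omega ^ 3 = 1"
proof -
  have "omega ^ 3 - 1 = (omega - 1) * (1 + omega + omega ^ 2)"
    by (simp add: power3_eq_cube power2_eq_square algebra_simps)
  then show ?thesis by (simp add: omega_sum)
qed

lemma rad_product: "(cbrt2 - 1) * (omega * cbrt2 - 1) * (omega ^ 2 * cbrt2 - 1) = 1"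
proof -
  let ?t = cbrt2 and ?w = omega
  have "(?t - 1) * (?w * ?t - 1) * (?w ^ 2 * ?t - 1)
    = ?w ^ 3 * ?t ^ 3 - ?t ^ 2 * ?w * (1 + ?w + ?w ^ 2) + ?t * (1 + ?w + ?w ^ 2) - 1"
    by (simp add: power3_eq_cube power2_eq_square algebra_simps)
  then show ?thesis by (simp add: omega_cube cbrt2_cube omega_sum)
qed

lemma cbrt2_minus_1_nonzero: "cbrt2 - 1 \<noteq> 0" "omega * cbrt2 - 1 \<noteq> 0" "omega ^ 2 * cbrt2 - 1 \<noteq> 0"
  using rad_product by auto

lemma rad_nonzero: "rad0 \<noteq> 0" "rad1 \<noteq> 0" "rad2 \<noteq> 0"
proof -
  show "rad0 \<noteq> 0" "rad1 \<noteq> 0"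
    using sqrt_squares(5,6) cbrt2_minus_1_nonzero by auto
  then show "rad2 \<noteq> 0" by (simp add: rad2_def)
qed

lemma rad_mult: "rad0 * rad1 * rad2 = 1"
  using rad_nonzero by (simp add: rad2_def)

lemma rad2_square: "rad2 ^ 2 = omega ^ 2 * cbrt2 - 1"
proof -
  have "rad2 ^ 2 = 1 / ((cbrt2 - 1) * (omega * cbrt2 - 1))"
    by (simp add: rad2_def power_divide power_mult_distrib sqrt_squares)
  then show ?thesis using rad_product cbrt2_minus_1_nonzero
    by (simp add: divide_eq_eq mult.commute)
qed

text \<open>The resolvent cubic of this quartic has the roots \<open>rad0\<^sup>2, rad1\<^sup>2, rad2\<^sup>2\<close>.\<close>

lemma quartic:
  fixes w t r0 r1 r2 :: "'a::comm_ring_1"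
  assumes w: "1 + w + w ^ 2 = 0" and r: "r0 ^ 2 = t - 1" "r1 ^ 2 = w * t - 1" "r2 ^ 2 = w ^ 2 * t - 1"
    and prod: "r0 * r1 * r2 = 1"
  shows "(r0 + r1 + r2) ^ 4 + 6 * (r0 + r1 + r2) ^ 2 - 8 * (r0 + r1 + r2) - 3 = 0"
proof -
  define S p where "S = r0 + r1 + r2" and "p = r0 * r1 + r0 * r2 + r1 * r2"
  have "S ^ 2 = r0 ^ 2 + r1 ^ 2 + r2 ^ 2 + 2 * p"
    by (simp add: S_def p_def power2_eq_square algebra_simps)
  also have "\<dots> = (1 + w + w ^ 2) * t - 3 + 2 * p" by (simp add: r algebra_simps)
  finally have S2: "S ^ 2 = 2 * p - 3" using w by simp
  have "p ^ 2 = r0 ^ 2 * r1 ^ 2 + r0 ^ 2 * r2 ^ 2 + r1 ^ 2 * r2 ^ 2 + 2 * (r0 * r1 * r2) * S"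
    by (simp add: S_def p_def power2_eq_square algebra_simps)
  also have "\<dots> = t ^ 2 * w * (1 + w + w ^ 2) - 2 * t * (1 + w + w ^ 2) + 3 + 2 * S"
    unfolding r prod by (simp add: power2_eq_square algebra_simps)
  finally have p2: "p ^ 2 = 3 + 2 * S" using w by simp
  have "S ^ 4 + 6 * S ^ 2 - 8 * S - 3 = (S ^ 2) ^ 2 + 6 * S ^ 2 - 8 * S - 3" by simp
  also have "\<dots> = 4 * p ^ 2 - 12 - 8 * S"
    unfolding S2 by (simp add: power2_eq_square algebra_simps)
  also have "\<dots> = 0" by (simp add: p2)
  finally show ?thesis by (simp add: S_def)
qed

lemma theta_quartic: "theta ^ 4 + 6 * theta ^ 2 - 8 * theta - 3 = 0"
  unfolding theta_def
  by (rule quartic[OF omega_sum sqrt_squares(5,6) rad2_square rad_mult])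

lemma theta_nonzero: "theta \<noteq> 0"
  using theta_quartic by auto

lemma mu_norm: "mu * (- sqrt_7 - 2) = -3"
  using sqrt_squares(2) by (simp add: mu_def power2_eq_square algebra_simps)

lemma lam_norm: "lam * (4 - sqrt_19) = -3"
  using sqrt_squares(3) by (simp add: lam_def power2_eq_square algebra_simps)

lemma other_nonzero: "mu \<noteq> 0" "lam \<noteq> 0" "sqrt_7 \<noteq> 0" "sqrt_m3 \<noteq> 0" "sqrt_19 \<noteq> 0" "sqrt_m7 \<noteq> 0"
    "yy \<noteq> 0" "zz \<noteq> 0"
proof -
  show 1: "mu \<noteq> 0" "lam \<noteq> 0" "sqrt_7 \<noteq> 0" "sqrt_m3 \<noteq> 0" "sqrt_19 \<noteq> 0" "sqrt_m7 \<noteq> 0"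
    using mu_norm lam_norm sqrt_squares by auto
  then show "yy \<noteq> 0" "zz \<noteq> 0"
    using sqrt_squares(7,8) theta_nonzero by auto
qed

text \<open>Square roots of integers come first, so that \<open>square_classes\<close> can be pushed
  through them up to \<open>F5\<close>. Every step above \<open>F1\<close> is quadratic: extending a
  homomorphism there costs one proof that the generator is new.\<close>

definition F1 :: "complex set" where "F1 = adjoin \<rat> cbrt2"
definition F2 :: "complex set" where "F2 = adjoin F1 sqrt_m3"
definition F3 :: "complex set" where "F3 = adjoin F2 sqrt_7"
definition F4 :: "complex set" where "F4 = adjoin F3 sqrt_19"
definition F5 :: "complex set" where "F5 = adjoin F4 sqrt_m7"
definition F6 :: "complex set" where "F6 = adjoin F5 rad0"
definition F7 :: "complex set" where "F7 = adjoin F6 rad1"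
definition F8 :: "complex set" where "F8 = adjoin F7 yy"
definition LL :: "complex set" where "LL = adjoin F8 zz"

section \<open>The tower as a chain of number fields\<close>

lemma number_field_F1: "number_field F1"
proof -
  interpret ring complex_ring by (rule ring_complex_ring)
  show ?thesis unfolding F1_def
    by (rule number_field_adjoin[OF number_field_Rats, of "[0, 0, - 2]"])
      (use cbrt2_cube in \<open>simp_all add: eval_nat_numeral mult.assoc\<close>)
qed

lemma number_field_step:
  assumes "number_field F" "x ^ 2 \<in> F" "F' = adjoin F x"
  shows "number_field F'" "csubfield F'" "F \<subseteq> F'" "x \<in> F'"
  using number_field_adjoin_sqrt[OF assms(1,2)] csubfield_number_field assms
    adjoin_base adjoin_self by auto

lemma F1_facts: "number_field F1" "csubfield F1" "\<rat> \<subseteq> F1" "cbrt2 \<in> F1"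
  using number_field_F1 csubfield_number_field adjoin_base[OF csubfield_Rats]
    adjoin_self[OF csubfield_Rats] unfolding F1_def by auto

lemma F2_facts: "number_field F2" "csubfield F2" "F1 \<subseteq> F2" "sqrt_m3 \<in> F2"
  by (rule number_field_step[OF F1_facts(1) _ F2_def];
      simp add: sqrt_squares csubfield_closed[OF F1_facts(2)])+

lemma F3_facts: "number_field F3" "csubfield F3" "F2 \<subseteq> F3" "sqrt_7 \<in> F3"
  by (rule number_field_step[OF F2_facts(1) _ F3_def];
      simp add: sqrt_squares csubfield_closed[OF F2_facts(2)])+

lemma F4_facts: "number_field F4" "csubfield F4" "F3 \<subseteq> F4" "sqrt_19 \<in> F4"
  by (rule number_field_step[OF F3_facts(1) _ F4_def];
      simp add: sqrt_squares csubfield_closed[OF F3_facts(2)])+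

lemma F5_facts: "number_field F5" "csubfield F5" "F4 \<subseteq> F5" "sqrt_m7 \<in> F5"
  by (rule number_field_step[OF F4_facts(1) _ F5_def];
      simp add: sqrt_squares csubfield_closed[OF F4_facts(2)])+

lemma F5_mem: "cbrt2 \<in> F5" "sqrt_m3 \<in> F5" "sqrt_7 \<in> F5" "sqrt_19 \<in> F5" "sqrt_m7 \<in> F5" "omega \<in> F5"
proof -
  show 1: "cbrt2 \<in> F5" "sqrt_m3 \<in> F5" "sqrt_7 \<in> F5" "sqrt_19 \<in> F5" "sqrt_m7 \<in> F5"
    using F1_facts(4) F2_facts(3,4) F3_facts(3,4) F4_facts(3,4) F5_facts(3,4) by auto
  show "omega \<in> F5" unfolding omega_def using 1 by (simp add: csubfield_closed[OF F5_facts(2)])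
qed

lemma F6_facts: "number_field F6" "csubfield F6" "F5 \<subseteq> F6" "rad0 \<in> F6"
  by (rule number_field_step[OF F5_facts(1) _ F6_def];
      simp add: sqrt_squares F5_mem csubfield_closed[OF F5_facts(2)])+

lemma F7_facts: "number_field F7" "csubfield F7" "F6 \<subseteq> F7" "rad1 \<in> F7"
  by (rule number_field_step[OF F6_facts(1) _ F7_def];
      simp add: sqrt_squares subsetD[OF F6_facts(3)] F5_mem csubfield_closed[OF F6_facts(2)])+

lemma F7_mem: "cbrt2 \<in> F7" "sqrt_m3 \<in> F7" "sqrt_7 \<in> F7" "sqrt_19 \<in> F7" "sqrt_m7 \<in> F7" "omega \<in> F7"
  "rad0 \<in> F7" "rad1 \<in> F7" "rad2 \<in> F7" "theta \<in> F7" "mu \<in> F7" "lam \<in> F7"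
proof -
  show 1: "cbrt2 \<in> F7" "sqrt_m3 \<in> F7" "sqrt_7 \<in> F7" "sqrt_19 \<in> F7" "sqrt_m7 \<in> F7" "omega \<in> F7"
    "rad0 \<in> F7" "rad1 \<in> F7"
    using F5_mem F6_facts(3,4) F7_facts(3,4) by auto
  show 2: "rad2 \<in> F7" unfolding rad2_def using 1 by (simp add: csubfield_closed[OF F7_facts(2)])
  show "theta \<in> F7" "mu \<in> F7" "lam \<in> F7"
    unfolding theta_def mu_def lam_def using 1 2 by (simp_all add: csubfield_closed[OF F7_facts(2)])
qed

lemma F8_facts: "number_field F8" "csubfield F8" "F7 \<subseteq> F8" "yy \<in> F8"
  by (rule number_field_step[OF F7_facts(1) _ F8_def];
      simp add: sqrt_squares F7_mem csubfield_closed[OF F7_facts(2)])+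

lemma LL_facts: "number_field LL" "csubfield LL" "F8 \<subseteq> LL" "zz \<in> LL"
  by (rule number_field_step[OF F8_facts(1) _ LL_def];
      simp add: sqrt_squares subsetD[OF F8_facts(3)] F7_mem csubfield_closed[OF F8_facts(2)])+

lemma LL_mem: "cbrt2 \<in> LL" "sqrt_m3 \<in> LL" "sqrt_7 \<in> LL" "sqrt_19 \<in> LL" "sqrt_m7 \<in> LL" "omega \<in> LL"
  "rad0 \<in> LL" "rad1 \<in> LL" "rad2 \<in> LL" "theta \<in> LL" "mu \<in> LL" "lam \<in> LL" "yy \<in> LL" "zz \<in> LL"
  using F7_mem F8_facts(3,4) LL_facts(3,4) by auto

lemma square_classes_tower:
  "square_classes F1 {1}" "sqrt_m3 \<notin> F1" "sqrt_7 \<notin> F2" "sqrt_19 \<notin> F3" "sqrt_m7 \<notin> F4"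
  "square_classes F5 ({1, -3, 7, -21, 19, -57, 133, -399} \<union> {-7, 21, -49, 147, -133, 399, -931, 2793})"
proof -
  \<comment> \<open>The first arguments are the integer parts of the square roots of the positive
    products met by the nonsquare tests.\<close>
  note ns = nonsquare_negative nonsquare_between[of 2 7] nonsquare_between[of 4 21]
    nonsquare_between[of 4 19] nonsquare_between[of 11 133] nonsquare_between[of 12 147]
    nonsquare_between[of 19 399] nonsquare_between[of 52 2793]
  have t: "cbrt2 \<in> F2" "cbrt2 \<in> F3" "cbrt2 \<in> F4"
    using F1_facts(4) F2_facts(3) F3_facts(3) F4_facts(3) by auto
  show S1: "square_classes F1 {1}" unfolding F1_def by (rule square_classes_cbrt2)
  show 1: "sqrt_m3 \<notin> F1"
    by (rule not_in_of_square_classes[OF S1, of "-3"]) (auto simp: sqrt_squares ns)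
  have S2: "square_classes F2 {1, -3}"
    using square_classes_adjoin[OF F1_facts(2,4) S1 _ _ 1, of "-3"]
    by (simp add: F2_def sqrt_squares insert_commute)
  show 2: "sqrt_7 \<notin> F2"
    by (rule not_in_of_square_classes[OF S2, of 7]) (auto simp: sqrt_squares ns)
  have S3: "square_classes F3 {1, -3, 7, -21}"
    using square_classes_adjoin[OF F2_facts(2) t(1) S2 _ _ 2, of 7]
    by (simp add: F3_def sqrt_squares insert_commute)
  show 3: "sqrt_19 \<notin> F3"
    by (rule not_in_of_square_classes[OF S3, of 19]) (auto simp: sqrt_squares ns)
  have S4: "square_classes F4 {1, -3, 7, -21, 19, -57, 133, -399}"
    using square_classes_adjoin[OF F3_facts(2) t(2) S3 _ _ 3, of 19]
    by (simp add: F4_def sqrt_squares insert_commute)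
  show 4: "sqrt_m7 \<notin> F4"
    by (rule not_in_of_square_classes[OF S4, of "-7"]) (auto simp: sqrt_squares ns)
  show "square_classes F5 ({1, -3, 7, -21, 19, -57, 133, -399} \<union> {-7, 21, -49, 147, -133, 399, -931, 2793})"
    using square_classes_adjoin[OF F4_facts(2) t(3) S4 _ _ 4, of "-7"]
    by (simp add: F5_def sqrt_squares)
qed

text \<open>The case \<open>e = 1\<close>, \<open>b = 1\<close> of
  \<open>square_classes\<close>.\<close>

lemma rad0_notin: "rad0 \<notin> F5" "y \<in> F5 \<Longrightarrow> y ^ 2 \<noteq> cbrt2 - 1"
proof -
  show *: "y ^ 2 \<noteq> cbrt2 - 1" if "y \<in> F5" for y
  proof
    assume "y ^ 2 = cbrt2 - 1"
    then have "y ^ 2 = (cbrt2 - 1) ^ 1 * of_int 1" by simp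
    with square_classes_tower(6) that have "(1::nat) = 0"
      unfolding square_classes_def by (metis odd_one order_refl)
    then show False by simp
  qed
  then show "rad0 \<notin> F5" using sqrt_squares(5) by blast
qed

section \<open>Prescribing homomorphisms on the tower\<close>

lemma hom_step:
  fixes \<sigma> :: "complex \<Rightarrow> complex"
  assumes "csubfield F" "hom_on F \<sigma>" "F' = adjoin F x" "x ^ 2 \<in> F" "x \<notin> F" "y ^ 2 = \<sigma> (x ^ 2)"
  obtains \<tau> where "hom_on F' \<tau>" "\<And>a. a \<in> F \<Longrightarrow> \<tau> a = \<sigma> a" "\<tau> x = y"
  using hom_extend_sqrt[OF assms(1,2,4,5,6)] assms(3) by metis

lemma hom_F1:
  assumes t: "t ^ 3 = 2"
  obtains \<tau> :: "complex \<Rightarrow> complex" where "hom_on F1 \<tau>" "\<tau> cbrt2 = t"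
proof (rule hom_extend_monic[OF csubfield_Rats hom_on_id _ _ cbrt2_relation, of t])
  show "t ^ 3 = (\<Sum>i<3. (if i = 0 then 2 else 0) * t ^ i)" by (simp add: sum3 t)
  fix b and i :: nat
  assume b: "\<And>i. i < 3 \<Longrightarrow> b i \<in> (\<rat> :: complex set)" and 0: "(\<Sum>i<3. b i * cbrt2 ^ i) = 0" and i: "i < 3"
  have "b 0 = 0 \<and> b 1 = 0 \<and> b 2 = 0"
    using 0 b by (intro cbrt2_independent) (simp_all add: sum3)
  moreover have "i = 0 \<or> i = 1 \<or> i = 2" using i by auto
  ultimately show "b i = 0" by auto
qed (use that in \<open>simp_all add: F1_def\<close>)

text \<open>Since each step of the tower has full degree, the roots of the defining equations can be
  prescribed independently of each other.\<close>

lemma hom_F5: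
  assumes t: "t ^ 3 = 2" and s: "s ^ 2 = -3" and a: "a ^ 2 = 7" and b: "b ^ 2 = 19" and c: "c ^ 2 = -7"
  obtains \<tau> :: "complex \<Rightarrow> complex" where "hom_on F5 \<tau>" "\<tau> cbrt2 = t" "\<tau> sqrt_m3 = s" "\<tau> sqrt_7 = a"
    "\<tau> sqrt_19 = b" "\<tau> sqrt_m7 = c"
proof -
  obtain \<tau>1 :: "complex \<Rightarrow> complex" where 1: "hom_on F1 \<tau>1" "\<tau>1 cbrt2 = t" using hom_F1[OF t] .
  have rat: "\<tau> (x ^ 2) = y ^ 2" if "csubfield F" "hom_on F \<tau>" "x ^ 2 = of_int k" "y ^ 2 = of_int k"
    for \<tau> :: "complex \<Rightarrow> complex" and F x y k
    using that by (simp add: hom_on_of_int)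
  obtain \<tau>2 where 2: "hom_on F2 \<tau>2" "\<And>a. a \<in> F1 \<Longrightarrow> \<tau>2 a = \<tau>1 a" "\<tau>2 sqrt_m3 = s"
    by (rule hom_step[OF F1_facts(2) 1(1) F2_def _ square_classes_tower(2), of s])
      (auto simp: sqrt_squares s csubfield_closed[OF F1_facts(2)]
        hom_on_minus[OF F1_facts(2) 1(1)] hom_on_numeral[OF F1_facts(2) 1(1)])
  obtain \<tau>3 where 3: "hom_on F3 \<tau>3" "\<And>a. a \<in> F2 \<Longrightarrow> \<tau>3 a = \<tau>2 a" "\<tau>3 sqrt_7 = a"
    by (rule hom_step[OF F2_facts(2) 2(1) F3_def _ square_classes_tower(3), of a])
      (auto simp: sqrt_squares a csubfield_closed[OF F2_facts(2)] hom_on_numeral[OF F2_facts(2) 2(1)])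
  obtain \<tau>4 where 4: "hom_on F4 \<tau>4" "\<And>a. a \<in> F3 \<Longrightarrow> \<tau>4 a = \<tau>3 a" "\<tau>4 sqrt_19 = b"
    by (rule hom_step[OF F3_facts(2) 3(1) F4_def _ square_classes_tower(4), of b])
      (auto simp: sqrt_squares b csubfield_closed[OF F3_facts(2)] hom_on_numeral[OF F3_facts(2) 3(1)])
  obtain \<tau>5 where 5: "hom_on F5 \<tau>5" "\<And>a. a \<in> F4 \<Longrightarrow> \<tau>5 a = \<tau>4 a" "\<tau>5 sqrt_m7 = c"
    by (rule hom_step[OF F4_facts(2) 4(1) F5_def _ square_classes_tower(5), of c])
      (auto simp: sqrt_squares c csubfield_closed[OF F4_facts(2)]
        hom_on_minus[OF F4_facts(2) 4(1)] hom_on_numeral[OF F4_facts(2) 4(1)])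
  have "cbrt2 \<in> F2" "cbrt2 \<in> F3" "cbrt2 \<in> F4" "sqrt_m3 \<in> F3" "sqrt_m3 \<in> F4" "sqrt_7 \<in> F4"
    using F1_facts(4) F2_facts(3,4) F3_facts(3,4) F4_facts(3,4) by auto
  then show thesis
    using F1_facts(4) F2_facts(4) F3_facts(4) F4_facts(4)
    by (intro that[of \<tau>5]) (simp_all add: 1 2 3 4 5)
qed

lemma hom_F5_image:
  fixes \<tau> :: "complex \<Rightarrow> complex"
  assumes hom: "hom_on F5 \<tau>" and M: "csubfield M" "\<tau> cbrt2 \<in> M" "\<tau> sqrt_m3 \<in> M" "\<tau> sqrt_7 \<in> M"
    "\<tau> sqrt_19 \<in> M" "\<tau> sqrt_m7 \<in> M"
  shows "\<tau> ` F5 \<subseteq> M"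
proof -
  have sub: "F4 \<subseteq> F5" "F3 \<subseteq> F5" "F2 \<subseteq> F5" "F1 \<subseteq> F5" "\<rat> \<subseteq> F5"
    using F1_facts(3) F2_facts(3) F3_facts(3) F4_facts(3) F5_facts(3) by auto
  note homs = hom_on_subset[OF hom sub(1)] hom_on_subset[OF hom sub(2)] hom_on_subset[OF hom sub(3)]
    hom_on_subset[OF hom sub(4)]
  have "\<tau> ` \<rat> \<subseteq> M"
    using hom_on_Rats[OF F5_facts(2) hom] Rats_subset_csubfield[OF M(1)] by auto
  from hom_on_adjoin_image[OF csubfield_Rats F1_def F1_facts(2) homs(4) M(1) this M(2)]
  have "\<tau> ` F1 \<subseteq> M" .
  from hom_on_adjoin_image[OF F1_facts(2) F2_def F2_facts(2) homs(3) M(1) this M(3)]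
  have "\<tau> ` F2 \<subseteq> M" .
  from hom_on_adjoin_image[OF F2_facts(2) F3_def F3_facts(2) homs(2) M(1) this M(4)]
  have "\<tau> ` F3 \<subseteq> M" .
  from hom_on_adjoin_image[OF F3_facts(2) F4_def F4_facts(2) homs(1) M(1) this M(5)]
  have "\<tau> ` F4 \<subseteq> M" .
  from hom_on_adjoin_image[OF F4_facts(2) F5_def F5_facts(2) hom M(1) this M(6)]
  show ?thesis .
qed

text \<open>A homomorphism of \<open>F5\<close> that multiplies \<open>cbrt2\<close> by a power of
  \<open>omega\<close> carries a square root of the conjugate to a square root of
  \<open>cbrt2 - 1\<close>, which is already excluded.\<close>

lemma F5_conjugate_nonsquare:
  assumes k: "k \<le> 2" and y: "y \<in> F5"
  shows "y ^ 2 \<noteq> omega ^ k * cbrt2 - 1"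
proof
  assume eq: "y ^ 2 = omega ^ k * cbrt2 - 1"
  \<comment> \<open>\<open>omega ^ j\<close> is the inverse of \<open>omega ^ k\<close>.\<close>
  define j where "j = 3 - k"
  have 1: "omega ^ k * omega ^ j = 1"
    using k by (simp add: j_def omega_cube flip: power_add)
  have "(omega ^ j * cbrt2) ^ 3 = (omega ^ 3) ^ j * cbrt2 ^ 3"
    by (simp add: power_mult_distrib flip: power_mult) (simp add: mult.commute)
  then have "(omega ^ j * cbrt2) ^ 3 = 2" by (simp add: omega_cube cbrt2_cube)
  then obtain \<tau> :: "complex \<Rightarrow> complex" where hom: "hom_on F5 \<tau>" and \<tau>: "\<tau> cbrt2 = omega ^ j * cbrt2"
    "\<tau> sqrt_m3 = sqrt_m3" "\<tau> sqrt_7 = sqrt_7" "\<tau> sqrt_19 = sqrt_19" "\<tau> sqrt_m7 = sqrt_m7"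
    using hom_F5[of "omega ^ j * cbrt2" sqrt_m3 sqrt_7 sqrt_19 sqrt_m7] sqrt_squares by metis
  note F = F5_facts(2)
  have "\<tau> omega = omega"
    unfolding omega_def using \<tau>
    by (simp add: hom_on_divide[OF F hom] hom_on_diff[OF F hom] hom_on_one[OF F hom]
      hom_on_numeral[OF F hom] F5_mem csubfield_closed[OF F])
  then have "\<tau> (y ^ 2) = (omega ^ k * omega ^ j) * cbrt2 - 1"
    unfolding eq using \<tau>
    by (simp add: hom_on_mult[OF F hom] hom_on_power[OF F hom] hom_on_diff[OF F hom] hom_on_one[OF F hom]
      F5_mem csubfield_closed[OF F] mult.assoc)
  then have "(\<tau> y) ^ 2 = cbrt2 - 1"
    using 1 y by (simp add: hom_on_power[OF F hom])
  moreover have "\<tau> y \<in> F5"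
    using hom_F5_image[OF hom F] \<tau> F5_mem y by (auto simp: csubfield_closed[OF F])
  ultimately show False using rad0_notin(2) by blast
qed

text \<open>If \<open>rad1\<close> were \<open>q * rad0\<close> with \<open>q\<close> in
  \<open>F5\<close>, then \<open>rad2 = 1 / (rad0 * rad1)\<close> would lie in \<open>F5\<close>. So
  either case makes a conjugate of \<open>cbrt2 - 1\<close> a square in \<open>F5\<close>.\<close>

lemma rad1_notin: "rad1 \<notin> F6"
proof
  assume r: "rad1 \<in> F6"
  note F = F5_facts(2)
  have sq: "rad0 ^ 2 \<in> F5" "rad1 ^ 2 \<in> F5"
    using F5_mem by (simp_all add: sqrt_squares csubfield_closed[OF F])
  from sqrt_in_adjoin_sqrt[OF F sq(1) rad0_notin(1) r[unfolded F6_def] sq(2)]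
  consider "rad1 \<in> F5" | q where "q \<in> F5" "rad1 = q * rad0" by blast
  then show False
  proof cases
    case 1
    then show False using F5_conjugate_nonsquare[of 1 rad1] sqrt_squares(6) by simp
  next
    case 2
    have "rad2 = 1 / (q * rad0 ^ 2)" by (simp add: rad2_def 2 power2_eq_square mult_ac)
    also have "1 / (q * rad0 ^ 2) \<in> F5"
      using 2 sq by (intro csubfield_divide[OF F] csubfield_basic(2,4)[OF F])
    finally have "rad2 \<in> F5" .
    then show False using F5_conjugate_nonsquare[of 2 rad2] rad2_square by simp
  qed
qed

lemma hom_F7:
  assumes t: "t ^ 3 = 2" and s: "s ^ 2 = -3" and a: "a ^ 2 = 7" and b: "b ^ 2 = 19" and c: "c ^ 2 = -7"
    and r: "r0 ^ 2 = t - 1" "r1 ^ 2 = (s - 1) / 2 * t - 1"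
  obtains \<tau> :: "complex \<Rightarrow> complex" where "hom_on F7 \<tau>" "\<tau> cbrt2 = t" "\<tau> sqrt_m3 = s" "\<tau> sqrt_7 = a"
    "\<tau> sqrt_19 = b" "\<tau> sqrt_m7 = c" "\<tau> rad0 = r0" "\<tau> rad1 = r1"
proof -
  obtain \<tau>5 :: "complex \<Rightarrow> complex" where 5: "hom_on F5 \<tau>5" "\<tau>5 cbrt2 = t" "\<tau>5 sqrt_m3 = s" "\<tau>5 sqrt_7 = a"
    "\<tau>5 sqrt_19 = b" "\<tau>5 sqrt_m7 = c" using hom_F5[OF t s a b c] .
  note h5 = hom_on_diff[OF F5_facts(2) 5(1)] hom_on_one[OF F5_facts(2) 5(1)]
  obtain \<tau>6 where 6: "hom_on F6 \<tau>6" "\<And>a. a \<in> F5 \<Longrightarrow> \<tau>6 a = \<tau>5 a" "\<tau>6 rad0 = r0"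
    by (rule hom_step[OF F5_facts(2) 5(1) F6_def _ rad0_notin(1), of r0])
      (auto simp: sqrt_squares r h5 5 F5_mem csubfield_closed[OF F5_facts(2)])
  have m6: "x \<in> F6" if "x \<in> F5" for x using F6_facts(3) that by auto
  note F = F6_facts(2) and h6 = hom_on_diff[OF F6_facts(2) 6(1)] hom_on_one[OF F6_facts(2) 6(1)]
    hom_on_mult[OF F6_facts(2) 6(1)] hom_on_divide[OF F6_facts(2) 6(1)] hom_on_numeral[OF F6_facts(2) 6(1)]
  have "\<tau>6 (rad1 ^ 2) = r1 ^ 2"
    unfolding sqrt_squares omega_def
    by (simp add: h6 m6 F5_mem csubfield_closed[OF F] r 5 6(2))
  moreover have "rad1 ^ 2 \<in> F6"
    unfolding sqrt_squares by (simp add: m6 F5_mem csubfield_closed[OF F])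
  ultimately obtain \<tau>7 where 7: "hom_on F7 \<tau>7" "\<And>a. a \<in> F6 \<Longrightarrow> \<tau>7 a = \<tau>6 a" "\<tau>7 rad1 = r1"
    using hom_step[OF F6_facts(2) 6(1) F7_def _ rad1_notin, of r1] by metis
  show thesis
    by (rule that[of \<tau>7]) (simp_all add: 7 6 5 m6 F5_mem F6_facts)
qed

lemma F7_hom_values:
  fixes \<tau> :: "complex \<Rightarrow> complex"
  assumes F: "csubfield F" "F7 \<subseteq> F" and hom: "hom_on F \<tau>" and r: "r0 ^ 2 = t - 1" "r1 ^ 2 = (s - 1) / 2 * t - 1"
    and \<tau>: "\<tau> cbrt2 = t" "\<tau> sqrt_m3 = s" "\<tau> sqrt_7 = a"
    "\<tau> sqrt_19 = b" "\<tau> rad0 = r0" "\<tau> rad1 = r1"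
  shows "\<tau> omega = (s - 1) / 2" "\<tau> rad2 = 1 / (r0 * r1)" "\<tau> theta = r0 + r1 + 1 / (r0 * r1)"
    "\<tau> mu = a - 2" "\<tau> lam = b + 4"
proof -
  have m: "x \<in> F" if "x \<in> F7" for x using F(2) that by auto
  note h = hom_on_diff[OF F(1) hom] hom_on_one[OF F(1) hom] hom_on_add[OF F(1) hom]
    hom_on_mult[OF F(1) hom] hom_on_divide[OF F(1) hom] hom_on_numeral[OF F(1) hom]
  note s = F7_mem m csubfield_closed[OF F(1)]
  show "\<tau> omega = (s - 1) / 2" "\<tau> mu = a - 2" "\<tau> lam = b + 4"
    by (simp_all add: omega_def mu_def lam_def h s \<tau>)
  show r2: "\<tau> rad2 = 1 / (r0 * r1)" by (simp add: rad2_def h s \<tau>)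
  show "\<tau> theta = r0 + r1 + 1 / (r0 * r1)" by (simp add: theta_def h s \<tau> r2)
qed

lemma hom_F7_cong:
  fixes \<sigma> \<tau> :: "complex \<Rightarrow> complex"
  assumes hom: "hom_on F7 \<sigma>" "hom_on F7 \<tau>"
    and eq: "\<sigma> cbrt2 = \<tau> cbrt2" "\<sigma> sqrt_m3 = \<tau> sqrt_m3" "\<sigma> sqrt_7 = \<tau> sqrt_7" "\<sigma> sqrt_19 = \<tau> sqrt_19"
    "\<sigma> sqrt_m7 = \<tau> sqrt_m7" "\<sigma> rad0 = \<tau> rad0" "\<sigma> rad1 = \<tau> rad1" and x: "x \<in> F7"
  shows "\<sigma> x = \<tau> x"
proof -
  have sub: "F6 \<subseteq> F7" "F5 \<subseteq> F7" "F4 \<subseteq> F7" "F3 \<subseteq> F7" "F2 \<subseteq> F7" "F1 \<subseteq> F7"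
    using F1_facts(3) F2_facts(3) F3_facts(3) F4_facts(3) F5_facts(3) F6_facts(3) F7_facts(3) by auto
  note s = hom_on_subset[OF hom(1) sub(1)] hom_on_subset[OF hom(1) sub(2)] hom_on_subset[OF hom(1) sub(3)]
    hom_on_subset[OF hom(1) sub(4)] hom_on_subset[OF hom(1) sub(5)] hom_on_subset[OF hom(1) sub(6)]
  note t = hom_on_subset[OF hom(2) sub(1)] hom_on_subset[OF hom(2) sub(2)] hom_on_subset[OF hom(2) sub(3)]
    hom_on_subset[OF hom(2) sub(4)] hom_on_subset[OF hom(2) sub(5)] hom_on_subset[OF hom(2) sub(6)]
  have 0: "\<sigma> x = \<tau> x" if "x \<in> \<rat>" for x
    using hom_on_Rats[OF F7_facts(2) hom(1) that] hom_on_Rats[OF F7_facts(2) hom(2) that] by simp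
  note 1 = hom_on_adjoin_cong[OF csubfield_Rats F1_def F1_facts(2) s(6) t(6) 0 eq(1)]
  note 2 = hom_on_adjoin_cong[OF F1_facts(2) F2_def F2_facts(2) s(5) t(5) 1 eq(2)]
  note 3 = hom_on_adjoin_cong[OF F2_facts(2) F3_def F3_facts(2) s(4) t(4) 2 eq(3)]
  note 4 = hom_on_adjoin_cong[OF F3_facts(2) F4_def F4_facts(2) s(3) t(3) 3 eq(4)]
  note 5 = hom_on_adjoin_cong[OF F4_facts(2) F5_def F5_facts(2) s(2) t(2) 4 eq(5)]
  note 6 = hom_on_adjoin_cong[OF F5_facts(2) F6_def F6_facts(2) s(1) t(1) 5 eq(6)]
  note 7 = hom_on_adjoin_cong[OF F6_facts(2) F7_def F7_facts(2) hom 6 eq(7)]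
  show ?thesis using 7 x by blast
qed

lemma hom_F7_image:
  fixes \<tau> :: "complex \<Rightarrow> complex"
  assumes hom: "hom_on F7 \<tau>" and M: "csubfield M" "\<tau> cbrt2 \<in> M" "\<tau> sqrt_m3 \<in> M" "\<tau> sqrt_7 \<in> M"
    "\<tau> sqrt_19 \<in> M" "\<tau> sqrt_m7 \<in> M" "\<tau> rad0 \<in> M" "\<tau> rad1 \<in> M"
  shows "\<tau> ` F7 \<subseteq> M"
proof -
  have sub: "F6 \<subseteq> F7" "F5 \<subseteq> F7" using F6_facts(3) F7_facts(3) by auto
  note homs = hom_on_subset[OF hom sub(1)] hom_on_subset[OF hom sub(2)]
  have "\<tau> ` F5 \<subseteq> M" by (rule hom_F5_image[OF homs(2) M(1-6)])
  from hom_on_adjoin_image[OF F5_facts(2) F6_def F6_facts(2) homs(1) M(1) this M(7)]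
  have "\<tau> ` F6 \<subseteq> M" .
  from hom_on_adjoin_image[OF F6_facts(2) F7_def F7_facts(2) hom M(1) this M(8)]
  show ?thesis .
qed

lemma omega_square_sqrt: "omega ^ 2 = (- sqrt_m3 - 1) / 2"
  unfolding omega_square unfolding omega_def by (simp add: field_simps)

section \<open>Adjoining the radicals \<open>yy\<close> and \<open>zz\<close>\<close>

lemma square_eq_sign: "a ^ 2 = b ^ 2 \<Longrightarrow> \<exists>k. a = k * b \<and> (k = 1 \<or> k = -1)" for a b :: complex
  by (metis mult_1 mult_minus1 power2_eq_iff)

lemma rad_quotients: "1 / (rad0 * rad1) = rad2" "1 / (rad0 * rad2) = rad1" "1 / (rad1 * rad2) = rad0"
  using rad_mult rad_nonzero by (auto simp: field_simps mult_ac)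

text \<open>As \<open>mu\<close> has norm -3, a square root of the conjugate radicand is
  \<open>yy\<close> times \<open>sqrt_m3 / mu\<close>; no new radical is needed. The next two lemmas
  do the same for \<open>zz\<close>, once through \<open>sqrt_m7 / sqrt_7\<close>, a square root of
  -1, and once through the norm of \<open>lam\<close>.\<close>

lemma yy_bar_square: "(yy * sqrt_m3 / mu) ^ 2 = theta * (- sqrt_7 - 2)"
proof -
  have "(yy * sqrt_m3 / mu) ^ 2 = theta * (- 3 / mu)"
    using other_nonzero(1) by (simp add: power_mult_distrib power_divide sqrt_squares) (simp add: power2_eq_square)
  also have "- 3 / mu = - sqrt_7 - 2"
    using mu_norm other_nonzero(1) by (simp add: field_simps)
  finally show ?thesis .
qed

lemma zz_bar_square: "(zz * sqrt_m7 / sqrt_7) ^ 2 = lam * (- sqrt_7)"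
  by (simp add: power_mult_distrib power_divide sqrt_squares)

lemma zz_bar2_square: "(zz * sqrt_m3 / lam) ^ 2 = (- sqrt_19 + 4) * sqrt_7"
proof -
  have "(zz * sqrt_m3 / lam) ^ 2 = (- 3 / lam) * sqrt_7"
    using other_nonzero(2) by (simp add: power_mult_distrib power_divide sqrt_squares) (simp add: power2_eq_square)
  also have "- 3 / lam = - sqrt_19 + 4"
    using lam_norm other_nonzero(2) by (simp add: field_simps)
  finally show ?thesis .
qed

text \<open>On \<open>F7\<close> the map changing the sign of \<open>sqrt_7\<close> commutes with
  the one changing the sign of \<open>sqrt_m3\<close> and exchanging \<open>rad1\<close>,
  \<open>rad2\<close>. If \<open>yy\<close> were in \<open>F7\<close>, the first would send it, up
  to sign, to \<open>yy * sqrt_m3 / mu\<close>, where the second negates \<open>sqrt_m3\<close>; so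
  the two would anticommute on \<open>yy\<close>.\<close>

lemma yy_notin: "yy \<notin> F7"
proof
  assume Y: "yy \<in> F7"
  note F = F7_facts(2)
  obtain \<tau> :: "complex \<Rightarrow> complex" where \<tau>: "hom_on F7 \<tau>" "\<tau> cbrt2 = cbrt2" "\<tau> sqrt_m3 = sqrt_m3"
    "\<tau> sqrt_7 = - sqrt_7" "\<tau> sqrt_19 = sqrt_19" "\<tau> sqrt_m7 = sqrt_m7" "\<tau> rad0 = rad0" "\<tau> rad1 = rad1"
    by (rule hom_F7[of cbrt2 sqrt_m3 "- sqrt_7" sqrt_19 sqrt_m7 rad0 rad1])
      (simp_all add: cbrt2_cube sqrt_squares omega_def)
  obtain \<sigma> :: "complex \<Rightarrow> complex" where \<sigma>: "hom_on F7 \<sigma>" "\<sigma> cbrt2 = cbrt2" "\<sigma> sqrt_m3 = - sqrt_m3"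
    "\<sigma> sqrt_7 = sqrt_7" "\<sigma> sqrt_19 = sqrt_19" "\<sigma> sqrt_m7 = sqrt_m7" "\<sigma> rad0 = rad0" "\<sigma> rad1 = rad2"
    by (rule hom_F7[of cbrt2 "- sqrt_m3" "sqrt_7" sqrt_19 sqrt_m7 rad0 rad2])
      (simp_all add: cbrt2_cube sqrt_squares rad2_square omega_square_sqrt)
  note v\<tau> = F7_hom_values[OF F order_refl \<tau>(1) _ _ \<tau>(2-5,7,8)]
  note v\<sigma> = F7_hom_values[OF F order_refl \<sigma>(1) _ _ \<sigma>(2-5,7,8)]
  have \<tau>v: "\<tau> theta = theta" "\<tau> mu = - sqrt_7 - 2" "\<tau> rad2 = rad2"
    using v\<tau>(2,3,4) by (simp_all add: sqrt_squares omega_def rad_quotients theta_def)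
  have \<sigma>v: "\<sigma> theta = theta" "\<sigma> mu = mu" "\<sigma> rad2 = rad1"
    using v\<sigma>(2,3,4) by (simp_all add: sqrt_squares rad2_square omega_square_sqrt rad_quotients theta_def mu_def)
  define yb where "yb = yy * sqrt_m3 / mu"
  have yb0: "yb \<noteq> 0" using other_nonzero by (simp add: yb_def)
  have "(\<tau> yy) ^ 2 = yb ^ 2"
    using hom_on_power[OF F \<tau>(1) Y, of 2] hom_on_mult[OF F \<tau>(1) F7_mem(10,11)]
    by (simp add: sqrt_squares \<tau>v yb_def yy_bar_square)
  \<comment> \<open>The signs \<open>k\<close> and \<open>l\<close> remain undetermined, but both
    composites contain them only through the product \<open>k * l\<close>.\<close>
  then obtain k :: complex where k: "\<tau> yy = k * yb" "k = 1 \<or> k = -1"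
    using square_eq_sign by blast
  have "(\<sigma> yy) ^ 2 = yy ^ 2"
    using hom_on_power[OF F \<sigma>(1) Y, of 2] hom_on_mult[OF F \<sigma>(1) F7_mem(10,11)]
    by (simp add: sqrt_squares \<sigma>v)
  then obtain l :: complex where l: "\<sigma> yy = l * yy" "l = 1 \<or> l = -1"
    using square_eq_sign by blast
  have kF: "k \<in> F7" "l \<in> F7" and fixed: "\<sigma> k = k" "\<tau> l = l"
    using k(2) l(2) F by (auto simp: csubfield_closed hom_on_minus[OF F \<sigma>(1)] hom_on_one[OF F \<sigma>(1)]
      hom_on_minus[OF F \<tau>(1)] hom_on_one[OF F \<tau>(1)])
  have ybF: "yb \<in> F7" unfolding yb_def using Y F7_mem by (simp add: csubfield_closed[OF F])
  have "\<sigma> yb = - (l * yb)"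
    using \<sigma>v \<sigma> Y F7_mem by (simp add: yb_def l hom_on_mult[OF F \<sigma>(1)] hom_on_divide[OF F \<sigma>(1)] csubfield_closed[OF F])
  then have 1: "\<sigma> (\<tau> yy) = - (k * l * yb)"
    using k kF ybF fixed by (simp add: hom_on_mult[OF F \<sigma>(1)])
  have 2: "\<tau> (\<sigma> yy) = k * l * yb"
    using k l kF Y fixed by (simp add: hom_on_mult[OF F \<tau>(1)])
  have img: "\<tau> ` F7 \<subseteq> F7" "\<sigma> ` F7 \<subseteq> F7"
    by (rule hom_F7_image[OF \<tau>(1) F] hom_F7_image[OF \<sigma>(1) F];
        simp add: \<tau> \<sigma> F7_mem csubfield_closed[OF F])+
  have "\<sigma> (\<tau> yy) = \<tau> (\<sigma> yy)"
    by (rule hom_F7_cong[OF hom_on_compose[OF \<tau>(1) \<sigma>(1) img(1)] hom_on_compose[OF \<sigma>(1) \<tau>(1) img(2)] _ _ _ _ _ _ _ Y])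
      (simp_all add: \<tau> \<sigma> \<tau>v \<sigma>v hom_on_minus[OF F \<tau>(1)] hom_on_minus[OF F \<sigma>(1)] F7_mem)
  then show False using 1 2 yb0 k(2) l(2) by auto
qed

lemma hom_F8:
  assumes t: "t ^ 3 = 2" and s: "s ^ 2 = -3" and a: "a ^ 2 = 7" and b: "b ^ 2 = 19" and c: "c ^ 2 = -7"
    and r: "r0 ^ 2 = t - 1" "r1 ^ 2 = (s - 1) / 2 * t - 1"
    and y: "y ^ 2 = (r0 + r1 + 1 / (r0 * r1)) * (a - 2)"
  obtains \<tau> :: "complex \<Rightarrow> complex" where "hom_on F8 \<tau>" "\<tau> cbrt2 = t" "\<tau> sqrt_m3 = s" "\<tau> sqrt_7 = a"
    "\<tau> sqrt_19 = b" "\<tau> sqrt_m7 = c" "\<tau> rad0 = r0" "\<tau> rad1 = r1" "\<tau> yy = y"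
proof -
  note F = F7_facts(2)
  obtain \<sigma> :: "complex \<Rightarrow> complex" where \<sigma>: "hom_on F7 \<sigma>" "\<sigma> cbrt2 = t" "\<sigma> sqrt_m3 = s" "\<sigma> sqrt_7 = a"
    "\<sigma> sqrt_19 = b" "\<sigma> sqrt_m7 = c" "\<sigma> rad0 = r0" "\<sigma> rad1 = r1" using hom_F7[OF t s a b c r] .
  note v = F7_hom_values[OF F order_refl \<sigma>(1) r \<sigma>(2-5,7,8)]
  have "yy ^ 2 \<in> F7" using F7_mem by (simp add: sqrt_squares csubfield_closed[OF F])
  moreover have "\<sigma> (yy ^ 2) = y ^ 2"
    by (simp add: sqrt_squares hom_on_mult[OF F \<sigma>(1)] F7_mem v y)
  ultimately obtain \<tau> where \<tau>: "hom_on F8 \<tau>" "\<And>a. a \<in> F7 \<Longrightarrow> \<tau> a = \<sigma> a" "\<tau> yy = y"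
    using hom_step[OF F \<sigma>(1) F8_def _ yy_notin, of y] by metis
  show thesis by (rule that[of \<tau>]) (simp_all add: \<tau> \<sigma> F7_mem)
qed

lemma hom_F8_cong:
  fixes \<sigma> \<tau> :: "complex \<Rightarrow> complex"
  assumes hom: "hom_on F8 \<sigma>" "hom_on F8 \<tau>"
    and eq: "\<sigma> cbrt2 = \<tau> cbrt2" "\<sigma> sqrt_m3 = \<tau> sqrt_m3" "\<sigma> sqrt_7 = \<tau> sqrt_7" "\<sigma> sqrt_19 = \<tau> sqrt_19"
    "\<sigma> sqrt_m7 = \<tau> sqrt_m7" "\<sigma> rad0 = \<tau> rad0" "\<sigma> rad1 = \<tau> rad1" "\<sigma> yy = \<tau> yy" and x: "x \<in> F8"
  shows "\<sigma> x = \<tau> x"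
proof -
  have "\<sigma> x = \<tau> x" if "x \<in> F7" for x
    by (rule hom_F7_cong[OF hom_on_subset[OF hom(1) F8_facts(3)] hom_on_subset[OF hom(2) F8_facts(3)] eq(1-7) that])
  then show ?thesis by (rule hom_on_adjoin_cong[OF F7_facts(2) F8_def F8_facts(2) hom _ eq(8) x])
qed

lemma hom_F8_image:
  fixes \<tau> :: "complex \<Rightarrow> complex"
  assumes hom: "hom_on F8 \<tau>" and M: "csubfield M" "\<tau> cbrt2 \<in> M" "\<tau> sqrt_m3 \<in> M" "\<tau> sqrt_7 \<in> M"
    "\<tau> sqrt_19 \<in> M" "\<tau> sqrt_m7 \<in> M" "\<tau> rad0 \<in> M" "\<tau> rad1 \<in> M" "\<tau> yy \<in> M"
  shows "\<tau> ` F8 \<subseteq> M"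
  by (rule hom_on_adjoin_image[OF F7_facts(2) F8_def F8_facts(2) hom M(1)
      hom_F7_image[OF hom_on_subset[OF hom F8_facts(3)] M(1-8)] M(9)])

lemma F8_mem: "cbrt2 \<in> F8" "sqrt_m3 \<in> F8" "sqrt_7 \<in> F8" "sqrt_19 \<in> F8" "sqrt_m7 \<in> F8" "omega \<in> F8"
  "rad0 \<in> F8" "rad1 \<in> F8" "rad2 \<in> F8" "theta \<in> F8" "mu \<in> F8" "lam \<in> F8" "yy \<in> F8"
  using F7_mem F8_facts(3,4) by auto

text \<open>The same argument with \<open>sqrt_m7\<close> in place of \<open>sqrt_m3\<close>:
  changing the sign of \<open>sqrt_7\<close> sends \<open>zz\<close>, up to sign, to
  \<open>zz * sqrt_m7 / sqrt_7\<close>.\<close>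

lemma zz_notin: "zz \<notin> F8"
proof
  assume Z: "zz \<in> F8"
  note F = F8_facts(2)
  obtain \<tau> :: "complex \<Rightarrow> complex" where \<tau>: "hom_on F8 \<tau>" "\<tau> cbrt2 = cbrt2" "\<tau> sqrt_m3 = sqrt_m3"
    "\<tau> sqrt_7 = - sqrt_7" "\<tau> sqrt_19 = sqrt_19" "\<tau> sqrt_m7 = sqrt_m7" "\<tau> rad0 = rad0" "\<tau> rad1 = rad1"
    "\<tau> yy = yy * sqrt_m3 / mu"
    by (rule hom_F8[of cbrt2 sqrt_m3 "- sqrt_7" sqrt_19 sqrt_m7 rad0 rad1 "yy * sqrt_m3 / mu"])
      (simp_all add: cbrt2_cube sqrt_squares omega_def yy_bar_square rad_quotients theta_def)
  obtain \<sigma> :: "complex \<Rightarrow> complex" where \<sigma>: "hom_on F8 \<sigma>" "\<sigma> cbrt2 = cbrt2" "\<sigma> sqrt_m3 = sqrt_m3"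
    "\<sigma> sqrt_7 = sqrt_7" "\<sigma> sqrt_19 = sqrt_19" "\<sigma> sqrt_m7 = - sqrt_m7" "\<sigma> rad0 = rad0" "\<sigma> rad1 = rad1" "\<sigma> yy = yy"
    by (rule hom_F8[of cbrt2 "sqrt_m3" "sqrt_7" sqrt_19 "- sqrt_m7" rad0 rad1 yy])
      (simp_all add: cbrt2_cube sqrt_squares omega_def rad_quotients theta_def mu_def)
  note v\<tau> = F7_hom_values[OF F F8_facts(3) \<tau>(1) _ _ \<tau>(2-5,7,8)]
  note v\<sigma> = F7_hom_values[OF F F8_facts(3) \<sigma>(1) _ _ \<sigma>(2-5,7,8)]
  have \<tau>v: "\<tau> lam = lam"
    using v\<tau>(5) by (simp_all add: sqrt_squares omega_def lam_def)
  have \<sigma>v: "\<sigma> mu = mu" "\<sigma> lam = lam"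
    using v\<sigma>(4,5) by (simp_all add: sqrt_squares omega_def mu_def lam_def)
  define zb where "zb = zz * sqrt_m7 / sqrt_7"
  have zb0: "zb \<noteq> 0" using other_nonzero by (simp add: zb_def)
  have "(\<tau> zz) ^ 2 = zb ^ 2"
    using hom_on_power[OF F \<tau>(1) Z, of 2] hom_on_mult[OF F \<tau>(1) F8_mem(12,3)]
    by (simp add: sqrt_squares \<tau>v \<tau> zb_def zz_bar_square)
  then obtain k :: complex where k: "\<tau> zz = k * zb" "k = 1 \<or> k = -1"
    using square_eq_sign by blast
  have "(\<sigma> zz) ^ 2 = zz ^ 2"
    using hom_on_power[OF F \<sigma>(1) Z, of 2] hom_on_mult[OF F \<sigma>(1) F8_mem(12,3)]
    by (simp add: sqrt_squares \<sigma>v \<sigma>)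
  then obtain l :: complex where l: "\<sigma> zz = l * zz" "l = 1 \<or> l = -1"
    using square_eq_sign by blast
  have kF: "k \<in> F8" "l \<in> F8" and fixed: "\<sigma> k = k" "\<tau> l = l"
    using k(2) l(2) F by (auto simp: csubfield_closed hom_on_minus[OF F \<sigma>(1)] hom_on_one[OF F \<sigma>(1)]
      hom_on_minus[OF F \<tau>(1)] hom_on_one[OF F \<tau>(1)])
  have zbF: "zb \<in> F8" unfolding zb_def using Z F8_mem by (simp add: csubfield_closed[OF F])
  have "\<sigma> zb = - (l * zb)"
    using \<sigma> Z F8_mem by (simp add: zb_def l hom_on_mult[OF F \<sigma>(1)] hom_on_divide[OF F \<sigma>(1)] csubfield_closed[OF F])
  then have 1: "\<sigma> (\<tau> zz) = - (k * l * zb)"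
    using k kF zbF fixed by (simp add: hom_on_mult[OF F \<sigma>(1)])
  have 2: "\<tau> (\<sigma> zz) = k * l * zb"
    using k l kF Z fixed by (simp add: hom_on_mult[OF F \<tau>(1)])
  have img: "\<tau> ` F8 \<subseteq> F8" "\<sigma> ` F8 \<subseteq> F8"
    by (rule hom_F8_image[OF \<tau>(1) F] hom_F8_image[OF \<sigma>(1) F];
        simp add: \<tau> \<sigma> F8_mem csubfield_closed[OF F])+
  have "\<sigma> (\<tau> zz) = \<tau> (\<sigma> zz)"
    by (rule hom_F8_cong[OF hom_on_compose[OF \<tau>(1) \<sigma>(1) img(1)] hom_on_compose[OF \<sigma>(1) \<tau>(1) img(2)] _ _ _ _ _ _ _ _ Z])
      (simp_all add: \<tau> \<sigma> \<sigma>v hom_on_minus[OF F \<tau>(1)] hom_on_minus[OF F \<sigma>(1)] F8_mem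
        hom_on_mult[OF F \<sigma>(1)] hom_on_divide[OF F \<sigma>(1)] csubfield_closed[OF F])
  then show False using 1 2 zb0 k(2) l(2) by auto
qed

lemma hom_LL:
  assumes t: "t ^ 3 = 2" and s: "s ^ 2 = -3" and a: "a ^ 2 = 7" and b: "b ^ 2 = 19" and c: "c ^ 2 = -7"
    and r: "r0 ^ 2 = t - 1" "r1 ^ 2 = (s - 1) / 2 * t - 1"
    and y: "y ^ 2 = (r0 + r1 + 1 / (r0 * r1)) * (a - 2)" and z: "z ^ 2 = (b + 4) * a"
  obtains \<tau> :: "complex \<Rightarrow> complex" where "hom_on LL \<tau>" "\<tau> cbrt2 = t" "\<tau> sqrt_m3 = s" "\<tau> sqrt_7 = a"
    "\<tau> sqrt_19 = b" "\<tau> sqrt_m7 = c" "\<tau> rad0 = r0" "\<tau> rad1 = r1" "\<tau> yy = y" "\<tau> zz = z"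
proof -
  note F = F8_facts(2)
  obtain \<sigma> :: "complex \<Rightarrow> complex" where \<sigma>: "hom_on F8 \<sigma>" "\<sigma> cbrt2 = t" "\<sigma> sqrt_m3 = s" "\<sigma> sqrt_7 = a"
    "\<sigma> sqrt_19 = b" "\<sigma> sqrt_m7 = c" "\<sigma> rad0 = r0" "\<sigma> rad1 = r1" "\<sigma> yy = y" using hom_F8[OF t s a b c r y] .
  note v = F7_hom_values[OF F F8_facts(3) \<sigma>(1) r \<sigma>(2-5,7,8)]
  have "zz ^ 2 \<in> F8" using F8_mem by (simp add: sqrt_squares csubfield_closed[OF F])
  moreover have "\<sigma> (zz ^ 2) = z ^ 2"
    by (simp add: sqrt_squares hom_on_mult[OF F \<sigma>(1)] F8_mem v z \<sigma>)
  ultimately obtain \<tau> where \<tau>: "hom_on LL \<tau>" "\<And>a. a \<in> F8 \<Longrightarrow> \<tau> a = \<sigma> a" "\<tau> zz = z"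
    using hom_step[OF F \<sigma>(1) LL_def _ zz_notin, of z] by metis
  show thesis by (rule that[of \<tau>]) (simp_all add: \<tau> \<sigma> F8_mem)
qed

lemma hom_LL_cong:
  fixes \<sigma> \<tau> :: "complex \<Rightarrow> complex"
  assumes hom: "hom_on LL \<sigma>" "hom_on LL \<tau>"
    and eq: "\<sigma> cbrt2 = \<tau> cbrt2" "\<sigma> sqrt_m3 = \<tau> sqrt_m3" "\<sigma> sqrt_7 = \<tau> sqrt_7" "\<sigma> sqrt_19 = \<tau> sqrt_19"
    "\<sigma> sqrt_m7 = \<tau> sqrt_m7" "\<sigma> rad0 = \<tau> rad0" "\<sigma> rad1 = \<tau> rad1" "\<sigma> yy = \<tau> yy" "\<sigma> zz = \<tau> zz" and x: "x \<in> LL"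
  shows "\<sigma> x = \<tau> x"
proof -
  have "\<sigma> x = \<tau> x" if "x \<in> F8" for x
    by (rule hom_F8_cong[OF hom_on_subset[OF hom(1) LL_facts(3)] hom_on_subset[OF hom(2) LL_facts(3)] eq(1-8) that])
  then show ?thesis by (rule hom_on_adjoin_cong[OF F8_facts(2) LL_def LL_facts(2) hom _ eq(9) x])
qed

lemma hom_LL_image:
  fixes \<tau> :: "complex \<Rightarrow> complex"
  assumes hom: "hom_on LL \<tau>" and M: "csubfield M" "\<tau> cbrt2 \<in> M" "\<tau> sqrt_m3 \<in> M" "\<tau> sqrt_7 \<in> M"
    "\<tau> sqrt_19 \<in> M" "\<tau> sqrt_m7 \<in> M" "\<tau> rad0 \<in> M" "\<tau> rad1 \<in> M" "\<tau> yy \<in> M" "\<tau> zz \<in> M"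
  shows "\<tau> ` LL \<subseteq> M"
  by (rule hom_on_adjoin_image[OF F8_facts(2) LL_def LL_facts(2) hom M(1)
      hom_F8_image[OF hom_on_subset[OF hom LL_facts(3)] M(1-9)] M(10)])

subsection \<open>Galois groups\<close>

lemma galois_group_carrier:
  "\<sigma> \<in> carrier (galois_group L K) \<longleftrightarrow> \<sigma> \<in> Bij L \<and> hom_on L \<sigma> \<and> (\<forall>x\<in>K. \<sigma> x = x)"
  by (auto simp: galois_group_def ring_hom_def hom_on_def Bij_def bij_betw_def)

lemma subgroup_galois_BijGroup:
  assumes L: "csubfield L" and K: "K \<subseteq> L"
  shows "subgroup (carrier (galois_group L K)) (BijGroup L)"
proof (rule group.subgroupI[OF group_BijGroup])
  show "carrier (galois_group L K) \<subseteq> carrier (BijGroup L)"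
    by (auto simp: galois_group_carrier BijGroup_def)
  have "restrict (\<lambda>x. x) L \<in> carrier (galois_group L K)"
    using K csubfield_basic[OF L] by (auto simp: galois_group_carrier id_Bij hom_on_def)
  then show "carrier (galois_group L K) \<noteq> {}" by blast
next
  fix \<sigma> assume \<sigma>: "\<sigma> \<in> carrier (galois_group L K)"
  then have B: "\<sigma> \<in> Bij L" and hom: "hom_on L \<sigma>" and fixK: "\<And>x. x \<in> K \<Longrightarrow> \<sigma> x = x"
    by (auto simp: galois_group_carrier)
  have inj: "inj_on \<sigma> L" and im: "\<sigma> ` L = L" using B by (auto simp: Bij_def bij_betw_def)
  define \<tau> where "\<tau> = (\<lambda>x\<in>L. inv_into L \<sigma> x)"
  have \<tau>: "\<tau> x \<in> L" "\<sigma> (\<tau> x) = x" if "x \<in> L" for x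
    using that im by (auto simp: \<tau>_def inv_into_into f_inv_into_f)
  have \<tau>I: "\<tau> x = y" if "x \<in> L" "y \<in> L" "\<sigma> y = x" for x y
    using that inj \<tau>[of x] by (auto dest: inj_onD)
  have "hom_on L \<tau>"
    unfolding hom_on_def
  proof (intro conjI ballI)
    show "\<tau> 1 = 1" by (rule \<tau>I) (use csubfield_basic[OF L] hom_on_one[OF L hom] in auto)
    fix x y assume "x \<in> L" "y \<in> L"
    then show "\<tau> (x + y) = \<tau> x + \<tau> y" "\<tau> (x * y) = \<tau> x * \<tau> y"
      by (auto intro!: \<tau>I simp: \<tau> csubfield_basic[OF L] hom_on_add[OF L hom] hom_on_mult[OF L hom])
  qed
  moreover have "\<tau> x = x" if "x \<in> K" for x by (rule \<tau>I) (use that K fixK in auto)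
  moreover have "\<tau> \<in> Bij L" unfolding \<tau>_def by (rule restrict_inv_into_Bij[OF B])
  moreover have "inv\<^bsub>BijGroup L\<^esub> \<sigma> = \<tau>" unfolding \<tau>_def by (rule inv_BijGroup[OF B])
  ultimately show "inv\<^bsub>BijGroup L\<^esub> \<sigma> \<in> carrier (galois_group L K)"
    by (simp add: galois_group_carrier)
next
  fix \<sigma> \<tau> assume "\<sigma> \<in> carrier (galois_group L K)" "\<tau> \<in> carrier (galois_group L K)"
  then have B: "\<sigma> \<in> Bij L" "\<tau> \<in> Bij L" and hom: "hom_on L \<sigma>" "hom_on L \<tau>"
    and fixK: "\<And>x. x \<in> K \<Longrightarrow> \<sigma> x = x" "\<And>x. x \<in> K \<Longrightarrow> \<tau> x = x"
    by (auto simp: galois_group_carrier)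
  have im: "x \<in> L \<Longrightarrow> \<tau> x \<in> L" for x using B by (auto simp: Bij_def bij_betw_def)
  have "hom_on L (compose L \<sigma> \<tau>)"
    using hom im csubfield_basic[OF L] by (auto simp: hom_on_def compose_def)
  then show "\<sigma> \<otimes>\<^bsub>BijGroup L\<^esub> \<tau> \<in> carrier (galois_group L K)"
    using B K fixK compose_Bij[OF B] by (auto simp: galois_group_carrier BijGroup_def compose_def)
qed

lemma galois_group_ops:
  "\<sigma> \<otimes>\<^bsub>galois_group L K\<^esub> \<tau> = \<sigma> \<otimes>\<^bsub>BijGroup L\<^esub> \<tau>" "\<one>\<^bsub>galois_group L K\<^esub> = (\<lambda>x\<in>L. x)"
  by (simp_all add: galois_group_def BijGroup_def)

lemma group_galois_group:
  assumes "csubfield L" "K \<subseteq> L"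
  shows "group (galois_group L K)"
proof -
  have "galois_group L K = BijGroup L\<lparr>carrier := carrier (galois_group L K)\<rparr>"
    by (simp add: galois_group_def)
  then show ?thesis
    using subgroup.subgroup_is_group[OF subgroup_galois_BijGroup[OF assms] group_BijGroup] by simp
qed

lemma subgroup_galois_group:
  assumes L: "csubfield L" and K: "K \<subseteq> L"
  shows "subgroup (carrier (galois_group L K)) (galois_group L \<rat>)"
proof -
  have sub: "carrier (galois_group L K) \<subseteq> carrier (galois_group L \<rat>)"
    using hom_on_Rats[OF L] by (auto simp: galois_group_carrier)
  have "galois_group L \<rat> = BijGroup L\<lparr>carrier := carrier (galois_group L \<rat>)\<rparr>"
    by (simp add: galois_group_def)
  then show ?thesis
    using group.subgroup_incl[OF group_BijGroup subgroup_galois_BijGroup[OF L K]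
      subgroup_galois_BijGroup[OF L Rats_subset_csubfield[OF L]] sub] by simp
qed

abbreviation GG :: "(complex \<Rightarrow> complex) monoid" where "GG \<equiv> galois_group LL \<rat>"

lemma group_GG: "group GG"
  by (rule group_galois_group[OF LL_facts(2) Rats_subset_csubfield[OF LL_facts(2)]])

lemma GG_hom: "\<sigma> \<in> carrier GG \<Longrightarrow> hom_on LL \<sigma>"
  by (simp add: galois_group_carrier)

lemma GG_apply:
  "\<sigma> \<in> carrier GG \<Longrightarrow> \<tau> \<in> carrier GG \<Longrightarrow> x \<in> LL \<Longrightarrow> (\<sigma> \<otimes>\<^bsub>GG\<^esub> \<tau>) x = \<sigma> (\<tau> x)"
  by (simp add: galois_group_ops galois_group_carrier BijGroup_def compose_def)

lemma GG_mult_closed: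
  "\<sigma> \<in> carrier GG \<Longrightarrow> \<tau> \<in> carrier GG \<Longrightarrow> \<sigma> \<otimes>\<^bsub>GG\<^esub> \<tau> \<in> carrier GG"
  using group_GG by (simp add: group.is_monoid monoid.m_closed)

lemma GG_one: "\<one>\<^bsub>GG\<^esub> \<in> carrier GG" "x \<in> LL \<Longrightarrow> \<one>\<^bsub>GG\<^esub> x = x"
  using monoid.one_closed[OF group.is_monoid[OF group_GG]] by (simp_all add: galois_group_ops(2))

lemma GG_eqI:
  assumes "\<sigma> \<in> carrier GG" "\<tau> \<in> carrier GG"
    "\<sigma> cbrt2 = \<tau> cbrt2" "\<sigma> sqrt_m3 = \<tau> sqrt_m3" "\<sigma> sqrt_7 = \<tau> sqrt_7" "\<sigma> sqrt_19 = \<tau> sqrt_19"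
    "\<sigma> sqrt_m7 = \<tau> sqrt_m7" "\<sigma> rad0 = \<tau> rad0" "\<sigma> rad1 = \<tau> rad1" "\<sigma> yy = \<tau> yy" "\<sigma> zz = \<tau> zz"
  shows "\<sigma> = \<tau>"
proof (rule extensionalityI[where A = LL])
  show "\<sigma> \<in> extensional LL" "\<tau> \<in> extensional LL"
    using assms(1,2) by (auto simp: galois_group_carrier Bij_def)
  show "\<sigma> x = \<tau> x" if "x \<in> LL" for x
    using hom_LL_cong[OF GG_hom GG_hom] assms that by blast
qed

lemma GG_hom_simps:
  assumes "\<sigma> \<in> carrier GG"
  shows "x \<in> LL \<Longrightarrow> y \<in> LL \<Longrightarrow> \<sigma> (x + y) = \<sigma> x + \<sigma> y"
    "x \<in> LL \<Longrightarrow> y \<in> LL \<Longrightarrow> \<sigma> (x - y) = \<sigma> x - \<sigma> y"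
    "x \<in> LL \<Longrightarrow> \<sigma> (- x) = - \<sigma> x"
    "x \<in> LL \<Longrightarrow> y \<in> LL \<Longrightarrow> \<sigma> (x * y) = \<sigma> x * \<sigma> y"
    "x \<in> LL \<Longrightarrow> y \<in> LL \<Longrightarrow> \<sigma> (x / y) = \<sigma> x / \<sigma> y"
    "x \<in> LL \<Longrightarrow> \<sigma> (x ^ n) = \<sigma> x ^ n" "\<sigma> 1 = 1" "\<sigma> (numeral m) = numeral m"
  by (simp_all add: hom_on_add[OF LL_facts(2) GG_hom[OF assms]] hom_on_diff[OF LL_facts(2) GG_hom[OF assms]]
    hom_on_minus[OF LL_facts(2) GG_hom[OF assms]] hom_on_mult[OF LL_facts(2) GG_hom[OF assms]]
    hom_on_divide[OF LL_facts(2) GG_hom[OF assms]] hom_on_power[OF LL_facts(2) GG_hom[OF assms]]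
    hom_on_one[OF LL_facts(2) GG_hom[OF assms]] hom_on_numeral[OF LL_facts(2) GG_hom[OF assms]])

lemma LL_least:
  assumes "csubfield M" "cbrt2 \<in> M" "sqrt_m3 \<in> M" "sqrt_7 \<in> M" "sqrt_19 \<in> M" "sqrt_m7 \<in> M"
    "rad0 \<in> M" "rad1 \<in> M" "yy \<in> M" "zz \<in> M"
  shows "LL \<subseteq> M"
  using hom_LL_image[OF hom_on_id assms] by simp

lemma csubfield_hom_image:
  fixes \<sigma> :: "complex \<Rightarrow> complex"
  assumes F: "csubfield F" and hom: "hom_on F \<sigma>"
  shows "csubfield (\<sigma> ` F)"
proof (rule csubfieldI)
  show "1 \<in> \<sigma> ` F"
    using imageI[OF csubfield_basic(2)[OF F], of \<sigma>] by (simp add: hom_on_one[OF F hom])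
  fix x y assume "x \<in> \<sigma> ` F" "y \<in> \<sigma> ` F"
  then obtain u v where uv: "u \<in> F" "v \<in> F" and [simp]: "x = \<sigma> u" "y = \<sigma> v" by blast
  have "\<sigma> (- u) \<in> \<sigma> ` F" "\<sigma> (u * v) \<in> \<sigma> ` F" "\<sigma> (u + v) \<in> \<sigma> ` F" "\<sigma> (inverse u) \<in> \<sigma> ` F"
    using uv by (auto intro!: imageI csubfield_basic[OF F] csubfield_inverse[OF F])
  then show "- x \<in> \<sigma> ` F" "x * y \<in> \<sigma> ` F" "x + y \<in> \<sigma> ` F" "inverse x \<in> \<sigma> ` F"
    using uv by (simp_all add: hom_on_add[OF F hom] hom_on_mult[OF F hom] hom_on_minus[OF F hom]
      hom_on_inverse[OF F hom])
qed

text \<open>The element exists under the hypotheses of the lemma \<open>aut\<close>, and it is then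
  unique by \<open>GG_eqI\<close>.\<close>

definition aut where
  "aut t s a b c r0 r1 y z = (SOME \<sigma>. \<sigma> \<in> carrier GG \<and> \<sigma> cbrt2 = t \<and> \<sigma> sqrt_m3 = s \<and> \<sigma> sqrt_7 = a \<and>
    \<sigma> sqrt_19 = b \<and> \<sigma> sqrt_m7 = c \<and> \<sigma> rad0 = r0 \<and> \<sigma> rad1 = r1 \<and> \<sigma> yy = y \<and> \<sigma> zz = z)"

text \<open>\<open>hom_LL\<close> supplies an injective endomorphism; \<open>gen\<close> makes it
  surjective, because its image is a subfield containing the prescribed values and hence all
  generators.\<close>

lemma aut:
  assumes t: "t ^ 3 = 2" and s: "s ^ 2 = -3" and a: "a ^ 2 = 7" and b: "b ^ 2 = 19" and c: "c ^ 2 = -7"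
    and r: "r0 ^ 2 = t - 1" "r1 ^ 2 = (s - 1) / 2 * t - 1"
    and y: "y ^ 2 = (r0 + r1 + 1 / (r0 * r1)) * (a - 2)" and z: "z ^ 2 = (b + 4) * a"
    and LL: "{t, s, a, b, c, r0, r1, y, z} \<subseteq> LL"
    and gen: "\<And>M. csubfield M \<Longrightarrow> {t, s, a, b, c, r0, r1, y, z} \<subseteq> M \<Longrightarrow>
      {cbrt2, sqrt_m3, sqrt_7, sqrt_19, sqrt_m7, rad0, rad1, yy, zz} \<subseteq> M"
    and \<sigma>: "\<sigma> = aut t s a b c r0 r1 y z"
  shows "\<sigma> \<in> carrier GG" "\<sigma> cbrt2 = t" "\<sigma> sqrt_m3 = s" "\<sigma> sqrt_7 = a" "\<sigma> sqrt_19 = b" "\<sigma> sqrt_m7 = c"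
    "\<sigma> rad0 = r0" "\<sigma> rad1 = r1" "\<sigma> yy = y" "\<sigma> zz = z"
    "\<sigma> omega = (s - 1) / 2" "\<sigma> rad2 = 1 / (r0 * r1)" "\<sigma> theta = r0 + r1 + 1 / (r0 * r1)"
    "\<sigma> mu = a - 2" "\<sigma> lam = b + 4"
proof -
  obtain \<tau> :: "complex \<Rightarrow> complex" where \<tau>: "hom_on LL \<tau>" "\<tau> cbrt2 = t" "\<tau> sqrt_m3 = s" "\<tau> sqrt_7 = a"
    "\<tau> sqrt_19 = b" "\<tau> sqrt_m7 = c" "\<tau> rad0 = r0" "\<tau> rad1 = r1" "\<tau> yy = y" "\<tau> zz = z"
    using hom_LL[OF t s a b c r y z] .
  have sub: "\<tau> ` LL \<subseteq> LL" by (rule hom_LL_image[OF \<tau>(1) LL_facts(2)]) (use LL \<tau> in auto)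
  have mem: "{t, s, a, b, c, r0, r1, y, z} \<subseteq> \<tau> ` LL"
    using LL_mem by (auto simp flip: \<tau>(2-10))
  have "LL \<subseteq> \<tau> ` LL"
    using gen[OF csubfield_hom_image[OF LL_facts(2) \<tau>(1)] mem]
    by (intro LL_least[OF csubfield_hom_image[OF LL_facts(2) \<tau>(1)]]) simp_all
  then have "bij_betw \<tau> LL LL"
    using sub hom_on_inj[OF LL_facts(2) \<tau>(1)] by (simp add: bij_betw_def subset_antisym)
  then have "bij_betw (restrict \<tau> LL) LL LL" by (subst bij_betw_cong[of LL _ \<tau>]) simp_all
  then have B: "restrict \<tau> LL \<in> Bij LL" by (simp add: Bij_def)
  have "hom_on LL (restrict \<tau> LL)"
    using \<tau>(1) csubfield_basic(2,4,5)[OF LL_facts(2)] by (simp add: hom_on_def)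
  moreover have "restrict \<tau> LL x = x" if "x \<in> \<rat>" for x
    using hom_on_Rats[OF LL_facts(2) \<tau>(1) that] that Rats_subset_csubfield[OF LL_facts(2)] by auto
  ultimately have G: "restrict \<tau> LL \<in> carrier GG"
    using B by (simp add: galois_group_carrier)
  define P where "P \<sigma> \<longleftrightarrow> \<sigma> \<in> carrier GG \<and> \<sigma> cbrt2 = t \<and> \<sigma> sqrt_m3 = s \<and> \<sigma> sqrt_7 = a \<and>
    \<sigma> sqrt_19 = b \<and> \<sigma> sqrt_m7 = c \<and> \<sigma> rad0 = r0 \<and> \<sigma> rad1 = r1 \<and> \<sigma> yy = y \<and> \<sigma> zz = z" for \<sigma>
  have "P (restrict \<tau> LL)" using G LL_mem by (simp add: P_def \<tau>(2-10))
  then have "P (Eps P)" by (rule someI[of P])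
  moreover have "\<sigma> = Eps P" unfolding \<sigma> aut_def P_def ..
  ultimately have "P \<sigma>" by simp
  then show *: "\<sigma> \<in> carrier GG" "\<sigma> cbrt2 = t" "\<sigma> sqrt_m3 = s" "\<sigma> sqrt_7 = a" "\<sigma> sqrt_19 = b" "\<sigma> sqrt_m7 = c"
    "\<sigma> rad0 = r0" "\<sigma> rad1 = r1" "\<sigma> yy = y" "\<sigma> zz = z" by (simp_all add: P_def)
  show "\<sigma> omega = (s - 1) / 2" "\<sigma> rad2 = 1 / (r0 * r1)" "\<sigma> theta = r0 + r1 + 1 / (r0 * r1)"
    "\<sigma> mu = a - 2" "\<sigma> lam = b + 4"
    using F7_hom_values[OF LL_facts(2) subset_trans[OF F8_facts(3) LL_facts(3)] GG_hom[OF *(1)] r *(2-5,7,8)]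
    by simp_all
qed

text \<open>Square roots, inside the splitting field of the quartic, of \<open>theta\<close> times
  each of its other roots. Thanks to them the sign changes of the \<open>rad\<close>s extend to
  \<open>yy\<close> without enlarging the field.\<close>

definition rho_i :: complex where "rho_i = omega * rad1 - omega ^ 2 * rad2"
definition rho_j :: complex where "rho_j = omega * rad2 - omega ^ 2 * rad0"
definition rho_k :: complex where "rho_k = omega * rad0 - omega ^ 2 * rad1"

text \<open>\<open>c\<close> and \<open>s\<close> permute the three \<open>rad\<close>s and so fix
  \<open>theta\<close>; \<open>z\<close>, \<open>e\<close>, \<open>a\<close> each negate one square
  root; \<open>u\<close> and \<open>w\<close> conjugate \<open>sqrt_7\<close> and
  \<open>sqrt_19\<close>, which dictates the images of \<open>yy\<close> and \<open>zz\<close> up to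
  sign; \<open>i\<close>, \<open>j\<close>, \<open>k\<close> lift the sign changes of two of the
  \<open>rad\<close>s.\<close>

definition aut_c where "aut_c = aut (omega * cbrt2) sqrt_m3 sqrt_7 sqrt_19 sqrt_m7 rad1 rad2 yy zz"
definition aut_s where "aut_s = aut cbrt2 (- sqrt_m3) sqrt_7 sqrt_19 sqrt_m7 rad0 rad2 yy zz"
definition aut_z where "aut_z = aut cbrt2 sqrt_m3 sqrt_7 sqrt_19 (- sqrt_m7) rad0 rad1 yy zz"
definition aut_e where "aut_e = aut cbrt2 sqrt_m3 sqrt_7 sqrt_19 sqrt_m7 rad0 rad1 (- yy) zz"
definition aut_a where "aut_a = aut cbrt2 sqrt_m3 sqrt_7 sqrt_19 sqrt_m7 rad0 rad1 yy (- zz)"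
definition aut_u where "aut_u = aut cbrt2 sqrt_m3 (- sqrt_7) sqrt_19 sqrt_m7 rad0 rad1
  (yy * sqrt_m3 / mu) (zz * sqrt_m7 / sqrt_7)"
definition aut_w where "aut_w = aut cbrt2 sqrt_m3 sqrt_7 (- sqrt_19) sqrt_m7 rad0 rad1 yy (zz * sqrt_m3 / lam)"
definition aut_i where "aut_i = aut cbrt2 sqrt_m3 sqrt_7 sqrt_19 sqrt_m7 rad0 (- rad1) (yy * rho_i / theta) zz"
definition aut_j where "aut_j = aut cbrt2 sqrt_m3 sqrt_7 sqrt_19 sqrt_m7 (- rad0) rad1 (yy * rho_j / theta) zz"
definition aut_k where "aut_k = aut cbrt2 sqrt_m3 sqrt_7 sqrt_19 sqrt_m7 (- rad0) (- rad1) (yy * rho_k / theta) zz"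

lemma omega_sqrt: "(sqrt_m3 - 1) / 2 = omega"
  by (simp add: omega_def)

lemma rho_mem: "rho_i \<in> LL" "rho_j \<in> LL" "rho_k \<in> LL"
  using LL_mem by (simp_all add: rho_i_def rho_j_def rho_k_def csubfield_closed[OF LL_facts(2)])

lemma omega_nonzero: "omega \<noteq> 0"
  using omega_cube by auto

text \<open>Changing two signs among the \<open>rad\<close>s keeps their product, so these are roots
  of the same quartic, whose constant term is -3.\<close>

lemma conjugate_nonzero:
  "rad0 - rad1 - rad2 \<noteq> 0" "rad1 - rad0 - rad2 \<noteq> 0" "rad2 - rad0 - rad1 \<noteq> 0"
proof -
  let ?f = "\<lambda>x. x ^ 4 + 6 * x ^ 2 - 8 * x - 3"
  have "?f (rad0 + - rad1 + - rad2) = 0" "?f (- rad0 + rad1 + - rad2) = 0" "?f (- rad0 + - rad1 + rad2) = 0"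
    by (rule quartic[OF omega_sum, of _ cbrt2]; simp add: sqrt_squares rad2_square rad_mult)+
  moreover have "?f 0 \<noteq> (0::complex)" by simp
  moreover have "rad0 + - rad1 + - rad2 = rad0 - rad1 - rad2" "- rad0 + rad1 + - rad2 = rad1 - rad0 - rad2"
    "- rad0 + - rad1 + rad2 = rad2 - rad0 - rad1" by simp_all
  ultimately show "rad0 - rad1 - rad2 \<noteq> 0" "rad1 - rad0 - rad2 \<noteq> 0" "rad2 - rad0 - rad1 \<noteq> 0"
    by metis+
qed

lemma rho_square:
  "rho_i ^ 2 = theta * (rad0 - rad1 - rad2)"
  "rho_j ^ 2 = theta * (rad1 - rad0 - rad2)"
  "rho_k ^ 2 = theta * (rad2 - rad0 - rad1)"
proof -
  have *: "(omega * x - omega ^ 2 * y) ^ 2 = omega ^ 2 * x ^ 2 + omega ^ 3 * (omega * y ^ 2) - 2 * omega ^ 3 * (x * y)" for x y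
    by (simp add: power2_eq_square power3_eq_cube algebra_simps)
  have **: "(x + y + z) * (x - y - z) = x ^ 2 - y ^ 2 - z ^ 2 - 2 * (y * z)" for x y z :: complex
    by (simp add: power2_eq_square algebra_simps)
  have w3: "omega * (omega * omega) = 1" using omega_cube by (simp add: power3_eq_cube mult.assoc)
  have w2: "omega * omega = - 1 - omega" using omega_square by (simp add: power2_eq_square)
  have p: "theta = rad0 + rad1 + rad2" "theta = rad1 + rad0 + rad2" "theta = rad2 + rad0 + rad1"
    by (simp_all add: theta_def)
  show "rho_i ^ 2 = theta * (rad0 - rad1 - rad2)"
    unfolding rho_i_def * p(1) ** sqrt_squares rad2_square omega_cube
    by (simp add: power2_eq_square w2 w3 algebra_simps)
  show "rho_j ^ 2 = theta * (rad1 - rad0 - rad2)"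
    unfolding rho_j_def * p(2) ** sqrt_squares rad2_square omega_cube
    by (simp add: power2_eq_square w2 w3 algebra_simps)
  show "rho_k ^ 2 = theta * (rad2 - rad0 - rad1)"
    unfolding rho_k_def * p(3) ** sqrt_squares rad2_square omega_cube
    by (simp add: power2_eq_square w2 w3 algebra_simps)
qed

lemma rho_nonzero: "rho_i \<noteq> 0" "rho_j \<noteq> 0" "rho_k \<noteq> 0"
  using rho_square conjugate_nonzero theta_nonzero by auto

lemma yy_rho_square:
  assumes "r ^ 2 = theta * x"
  shows "(yy * r / theta) ^ 2 = x * mu"
proof -
  have "(yy * r / theta) ^ 2 = theta * mu * (theta * x) / theta ^ 2"
    by (simp add: power_mult_distrib power_divide sqrt_squares assms)
  then show ?thesis using theta_nonzero by (simp add: power2_eq_square)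
qed

lemmas aut_conds = cbrt2_cube sqrt_squares rad2_square omega_cube omega_sqrt omega_square_sqrt rad_quotients
  yy_bar_square zz_bar_square zz_bar2_square yy_rho_square[OF rho_square(1)] yy_rho_square[OF rho_square(2)]
  yy_rho_square[OF rho_square(3)] power_mult_distrib

text \<open>Recovers a radical from its image when checking that the images generate the
  field.\<close>

lemma csubfield_cancel:
  assumes "csubfield M" "x * y / z \<in> M" "y \<in> M" "z \<in> M" "y \<noteq> 0" "z \<noteq> 0"
  shows "x \<in> M"
proof -
  have "x = x * y / z * z / y" using assms(5,6) by simp
  also have "\<dots> \<in> M" by (intro csubfield_divide[OF assms(1)] csubfield_basic(4)[OF assms(1)] assms)
  finally show ?thesis .
qed

lemma aut_c:
  "aut_c \<in> carrier GG" "aut_c cbrt2 = omega * cbrt2" "aut_c sqrt_m3 = sqrt_m3" "aut_c sqrt_7 = sqrt_7"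
  "aut_c sqrt_19 = sqrt_19" "aut_c sqrt_m7 = sqrt_m7" "aut_c rad0 = rad1" "aut_c rad1 = rad2" "aut_c yy = yy"
  "aut_c zz = zz" "aut_c omega = omega" "aut_c rad2 = rad0" "aut_c theta = theta" "aut_c mu = mu" "aut_c lam = lam"
proof -
  have gen: "{cbrt2, sqrt_m3, sqrt_7, sqrt_19, sqrt_m7, rad0, rad1, yy, zz} \<subseteq> M"
    if M: "csubfield M" and m: "{omega * cbrt2, sqrt_m3, sqrt_7, sqrt_19, sqrt_m7, rad1, rad2, yy, zz} \<subseteq> M" for M
  proof -
    have "omega \<in> M" unfolding omega_def using m by (simp add: csubfield_closed[OF M])
    then have "cbrt2 \<in> M" "1 / (rad1 * rad2) \<in> M"
      using m omega_nonzero csubfield_cancel[OF M, of cbrt2 omega 1]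
      by (auto intro!: csubfield_divide[OF M] csubfield_basic[OF M] simp: mult.commute)
    then show ?thesis using m by (simp add: rad_quotients)
  qed
  have r2: "rad2 ^ 2 = (sqrt_m3 - 1) / 2 * (omega * cbrt2) - 1"
    unfolding omega_sqrt rad2_square by (simp add: power2_eq_square)
  have 1: "(omega * cbrt2) ^ 3 = 2" "rad1 ^ 2 = omega * cbrt2 - 1"
    "yy ^ 2 = (rad1 + rad2 + 1 / (rad1 * rad2)) * (sqrt_7 - 2)" "zz ^ 2 = (sqrt_19 + 4) * sqrt_7"
    "{omega * cbrt2, sqrt_m3, sqrt_7, sqrt_19, sqrt_m7, rad1, rad2, yy, zz} \<subseteq> LL"
    using LL_mem
    by (simp_all add: aut_conds theta_def mu_def lam_def csubfield_closed[OF LL_facts(2)] add.assoc add.commute[of rad0])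
  note * = aut[OF 1(1) sqrt_squares(1-4) 1(2) r2 1(3-5) gen aut_c_def]
  show "aut_c \<in> carrier GG" "aut_c cbrt2 = omega * cbrt2" "aut_c sqrt_m3 = sqrt_m3" "aut_c sqrt_7 = sqrt_7"
  "aut_c sqrt_19 = sqrt_19" "aut_c sqrt_m7 = sqrt_m7" "aut_c rad0 = rad1" "aut_c rad1 = rad2" "aut_c yy = yy"
  "aut_c zz = zz" "aut_c omega = omega" "aut_c rad2 = rad0" "aut_c theta = theta" "aut_c mu = mu" "aut_c lam = lam"
    using * by (simp_all add: omega_sqrt rad_quotients theta_def mu_def lam_def)
qed

lemma aut_s:
  "aut_s \<in> carrier GG" "aut_s cbrt2 = cbrt2" "aut_s sqrt_m3 = - sqrt_m3" "aut_s sqrt_7 = sqrt_7"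
  "aut_s sqrt_19 = sqrt_19" "aut_s sqrt_m7 = sqrt_m7" "aut_s rad0 = rad0" "aut_s rad1 = rad2" "aut_s yy = yy"
  "aut_s zz = zz" "aut_s omega = omega ^ 2" "aut_s rad2 = rad1" "aut_s theta = theta" "aut_s mu = mu" "aut_s lam = lam"
proof -
  have gen: "{cbrt2, sqrt_m3, sqrt_7, sqrt_19, sqrt_m7, rad0, rad1, yy, zz} \<subseteq> M"
    if M: "csubfield M" and m: "{cbrt2, - sqrt_m3, sqrt_7, sqrt_19, sqrt_m7, rad0, rad2, yy, zz} \<subseteq> M" for M
  proof -
    have "1 / (rad0 * rad2) \<in> M"
      using m by (auto intro!: csubfield_divide[OF M] csubfield_basic[OF M])
    then show ?thesis using m csubfield_basic(3)[OF M, of "- sqrt_m3"] by (simp add: rad_quotients)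
  qed
  have 1: "cbrt2 ^ 3 = 2" "(- sqrt_m3) ^ 2 = -3" "rad0 ^ 2 = cbrt2 - 1" "rad2 ^ 2 = (- sqrt_m3 - 1) / 2 * cbrt2 - 1"
    "yy ^ 2 = (rad0 + rad2 + 1 / (rad0 * rad2)) * (sqrt_7 - 2)" "zz ^ 2 = (sqrt_19 + 4) * sqrt_7"
    "{cbrt2, - sqrt_m3, sqrt_7, sqrt_19, sqrt_m7, rad0, rad2, yy, zz} \<subseteq> LL"
    using LL_mem by (simp_all add: aut_conds theta_def mu_def lam_def csubfield_closed[OF LL_facts(2)])
  note * = aut[OF 1(1,2) sqrt_squares(2-4) 1(3-7) gen aut_s_def]
  show "aut_s \<in> carrier GG" "aut_s cbrt2 = cbrt2" "aut_s sqrt_m3 = - sqrt_m3" "aut_s sqrt_7 = sqrt_7"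
  "aut_s sqrt_19 = sqrt_19" "aut_s sqrt_m7 = sqrt_m7" "aut_s rad0 = rad0" "aut_s rad1 = rad2" "aut_s yy = yy"
  "aut_s zz = zz" "aut_s omega = omega ^ 2" "aut_s rad2 = rad1" "aut_s theta = theta" "aut_s mu = mu" "aut_s lam = lam"
    using * by (simp_all add: omega_square_sqrt rad_quotients theta_def mu_def lam_def)
qed

lemma aut_z:
  "aut_z \<in> carrier GG" "aut_z cbrt2 = cbrt2" "aut_z sqrt_m3 = sqrt_m3" "aut_z sqrt_7 = sqrt_7"
  "aut_z sqrt_19 = sqrt_19" "aut_z sqrt_m7 = - sqrt_m7" "aut_z rad0 = rad0" "aut_z rad1 = rad1" "aut_z yy = yy"
  "aut_z zz = zz" "aut_z omega = omega" "aut_z rad2 = rad2" "aut_z theta = theta" "aut_z mu = mu" "aut_z lam = lam"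
proof -
  have gen: "{cbrt2, sqrt_m3, sqrt_7, sqrt_19, sqrt_m7, rad0, rad1, yy, zz} \<subseteq> M"
    if M: "csubfield M" and m: "{cbrt2, sqrt_m3, sqrt_7, sqrt_19, - sqrt_m7, rad0, rad1, yy, zz} \<subseteq> M" for M
    using m csubfield_basic(3)[OF M, of "- sqrt_m7"] by simp
  have 1: "cbrt2 ^ 3 = 2" "(- sqrt_m7) ^ 2 = -7" "rad0 ^ 2 = cbrt2 - 1" "rad1 ^ 2 = (sqrt_m3 - 1) / 2 * cbrt2 - 1"
    "yy ^ 2 = (rad0 + rad1 + 1 / (rad0 * rad1)) * (sqrt_7 - 2)" "zz ^ 2 = (sqrt_19 + 4) * sqrt_7"
    "{cbrt2, sqrt_m3, sqrt_7, sqrt_19, - sqrt_m7, rad0, rad1, yy, zz} \<subseteq> LL"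
    using LL_mem by (simp_all add: aut_conds theta_def mu_def lam_def csubfield_closed[OF LL_facts(2)])
  note * = aut[OF 1(1) sqrt_squares(1-3) 1(2-7) gen aut_z_def]
  show "aut_z \<in> carrier GG" "aut_z cbrt2 = cbrt2" "aut_z sqrt_m3 = sqrt_m3" "aut_z sqrt_7 = sqrt_7"
  "aut_z sqrt_19 = sqrt_19" "aut_z sqrt_m7 = - sqrt_m7" "aut_z rad0 = rad0" "aut_z rad1 = rad1" "aut_z yy = yy"
  "aut_z zz = zz" "aut_z omega = omega" "aut_z rad2 = rad2" "aut_z theta = theta" "aut_z mu = mu" "aut_z lam = lam"
    using * by (simp_all add: omega_sqrt rad_quotients theta_def mu_def lam_def)
qed

lemma aut_e:
  "aut_e \<in> carrier GG" "aut_e cbrt2 = cbrt2" "aut_e sqrt_m3 = sqrt_m3" "aut_e sqrt_7 = sqrt_7"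
  "aut_e sqrt_19 = sqrt_19" "aut_e sqrt_m7 = sqrt_m7" "aut_e rad0 = rad0" "aut_e rad1 = rad1" "aut_e yy = - yy"
  "aut_e zz = zz" "aut_e omega = omega" "aut_e rad2 = rad2" "aut_e theta = theta" "aut_e mu = mu" "aut_e lam = lam"
proof -
  have gen: "{cbrt2, sqrt_m3, sqrt_7, sqrt_19, sqrt_m7, rad0, rad1, yy, zz} \<subseteq> M"
    if M: "csubfield M" and m: "{cbrt2, sqrt_m3, sqrt_7, sqrt_19, sqrt_m7, rad0, rad1, - yy, zz} \<subseteq> M" for M
    using m csubfield_basic(3)[OF M, of "- yy"] by simp
  have 1: "cbrt2 ^ 3 = 2" "rad0 ^ 2 = cbrt2 - 1" "rad1 ^ 2 = (sqrt_m3 - 1) / 2 * cbrt2 - 1"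
    "(- yy) ^ 2 = (rad0 + rad1 + 1 / (rad0 * rad1)) * (sqrt_7 - 2)" "zz ^ 2 = (sqrt_19 + 4) * sqrt_7"
    "{cbrt2, sqrt_m3, sqrt_7, sqrt_19, sqrt_m7, rad0, rad1, - yy, zz} \<subseteq> LL"
    using LL_mem by (simp_all add: aut_conds theta_def mu_def lam_def csubfield_closed[OF LL_facts(2)])
  note * = aut[OF 1(1) sqrt_squares(1-4) 1(2-6) gen aut_e_def]
  show "aut_e \<in> carrier GG" "aut_e cbrt2 = cbrt2" "aut_e sqrt_m3 = sqrt_m3" "aut_e sqrt_7 = sqrt_7"
  "aut_e sqrt_19 = sqrt_19" "aut_e sqrt_m7 = sqrt_m7" "aut_e rad0 = rad0" "aut_e rad1 = rad1" "aut_e yy = - yy"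
  "aut_e zz = zz" "aut_e omega = omega" "aut_e rad2 = rad2" "aut_e theta = theta" "aut_e mu = mu" "aut_e lam = lam"
    using * by (simp_all add: omega_sqrt rad_quotients theta_def mu_def lam_def)
qed

lemma aut_a:
  "aut_a \<in> carrier GG" "aut_a cbrt2 = cbrt2" "aut_a sqrt_m3 = sqrt_m3" "aut_a sqrt_7 = sqrt_7"
  "aut_a sqrt_19 = sqrt_19" "aut_a sqrt_m7 = sqrt_m7" "aut_a rad0 = rad0" "aut_a rad1 = rad1" "aut_a yy = yy"
  "aut_a zz = - zz" "aut_a omega = omega" "aut_a rad2 = rad2" "aut_a theta = theta" "aut_a mu = mu" "aut_a lam = lam"
proof -
  have gen: "{cbrt2, sqrt_m3, sqrt_7, sqrt_19, sqrt_m7, rad0, rad1, yy, zz} \<subseteq> M"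
    if M: "csubfield M" and m: "{cbrt2, sqrt_m3, sqrt_7, sqrt_19, sqrt_m7, rad0, rad1, yy, - zz} \<subseteq> M" for M
    using m csubfield_basic(3)[OF M, of "- zz"] by simp
  have 1: "cbrt2 ^ 3 = 2" "rad0 ^ 2 = cbrt2 - 1" "rad1 ^ 2 = (sqrt_m3 - 1) / 2 * cbrt2 - 1"
    "yy ^ 2 = (rad0 + rad1 + 1 / (rad0 * rad1)) * (sqrt_7 - 2)" "(- zz) ^ 2 = (sqrt_19 + 4) * sqrt_7"
    "{cbrt2, sqrt_m3, sqrt_7, sqrt_19, sqrt_m7, rad0, rad1, yy, - zz} \<subseteq> LL"
    using LL_mem by (simp_all add: aut_conds theta_def mu_def lam_def csubfield_closed[OF LL_facts(2)])
  note * = aut[OF 1(1) sqrt_squares(1-4) 1(2-6) gen aut_a_def]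
  show "aut_a \<in> carrier GG" "aut_a cbrt2 = cbrt2" "aut_a sqrt_m3 = sqrt_m3" "aut_a sqrt_7 = sqrt_7"
  "aut_a sqrt_19 = sqrt_19" "aut_a sqrt_m7 = sqrt_m7" "aut_a rad0 = rad0" "aut_a rad1 = rad1" "aut_a yy = yy"
  "aut_a zz = - zz" "aut_a omega = omega" "aut_a rad2 = rad2" "aut_a theta = theta" "aut_a mu = mu" "aut_a lam = lam"
    using * by (simp_all add: omega_sqrt rad_quotients theta_def mu_def lam_def)
qed

lemma aut_u:
  "aut_u \<in> carrier GG" "aut_u cbrt2 = cbrt2" "aut_u sqrt_m3 = sqrt_m3" "aut_u sqrt_7 = - sqrt_7"
  "aut_u sqrt_19 = sqrt_19" "aut_u sqrt_m7 = sqrt_m7" "aut_u rad0 = rad0" "aut_u rad1 = rad1"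
  "aut_u yy = yy * sqrt_m3 / mu" "aut_u zz = zz * sqrt_m7 / sqrt_7"
  "aut_u omega = omega" "aut_u rad2 = rad2" "aut_u theta = theta" "aut_u mu = - sqrt_7 - 2" "aut_u lam = lam"
proof -
  let ?y = "yy * sqrt_m3 / mu" and ?z = "zz * sqrt_m7 / sqrt_7"
  have gen: "{cbrt2, sqrt_m3, sqrt_7, sqrt_19, sqrt_m7, rad0, rad1, yy, zz} \<subseteq> M"
    if M: "csubfield M" and m: "{cbrt2, sqrt_m3, - sqrt_7, sqrt_19, sqrt_m7, rad0, rad1, ?y, ?z} \<subseteq> M" for M
  proof -
    have 7: "sqrt_7 \<in> M" using m csubfield_basic(3)[OF M, of "- sqrt_7"] by simp
    then have "mu \<in> M" unfolding mu_def by (simp add: csubfield_closed[OF M])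
    then show ?thesis
      using m 7 other_nonzero csubfield_cancel[OF M, of yy sqrt_m3 mu] csubfield_cancel[OF M, of zz sqrt_m7 sqrt_7]
      by simp
  qed
  have 1: "cbrt2 ^ 3 = 2" "(- sqrt_7) ^ 2 = 7" "rad0 ^ 2 = cbrt2 - 1" "rad1 ^ 2 = (sqrt_m3 - 1) / 2 * cbrt2 - 1"
    "?y ^ 2 = (rad0 + rad1 + 1 / (rad0 * rad1)) * (- sqrt_7 - 2)" "?z ^ 2 = (sqrt_19 + 4) * (- sqrt_7)"
    "{cbrt2, sqrt_m3, - sqrt_7, sqrt_19, sqrt_m7, rad0, rad1, ?y, ?z} \<subseteq> LL"
    using LL_mem yy_bar_square zz_bar_square
    by (simp_all add: cbrt2_cube sqrt_squares rad_quotients omega_sqrt theta_def lam_def csubfield_closed[OF LL_facts(2)])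
  note * = aut[OF 1(1) sqrt_squares(1) 1(2) sqrt_squares(3,4) 1(3-7) gen aut_u_def]
  show "aut_u \<in> carrier GG" "aut_u cbrt2 = cbrt2" "aut_u sqrt_m3 = sqrt_m3" "aut_u sqrt_7 = - sqrt_7"
  "aut_u sqrt_19 = sqrt_19" "aut_u sqrt_m7 = sqrt_m7" "aut_u rad0 = rad0" "aut_u rad1 = rad1"
  "aut_u yy = yy * sqrt_m3 / mu" "aut_u zz = zz * sqrt_m7 / sqrt_7"
  "aut_u omega = omega" "aut_u rad2 = rad2" "aut_u theta = theta" "aut_u mu = - sqrt_7 - 2" "aut_u lam = lam"
    using * by (simp_all add: omega_sqrt rad_quotients theta_def lam_def)
qed

lemma aut_w:
  "aut_w \<in> carrier GG" "aut_w cbrt2 = cbrt2" "aut_w sqrt_m3 = sqrt_m3" "aut_w sqrt_7 = sqrt_7"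
  "aut_w sqrt_19 = - sqrt_19" "aut_w sqrt_m7 = sqrt_m7" "aut_w rad0 = rad0" "aut_w rad1 = rad1"
  "aut_w yy = yy" "aut_w zz = zz * sqrt_m3 / lam"
  "aut_w omega = omega" "aut_w rad2 = rad2" "aut_w theta = theta" "aut_w mu = mu" "aut_w lam = 4 - sqrt_19"
proof -
  let ?z = "zz * sqrt_m3 / lam"
  have gen: "{cbrt2, sqrt_m3, sqrt_7, sqrt_19, sqrt_m7, rad0, rad1, yy, zz} \<subseteq> M"
    if M: "csubfield M" and m: "{cbrt2, sqrt_m3, sqrt_7, - sqrt_19, sqrt_m7, rad0, rad1, yy, ?z} \<subseteq> M" for M
  proof -
    have 19: "sqrt_19 \<in> M" using m csubfield_basic(3)[OF M, of "- sqrt_19"] by simp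
    then have "lam \<in> M" unfolding lam_def by (simp add: csubfield_closed[OF M])
    then show ?thesis using m 19 other_nonzero csubfield_cancel[OF M, of zz sqrt_m3 lam] by simp
  qed
  have 1: "cbrt2 ^ 3 = 2" "(- sqrt_19) ^ 2 = 19" "rad0 ^ 2 = cbrt2 - 1" "rad1 ^ 2 = (sqrt_m3 - 1) / 2 * cbrt2 - 1"
    "yy ^ 2 = (rad0 + rad1 + 1 / (rad0 * rad1)) * (sqrt_7 - 2)" "?z ^ 2 = (- sqrt_19 + 4) * sqrt_7"
    "{cbrt2, sqrt_m3, sqrt_7, - sqrt_19, sqrt_m7, rad0, rad1, yy, ?z} \<subseteq> LL"
    using LL_mem zz_bar2_square
    by (simp_all add: cbrt2_cube sqrt_squares rad_quotients omega_sqrt theta_def mu_def csubfield_closed[OF LL_facts(2)])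
  note * = aut[OF 1(1) sqrt_squares(1,2) 1(2) sqrt_squares(4) 1(3-7) gen aut_w_def]
  show "aut_w \<in> carrier GG" "aut_w cbrt2 = cbrt2" "aut_w sqrt_m3 = sqrt_m3" "aut_w sqrt_7 = sqrt_7"
  "aut_w sqrt_19 = - sqrt_19" "aut_w sqrt_m7 = sqrt_m7" "aut_w rad0 = rad0" "aut_w rad1 = rad1"
  "aut_w yy = yy" "aut_w zz = zz * sqrt_m3 / lam"
  "aut_w omega = omega" "aut_w rad2 = rad2" "aut_w theta = theta" "aut_w mu = mu" "aut_w lam = 4 - sqrt_19"
    using * by (simp_all add: omega_sqrt rad_quotients theta_def mu_def)
qed

lemma aut_i:
  "aut_i \<in> carrier GG" "aut_i cbrt2 = cbrt2" "aut_i sqrt_m3 = sqrt_m3" "aut_i sqrt_7 = sqrt_7"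
  "aut_i sqrt_19 = sqrt_19" "aut_i sqrt_m7 = sqrt_m7" "aut_i rad0 = rad0" "aut_i rad1 = - rad1"
  "aut_i yy = yy * rho_i / theta" "aut_i zz = zz"
  "aut_i omega = omega" "aut_i rad2 = - rad2" "aut_i theta = rad0 - rad1 - rad2" "aut_i mu = mu" "aut_i lam = lam"
proof -
  let ?y = "yy * rho_i / theta"
  have gen: "{cbrt2, sqrt_m3, sqrt_7, sqrt_19, sqrt_m7, rad0, rad1, yy, zz} \<subseteq> M"
    if M: "csubfield M" and m: "{cbrt2, sqrt_m3, sqrt_7, sqrt_19, sqrt_m7, rad0, - rad1, ?y, zz} \<subseteq> M" for M
  proof -
    have r: "rad0 \<in> M" "rad1 \<in> M"
      using m csubfield_basic(3)[OF M, of "- rad0"] csubfield_basic(3)[OF M, of "- rad1"] by simp_all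
    then have r2: "rad2 \<in> M" "omega \<in> M"
      unfolding rad2_def omega_def using m by (simp_all add: csubfield_closed[OF M])
    then have "rho_i \<in> M" "theta \<in> M"
      unfolding rho_i_def theta_def using r by (simp_all add: csubfield_closed[OF M])
    then show ?thesis
      using m r theta_nonzero rho_nonzero csubfield_cancel[OF M, of yy rho_i theta] by simp
  qed
  have 1: "cbrt2 ^ 3 = 2" "(rad0) ^ 2 = cbrt2 - 1" "(- rad1) ^ 2 = (sqrt_m3 - 1) / 2 * cbrt2 - 1"
    "?y ^ 2 = (rad0 + - rad1 + 1 / ((rad0) * (- rad1))) * (sqrt_7 - 2)" "zz ^ 2 = (sqrt_19 + 4) * sqrt_7"
    "{cbrt2, sqrt_m3, sqrt_7, sqrt_19, sqrt_m7, rad0, - rad1, ?y, zz} \<subseteq> LL"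
    using LL_mem yy_rho_square[OF rho_square(1)] rho_mem
    by (simp_all add: cbrt2_cube sqrt_squares rad_quotients omega_sqrt lam_def mu_def csubfield_closed[OF LL_facts(2)])
  note * = aut[OF 1(1) sqrt_squares(1-4) 1(2-6) gen aut_i_def]
  show "aut_i \<in> carrier GG" "aut_i cbrt2 = cbrt2" "aut_i sqrt_m3 = sqrt_m3" "aut_i sqrt_7 = sqrt_7"
  "aut_i sqrt_19 = sqrt_19" "aut_i sqrt_m7 = sqrt_m7" "aut_i rad0 = rad0" "aut_i rad1 = - rad1"
  "aut_i yy = yy * rho_i / theta" "aut_i zz = zz"
  "aut_i omega = omega" "aut_i rad2 = - rad2" "aut_i theta = rad0 - rad1 - rad2" "aut_i mu = mu" "aut_i lam = lam"
    using * by (simp_all add: omega_sqrt rad_quotients mu_def lam_def)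
qed

lemma aut_j:
  "aut_j \<in> carrier GG" "aut_j cbrt2 = cbrt2" "aut_j sqrt_m3 = sqrt_m3" "aut_j sqrt_7 = sqrt_7"
  "aut_j sqrt_19 = sqrt_19" "aut_j sqrt_m7 = sqrt_m7" "aut_j rad0 = - rad0" "aut_j rad1 = rad1"
  "aut_j yy = yy * rho_j / theta" "aut_j zz = zz"
  "aut_j omega = omega" "aut_j rad2 = - rad2" "aut_j theta = rad1 - rad0 - rad2" "aut_j mu = mu" "aut_j lam = lam"
proof -
  let ?y = "yy * rho_j / theta"
  have gen: "{cbrt2, sqrt_m3, sqrt_7, sqrt_19, sqrt_m7, rad0, rad1, yy, zz} \<subseteq> M"
    if M: "csubfield M" and m: "{cbrt2, sqrt_m3, sqrt_7, sqrt_19, sqrt_m7, - rad0, rad1, ?y, zz} \<subseteq> M" for M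
  proof -
    have r: "rad0 \<in> M" "rad1 \<in> M"
      using m csubfield_basic(3)[OF M, of "- rad0"] csubfield_basic(3)[OF M, of "- rad1"] by simp_all
    then have r2: "rad2 \<in> M" "omega \<in> M"
      unfolding rad2_def omega_def using m by (simp_all add: csubfield_closed[OF M])
    then have "rho_j \<in> M" "theta \<in> M"
      unfolding rho_j_def theta_def using r by (simp_all add: csubfield_closed[OF M])
    then show ?thesis
      using m r theta_nonzero rho_nonzero csubfield_cancel[OF M, of yy rho_j theta] by simp
  qed
  have 1: "cbrt2 ^ 3 = 2" "(- rad0) ^ 2 = cbrt2 - 1" "(rad1) ^ 2 = (sqrt_m3 - 1) / 2 * cbrt2 - 1"
    "?y ^ 2 = (- rad0 + rad1 + 1 / ((- rad0) * (rad1))) * (sqrt_7 - 2)" "zz ^ 2 = (sqrt_19 + 4) * sqrt_7"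
    "{cbrt2, sqrt_m3, sqrt_7, sqrt_19, sqrt_m7, - rad0, rad1, ?y, zz} \<subseteq> LL"
    using LL_mem yy_rho_square[OF rho_square(2)] rho_mem
    by (simp_all add: cbrt2_cube sqrt_squares rad_quotients omega_sqrt lam_def mu_def csubfield_closed[OF LL_facts(2)])
  note * = aut[OF 1(1) sqrt_squares(1-4) 1(2-6) gen aut_j_def]
  show "aut_j \<in> carrier GG" "aut_j cbrt2 = cbrt2" "aut_j sqrt_m3 = sqrt_m3" "aut_j sqrt_7 = sqrt_7"
  "aut_j sqrt_19 = sqrt_19" "aut_j sqrt_m7 = sqrt_m7" "aut_j rad0 = - rad0" "aut_j rad1 = rad1"
  "aut_j yy = yy * rho_j / theta" "aut_j zz = zz"
  "aut_j omega = omega" "aut_j rad2 = - rad2" "aut_j theta = rad1 - rad0 - rad2" "aut_j mu = mu" "aut_j lam = lam"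
    using * by (simp_all add: omega_sqrt rad_quotients mu_def lam_def)
qed

lemma aut_k:
  "aut_k \<in> carrier GG" "aut_k cbrt2 = cbrt2" "aut_k sqrt_m3 = sqrt_m3" "aut_k sqrt_7 = sqrt_7"
  "aut_k sqrt_19 = sqrt_19" "aut_k sqrt_m7 = sqrt_m7" "aut_k rad0 = - rad0" "aut_k rad1 = - rad1"
  "aut_k yy = yy * rho_k / theta" "aut_k zz = zz"
  "aut_k omega = omega" "aut_k rad2 = rad2" "aut_k theta = rad2 - rad0 - rad1" "aut_k mu = mu" "aut_k lam = lam"
proof -
  let ?y = "yy * rho_k / theta"
  have gen: "{cbrt2, sqrt_m3, sqrt_7, sqrt_19, sqrt_m7, rad0, rad1, yy, zz} \<subseteq> M"
    if M: "csubfield M" and m: "{cbrt2, sqrt_m3, sqrt_7, sqrt_19, sqrt_m7, - rad0, - rad1, ?y, zz} \<subseteq> M" for M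
  proof -
    have r: "rad0 \<in> M" "rad1 \<in> M"
      using m csubfield_basic(3)[OF M, of "- rad0"] csubfield_basic(3)[OF M, of "- rad1"] by simp_all
    then have r2: "rad2 \<in> M" "omega \<in> M"
      unfolding rad2_def omega_def using m by (simp_all add: csubfield_closed[OF M])
    then have "rho_k \<in> M" "theta \<in> M"
      unfolding rho_k_def theta_def using r by (simp_all add: csubfield_closed[OF M])
    then show ?thesis
      using m r theta_nonzero rho_nonzero csubfield_cancel[OF M, of yy rho_k theta] by simp
  qed
  have 1: "cbrt2 ^ 3 = 2" "(- rad0) ^ 2 = cbrt2 - 1" "(- rad1) ^ 2 = (sqrt_m3 - 1) / 2 * cbrt2 - 1"
    "?y ^ 2 = (- rad0 + - rad1 + 1 / ((- rad0) * (- rad1))) * (sqrt_7 - 2)" "zz ^ 2 = (sqrt_19 + 4) * sqrt_7"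
    "{cbrt2, sqrt_m3, sqrt_7, sqrt_19, sqrt_m7, - rad0, - rad1, ?y, zz} \<subseteq> LL"
    using LL_mem yy_rho_square[OF rho_square(3)] rho_mem
    by (simp_all add: cbrt2_cube sqrt_squares rad_quotients omega_sqrt lam_def mu_def csubfield_closed[OF LL_facts(2)])
  note * = aut[OF 1(1) sqrt_squares(1-4) 1(2-6) gen aut_k_def]
  show "aut_k \<in> carrier GG" "aut_k cbrt2 = cbrt2" "aut_k sqrt_m3 = sqrt_m3" "aut_k sqrt_7 = sqrt_7"
  "aut_k sqrt_19 = sqrt_19" "aut_k sqrt_m7 = sqrt_m7" "aut_k rad0 = - rad0" "aut_k rad1 = - rad1"
  "aut_k yy = yy * rho_k / theta" "aut_k zz = zz"
  "aut_k omega = omega" "aut_k rad2 = rad2" "aut_k theta = rad2 - rad0 - rad1" "aut_k mu = mu" "aut_k lam = lam"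
    using * by (simp_all add: omega_sqrt rad_quotients mu_def lam_def)
qed

section \<open>Relations in the Galois group\<close>

abbreviation gmult (infixl "\<cdot>" 70) where "x \<cdot> y \<equiv> x \<otimes>\<^bsub>GG\<^esub> y"

lemmas aut_mem = aut_c(1) aut_s(1) aut_z(1) aut_e(1) aut_a(1) aut_u(1) aut_w(1) aut_i(1) aut_j(1) aut_k(1)

lemmas aut_values = aut_c(2-) aut_s(2-) aut_z(2-) aut_e(2-) aut_a(2-) aut_u(2-) aut_w(2-) aut_i(2-) aut_j(2-) aut_k(2-)

lemmas aut_hom_simps =
  GG_hom_simps[OF aut_c(1)] GG_hom_simps[OF aut_s(1)] GG_hom_simps[OF aut_z(1)] GG_hom_simps[OF aut_e(1)]
  GG_hom_simps[OF aut_a(1)] GG_hom_simps[OF aut_u(1)] GG_hom_simps[OF aut_w(1)] GG_hom_simps[OF aut_i(1)]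
  GG_hom_simps[OF aut_j(1)] GG_hom_simps[OF aut_k(1)]

lemmas LL_closed = csubfield_closed[OF LL_facts(2)] LL_mem rho_mem

lemmas aut_simps = GG_apply aut_mem GG_mult_closed aut_values aut_hom_simps LL_closed GG_one

text \<open>\<open>aut_s\<close> exchanges \<open>omega\<close> with its square and thereby produces
  a minus sign; this sign is the factor \<open>e\<close> in the relation \<open>s i = i s e\<close>
  and its companions. That \<open>i\<close> negates \<open>rho_i\<close> is what makes
  \<open>i\<close> a square root of \<open>e\<close>.\<close>

lemma aut_rho:
  "aut_c rho_i = rho_j" "aut_c rho_j = rho_k" "aut_c rho_k = rho_i"
  "aut_z rho_i = rho_i" "aut_z rho_j = rho_j" "aut_z rho_k = rho_k"
  "aut_e rho_i = rho_i" "aut_e rho_j = rho_j" "aut_e rho_k = rho_k"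
  "aut_s rho_i = - rho_i" "aut_s rho_j = - rho_k" "aut_s rho_k = - rho_j"
  "aut_i rho_i = - rho_i" "aut_j rho_j = - rho_j" "aut_k rho_k = - rho_k"
proof -
  have "omega ^ 4 = omega ^ 3 * omega" by (simp add: eval_nat_numeral mult.assoc)
  then have w4: "omega ^ 4 = omega" by (simp add: omega_cube)
  show "aut_c rho_i = rho_j" "aut_c rho_j = rho_k" "aut_c rho_k = rho_i"
    "aut_z rho_i = rho_i" "aut_z rho_j = rho_j" "aut_z rho_k = rho_k"
    "aut_e rho_i = rho_i" "aut_e rho_j = rho_j" "aut_e rho_k = rho_k"
    by (simp_all add: rho_i_def rho_j_def rho_k_def aut_simps)
  show "aut_s rho_i = - rho_i" "aut_s rho_j = - rho_k" "aut_s rho_k = - rho_j"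
    "aut_i rho_i = - rho_i" "aut_j rho_j = - rho_j" "aut_k rho_k = - rho_k"
    by (simp_all add: rho_i_def rho_j_def rho_k_def aut_simps w4)
qed

lemma rel_ccc: "aut_c \<cdot> (aut_c \<cdot> aut_c) = \<one>\<^bsub>GG\<^esub>"
proof (rule GG_eqI)
  have "omega * (omega * (omega * cbrt2)) = omega ^ 3 * cbrt2"
    by (simp add: power3_eq_cube)
  then show "(aut_c \<cdot> (aut_c \<cdot> aut_c)) cbrt2 = \<one>\<^bsub>GG\<^esub> cbrt2"
    by (simp add: aut_simps omega_cube)
qed (simp_all add: aut_simps)

lemma rel_e:
  "aut_e \<cdot> aut_e = \<one>\<^bsub>GG\<^esub>" "aut_c \<cdot> aut_e = aut_e \<cdot> aut_c" "aut_s \<cdot> aut_e = aut_e \<cdot> aut_s"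
  "aut_z \<cdot> aut_e = aut_e \<cdot> aut_z" "aut_u \<cdot> aut_e = aut_e \<cdot> aut_u" "aut_w \<cdot> aut_e = aut_e \<cdot> aut_w"
  "aut_a \<cdot> aut_e = aut_e \<cdot> aut_a" "aut_i \<cdot> aut_e = aut_e \<cdot> aut_i" "aut_j \<cdot> aut_e = aut_e \<cdot> aut_j"
  "aut_k \<cdot> aut_e = aut_e \<cdot> aut_k"
  by (rule GG_eqI; simp add: aut_simps aut_rho)+

lemma rel_a:
  "aut_a \<cdot> aut_a = \<one>\<^bsub>GG\<^esub>" "aut_c \<cdot> aut_a = aut_a \<cdot> aut_c" "aut_s \<cdot> aut_a = aut_a \<cdot> aut_s"
  "aut_z \<cdot> aut_a = aut_a \<cdot> aut_z" "aut_u \<cdot> aut_a = aut_a \<cdot> aut_u" "aut_w \<cdot> aut_a = aut_a \<cdot> aut_w"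
  by (rule GG_eqI; simp add: aut_simps)+

text \<open>The images of \<open>yy\<close> and \<open>zz\<close> under \<open>u\<close> contain
  \<open>sqrt_m3\<close> and \<open>sqrt_m7\<close>, which \<open>s\<close> and \<open>z\<close>
  negate: hence the twists by \<open>e\<close> and by \<open>a\<close>.\<close>

lemma rel_u:
  "aut_s \<cdot> aut_u = aut_u \<cdot> (aut_s \<cdot> aut_e)" "aut_z \<cdot> aut_u = aut_u \<cdot> (aut_z \<cdot> aut_a)"
  "aut_c \<cdot> aut_u = aut_u \<cdot> aut_c"
  by (rule GG_eqI; simp add: aut_simps)+

lemma rel_uu: "aut_u \<cdot> aut_u = \<one>\<^bsub>GG\<^esub>"
proof (rule GG_eqI)
  have "yy * sqrt_m3 / mu * sqrt_m3 / (- sqrt_7 - 2) = yy * sqrt_m3 ^ 2 / (mu * (- sqrt_7 - 2))"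
    by (simp add: power2_eq_square)
  also have "\<dots> = yy" by (simp add: mu_norm sqrt_squares)
  finally show "(aut_u \<cdot> aut_u) yy = \<one>\<^bsub>GG\<^esub> yy" by (simp add: aut_simps)
  have "zz * sqrt_m7 / sqrt_7 * sqrt_m7 / - sqrt_7 = - (zz * sqrt_m7 ^ 2 / sqrt_7 ^ 2)"
    by (simp add: power2_eq_square)
  also have "\<dots> = zz" by (simp add: sqrt_squares)
  finally show "(aut_u \<cdot> aut_u) zz = \<one>\<^bsub>GG\<^esub> zz" by (simp add: aut_simps)
qed (simp_all add: aut_simps)

text \<open>The image of \<open>zz\<close> under \<open>w\<close> contains \<open>sqrt_m3\<close>,
  so \<open>s\<close> is twisted by \<open>a\<close> here; \<open>yy\<close> is fixed and
  \<open>sqrt_m7\<close> does not occur, so \<open>z\<close> is untouched.\<close>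

lemma rel_w:
  "aut_s \<cdot> aut_w = aut_w \<cdot> (aut_s \<cdot> aut_a)" "aut_z \<cdot> aut_w = aut_w \<cdot> aut_z" "aut_c \<cdot> aut_w = aut_w \<cdot> aut_c"
  "aut_w \<cdot> aut_u = aut_u \<cdot> aut_w"
  by (rule GG_eqI; simp add: aut_simps; simp add: mult_ac)+

lemma rel_ww: "aut_w \<cdot> aut_w = \<one>\<^bsub>GG\<^esub>"
proof (rule GG_eqI)
  have "zz * sqrt_m3 / lam * sqrt_m3 / (4 - sqrt_19) = zz * sqrt_m3 ^ 2 / (lam * (4 - sqrt_19))"
    by (simp add: power2_eq_square)
  also have "\<dots> = zz" by (simp add: lam_norm sqrt_squares)
  finally show "(aut_w \<cdot> aut_w) zz = \<one>\<^bsub>GG\<^esub> zz" by (simp add: aut_simps)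
qed (simp_all add: aut_simps)

lemma rel_ijk_conj:
  "aut_c \<cdot> aut_i = aut_j \<cdot> aut_c" "aut_c \<cdot> aut_j = aut_k \<cdot> aut_c" "aut_c \<cdot> aut_k = aut_i \<cdot> aut_c"
  "aut_s \<cdot> aut_i = aut_i \<cdot> (aut_s \<cdot> aut_e)" "aut_s \<cdot> aut_j = aut_k \<cdot> (aut_s \<cdot> aut_e)"
  "aut_s \<cdot> aut_k = aut_j \<cdot> (aut_s \<cdot> aut_e)"
  "aut_z \<cdot> aut_i = aut_i \<cdot> aut_z" "aut_z \<cdot> aut_j = aut_j \<cdot> aut_z" "aut_z \<cdot> aut_k = aut_k \<cdot> aut_z"
  by (rule GG_eqI; simp add: aut_simps aut_rho)+

text \<open>\<open>i\<close> multiplies \<open>yy\<close> by \<open>rho_i / theta\<close>. Applied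
  once more it turns this factor into \<open>- rho_i\<close> over the conjugate of
  \<open>theta\<close>, and \<open>rho_i ^ 2\<close> is \<open>theta\<close> times that conjugate;
  \<open>yy\<close> comes back negated.\<close>

lemma rel_ii:
  "aut_i \<cdot> aut_i = aut_e" "aut_j \<cdot> aut_j = aut_e" "aut_k \<cdot> aut_k = aut_e"
proof -
  have *: "yy * r / theta * - r / x = - yy" if "r ^ 2 = theta * x" "x \<noteq> 0" for r x
  proof -
    have "yy * r / theta * - r / x = - (yy * r ^ 2 / (theta * x))" by (simp add: power2_eq_square)
    then show ?thesis using that theta_nonzero by simp
  qed
  note ** = *[OF rho_square(1) conjugate_nonzero(1)] *[OF rho_square(2) conjugate_nonzero(2)]
    *[OF rho_square(3) conjugate_nonzero(3)]
  show "aut_i \<cdot> aut_i = aut_e" "aut_j \<cdot> aut_j = aut_e" "aut_k \<cdot> aut_k = aut_e"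
    by (rule GG_eqI; use ** in \<open>simp add: aut_simps aut_rho\<close>)+
qed

lemma rel_ij: "aut_i \<cdot> aut_j = aut_e \<cdot> aut_k"
proof (rule GG_eqI)
  \<comment> \<open>The image of \<open>rho_j\<close> under \<open>i\<close>. On \<open>yy\<close>
    the claim amounts to \<open>rho_i * ?x = - (rho_k * (rad0 - rad1 - rad2))\<close>.\<close>
  let ?x = "- omega * rad2 - omega ^ 2 * rad0"
  have w12: "omega + omega ^ 2 = - 1" by (simp add: omega_square)
  \<comment> \<open>The squares of the three \<open>rad\<close>s are combinations of
    \<open>cbrt2\<close> and 1, hence linearly dependent over the field of
    \<open>omega\<close>.\<close>
  have "- omega * rad0 ^ 2 - omega ^ 2 * rad1 ^ 2 = - (omega + omega ^ 3) * cbrt2 + (omega + omega ^ 2)"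
    unfolding sqrt_squares by (simp add: power2_eq_square power3_eq_cube algebra_simps)
  also have "\<dots> = rad2 ^ 2" unfolding rad2_square omega_cube w12 by (simp add: omega_square)
  finally have r2: "rad2 ^ 2 = - omega * rad0 ^ 2 - omega ^ 2 * rad1 ^ 2" by simp
  have w4: "omega ^ 4 = omega"
  proof -
    have "omega ^ 4 = omega ^ 3 * omega" by (simp add: eval_nat_numeral mult.assoc)
    then show ?thesis by (simp add: omega_cube)
  qed
  have "rho_i * ?x = - (omega ^ 3 * (rad0 * rad1)) - omega ^ 2 * (rad1 * rad2) + omega ^ 3 * rad2 ^ 2
     + omega ^ 4 * (rad0 * rad2)"
    by (simp add: rho_i_def eval_nat_numeral algebra_simps)
  then have "rho_i * ?x = - (rad0 * rad1) - omega ^ 2 * (rad1 * rad2) + rad2 ^ 2 + omega * (rad0 * rad2)"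
    by (simp only: w4 omega_cube mult_1)
  moreover have "rho_k * (rad0 - rad1 - rad2) = omega * rad0 ^ 2 + omega ^ 2 * rad1 ^ 2 - (omega + omega ^ 2) * (rad0 * rad1)
    - omega * (rad0 * rad2) + omega ^ 2 * (rad1 * rad2)"
    by (simp add: rho_k_def power2_eq_square algebra_simps)
  ultimately have "rho_i * ?x = - (rho_k * (rad0 - rad1 - rad2))"
    unfolding r2 w12 by simp
  then have "?x = - (rho_k * (rad0 - rad1 - rad2) / rho_i)"
    using rho_nonzero by (simp add: field_simps)
  then have "yy * rho_i / theta * ?x / (rad0 - rad1 - rad2) = - (yy * rho_k / theta)"
    using rho_nonzero conjugate_nonzero by simp
  then show "(aut_i \<cdot> aut_j) yy = (aut_e \<cdot> aut_k) yy"
    by (simp add: aut_simps aut_rho) (simp add: rho_j_def aut_simps)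
qed (simp_all add: aut_simps)

subsection \<open>Hecke operators between permutation modules\<close>

text \<open>The list stands for the element \<open>\<Sum> c v\<close> of the integral group ring.
  \<open>F\<close> is a coefficient vector at one level \<open>n\<close>, so the calculus takes
  place over the integers and is reduced modulo \<open>p ^ n\<close> only afterwards.\<close>

definition hecke_sum ::
  "('g, 'n) monoid_scheme \<Rightarrow> (int \<times> 'g) list \<Rightarrow> 'g set \<Rightarrow> ('g set \<Rightarrow> int) \<Rightarrow> 'g \<Rightarrow> int" where
  "hecke_sum G l H F g = (\<Sum>(c, v)\<leftarrow>l. c * F (H #>\<^bsub>G\<^esub> (v \<otimes>\<^bsub>G\<^esub> g)))"

lemma hecke_sum_simps [simp]:
  "hecke_sum G [] H F g = 0"
  "hecke_sum G ((c, v) # l) H F g = c * F (H #>\<^bsub>G\<^esub> (v \<otimes>\<^bsub>G\<^esub> g)) + hecke_sum G l H F g"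
  by (simp_all add: hecke_sum_def)

lemma hecke_sum_add: "hecke_sum G l H (\<lambda>D. F D + F' D) g = hecke_sum G l H F g + hecke_sum G l H F' g"
  by (induction l) (auto simp: algebra_simps)

lemma hecke_sum_mult: "hecke_sum G l H (\<lambda>D. a * F D) g = a * hecke_sum G l H F g"
  by (induction l) (auto simp: algebra_simps)

text \<open>Independence of the representative picked by \<open>SOME\<close> is not automatic: it is
  the invariance under \<open>H2\<close> demanded in \<open>hecke_operator_apply\<close>.\<close>

definition hecke_operator ::
  "nat \<Rightarrow> ('g, 'n) monoid_scheme \<Rightarrow> (int \<times> 'g) list \<Rightarrow> 'g set \<Rightarrow> 'g set \<Rightarrow> ('g set \<Rightarrow> nat \<Rightarrow> int) \<Rightarrow> 'g set \<Rightarrow> nat \<Rightarrow> int"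
  where "hecke_operator p G l H1 H2 x =
    (\<lambda>C\<in>rcosets\<^bsub>G\<^esub> H2. \<lambda>n. hecke_sum G l H1 (\<lambda>D. x D n) (SOME g. g \<in> C) mod int p ^ n)"

context
  fixes G :: "('g, 'n) monoid_scheme" (structure)
  assumes group: "group G"
begin

interpretation group G by (rule group)

lemma hecke_sum_mod_cong:
  assumes "snd ` set l \<subseteq> carrier G" "g \<in> carrier G"
    and "\<And>k. k \<in> carrier G \<Longrightarrow> F (H #> k) mod q = F' (H #> k) mod q"
  shows "hecke_sum G l H F g mod q = hecke_sum G l H F' g mod q"
  using assms(1)
proof (induction l)
  case (Cons cv l)
  obtain c v where [simp]: "cv = (c, v)" by force
  have "F (H #> (v \<otimes> g)) mod q = F' (H #> (v \<otimes> g)) mod q"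
    using Cons.prems assms(2) by (intro assms(3)) auto
  then have "(c * F (H #> (v \<otimes> g))) mod q = (c * F' (H #> (v \<otimes> g))) mod q"
    by (rule mod_mult_cong[OF refl])
  moreover have "hecke_sum G l H F g mod q = hecke_sum G l H F' g mod q" using Cons by simp
  ultimately show ?case using mod_add_cong by simp
qed simp

text \<open>Left multiplication by the entries of \<open>l\<close> commutes with right translation.
  Therefore invariance needs to be tested only at the identity, provided that it is tested for all
  \<open>F\<close>.\<close>

lemma hecke_sum_translate:
  assumes "snd ` set l \<subseteq> carrier G" "h \<in> carrier G" "g \<in> carrier G" "H \<subseteq> carrier G"
  shows "hecke_sum G l H F (h \<otimes> g) = hecke_sum G l H (\<lambda>D. F (D #> g)) h"
  using assms(1)
proof (induction l)
  case (Cons cv l)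
  obtain c v where [simp]: "cv = (c, v)" by force
  have "H #> (v \<otimes> (h \<otimes> g)) = H #> (v \<otimes> h) #> g"
    using Cons.prems assms by (simp add: coset_mult_assoc m_assoc)
  then show ?case using Cons by simp
qed simp

text \<open>Reduces invariance under a stabilizer to a set of generators; the first hypothesis is
  applied to the translate of \<open>F\<close> by \<open>k\<close>.\<close>

lemma hecke_invariant_mult:
  assumes l: "snd ` set l \<subseteq> carrier G" and H: "H \<subseteq> carrier G" and hk: "h \<in> carrier G" "k \<in> carrier G"
    and "\<And>F. hecke_sum G l H F h = hecke_sum G l H F \<one>" "\<And>F. hecke_sum G l H F k = hecke_sum G l H F \<one>"
  shows "hecke_sum G l H F (h \<otimes> k) = hecke_sum G l H F \<one>"
  using assms(5)[of "\<lambda>D. F (D #> k)"] assms(6) hecke_sum_translate[OF l hk H]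
    hecke_sum_translate[OF l one_closed hk(2) H] hk by simp

lemma hecke_operator_apply:
  assumes l: "snd ` set l \<subseteq> carrier G" and H1: "subgroup H1 G" and H2: "subgroup H2 G"
    and inv: "\<And>h F. h \<in> H2 \<Longrightarrow> hecke_sum G l H1 F h = hecke_sum G l H1 F \<one>" and g: "g \<in> carrier G"
  shows "hecke_operator p G l H1 H2 x (H2 #> g) n = hecke_sum G l H1 (\<lambda>D. x D n) g mod int p ^ n"
proof -
  note sub = subgroup.subset[OF H1] subgroup.subset[OF H2]
  define k where "k = (SOME g'. g' \<in> H2 #> g)"
  have "g \<in> H2 #> g" using rcos_self[OF g H2] .
  then have "k \<in> H2 #> g" unfolding k_def by (rule someI)
  then obtain h where h: "h \<in> H2" "k = h \<otimes> g" by (auto simp: r_coset_def)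
  have hG: "h \<in> carrier G" using h sub by blast
  have "hecke_sum G l H1 (\<lambda>D. x D n) k = hecke_sum G l H1 (\<lambda>D. x D n) g"
    unfolding h(2) hecke_sum_translate[OF l hG g sub(1)]
    using inv[OF h(1)] hecke_sum_translate[OF l one_closed g sub(1)] g by simp
  moreover have "H2 #> g \<in> rcosets H2" using g sub by (simp add: rcosetsI)
  ultimately show ?thesis by (simp add: hecke_operator_def k_def)
qed

end

section \<open>Operators on p-adic permutation modules\<close>

lemma padic_carrier:
  "x \<in> carrier (padic_int p) \<longleftrightarrow> (\<forall>n. 0 \<le> x n \<and> x n < int p ^ n \<and> x (Suc n) mod int p ^ n = x n)"
  by (auto simp: padic_int_def)

lemma padic_mod: "x \<in> carrier (padic_int p) \<Longrightarrow> x n mod int p ^ n = x n"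
  by (simp add: padic_carrier)

lemma perm_module_carrier:
  "x \<in> carrier (perm_module R G H) \<longleftrightarrow> x \<in> (rcosets\<^bsub>G\<^esub> H) \<rightarrow>\<^sub>E carrier R"
  by (simp add: perm_module_def)

lemma rcosets_iff: "C \<in> rcosets\<^bsub>G\<^esub> H \<longleftrightarrow> (\<exists>g\<in>carrier G. C = H #>\<^bsub>G\<^esub> g)"
  by (auto simp: RCOSETS_def)

lemma perm_module_padic:
  assumes "x \<in> carrier (perm_module R G H)" "g \<in> carrier G"
  shows "x (H #>\<^bsub>G\<^esub> g) \<in> carrier R"
  using assms PiE_mem[of x "rcosets\<^bsub>G\<^esub> H" "\<lambda>_. carrier R" "H #>\<^bsub>G\<^esub> g"]
  by (simp add: perm_module_carrier) (metis rcosets_iff)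

lemma perm_module_eqI:
  assumes "x \<in> carrier (perm_module R G H)" "y \<in> carrier (perm_module R G H)"
    "\<And>g. g \<in> carrier G \<Longrightarrow> x (H #>\<^bsub>G\<^esub> g) = y (H #>\<^bsub>G\<^esub> g)"
  shows "x = y"
  using assms unfolding perm_module_carrier by (intro PiE_ext) (auto simp: rcosets_iff)

context
  fixes G :: "('g, 'n) monoid_scheme" (structure) and p :: nat and l :: "(int \<times> 'g) list" and H1 H2
  assumes group: "group G" and l: "snd ` set l \<subseteq> carrier G" and H1: "subgroup H1 G" and H2: "subgroup H2 G"
    and inv: "\<And>h F. h \<in> H2 \<Longrightarrow> hecke_sum G l H1 F h = hecke_sum G l H1 F \<one>"
begin

interpretation group G by (rule group)

abbreviation (input) "M1 \<equiv> perm_module (padic_int p) G H1"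
abbreviation (input) "M2 \<equiv> perm_module (padic_int p) G H2"
abbreviation (input) "T \<equiv> hecke_operator p G l H1 H2"

lemmas hecke_apply = hecke_operator_apply[OF group l H1 H2 inv]
lemmas hecke_mod_cong = hecke_sum_mod_cong[OF group l]

lemma rcoset_mem: "g \<in> carrier G \<Longrightarrow> H1 #> g \<in> rcosets H1" "g \<in> carrier G \<Longrightarrow> H2 #> g \<in> rcosets H2"
  by (auto simp: rcosets_iff)

lemma hecke_operator_closed:
  assumes p: "p > 0" and x: "x \<in> carrier M1"
  shows "T x \<in> carrier M2"
  unfolding perm_module_carrier
proof (rule PiE_I)
  fix C assume "C \<in> rcosets H2"
  then obtain g where g: "g \<in> carrier G" "C = H2 #> g" by (auto simp: rcosets_iff)
  have "hecke_sum G l H1 (\<lambda>D. x D (Suc n)) g mod int p ^ n = hecke_sum G l H1 (\<lambda>D. x D n) g mod int p ^ n" for n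
  proof (rule hecke_mod_cong[OF g(1)])
    fix k assume "k \<in> carrier G"
    then show "x (H1 #> k) (Suc n) mod int p ^ n = x (H1 #> k) n mod int p ^ n"
      using perm_module_padic[OF x] by (simp add: padic_carrier)
  qed
  then show "T x C \<in> carrier (padic_int p)"
    using p by (simp add: padic_carrier g hecke_apply mod_mod_cancel)
next
  fix C assume "C \<notin> rcosets H2"
  then show "T x C = undefined" by (simp add: hecke_operator_def)
qed

lemma hecke_operator_add:
  assumes p: "p > 0" and x: "x \<in> carrier M1" and y: "y \<in> carrier M1"
  shows "T (x \<oplus>\<^bsub>M1\<^esub> y) = T x \<oplus>\<^bsub>M2\<^esub> T y"
proof (rule ext)
  fix C
  show "T (x \<oplus>\<^bsub>M1\<^esub> y) C = (T x \<oplus>\<^bsub>M2\<^esub> T y) C"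
  proof (cases "C \<in> rcosets H2")
    case True
    then obtain g where g: "g \<in> carrier G" "C = H2 #> g" by (auto simp: rcosets_iff)
    have "hecke_sum G l H1 (\<lambda>D. (x \<oplus>\<^bsub>M1\<^esub> y) D n) g mod int p ^ n
      = hecke_sum G l H1 (\<lambda>D. x D n + y D n) g mod int p ^ n" for n
      by (rule hecke_mod_cong[OF g(1)]) (simp add: perm_module_def padic_int_def rcoset_mem)
    then have "T (x \<oplus>\<^bsub>M1\<^esub> y) C n = (T x C n + T y C n) mod int p ^ n" for n
      using g by (simp add: hecke_apply hecke_sum_add mod_add_eq)
    then show ?thesis
      using True by (intro ext) (simp add: perm_module_def padic_int_def)
  qed (simp add: perm_module_def hecke_operator_def)
qed

lemma hecke_operator_smult:
  assumes p: "p > 0" and a: "a \<in> carrier (padic_int p)" and x: "x \<in> carrier M1"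
  shows "T (a \<odot>\<^bsub>M1\<^esub> x) = a \<odot>\<^bsub>M2\<^esub> T x"
proof (rule ext)
  fix C
  show "T (a \<odot>\<^bsub>M1\<^esub> x) C = (a \<odot>\<^bsub>M2\<^esub> T x) C"
  proof (cases "C \<in> rcosets H2")
    case True
    then obtain g where g: "g \<in> carrier G" "C = H2 #> g" by (auto simp: rcosets_iff)
    have "hecke_sum G l H1 (\<lambda>D. (a \<odot>\<^bsub>M1\<^esub> x) D n) g mod int p ^ n
      = hecke_sum G l H1 (\<lambda>D. a n * x D n) g mod int p ^ n" for n
      by (rule hecke_mod_cong[OF g(1)]) (simp add: perm_module_def padic_int_def rcoset_mem)
    then have "T (a \<odot>\<^bsub>M1\<^esub> x) C n = (a n * T x C n) mod int p ^ n" for n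
      using g by (simp add: hecke_apply hecke_sum_mult mod_mult_right_eq)
    then show ?thesis
      using True by (intro ext) (simp add: perm_module_def padic_int_def)
  qed (simp add: perm_module_def hecke_operator_def)
qed

lemma hecke_operator_equivariant:
  assumes g: "g \<in> carrier G" and x: "x \<in> carrier M1"
  shows "T (perm_action G H1 x g) = perm_action G H2 (T x) g"
proof (rule ext)
  fix C
  show "T (perm_action G H1 x g) C = perm_action G H2 (T x) g C"
  proof (cases "C \<in> rcosets H2")
    case True
    then obtain k where k: "k \<in> carrier G" "C = H2 #> k" by (auto simp: rcosets_iff)
    have C: "C #> inv g = H2 #> (k \<otimes> inv g)"
      using k g subgroup.subset[OF H2] by (simp add: coset_mult_assoc)
    have "hecke_sum G l H1 (\<lambda>D. perm_action G H1 x g D n) k mod int p ^ n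
      = hecke_sum G l H1 (\<lambda>D. x (D #> inv g) n) k mod int p ^ n" for n
      by (rule hecke_mod_cong[OF k(1)]) (simp add: perm_action_def rcoset_mem)
    also have "\<dots> n = hecke_sum G l H1 (\<lambda>D. x D n) (k \<otimes> inv g) mod int p ^ n" for n
      using hecke_sum_translate[OF group l k(1) _ subgroup.subset[OF H1], of "inv g"] g by simp
    finally have "T (perm_action G H1 x g) C n = T x (C #> inv g) n" for n
      unfolding C using k g by (simp add: hecke_apply)
    then show ?thesis
      using True by (intro ext) (simp add: perm_action_def)
  qed (simp add: perm_action_def hecke_operator_def)
qed

end

lemma padic_mult_unit:
  assumes p: "p > 0" and m: "coprime m (int p)"
  shows "x \<in> carrier (padic_int p) \<Longrightarrow> y \<in> carrier (padic_int p) \<Longrightarrow>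
      (\<And>n. (m * x n) mod int p ^ n = (m * y n) mod int p ^ n) \<Longrightarrow> x = y"
    and "y \<in> carrier (padic_int p) \<Longrightarrow> \<exists>x\<in>carrier (padic_int p). \<forall>n. (m * x n) mod int p ^ n = y n"
proof -
  have cop: "coprime m (int p ^ n)" for n using m by simp
  have cancel: "a mod int p ^ n = b mod int p ^ n"
    if "(m * a) mod int p ^ n = (m * b) mod int p ^ n" for a b n
  proof -
    have "int p ^ n dvd m * (a - b)"
      using that by (simp add: mod_eq_dvd_iff right_diff_distrib)
    then show ?thesis
      using cop by (simp add: mod_eq_dvd_iff coprime_commute coprime_dvd_mult_right_iff)
  qed
  show "x = y" if "x \<in> carrier (padic_int p)" "y \<in> carrier (padic_int p)"
    "\<And>n. (m * x n) mod int p ^ n = (m * y n) mod int p ^ n"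
  proof
    fix n
    have "x n mod int p ^ n = y n mod int p ^ n" by (rule cancel) (rule that(3))
    then show "x n = y n" by (simp add: padic_mod that(1,2))
  qed
  assume y: "y \<in> carrier (padic_int p)"
  have "\<exists>v. (m * v) mod int p ^ n = 1 mod int p ^ n" for n
  proof -
    obtain u v where "u * m + v * int p ^ n = 1" using bezout_int[of m "int p ^ n"] cop[of n] by auto
    then have "(m * u + int p ^ n * v) mod int p ^ n = 1 mod int p ^ n" by (simp add: mult.commute)
    then show ?thesis by auto
  qed
  \<comment> \<open>The inverses of \<open>m\<close> modulo the various \<open>p ^ n\<close> are
    chosen independently of each other; compatibility of \<open>x\<close> is recovered below by
    cancelling \<open>m\<close>.\<close>
  then obtain v where v: "\<And>n. (m * v n) mod int p ^ n = 1 mod int p ^ n" by metis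
  define x where "x n = (v n * y n) mod int p ^ n" for n
  have mx: "(m * x n) mod int p ^ n = y n" for n
  proof -
    have "(m * x n) mod int p ^ n = ((m * v n) mod int p ^ n * y n) mod int p ^ n"
      by (simp add: x_def mod_simps mult.assoc)
    also have "\<dots> = y n" unfolding v by (simp add: mod_simps padic_mod[OF y])
    finally show ?thesis .
  qed
  have "x \<in> carrier (padic_int p)"
    unfolding padic_carrier
  proof (intro allI conjI)
    fix n
    show "0 \<le> x n" "x n < int p ^ n" using p by (simp_all add: x_def)
    have "(m * x (Suc n)) mod int p ^ n = ((m * x (Suc n)) mod int p ^ Suc n) mod int p ^ n"
      by (simp add: mod_mod_cancel)
    also have "\<dots> = (m * x n) mod int p ^ n" unfolding mx using y by (simp add: padic_carrier)
    finally have "x (Suc n) mod int p ^ n = x n mod int p ^ n" by (rule cancel)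
    then show "x (Suc n) mod int p ^ n = x n" by (simp add: x_def)
  qed
  with mx show "\<exists>x\<in>carrier (padic_int p). \<forall>n. (m * x n) mod int p ^ n = y n" by blast
qed

text \<open>The operators pull functions back, so the composite belongs to the group ring product
  with \<open>l1\<close> on the left; \<open>prod\<close> expresses, tested on all \<open>F\<close>,
  that this product is the scalar \<open>m\<close>.\<close>

lemma hecke_compose:
  fixes G (structure)
  assumes group: "group G" and H: "subgroup H1 G" "subgroup H2 G"
    and l: "snd ` set l1 \<subseteq> carrier G" "snd ` set l2 \<subseteq> carrier G"
    and inv1: "\<And>h F. h \<in> H2 \<Longrightarrow> hecke_sum G l1 H1 F h = hecke_sum G l1 H1 F \<one>"
    and inv2: "\<And>h F. h \<in> H1 \<Longrightarrow> hecke_sum G l2 H2 F h = hecke_sum G l2 H2 F \<one>"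
    and prod: "\<And>F. (\<Sum>(d, b)\<leftarrow>l2. d * (\<Sum>(c, a)\<leftarrow>l1. c * F (a \<otimes> b))) = m * (F \<one> :: int)"
    and g: "g \<in> carrier G"
  shows "hecke_operator p G l2 H2 H1 (hecke_operator p G l1 H1 H2 x) (H1 #> g) n = (m * x (H1 #> g) n) mod int p ^ n"
proof -
  interpret group G by (rule group)
  \<comment> \<open>Pulled back to the group itself, the coefficients can be fed into
    \<open>prod\<close>.\<close>
  define F where "F k = x (H1 #> (k \<otimes> g)) n" for k
  have "hecke_sum G l2 H2 (\<lambda>C. hecke_operator p G l1 H1 H2 x C n) g mod int p ^ n
    = (\<Sum>(d, b)\<leftarrow>l2. d * (\<Sum>(c, a)\<leftarrow>l1. c * F (a \<otimes> b))) mod int p ^ n"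
    using l(2)
  proof (induction l2)
    case (Cons db l2)
    obtain d b where [simp]: "db = (d, b)" by force
    have b: "b \<in> carrier G" using Cons.prems by simp
    have "hecke_sum G l1 H1 (\<lambda>D. x D n) (b \<otimes> g) = (\<Sum>(c, a)\<leftarrow>l1. c * F (a \<otimes> b))"
      using l(1) b g by (induction l1) (auto simp: F_def m_assoc)
    then have "d * hecke_operator p G l1 H1 H2 x (H2 #> (b \<otimes> g)) n mod int p ^ n
      = d * (\<Sum>(c, a)\<leftarrow>l1. c * F (a \<otimes> b)) mod int p ^ n"
      using hecke_operator_apply[OF group l(1) H inv1, of "b \<otimes> g"] b g by (simp add: mod_mult_right_eq)
    moreover have "hecke_sum G l2 H2 (\<lambda>C. hecke_operator p G l1 H1 H2 x C n) g mod int p ^ n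
      = (\<Sum>(d, b)\<leftarrow>l2. d * (\<Sum>(c, a)\<leftarrow>l1. c * F (a \<otimes> b))) mod int p ^ n"
      using Cons by simp
    ultimately show ?case using mod_add_cong by simp
  qed simp
  then show ?thesis
    using hecke_operator_apply[OF group l(2) H(2,1) inv2 g] prod[of F] g by (simp add: F_def)
qed

text \<open>Both composites are multiplication by \<open>m\<close>, which is bijective over the
  p-adic integers because \<open>m\<close> is prime to \<open>p\<close>.\<close>

theorem hecke_isomorphism:
  fixes G (structure)
  assumes group: "group G" and H: "subgroup H1 G" "subgroup H2 G"
    and l: "snd ` set l1 \<subseteq> carrier G" "snd ` set l2 \<subseteq> carrier G"
    and inv1: "\<And>h F. h \<in> H2 \<Longrightarrow> hecke_sum G l1 H1 F h = hecke_sum G l1 H1 F \<one>"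
    and inv2: "\<And>h F. h \<in> H1 \<Longrightarrow> hecke_sum G l2 H2 F h = hecke_sum G l2 H2 F \<one>"
    and prod1: "\<And>F. (\<Sum>(d, b)\<leftarrow>l2. d * (\<Sum>(c, a)\<leftarrow>l1. c * F (a \<otimes> b))) = m * (F \<one> :: int)"
    and prod2: "\<And>F. (\<Sum>(d, b)\<leftarrow>l1. d * (\<Sum>(c, a)\<leftarrow>l2. c * F (a \<otimes> b))) = m * (F \<one> :: int)"
    and p: "p > 0" and m: "coprime m (int p)"
  shows "perm_modules_isomorphic (padic_int p) G H1 H2"
proof -
  let ?T = "hecke_operator p G l1 H1 H2" and ?S = "hecke_operator p G l2 H2 H1"
  let ?M1 = "perm_module (padic_int p) G H1" and ?M2 = "perm_module (padic_int p) G H2"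
  have ST: "?S (?T x) (H1 #> g) n = (m * x (H1 #> g) n) mod int p ^ n" if "g \<in> carrier G" for x g n
    by (rule hecke_compose[OF group H l inv1 inv2 prod1 that])
  have TS: "?T (?S x) (H2 #> g) n = (m * x (H2 #> g) n) mod int p ^ n" if "g \<in> carrier G" for x g n
    by (rule hecke_compose[OF group H(2,1) l(2,1) inv2 inv1 prod2 that])
  have Tcl: "?T x \<in> carrier ?M2" if "x \<in> carrier ?M1" for x
    by (rule hecke_operator_closed[OF group l(1) H inv1 p that])
  have Scl: "?S x \<in> carrier ?M1" if "x \<in> carrier ?M2" for x
    by (rule hecke_operator_closed[OF group l(2) H(2,1) inv2 p that])
  have "bij_betw ?T (carrier ?M1) (carrier ?M2)"
  proof (rule bij_betw_imageI)
    show "inj_on ?T (carrier ?M1)"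
    proof (rule inj_onI)
      fix x y assume xy: "x \<in> carrier ?M1" "y \<in> carrier ?M1" "?T x = ?T y"
      show "x = y"
      proof (rule perm_module_eqI[OF xy(1,2)])
        fix g assume g: "g \<in> carrier G"
        show "x (H1 #> g) = y (H1 #> g)"
          using ST[OF g, of x] ST[OF g, of y] xy(3) perm_module_padic[OF xy(1) g] perm_module_padic[OF xy(2) g]
          by (intro padic_mult_unit(1)[OF p m]) auto
      qed
    qed
    show "?T ` carrier ?M1 = carrier ?M2"
    proof (intro subset_antisym subsetI)
      fix y assume y: "y \<in> carrier ?M2"
      \<comment> \<open>For surjectivity the target is divided by \<open>m\<close> coefficientwise
        before \<open>?S\<close> and \<open>?T\<close> are applied.\<close>
      have "\<forall>C\<in>rcosets H2. \<exists>z\<in>carrier (padic_int p). \<forall>n. (m * z n) mod int p ^ n = y C n"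
        using y padic_mult_unit(2)[OF p m] by (auto simp: perm_module_carrier PiE_def)
      then obtain f where f: "\<And>C. C \<in> rcosets H2 \<Longrightarrow> f C \<in> carrier (padic_int p)"
        "\<And>C n. C \<in> rcosets H2 \<Longrightarrow> (m * f C n) mod int p ^ n = y C n" by metis
      define z where "z = restrict f (rcosets H2)"
      have z: "z \<in> carrier ?M2" using f(1) by (auto simp: perm_module_carrier z_def)
      have "?T (?S z) = y"
      proof (rule perm_module_eqI[OF Tcl[OF Scl[OF z]] y])
        fix g assume g: "g \<in> carrier G"
        then have "H2 #> g \<in> rcosets H2" by (auto simp: rcosets_iff)
        then show "?T (?S z) (H2 #> g) = y (H2 #> g)"
          using TS[OF g, of z] f(2) by (intro ext) (simp add: z_def)
      qed
      then show "y \<in> ?T ` carrier ?M1" using Scl[OF z] by blast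
    qed (use Tcl in auto)
  qed
  then show ?thesis
    unfolding perm_modules_isomorphic_def Let_def
    using hecke_operator_add[OF group l(1) H inv1 p] hecke_operator_smult[OF group l(1) H inv1 p]
      hecke_operator_equivariant[OF group l(1) H inv1]
    by (intro exI[of _ ?T]) auto
qed

section \<open>Normal forms for words in the automorphisms\<close>

interpretation GG: group GG by (rule group_GG)

text \<open>The commutation relations of \<open>s\<close> and \<open>z\<close> once more, now
  oriented so that these letters move to the left.\<close>

lemma rel_right:
  "aut_i \<cdot> aut_s = aut_s \<cdot> (aut_i \<cdot> aut_e)" "aut_j \<cdot> aut_s = aut_s \<cdot> (aut_k \<cdot> aut_e)"
  "aut_k \<cdot> aut_s = aut_s \<cdot> (aut_j \<cdot> aut_e)"
  "aut_u \<cdot> aut_s = aut_s \<cdot> (aut_u \<cdot> aut_e)" "aut_u \<cdot> aut_z = aut_z \<cdot> (aut_u \<cdot> aut_a)"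
  "aut_w \<cdot> aut_s = aut_s \<cdot> (aut_w \<cdot> aut_a)"
  by (rule GG_eqI; simp add: aut_simps aut_rho)+

lemma rel_ss: "aut_s \<cdot> aut_s = \<one>\<^bsub>GG\<^esub>" "aut_z \<cdot> aut_z = \<one>\<^bsub>GG\<^esub>" "aut_z \<cdot> aut_s = aut_s \<cdot> aut_z"
  by (rule GG_eqI; simp add: aut_simps)+

text \<open>Makes a relation usable for rewriting inside a right-nested product.\<close>

lemma assoc_rule:
  "x \<cdot> y = v \<Longrightarrow> x \<in> carrier GG \<Longrightarrow> y \<in> carrier GG \<Longrightarrow> r \<in> carrier GG \<Longrightarrow> x \<cdot> (y \<cdot> r) = v \<cdot> r"
  using GG.m_assoc by metis

text \<open>Oriented so that words are brought to the form \<open>c, s, z\<close> first, then \<open>i, j, k\<close> or \<open>u, w\<close>,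
  then \<open>a\<close>, \<open>e\<close>.\<close>

lemmas nf_e = rel_e(2-10)[symmetric]

lemmas nf_a = rel_a(2-6)[symmetric]

lemmas nf1 = nf_e nf_a rel_e(1) rel_a(1) rel_u(3)[symmetric] rel_uu rel_w(2,3)[symmetric] rel_w(4) rel_ww
  rel_right rel_ijk_conj(1,2,3)[symmetric] rel_ijk_conj(7,8,9)[symmetric] rel_ii rel_ss

lemmas nf1_assoc = nf1[THEN assoc_rule]

lemmas nf_simps = nf1 nf1_assoc aut_mem GG.m_assoc

lemma rel_ij': "aut_i \<cdot> aut_j = aut_k \<cdot> aut_e"
  using rel_ij rel_e(10) by simp

text \<open>Squaring \<open>i j = k e\<close> gives \<open>i j i j = e\<close>; multiplying by
  \<open>i\<close> on the left and by \<open>j\<close> on the right, with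
  \<open>i i = j j = e\<close>, leaves \<open>j i = i j e\<close>.\<close>

lemma rel_ji: "aut_j \<cdot> aut_i = aut_k"
proof -
  have "(aut_i \<cdot> aut_j) \<cdot> (aut_i \<cdot> aut_j) = (aut_k \<cdot> aut_e) \<cdot> (aut_k \<cdot> aut_e)"
    by (simp only: rel_ij')
  then have "aut_i \<cdot> (aut_j \<cdot> (aut_i \<cdot> aut_j)) = aut_e" by (simp add: nf_simps)
  then have "aut_i \<cdot> (aut_i \<cdot> (aut_j \<cdot> (aut_i \<cdot> aut_j))) \<cdot> aut_j = aut_i \<cdot> aut_e \<cdot> aut_j" by simp
  then have "aut_j \<cdot> aut_i = aut_i \<cdot> (aut_j \<cdot> aut_e)" by (simp add: nf_simps)
  also have "\<dots> = aut_k" by (simp add: rel_ij'[THEN assoc_rule] nf_simps)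
  finally show ?thesis .
qed

text \<open>Conjugation by \<open>c\<close> permutes \<open>i\<close>, \<open>j\<close>,
  \<open>k\<close> cyclically, so the remaining products follow from those of \<open>i\<close> and
  \<open>j\<close>.\<close>

lemma rel_jk:
  "aut_j \<cdot> aut_k = aut_i \<cdot> aut_e" "aut_k \<cdot> aut_i = aut_j \<cdot> aut_e" "aut_k \<cdot> aut_j = aut_i" "aut_i \<cdot> aut_k = aut_j"
proof -
  note c = rel_ijk_conj(1,2,3) rel_ijk_conj(1,2,3)[THEN assoc_rule] rel_e(2) rel_e(2)[THEN assoc_rule] aut_mem GG.m_assoc
  have "aut_c \<cdot> (aut_i \<cdot> aut_j) = aut_c \<cdot> (aut_k \<cdot> aut_e)" "aut_c \<cdot> (aut_j \<cdot> aut_i) = aut_c \<cdot> aut_k"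
    by (simp_all only: rel_ij' rel_ji)
  then have "aut_j \<cdot> aut_k \<cdot> aut_c = aut_i \<cdot> aut_e \<cdot> aut_c" "aut_k \<cdot> aut_j \<cdot> aut_c = aut_i \<cdot> aut_c"
    by (simp_all add: c)
  then show jk: "aut_j \<cdot> aut_k = aut_i \<cdot> aut_e" "aut_k \<cdot> aut_j = aut_i"
    by (simp_all add: aut_mem)
  have "aut_c \<cdot> (aut_j \<cdot> aut_k) = aut_c \<cdot> (aut_i \<cdot> aut_e)" "aut_c \<cdot> (aut_k \<cdot> aut_j) = aut_c \<cdot> aut_i"
    by (simp_all only: jk)
  then have "aut_k \<cdot> aut_i \<cdot> aut_c = aut_j \<cdot> aut_e \<cdot> aut_c" "aut_i \<cdot> aut_k \<cdot> aut_c = aut_j \<cdot> aut_c"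
    by (simp_all add: c)
  then show "aut_k \<cdot> aut_i = aut_j \<cdot> aut_e" "aut_i \<cdot> aut_k = aut_j"
    by (simp_all add: aut_mem)
qed

lemmas nf_all = nf_simps rel_ij' rel_ji rel_jk rel_ij'[THEN assoc_rule] rel_ji[THEN assoc_rule] rel_jk[THEN assoc_rule]

subsection \<open>The two fields\<close>

definition yb :: complex where "yb = yy * sqrt_m3 / mu"

text \<open>A tower of its own is needed: \<open>cbrt2\<close> belongs to neither of the two fields,
  since \<open>c\<close> fixes both of them but moves \<open>cbrt2\<close>. Here
  \<open>theta\<close> enters directly as a root of its quartic.\<close>

definition E1 :: "complex set" where "E1 = adjoin \<rat> sqrt_7"
definition E2 :: "complex set" where "E2 = adjoin E1 sqrt_19"
definition E3 :: "complex set" where "E3 = adjoin E2 zz"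
definition E4 :: "complex set" where "E4 = adjoin E3 theta"
definition K1 :: "complex set" where "K1 = adjoin E4 yy"
definition K2 :: "complex set" where "K2 = adjoin E4 yb"

lemma yb_square: "yb ^ 2 = theta * (- sqrt_7 - 2)"
  unfolding yb_def by (rule yy_bar_square)

lemma E1_facts: "number_field E1" "csubfield E1" "\<rat> \<subseteq> E1" "sqrt_7 \<in> E1"
  by (rule number_field_step[OF number_field_Rats _ E1_def]; simp add: sqrt_squares)+

lemma E2_facts: "number_field E2" "csubfield E2" "E1 \<subseteq> E2" "sqrt_19 \<in> E2"
  by (rule number_field_step[OF E1_facts(1) _ E2_def];
      simp add: sqrt_squares csubfield_closed[OF E1_facts(2)])+

lemma E3_facts: "number_field E3" "csubfield E3" "E2 \<subseteq> E3" "zz \<in> E3"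
  by (rule number_field_step[OF E2_facts(1) _ E3_def];
      simp add: sqrt_squares lam_def E2_facts(4) subsetD[OF E2_facts(3) E1_facts(4)] csubfield_closed[OF E2_facts(2)])+

lemma E4_facts: "number_field E4" "csubfield E4" "E3 \<subseteq> E4" "theta \<in> E4"
proof -
  interpret ring complex_ring by (rule ring_complex_ring)
  show E4: "number_field E4" unfolding E4_def
  proof (rule number_field_adjoin[OF E3_facts(1), of "[0, 6, - 8, - 3]"])
    show "set [0, 6, - 8, - 3] \<subseteq> E3" by (simp add: csubfield_closed[OF E3_facts(2)])
    show "eval [1, 0, 6, - 8, - 3] theta = 0"
      using theta_quartic by (simp add: eval_nat_numeral algebra_simps)
  qed
  then show "csubfield E4" by (rule csubfield_number_field)
  show "E3 \<subseteq> E4" "theta \<in> E4"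
    using adjoin_base[OF E3_facts(2)] adjoin_self[OF E3_facts(2)] by (auto simp: E4_def)
qed

lemma E4_mem: "sqrt_7 \<in> E4" "sqrt_19 \<in> E4" "zz \<in> E4" "theta \<in> E4" "mu \<in> E4"
proof -
  show 1: "sqrt_7 \<in> E4" "sqrt_19 \<in> E4" "zz \<in> E4" "theta \<in> E4"
    using E1_facts(4) E2_facts(3,4) E3_facts(3,4) E4_facts(3,4) by auto
  then show "mu \<in> E4" unfolding mu_def by (simp add: csubfield_closed[OF E4_facts(2)])
qed

lemma K1_facts: "number_field K1" "csubfield K1" "E4 \<subseteq> K1" "yy \<in> K1"
  by (rule number_field_step[OF E4_facts(1) _ K1_def];
      simp add: sqrt_squares E4_mem csubfield_closed[OF E4_facts(2)])+

lemma K2_facts: "number_field K2" "csubfield K2" "E4 \<subseteq> K2" "yb \<in> K2"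
  by (rule number_field_step[OF E4_facts(1) _ K2_def];
      simp add: yb_square E4_mem csubfield_closed[OF E4_facts(2)])+

lemma yb_LL: "yb \<in> LL"
  unfolding yb_def by (simp add: LL_closed)

lemma E4_LL: "E4 \<subseteq> LL"
  unfolding E4_def E3_def E2_def E1_def
  by (intro adjoin_least LL_facts LL_mem Rats_subset_csubfield)

lemma K1_LL: "K1 \<subseteq> LL" and K2_LL: "K2 \<subseteq> LL"
  unfolding K1_def K2_def by (intro adjoin_least LL_facts LL_mem yb_LL E4_LL)+

lemma fixes_adjoin:
  assumes "csubfield F" "F' = adjoin F x" "csubfield F'" "F' \<subseteq> LL" "\<sigma> \<in> carrier GG"
    "\<And>a. a \<in> F \<Longrightarrow> \<sigma> a = a" "\<sigma> x = x" "z \<in> F'"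
  shows "\<sigma> z = z"
  by (rule hom_on_adjoin_cong[OF assms(1-3) hom_on_subset[OF GG_hom[OF assms(5)] assms(4)] hom_on_id assms(6-8)])

lemma fixes_E4:
  assumes \<sigma>: "\<sigma> \<in> carrier GG" "\<sigma> sqrt_7 = sqrt_7" "\<sigma> sqrt_19 = sqrt_19" "\<sigma> zz = zz" "\<sigma> theta = theta" and x: "x \<in> E4"
  shows "\<sigma> x = x"
proof -
  have sub: "E1 \<subseteq> LL" "E2 \<subseteq> LL" "E3 \<subseteq> LL" using E4_LL E4_facts(3) E3_facts(3) E2_facts(3) by auto
  have 0: "\<sigma> x = x" if "x \<in> \<rat>" for x using \<sigma>(1) that by (auto simp: galois_group_carrier)
  note 1 = fixes_adjoin[OF csubfield_Rats E1_def E1_facts(2) sub(1) \<sigma>(1) 0 \<sigma>(2)]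
  note 2 = fixes_adjoin[OF E1_facts(2) E2_def E2_facts(2) sub(2) \<sigma>(1) 1 \<sigma>(3)]
  note 3 = fixes_adjoin[OF E2_facts(2) E3_def E3_facts(2) sub(3) \<sigma>(1) 2 \<sigma>(4)]
  show ?thesis by (rule fixes_adjoin[OF E3_facts(2) E4_def E4_facts(2) E4_LL \<sigma>(1) 3 \<sigma>(5) x])
qed

section \<open>The two stabilizers and their generators\<close>

abbreviation "H1 \<equiv> carrier (galois_group LL K1)"
abbreviation "H2 \<equiv> carrier (galois_group LL K2)"

lemma subgroup_H1: "subgroup H1 GG" and subgroup_H2: "subgroup H2 GG"
  by (rule subgroup_galois_group[OF LL_facts(2)], rule K1_LL K2_LL)+

lemma H_carrier:
  "\<sigma> \<in> carrier (galois_group LL K) \<longleftrightarrow> \<sigma> \<in> carrier GG \<and> (\<forall>x\<in>K. \<sigma> x = x)"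
  using hom_on_Rats[OF LL_facts(2)] by (auto simp: galois_group_carrier)

lemma H1_iff:
  "\<sigma> \<in> H1 \<longleftrightarrow> \<sigma> \<in> carrier GG \<and> \<sigma> sqrt_7 = sqrt_7 \<and> \<sigma> sqrt_19 = sqrt_19 \<and> \<sigma> zz = zz \<and> \<sigma> theta = theta \<and> \<sigma> yy = yy"
  (is "_ \<longleftrightarrow> ?R")
proof
  assume "\<sigma> \<in> H1" then show ?R using E4_mem K1_facts(3,4) unfolding H_carrier[of _ K1] by auto
next
  assume ?R
  then have \<sigma>: "\<sigma> \<in> carrier GG" "\<sigma> sqrt_7 = sqrt_7" "\<sigma> sqrt_19 = sqrt_19" "\<sigma> zz = zz" "\<sigma> theta = theta" "\<sigma> yy = yy"
    by simp_all
  have "\<sigma> x = x" if "x \<in> K1" for x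
    by (rule fixes_adjoin[OF E4_facts(2) K1_def K1_facts(2) K1_LL \<sigma>(1) fixes_E4[OF \<sigma>(1-5)] \<sigma>(6) that])
  with \<sigma>(1) show "\<sigma> \<in> H1" unfolding H_carrier[of _ K1] by blast
qed

lemma H2_iff:
  "\<sigma> \<in> H2 \<longleftrightarrow> \<sigma> \<in> carrier GG \<and> \<sigma> sqrt_7 = sqrt_7 \<and> \<sigma> sqrt_19 = sqrt_19 \<and> \<sigma> zz = zz \<and> \<sigma> theta = theta \<and> \<sigma> yb = yb"
  (is "_ \<longleftrightarrow> ?R")
proof
  assume "\<sigma> \<in> H2" then show ?R using E4_mem K2_facts(3,4) unfolding H_carrier[of _ K2] by auto
next
  assume ?R
  then have \<sigma>: "\<sigma> \<in> carrier GG" "\<sigma> sqrt_7 = sqrt_7" "\<sigma> sqrt_19 = sqrt_19" "\<sigma> zz = zz" "\<sigma> theta = theta" "\<sigma> yb = yb"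
    by simp_all
  have "\<sigma> x = x" if "x \<in> K2" for x
    by (rule fixes_adjoin[OF E4_facts(2) K2_def K2_facts(2) K2_LL \<sigma>(1) fixes_E4[OF \<sigma>(1-5)] \<sigma>(6) that])
  with \<sigma>(1) show "\<sigma> \<in> H2" unfolding H_carrier[of _ K2] by blast
qed

lemma H_generators:
  "aut_c \<in> H1" "aut_s \<in> H1" "aut_z \<in> H1" "aut_c \<in> H2" "aut_s \<cdot> aut_e \<in> H2" "aut_z \<in> H2"
  by (simp_all add: H1_iff H2_iff yb_def aut_simps)

text \<open>An element of the stabilizer is first normalized by \<open>c\<close>, \<open>s\<close> (or its twist \<open>s e\<close>) and \<open>z\<close>
  to fix \<open>cbrt2\<close>, \<open>sqrt_m3\<close> and \<open>sqrt_m7\<close>; fixing \<open>theta\<close> then excludes sign changes of the \<open>rad\<close>s.\<close>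

lemma stabilizer_induct:
  assumes y: "(x = aut_s \<and> y = yy) \<or> (x = aut_s \<cdot> aut_e \<and> y = yb)"
    and h: "h \<in> carrier GG" "h sqrt_7 = sqrt_7" "h sqrt_19 = sqrt_19" "h zz = zz" "h theta = theta" "h y = y"
    and P: "P \<one>\<^bsub>GG\<^esub>" "\<And>g. P g \<Longrightarrow> P (aut_c \<cdot> g)" "\<And>g. P g \<Longrightarrow> P (x \<cdot> g)" "\<And>g. P g \<Longrightarrow> P (aut_z \<cdot> g)"
  shows "P h"
proof -
  define Q where "Q h \<longleftrightarrow> h \<in> carrier GG \<and> h sqrt_7 = sqrt_7 \<and> h sqrt_19 = sqrt_19 \<and> h zz = zz \<and> h theta = theta \<and> h y = y" for h
  have y_cases: "y = yy \<or> y = yb" and y_LL: "y \<in> LL" using y LL_mem yb_LL by auto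
  have x: "x \<in> carrier GG" "x cbrt2 = cbrt2" "x sqrt_m3 = - sqrt_m3" "x sqrt_7 = sqrt_7" "x sqrt_19 = sqrt_19"
    "x zz = zz" "x theta = theta" "x y = y"
    using y by (auto simp: aut_simps yb_def)
  have xx: "x \<cdot> x = \<one>\<^bsub>GG\<^esub>" using y by (auto simp: nf_all)
  have cy: "aut_c y = y" "aut_z y = y" using y_cases by (auto simp: yb_def aut_simps)
  have Q_mult: "Q (aut_c \<cdot> g)" "Q (x \<cdot> g)" "Q (aut_z \<cdot> g)" if "Q g" for g
    using that x cy y_LL by (simp_all add: Q_def aut_simps)
  have base: "P h" if "Q h" "h cbrt2 = cbrt2" "h sqrt_m3 = sqrt_m3" "h sqrt_m7 = sqrt_m7" for h
  proof -
    have hG: "h \<in> carrier GG" using that by (simp add: Q_def)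
    note hom = GG_hom_simps[OF hG]
    have om: "h omega = omega" unfolding omega_def using that by (simp add: hom LL_closed)
    have sq: "(h rad0) ^ 2 = rad0 ^ 2" "(h rad1) ^ 2 = rad1 ^ 2"
      using that om by (simp_all add: sqrt_squares LL_closed hom flip: hom(6))
    obtain k where k: "h rad0 = k * rad0" "k = 1 \<or> k = -1" using square_eq_sign[OF sq(1)] by blast
    obtain l where l: "h rad1 = l * rad1" "l = 1 \<or> l = -1" using square_eq_sign[OF sq(2)] by blast
    have r2: "h rad2 = k * l * rad2"
      unfolding rad2_def using k l by (auto simp: hom LL_closed)
    have "h theta = k * rad0 + l * rad1 + k * l * rad2"
      unfolding theta_def using k(1) l(1) r2 by (simp add: hom LL_closed)
    then have th: "k * rad0 + l * rad1 + k * l * rad2 = rad0 + rad1 + rad2"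
      using that by (simp add: Q_def theta_def)
    have opp: "a \<noteq> - b" if "a ^ 2 \<noteq> b ^ 2" for a b :: complex using that by auto
    have om1: "omega \<noteq> 1" using omega_sum by auto
    have "cbrt2 \<noteq> 0" using cbrt2_cube by auto
    then have "rad0 ^ 2 \<noteq> rad1 ^ 2" "rad0 ^ 2 \<noteq> rad2 ^ 2" "rad1 ^ 2 \<noteq> rad2 ^ 2"
      using om1 omega_nonzero omega_cube unfolding sqrt_squares rad2_square
      by (auto simp: power2_eq_square power3_eq_cube)
    note ne = this[THEN opp]
    have "k = 1 \<and> l = 1"
    proof (rule ccontr)
      assume "\<not> (k = 1 \<and> l = 1)"
      then consider "k = 1" "l = -1" | "k = -1" "l = 1" | "k = -1" "l = -1" using k l by auto
      then show False
      proof cases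
        case 1
        then have "2 * (rad1 + rad2) = 0" using th by (simp add: algebra_simps)
        then show False using ne(3) by (simp add: add_eq_0_iff2)
      next
        case 2
        then have "2 * (rad0 + rad2) = 0" using th by (simp add: algebra_simps)
        then show False using ne(2) by (simp add: add_eq_0_iff2)
      next
        case 3
        then have "2 * (rad0 + rad1) = 0" using th by (simp add: algebra_simps)
        then show False using ne(1) by (simp add: add_eq_0_iff2)
      qed
    qed
    then have r: "h rad0 = rad0" "h rad1 = rad1" using k l by simp_all
    \<comment> \<open>In the case \<open>y = yb\<close> this is what recovers \<open>yy\<close>,
      which equals \<open>yb * mu / sqrt_m3\<close>.\<close>
    have "h mu = mu" unfolding mu_def using that by (simp add: Q_def hom LL_closed)
    then have "h (y * mu / sqrt_m3) = y * mu / sqrt_m3"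
      using that y_LL by (simp add: Q_def hom LL_closed)
    moreover have "yy = yb * mu / sqrt_m3" using other_nonzero by (simp add: yb_def)
    ultimately have "h yy = yy"
      using that y_cases by (auto simp: Q_def)
    then have "h = \<one>\<^bsub>GG\<^esub>"
      using that r by (intro GG_eqI) (simp_all add: Q_def aut_simps)
    then show "P h" using P(1) by simp
  qed
  have base2: "P h" if "Q h" "h cbrt2 = cbrt2" "h sqrt_m3 = sqrt_m3" for h
  proof -
    have hG: "h \<in> carrier GG" using that by (simp add: Q_def)
    have "(h sqrt_m7) ^ 2 = sqrt_m7 ^ 2"
      using GG_hom_simps(3,6,8)[OF hG] by (simp add: sqrt_squares LL_closed flip: GG_hom_simps(6)[OF hG])
    then consider "h sqrt_m7 = sqrt_m7" | "h sqrt_m7 = - sqrt_m7" by (auto simp: power2_eq_iff)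
    then show "P h"
    proof cases
      case 2
      have "P (aut_z \<cdot> h)"
        by (rule base) (use Q_mult that 2 hG in \<open>simp_all add: aut_simps\<close>)
      then have "P (aut_z \<cdot> (aut_z \<cdot> h))" by (rule P(4))
      then show ?thesis using hG by (simp add: nf_all)
    qed (use base that in blast)
  qed
  have base3: "P h" if "Q h" "h cbrt2 = cbrt2" for h
  proof -
    have hG: "h \<in> carrier GG" using that by (simp add: Q_def)
    have "(h sqrt_m3) ^ 2 = sqrt_m3 ^ 2"
      using GG_hom_simps(3,6,8)[OF hG] by (simp add: sqrt_squares LL_closed flip: GG_hom_simps(6)[OF hG])
    then consider "h sqrt_m3 = sqrt_m3" | "h sqrt_m3 = - sqrt_m3" by (auto simp: power2_eq_iff)
    then show "P h"
    proof cases
      case 2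
      have "x (- sqrt_m3) = sqrt_m3" using x(3) GG_hom_simps(3)[OF x(1)] by (simp add: LL_closed)
      then have "P (x \<cdot> h)"
        by (intro base2) (use Q_mult that 2 hG x in \<open>simp_all add: aut_simps\<close>)
      then have "P (x \<cdot> (x \<cdot> h))" by (rule P(3))
      then show ?thesis using hG x(1) xx by (simp flip: GG.m_assoc)
    qed (use base2 that in blast)
  qed
  have Qh: "Q h" using h by (simp add: Q_def)
  note hom = GG_hom_simps[OF h(1)]
  have cube: "(h cbrt2) ^ 3 = 2" using hom(6)[of cbrt2 3] by (simp add: LL_closed cbrt2_cube hom(8))
  define q where "q = h cbrt2 / cbrt2"
  have t0: "cbrt2 \<noteq> 0" using cbrt2_cube by auto
  have "q ^ 3 = 1" by (simp add: q_def power_divide cube cbrt2_cube)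
  moreover have "(q - 1) * (q - omega) * (q - omega ^ 2)
    = q ^ 3 - q ^ 2 * (1 + omega + omega ^ 2) + q * (omega * (1 + omega + omega ^ 2)) - omega ^ 3"
    by (simp add: power2_eq_square power3_eq_cube algebra_simps)
  ultimately have "(q - 1) * (q - omega) * (q - omega ^ 2) = 0" by (simp add: omega_cube omega_sum)
  then consider "q = 1" | "q = omega" | "q = omega ^ 2" by auto
  then show "P h"
  proof cases
    case 1
    then show ?thesis using base3[OF Qh] t0 by (simp add: q_def)
  next
    case 2
    have w3: "omega * (omega * (omega * cbrt2)) = cbrt2"
      using omega_cube by (simp add: power3_eq_cube flip: mult.assoc)
    have "h cbrt2 = omega * cbrt2" using 2 t0 by (simp add: q_def field_simps)
    then have "P (aut_c \<cdot> (aut_c \<cdot> h))"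
      by (intro base3) (use Q_mult Qh h(1) w3 in \<open>simp_all add: aut_simps\<close>)
    then have "P (aut_c \<cdot> (aut_c \<cdot> (aut_c \<cdot> h)))" by (rule P(2))
    then show ?thesis
      using h(1) rel_ccc by (simp add: aut_mem flip: GG.m_assoc)
  next
    case 3
    have w3: "omega * (omega * (omega * cbrt2)) = cbrt2"
      using omega_cube by (simp add: power3_eq_cube flip: mult.assoc)
    have "h cbrt2 = omega * (omega * cbrt2)" using 3 t0 by (simp add: q_def field_simps power2_eq_square)
    then have "P (aut_c \<cdot> h)"
      by (intro base3) (use Q_mult Qh h(1) w3 in \<open>simp_all add: aut_simps\<close>)
    then have "P (aut_c \<cdot> (aut_c \<cdot> (aut_c \<cdot> h)))" using P(2) by blast
    then show ?thesis
      using h(1) rel_ccc by (simp add: aut_mem flip: GG.m_assoc)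
  qed
qed

text \<open>Invariance is tested on three generators, and \<open>stabilizer_induct\<close> spreads
  it over the whole stabilizer; likewise below with \<open>s e\<close> in place of
  \<open>s\<close>.\<close>

lemma hecke_invariant_H1:
  assumes l: "snd ` set l \<subseteq> carrier GG" and H: "subgroup H GG"
    and inv: "\<And>F. hecke_sum GG l H F aut_c = hecke_sum GG l H F \<one>\<^bsub>GG\<^esub>"
      "\<And>F. hecke_sum GG l H F aut_s = hecke_sum GG l H F \<one>\<^bsub>GG\<^esub>"
      "\<And>F. hecke_sum GG l H F aut_z = hecke_sum GG l H F \<one>\<^bsub>GG\<^esub>"
    and h: "h \<in> H1"
  shows "hecke_sum GG l H F h = hecke_sum GG l H F \<one>\<^bsub>GG\<^esub>"
proof -
  define P where "P h \<longleftrightarrow> h \<in> carrier GG \<and> (\<forall>F. hecke_sum GG l H F h = hecke_sum GG l H F \<one>\<^bsub>GG\<^esub>)" for h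
  note mult = hecke_invariant_mult[OF group_GG l subgroup.subset[OF H]]
  have "P h"
  proof (rule stabilizer_induct[of aut_s yy h P])
    show "P \<one>\<^bsub>GG\<^esub>" by (simp add: P_def)
    show "P (aut_c \<cdot> g)" "P (aut_s \<cdot> g)" "P (aut_z \<cdot> g)" if "P g" for g
      using that inv mult[of _ g] unfolding P_def by (auto simp: aut_mem)
  qed (use h in \<open>simp_all add: H1_iff\<close>)
  then show ?thesis by (simp add: P_def)
qed

lemma hecke_invariant_H2:
  assumes l: "snd ` set l \<subseteq> carrier GG" and H: "subgroup H GG"
    and inv: "\<And>F. hecke_sum GG l H F aut_c = hecke_sum GG l H F \<one>\<^bsub>GG\<^esub>"
      "\<And>F. hecke_sum GG l H F (aut_s \<cdot> aut_e) = hecke_sum GG l H F \<one>\<^bsub>GG\<^esub>"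
      "\<And>F. hecke_sum GG l H F aut_z = hecke_sum GG l H F \<one>\<^bsub>GG\<^esub>"
    and h: "h \<in> H2"
  shows "hecke_sum GG l H F h = hecke_sum GG l H F \<one>\<^bsub>GG\<^esub>"
proof -
  define P where "P h \<longleftrightarrow> h \<in> carrier GG \<and> (\<forall>F. hecke_sum GG l H F h = hecke_sum GG l H F \<one>\<^bsub>GG\<^esub>)" for h
  note mult = hecke_invariant_mult[OF group_GG l subgroup.subset[OF H]]
  have "P h"
  proof (rule stabilizer_induct[of "aut_s \<cdot> aut_e" yb h P])
    show "P \<one>\<^bsub>GG\<^esub>" by (simp add: P_def)
    show "P (aut_c \<cdot> g)" "P (aut_s \<cdot> aut_e \<cdot> g)" "P (aut_z \<cdot> g)" if "P g" for g
      using that inv mult[of _ g] unfolding P_def by (auto simp: aut_mem)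
  qed (use h in \<open>simp_all add: H2_iff\<close>)
  then show ?thesis by (simp add: P_def)
qed

lemma coset_absorb:
  assumes H: "subgroup H GG" and x: "x \<in> H"
  shows "H #>\<^bsub>GG\<^esub> x = H #>\<^bsub>GG\<^esub> \<one>\<^bsub>GG\<^esub>" "g \<in> carrier GG \<Longrightarrow> H #>\<^bsub>GG\<^esub> (x \<cdot> g) = H #>\<^bsub>GG\<^esub> g"
proof -
  have sub: "H \<subseteq> carrier GG" and xG: "x \<in> carrier GG" using subgroup.subset[OF H] x by auto
  have Hx: "H #>\<^bsub>GG\<^esub> x = H" using subgroup.rcos_const[OF H group_GG x] .
  then show "H #>\<^bsub>GG\<^esub> x = H #>\<^bsub>GG\<^esub> \<one>\<^bsub>GG\<^esub>" using sub by simp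
  show "H #>\<^bsub>GG\<^esub> (x \<cdot> g) = H #>\<^bsub>GG\<^esub> g" if "g \<in> carrier GG"
    using GG.coset_mult_assoc[OF sub xG that] Hx by simp
qed

text \<open>\<open>s\<close> is not in \<open>H2\<close>, as it negates \<open>yb\<close>; but
  \<open>s = (s e) e\<close> identifies its coset.\<close>

lemma coset_H2_s:
  "H2 #>\<^bsub>GG\<^esub> aut_s = H2 #>\<^bsub>GG\<^esub> aut_e"
  "g \<in> carrier GG \<Longrightarrow> H2 #>\<^bsub>GG\<^esub> (aut_s \<cdot> g) = H2 #>\<^bsub>GG\<^esub> (aut_e \<cdot> g)"
proof -
  have *: "(aut_s \<cdot> aut_e) \<cdot> aut_e = aut_s" by (simp add: nf_all)
  show "H2 #>\<^bsub>GG\<^esub> aut_s = H2 #>\<^bsub>GG\<^esub> aut_e"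
    using coset_absorb(2)[OF subgroup_H2 H_generators(5) aut_e(1)] unfolding * .
  assume g: "g \<in> carrier GG"
  have "(aut_s \<cdot> aut_e) \<cdot> (aut_e \<cdot> g) = aut_s \<cdot> g" using g by (simp add: nf_all)
  then show "H2 #>\<^bsub>GG\<^esub> (aut_s \<cdot> g) = H2 #>\<^bsub>GG\<^esub> (aut_e \<cdot> g)"
    using coset_absorb(2)[OF subgroup_H2 H_generators(5), of "aut_e \<cdot> g"] g by (simp add: aut_mem)
qed

lemmas coset_simps =
  coset_absorb[OF subgroup_H1 H_generators(1)] coset_absorb[OF subgroup_H1 H_generators(2)]
  coset_absorb[OF subgroup_H1 H_generators(3)] coset_absorb[OF subgroup_H2 H_generators(4)]
  coset_absorb[OF subgroup_H2 H_generators(6)] coset_H2_s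

text \<open>In the group ring of the quaternion group, \<open>i + j + k\<close> satisfies
  \<open>(i + j + k) (e (i + j + k) - (1 + e)) = 3\<close>.\<close>

lemma equivalent_not_3:
  assumes "coprime (3::int) (int p)" "p > 0"
  shows "perm_modules_isomorphic (padic_int p) GG H1 H2"
proof -
  let ?l1 = "[(1, aut_i), (1, aut_j), (1, aut_k)]"
  let ?l2 = "[(1, aut_i \<cdot> aut_e), (1, aut_j \<cdot> aut_e), (1, aut_k \<cdot> aut_e), (- 1, \<one>\<^bsub>GG\<^esub>), (- 1, aut_e)]"
  have l: "snd ` set ?l1 \<subseteq> carrier GG" "snd ` set ?l2 \<subseteq> carrier GG" by (simp_all add: aut_mem)
  show ?thesis
  proof (rule hecke_isomorphism[OF group_GG subgroup_H1 subgroup_H2 l, of 3])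
    fix h F
    show "hecke_sum GG ?l1 H1 F h = hecke_sum GG ?l1 H1 F \<one>\<^bsub>GG\<^esub>" if "h \<in> H2"
      by (rule hecke_invariant_H2[OF l(1) subgroup_H1 _ _ _ that]) (simp_all add: nf_all coset_simps)
    show "hecke_sum GG ?l2 H2 F h = hecke_sum GG ?l2 H2 F \<one>\<^bsub>GG\<^esub>" if "h \<in> H1"
      by (rule hecke_invariant_H1[OF l(2) subgroup_H2 _ _ _ that]) (simp_all add: nf_all coset_simps)
  qed (use assms in \<open>simp_all add: nf_all\<close>)
qed

text \<open>The square of \<open>2 (1 + e) + (u (1 + a) + w (1 + a e)) (1 - e)\<close> is 16 in the group ring of the
  elementary abelian group generated by \<open>u, w, a, e\<close>: on characters with \<open>e = 1\<close> it takes the value 4,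
  on those with \<open>e = -1\<close> the value \<open>4 u\<close> or \<open>4 w\<close>, according to the sign of \<open>a\<close>.\<close>

lemma equivalent_odd:
  assumes "coprime (16::int) (int p)" "p > 0"
  shows "perm_modules_isomorphic (padic_int p) GG H1 H2"
proof -
  let ?l = "[(2, \<one>\<^bsub>GG\<^esub>), (2, aut_e), (1, aut_u), (1, aut_u \<cdot> aut_a), (- 1, aut_u \<cdot> aut_e),
    (- 1, aut_u \<cdot> (aut_a \<cdot> aut_e)), (1, aut_w), (1, aut_w \<cdot> (aut_a \<cdot> aut_e)), (- 1, aut_w \<cdot> aut_e), (- 1, aut_w \<cdot> aut_a)]"
  have l: "snd ` set ?l \<subseteq> carrier GG" by (simp add: aut_mem)
  show ?thesis
  proof (rule hecke_isomorphism[OF group_GG subgroup_H1 subgroup_H2 l l, of 16])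
    fix h F
    show "hecke_sum GG ?l H1 F h = hecke_sum GG ?l H1 F \<one>\<^bsub>GG\<^esub>" if "h \<in> H2"
      by (rule hecke_invariant_H2[OF l subgroup_H1 _ _ _ that]) (simp_all add: nf_all coset_simps)
    show "hecke_sum GG ?l H2 F h = hecke_sum GG ?l H2 F \<one>\<^bsub>GG\<^esub>" if "h \<in> H1"
      by (rule hecke_invariant_H1[OF l subgroup_H2 _ _ _ that]) (simp_all add: nf_all coset_simps)
  qed (use assms in \<open>simp_all add: nf_all\<close>)
qed

lemma locally_integrally_equivalent_H:
  "locally_integrally_equivalent GG H1 H2"
  unfolding locally_integrally_equivalent_def
proof (intro conjI allI impI subgroup_H1 subgroup_H2)
  fix p :: nat assume p: "Factorial_Ring.prime p"
  then have "p > 0" by (simp add: prime_gt_0_nat)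
  show "perm_modules_isomorphic (padic_int p) GG H1 H2"
  proof (cases "p = 3")
    case True
    have "coprime (2 ^ 4 :: int) 3" unfolding coprime_power_left_iff by simp
    then show ?thesis using True by (intro equivalent_odd) simp_all
  next
    case False
    have "coprime 3 p" by (rule primes_coprime) (use p False in auto)
    then have "coprime (int 3) (int p)" by (simp only: coprime_int_iff)
    then show ?thesis using \<open>p > 0\<close> by (intro equivalent_not_3) simp_all
  qed
qed

subsection \<open>The Galois closure\<close>

text \<open>Comparing \<open>b + c * x\<close> with its image \<open>b - c * x\<close> gives
  \<open>c = 0\<close>.\<close>

lemma fixed_adjoin_sqrt:
  assumes F: "csubfield F" "F' = adjoin F x" "F' \<subseteq> LL" "x \<in> LL" and \<sigma>: "\<sigma> \<in> carrier GG" "\<And>a. a \<in> F \<Longrightarrow> \<sigma> a = a" "\<sigma> x = - x"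
    and x: "x ^ 2 \<in> F" "x \<noteq> 0" and z: "z \<in> F'" "\<sigma> z = z"
  shows "z \<in> F"
proof -
  obtain b c where bc: "b \<in> F" "c \<in> F" "z = b + c * x" using adjoin_sqrt_elim[OF F(1) x(1)] z(1) F(2) by blast
  have "F \<subseteq> LL" using F adjoin_base[OF F(1)] by blast
  then have "\<sigma> z = b - c * x"
    using bc \<sigma> F(4) by (simp add: GG_hom_simps[OF \<sigma>(1)] LL_closed subset_iff)
  then have "2 * (c * x) = 0" using z(2) bc(3) by (simp add: algebra_simps)
  then show ?thesis using x(2) bc by simp
qed

text \<open>Descent through the tower: at each quadratic step some automorphism fixes the lower
  field and negates the generator, so a fixed element lies one step lower. The cubic step at the
  bottom is settled by \<open>c\<close>.\<close>

lemma galois_over_Q_LL: "galois_over_Q LL"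
  unfolding galois_over_Q_def
proof (intro conjI LL_facts(1) subset_antisym subsetI)
  fix x :: complex assume "x \<in> \<rat>"
  then show "x \<in> {x \<in> LL. \<forall>\<sigma>\<in>carrier GG. \<sigma> x = x}"
    using Rats_subset_csubfield[OF LL_facts(2)] by (auto simp: galois_group_carrier)
next
  fix x assume "x \<in> {x \<in> LL. \<forall>\<sigma>\<in>carrier GG. \<sigma> x = x}"
  then have x: "x \<in> LL" and fixd: "\<And>\<sigma>. \<sigma> \<in> carrier GG \<Longrightarrow> \<sigma> x = x" by auto
  have sub: "F8 \<subseteq> LL" "F7 \<subseteq> LL" "F6 \<subseteq> LL" "F5 \<subseteq> LL" "F4 \<subseteq> LL" "F3 \<subseteq> LL" "F2 \<subseteq> LL" "F1 \<subseteq> LL"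
    using LL_facts(3) F8_facts(3) F7_facts(3) F6_facts(3) F5_facts(3) F4_facts(3) F3_facts(3) F2_facts(3) by auto
  have 0: "\<sigma> a = a" if "\<sigma> \<in> carrier GG" "a \<in> \<rat>" for \<sigma> a
    using that by (auto simp: galois_group_carrier)
  have f1: "\<sigma> a = a" if "\<sigma> \<in> carrier GG" "\<sigma> cbrt2 = cbrt2" "a \<in> F1" for \<sigma> a
    by (rule fixes_adjoin[OF csubfield_Rats F1_def F1_facts(2) sub(8) that(1) 0[OF that(1)] that(2,3)])
  have f2: "\<sigma> a = a" if "\<sigma> \<in> carrier GG" "\<sigma> cbrt2 = cbrt2" "\<sigma> sqrt_m3 = sqrt_m3" "a \<in> F2" for \<sigma> a
    by (rule fixes_adjoin[OF F1_facts(2) F2_def F2_facts(2) sub(7) that(1) f1[OF that(1-2)] that(3,4)])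
  have f3: "\<sigma> a = a" if "\<sigma> \<in> carrier GG" "\<sigma> cbrt2 = cbrt2" "\<sigma> sqrt_m3 = sqrt_m3" "\<sigma> sqrt_7 = sqrt_7" "a \<in> F3" for \<sigma> a
    by (rule fixes_adjoin[OF F2_facts(2) F3_def F3_facts(2) sub(6) that(1) f2[OF that(1-3)] that(4,5)])
  have f4: "\<sigma> a = a" if "\<sigma> \<in> carrier GG" "\<sigma> cbrt2 = cbrt2" "\<sigma> sqrt_m3 = sqrt_m3" "\<sigma> sqrt_7 = sqrt_7" "\<sigma> sqrt_19 = sqrt_19" "a \<in> F4" for \<sigma> a
    by (rule fixes_adjoin[OF F3_facts(2) F4_def F4_facts(2) sub(5) that(1) f3[OF that(1-4)] that(5,6)])
  have f5: "\<sigma> a = a" if "\<sigma> \<in> carrier GG" "\<sigma> cbrt2 = cbrt2" "\<sigma> sqrt_m3 = sqrt_m3" "\<sigma> sqrt_7 = sqrt_7" "\<sigma> sqrt_19 = sqrt_19" "\<sigma> sqrt_m7 = sqrt_m7" "a \<in> F5" for \<sigma> a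
    by (rule fixes_adjoin[OF F4_facts(2) F5_def F5_facts(2) sub(4) that(1) f4[OF that(1-5)] that(6,7)])
  have f6: "\<sigma> a = a" if "\<sigma> \<in> carrier GG" "\<sigma> cbrt2 = cbrt2" "\<sigma> sqrt_m3 = sqrt_m3" "\<sigma> sqrt_7 = sqrt_7" "\<sigma> sqrt_19 = sqrt_19" "\<sigma> sqrt_m7 = sqrt_m7" "\<sigma> rad0 = rad0" "a \<in> F6" for \<sigma> a
    by (rule fixes_adjoin[OF F5_facts(2) F6_def F6_facts(2) sub(3) that(1) f5[OF that(1-6)] that(7,8)])
  have f7: "\<sigma> a = a" if "\<sigma> \<in> carrier GG" "\<sigma> cbrt2 = cbrt2" "\<sigma> sqrt_m3 = sqrt_m3" "\<sigma> sqrt_7 = sqrt_7" "\<sigma> sqrt_19 = sqrt_19" "\<sigma> sqrt_m7 = sqrt_m7" "\<sigma> rad0 = rad0" "\<sigma> rad1 = rad1" "a \<in> F7" for \<sigma> a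
    by (rule fixes_adjoin[OF F6_facts(2) F7_def F7_facts(2) sub(2) that(1) f6[OF that(1-7)] that(8,9)])
  have f8: "\<sigma> a = a" if "\<sigma> \<in> carrier GG" "\<sigma> cbrt2 = cbrt2" "\<sigma> sqrt_m3 = sqrt_m3" "\<sigma> sqrt_7 = sqrt_7" "\<sigma> sqrt_19 = sqrt_19" "\<sigma> sqrt_m7 = sqrt_m7" "\<sigma> rad0 = rad0" "\<sigma> rad1 = rad1" "\<sigma> yy = yy" "a \<in> F8" for \<sigma> a
    by (rule fixes_adjoin[OF F7_facts(2) F8_def F8_facts(2) sub(1) that(1) f7[OF that(1-8)] that(9,10)])
  have x8: "x \<in> F8"
    by (rule fixed_adjoin_sqrt[OF F8_facts(2) LL_def order_refl LL_mem(14) aut_a(1) f8[OF aut_a(1-9)] aut_a(10) _ other_nonzero(8) x fixd[OF aut_a(1)]])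
      (simp_all add: aut_mem aut_values sqrt_squares F8_mem csubfield_closed[OF F8_facts(2)])
  have x7: "x \<in> F7"
    by (rule fixed_adjoin_sqrt[OF F7_facts(2) F8_def sub(1) LL_mem(13) aut_e(1) f7[OF aut_e(1-8)] aut_e(9) _ other_nonzero(7) x8 fixd[OF aut_e(1)]])
      (simp_all add: aut_mem aut_values sqrt_squares F7_mem csubfield_closed[OF F7_facts(2)])
  have m6: "a \<in> F6" if "a \<in> F5" for a using that F6_facts(3) by blast
  have x6: "x \<in> F6"
    by (rule fixed_adjoin_sqrt[OF F6_facts(2) F7_def sub(2) LL_mem(8) aut_i(1) f6[OF aut_i(1-7)] aut_i(8) _ rad_nonzero(2) x7 fixd[OF aut_i(1)]])
      (simp_all add: aut_mem aut_values sqrt_squares m6 F5_mem csubfield_closed[OF F6_facts(2)])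
  have x5: "x \<in> F5"
    by (rule fixed_adjoin_sqrt[OF F5_facts(2) F6_def sub(3) LL_mem(7) aut_j(1) f5[OF aut_j(1-6)] aut_j(7) _ rad_nonzero(1) x6 fixd[OF aut_j(1)]])
      (simp_all add: aut_mem aut_values sqrt_squares F5_mem csubfield_closed[OF F5_facts(2)])
  have x4: "x \<in> F4"
    by (rule fixed_adjoin_sqrt[OF F4_facts(2) F5_def sub(4) LL_mem(5) aut_z(1) f4[OF aut_z(1-5)] aut_z(6) _ other_nonzero(6) x5 fixd[OF aut_z(1)]])
      (simp_all add: aut_mem aut_values sqrt_squares csubfield_closed[OF F4_facts(2)])
  have x3: "x \<in> F3"
    by (rule fixed_adjoin_sqrt[OF F3_facts(2) F4_def sub(5) LL_mem(4) aut_w(1) f3[OF aut_w(1-4)] aut_w(5) _ other_nonzero(5) x4 fixd[OF aut_w(1)]])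
      (simp_all add: aut_mem aut_values sqrt_squares csubfield_closed[OF F3_facts(2)])
  have x2: "x \<in> F2"
    by (rule fixed_adjoin_sqrt[OF F2_facts(2) F3_def sub(6) LL_mem(3) aut_u(1) f2[OF aut_u(1-3)] aut_u(4) _ other_nonzero(3) x3 fixd[OF aut_u(1)]])
      (simp_all add: aut_mem aut_values sqrt_squares csubfield_closed[OF F2_facts(2)])
  have x1: "x \<in> F1"
    by (rule fixed_adjoin_sqrt[OF F1_facts(2) F2_def sub(7) LL_mem(2) aut_s(1) f1[OF aut_s(1-2)] aut_s(3) _ other_nonzero(4) x2 fixd[OF aut_s(1)]])
      (simp_all add: aut_mem aut_values sqrt_squares csubfield_closed[OF F1_facts(2)])
  obtain f where f: "\<And>i. i < 3 \<Longrightarrow> f i \<in> \<rat>" "x = (\<Sum>i<3. f i * cbrt2 ^ i)"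
    by (rule adjoin_elim[OF csubfield_Rats _ _ cbrt2_relation x1[unfolded F1_def]]) auto
  define a b c where "a = f 0" and "b = f 1" and "c = f 2"
  have abc: "a \<in> \<rat>" "b \<in> \<rat>" "c \<in> \<rat>" and x_eq: "x = a + b * cbrt2 + c * cbrt2 ^ 2"
    using f by (auto simp: a_def b_def c_def sum3)
  have abcL: "a \<in> LL" "b \<in> LL" "c \<in> LL" using abc Rats_subset_csubfield[OF LL_facts(2)] by auto
  have "aut_c x = a + b * (omega * cbrt2) + c * (omega * cbrt2) ^ 2"
    using abc abcL 0[OF aut_c(1)] unfolding x_eq by (simp add: aut_simps)
  then have "a + b * (omega * cbrt2) + c * (omega * cbrt2) ^ 2 = a + b * cbrt2 + c * cbrt2 ^ 2"
    using fixd[OF aut_c(1)] x_eq by simp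
  \<comment> \<open>Invariance under \<open>c\<close> factors, and the last factor gives
    \<open>b = c * omega ^ 2 * cbrt2\<close>; cubing removes \<open>omega\<close> and leads back to
    \<open>b ^ 3 = 2 * c ^ 3\<close> over the rationals.\<close>
  then have "(omega - 1) * cbrt2 * (b + c * (omega + 1) * cbrt2) = 0"
    by (simp add: power2_eq_square algebra_simps)
  moreover have "omega \<noteq> 1" "cbrt2 \<noteq> 0" using omega_sum cbrt2_cube by auto
  ultimately have "b = - (c * (omega + 1) * cbrt2)" by (simp add: eq_neg_iff_add_eq_0)
  also have "\<dots> = c * omega ^ 2 * cbrt2" by (simp add: omega_square algebra_simps)
  finally have "b ^ 3 = c ^ 3 * (omega ^ 3) ^ 2 * cbrt2 ^ 3"
    by (simp add: power_mult_distrib flip: power_mult)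
  then have "b ^ 3 = 2 * c ^ 3" by (simp add: omega_cube cbrt2_cube)
  then have "c = 0" using cube_eq_2_cube_Rats abc by blast
  with \<open>b ^ 3 = 2 * c ^ 3\<close> abc show "x \<in> \<rat>" by (simp add: x_eq)
qed

text \<open>Prepares the invariance of coefficients: a homomorphism that permutes \<open>A\<close>
  fixes the product and hence each of its coefficients.\<close>

lemma map_poly_linear_factors:
  assumes M: "csubfield M" and \<tau>: "hom_on M \<tau>" and A: "finite A" "A \<subseteq> M"
  shows "(\<forall>i. poly.coeff (\<Prod>y\<in>A. [:- y, 1:]) i \<in> M) \<and>
    map_poly \<tau> (\<Prod>y\<in>A. [:- y, 1:]) = (\<Prod>y\<in>A. [:- \<tau> y, 1:])"
  using A
proof (induction A rule: finite_induct)
  case empty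
  then show ?case
    using hom_on_one[OF M \<tau>] hom_on_zero[OF M \<tau>] csubfield_basic[OF M]
    by (auto simp: coeff_pCons map_poly_pCons one_pCons split: nat.splits)
next
  case (insert y A)
  define Q where "Q = (\<Prod>y\<in>A. [:- y, 1:])"
  have Q: "\<And>i. poly.coeff Q i \<in> M" "map_poly \<tau> Q = (\<Prod>y\<in>A. [:- \<tau> y, 1:])" and y: "y \<in> M"
    using insert by (auto simp: Q_def)
  have c: "poly.coeff ([:- y, 1:] * Q) i = (case i of 0 \<Rightarrow> 0 | Suc j \<Rightarrow> poly.coeff Q j) - y * poly.coeff Q i" for i
    by (simp add: coeff_pCons split: nat.splits)
  have "poly.coeff ([:- y, 1:] * Q) i \<in> M" for i
    unfolding c using Q(1) y by (auto intro!: csubfield_diff[OF M] csubfield_basic[OF M] split: nat.splits)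
  moreover have "map_poly \<tau> ([:- y, 1:] * Q) = [:- \<tau> y, 1:] * map_poly \<tau> Q"
  proof (rule poly_eqI)
    fix i
    have "\<tau> (poly.coeff ([:- y, 1:] * Q) i) = (case i of 0 \<Rightarrow> 0 | Suc j \<Rightarrow> \<tau> (poly.coeff Q j)) - \<tau> y * \<tau> (poly.coeff Q i)"
      unfolding c using Q(1) y csubfield_basic[OF M]
      by (auto simp: hom_on_diff[OF M \<tau>] hom_on_mult[OF M \<tau>] hom_on_zero[OF M \<tau>] hom_on_minus[OF M \<tau>] split: nat.splits)
    then show "poly.coeff (map_poly \<tau> ([:- y, 1:] * Q)) i = poly.coeff ([:- \<tau> y, 1:] * map_poly \<tau> Q) i"
      by (simp add: coeff_map_poly[of \<tau>, OF hom_on_zero[OF M \<tau>]] coeff_pCons split: nat.splits)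
  qed
  ultimately show ?case
    using insert(1,2) unfolding Q(2) by (simp add: Q_def)
qed

text \<open>Take the polynomial whose roots are the images of \<open>x\<close> under the Galois
  group of \<open>M\<close>. Its coefficients are rational because \<open>M\<close> is Galois, so
  \<open>g x\<close> is one of its roots, and these lie in \<open>M\<close>. The set
  \<open>S\<close> provides finiteness of the orbit.\<close>

lemma conjugate_in_galois:
  assumes M: "galois_over_Q M" and x: "x \<in> M" "x \<in> LL" and g: "g \<in> carrier GG"
    and S: "finite S" "\<And>\<sigma>. \<sigma> \<in> carrier (galois_group M \<rat>) \<Longrightarrow> \<sigma> x \<in> S"
  shows "g x \<in> M"
proof -
  have Mf: "csubfield M" using M by (simp add: galois_over_Q_def number_field_def)
  define Gal where "Gal = carrier (galois_group M \<rat>)"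
  interpret G: group "galois_group M \<rat>"
    by (rule group_galois_group[OF Mf Rats_subset_csubfield[OF Mf]])
  define A where "A = (\<lambda>\<sigma>. \<sigma> x) ` Gal"
  have fin: "finite A" using S finite_subset[of A S] by (auto simp: A_def Gal_def)
  have hom: "hom_on M \<sigma>" and bij: "bij_betw \<sigma> M M" if "\<sigma> \<in> Gal" for \<sigma>
    using that by (auto simp: Gal_def galois_group_carrier Bij_def)
  have AM: "A \<subseteq> M" using bij x(1) by (auto simp: A_def bij_betw_def)
  have perm: "\<tau> ` A = A" if \<tau>: "\<tau> \<in> Gal" for \<tau>
  proof (rule card_subset_eq[OF fin])
    show "\<tau> ` A \<subseteq> A"
    proof (rule image_subsetI)
      fix y assume "y \<in> A"
      then obtain \<sigma> where \<sigma>: "\<sigma> \<in> Gal" "y = \<sigma> x" by (auto simp: A_def)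
      have "\<tau> \<otimes>\<^bsub>galois_group M \<rat>\<^esub> \<sigma> \<in> Gal" using G.m_closed \<sigma>(1) \<tau> by (simp add: Gal_def)
      moreover have "(\<tau> \<otimes>\<^bsub>galois_group M \<rat>\<^esub> \<sigma>) x = \<tau> y"
        using \<tau> \<sigma> x(1) by (simp add: Gal_def galois_group_ops galois_group_carrier BijGroup_def compose_def)
      ultimately show "\<tau> y \<in> A" by (metis A_def imageI)
    qed
    have "inj_on \<tau> A" using bij[OF \<tau>] AM by (auto simp: bij_betw_def intro: inj_on_subset)
    then show "card (\<tau> ` A) = card A" by (rule card_image)
  qed
  define P where "P = (\<Prod>y\<in>A. [:- y, 1:])"
  have coeff_rat: "poly.coeff P i \<in> \<rat>" for i
  proof -
    have "poly.coeff P i \<in> {x \<in> M. \<forall>\<sigma>\<in>Gal. \<sigma> x = x}"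
    proof (intro CollectI conjI ballI)
      have "\<one>\<^bsub>galois_group M \<rat>\<^esub> \<in> Gal" using G.one_closed by (simp add: Gal_def)
      then show "poly.coeff P i \<in> M"
        using map_poly_linear_factors[OF Mf hom fin AM] by (auto simp: P_def)
      fix \<tau> assume \<tau>: "\<tau> \<in> Gal"
      have "map_poly \<tau> P = (\<Prod>y\<in>A. [:- \<tau> y, 1:])"
        using map_poly_linear_factors[OF Mf hom[OF \<tau>] fin AM] by (simp add: P_def)
      also have "\<dots> = (\<Prod>y\<in>\<tau> ` A. [:- y, 1:])"
        using bij[OF \<tau>] AM by (subst prod.reindex) (auto simp: bij_betw_def intro: inj_on_subset)
      also have "\<dots> = P" by (simp add: perm[OF \<tau>] P_def)
      finally show "\<tau> (poly.coeff P i) = poly.coeff P i"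
        using coeff_map_poly[of \<tau> P i, OF hom_on_zero[OF Mf hom[OF \<tau>]]] by simp
    qed
    moreover have "{x \<in> M. \<forall>\<sigma>\<in>Gal. \<sigma> x = x} = \<rat>"
      using M unfolding galois_over_Q_def Gal_def by blast
    ultimately show ?thesis by (simp only:)
  qed
  have "x \<in> A"
  proof -
    have "\<one>\<^bsub>galois_group M \<rat>\<^esub> \<in> Gal" using G.one_closed by (simp add: Gal_def)
    then have "\<one>\<^bsub>galois_group M \<rat>\<^esub> x \<in> A" unfolding A_def by (rule imageI)
    then show ?thesis using x(1) by (simp add: galois_group_ops)
  qed
  then have "poly P x = 0" using fin by (auto simp: P_def poly_prod)
  moreover have "g (poly P x) = poly P (g x)"
  proof -
    have cL: "poly.coeff P i \<in> LL" "g (poly.coeff P i) = poly.coeff P i" for i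
      using coeff_rat[of i] Rats_subset_csubfield[OF LL_facts(2)] g by (auto simp: galois_group_carrier)
    show ?thesis
      unfolding poly_altdef using x(2) cL
      by (subst hom_on_sum[OF LL_facts(2) GG_hom[OF g]]) (auto simp: GG_hom_simps[OF g] LL_closed)
  qed
  moreover have "g 0 = 0" using hom_on_zero[OF LL_facts(2) GG_hom[OF g]] .
  ultimately have "poly P (g x) = 0" by simp
  then have "g x \<in> A" using fin by (auto simp: P_def poly_prod)
  then show ?thesis using AM by blast
qed

lemma finite_square_roots: "finite {z :: complex. z ^ 2 = c}"
proof (rule finite_subset)
  show "{z. z ^ 2 = c} \<subseteq> {csqrt c, - csqrt c}"
  proof
    fix z assume "z \<in> {z. z ^ 2 = c}"
    then have "z ^ 2 = (csqrt c) ^ 2" by simp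
    then show "z \<in> {csqrt c, - csqrt c}" unfolding power2_eq_iff by simp
  qed
qed simp

lemma finite_quartic_roots: "finite {z :: complex. z ^ 4 + 6 * z ^ 2 - 8 * z - 3 = 0}"
proof -
  have "finite {z :: complex. poly [:-3, -8, 6, 0, 1:] z = 0}" by (rule poly_roots_finite) simp
  then show ?thesis by (simp add: eval_nat_numeral algebra_simps)
qed

text \<open>The conjugates of \<open>theta\<close> in \<open>M\<close> give the \<open>rad\<close>s,
  hence \<open>cbrt2\<close>, \<open>omega\<close> and \<open>sqrt_m3\<close>; the image of
  \<open>zz\<close> under \<open>u\<close> gives \<open>sqrt_m7\<close>; and \<open>yy\<close>,
  \<open>yb\<close> then differ by a factor in \<open>M\<close>. So the two fields have the same
  closure.\<close>

lemma LL_minimal: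
  assumes M: "galois_over_Q M" and E: "E4 \<subseteq> M" and y: "yy \<in> M \<or> yb \<in> M"
  shows "LL \<subseteq> M"
proof -
  have Mf: "csubfield M" using M by (simp add: galois_over_Q_def number_field_def)
  have m: "sqrt_7 \<in> M" "sqrt_19 \<in> M" "zz \<in> M" "theta \<in> M" using E E4_mem by auto
  have hom: "hom_on M \<sigma>" if "\<sigma> \<in> carrier (galois_group M \<rat>)" for \<sigma>
    using that by (simp add: galois_group_carrier)
  have th: "g theta \<in> M" if "g \<in> carrier GG" for g
  proof (rule conjugate_in_galois[OF M m(4) LL_mem(10) that finite_quartic_roots])
    fix \<sigma> assume \<sigma>: "\<sigma> \<in> carrier (galois_group M \<rat>)"
    note h = hom_on_diff[OF Mf hom[OF \<sigma>]] hom_on_add[OF Mf hom[OF \<sigma>]] hom_on_mult[OF Mf hom[OF \<sigma>]]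
      hom_on_power[OF Mf hom[OF \<sigma>]] hom_on_numeral[OF Mf hom[OF \<sigma>]] hom_on_zero[OF Mf hom[OF \<sigma>]]
    have "\<sigma> (theta ^ 4 + 6 * theta ^ 2 - 8 * theta - 3) = 0" by (simp add: theta_quartic h)
    then show "\<sigma> theta \<in> {z. z ^ 4 + 6 * z ^ 2 - 8 * z - 3 = 0}"
      using m(4) by (simp add: h csubfield_closed[OF Mf])
  qed
  have z: "aut_u zz \<in> M"
  proof (rule conjugate_in_galois[OF M m(3) LL_mem(14) aut_u(1)])
    \<comment> \<open>Contains every possible image of \<open>zz\<close> under an automorphism of
      \<open>M\<close>, which may move \<open>sqrt_7\<close> and \<open>sqrt_19\<close> as
      well.\<close>
    let ?S = "\<Union>a\<in>{a. a ^ 2 = 7}. \<Union>b\<in>{b. b ^ 2 = 19}. {z :: complex. z ^ 2 = (b + 4) * a}"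
    show "finite ?S" by (intro finite_UN_I finite_square_roots)
    fix \<sigma> assume \<sigma>: "\<sigma> \<in> carrier (galois_group M \<rat>)"
    note h = hom_on_add[OF Mf hom[OF \<sigma>]] hom_on_mult[OF Mf hom[OF \<sigma>]]
      hom_on_numeral[OF Mf hom[OF \<sigma>]]
    have p: "(\<sigma> v) ^ 2 = \<sigma> (v ^ 2)" if "v \<in> M" for v
      using that hom_on_power[OF Mf hom[OF \<sigma>], of v 2] by simp
    have "(\<sigma> sqrt_7) ^ 2 = 7" "(\<sigma> sqrt_19) ^ 2 = 19" "(\<sigma> zz) ^ 2 = (\<sigma> sqrt_19 + 4) * \<sigma> sqrt_7"
      using m by (simp_all add: p sqrt_squares h lam_def csubfield_closed[OF Mf])
    then show "\<sigma> zz \<in> ?S" by blast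
  qed
  have r: "rad0 \<in> M" "rad1 \<in> M"
  proof -
    have "rad0 = (theta + aut_i theta) / 2" "rad1 = (theta + aut_j theta) / 2"
      unfolding aut_i(13) aut_j(13) unfolding theta_def by simp_all
    moreover have "(theta + aut_i theta) / 2 \<in> M" "(theta + aut_j theta) / 2 \<in> M"
      by (intro csubfield_divide[OF Mf] csubfield_basic(5)[OF Mf] csubfield_numeral[OF Mf] m th aut_mem)+
    ultimately show "rad0 \<in> M" "rad1 \<in> M" by (simp_all only:)
  qed
  have t: "cbrt2 \<in> M"
  proof -
    have "cbrt2 = rad0 ^ 2 + 1" by (simp add: sqrt_squares)
    moreover have "rad0 ^ 2 + 1 \<in> M" using r by (simp add: csubfield_closed[OF Mf])
    ultimately show ?thesis by (simp only:)
  qed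
  have w: "omega \<in> M"
  proof -
    have "cbrt2 \<noteq> 0" using cbrt2_cube by auto
    then have "omega = (rad1 ^ 2 + 1) / cbrt2" by (simp add: sqrt_squares)
    moreover have "(rad1 ^ 2 + 1) / cbrt2 \<in> M" using r t by (simp add: csubfield_closed[OF Mf])
    ultimately show ?thesis by (simp only:)
  qed
  have s: "sqrt_m3 \<in> M"
  proof -
    have "sqrt_m3 = 2 * omega + 1" by (simp add: omega_def)
    moreover have "2 * omega + 1 \<in> M" using w by (simp add: csubfield_closed[OF Mf])
    ultimately show ?thesis by (simp only:)
  qed
  have e: "sqrt_m7 \<in> M"
  proof -
    have "sqrt_m7 = aut_u zz * sqrt_7 / zz" using other_nonzero by (simp add: aut_values)
    moreover have "aut_u zz * sqrt_7 / zz \<in> M"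
      by (intro csubfield_divide[OF Mf] csubfield_basic(4)[OF Mf] z m)
    ultimately show ?thesis by (simp only:)
  qed
  have "yy \<in> M"
  proof -
    have "mu \<in> M" unfolding mu_def using m by (simp add: csubfield_closed[OF Mf])
    moreover have "yy = yb * mu / sqrt_m3" using other_nonzero by (simp add: yb_def)
    ultimately show ?thesis using y s by (metis csubfield_basic(4)[OF Mf] csubfield_divide[OF Mf])
  qed
  then show ?thesis by (intro LL_least Mf t s m e r)
qed

lemma galois_closure_K: "galois_closure K1 LL" "galois_closure K2 LL"
proof -
  have "LL \<subseteq> M" if "galois_over_Q M" "K1 \<subseteq> M" for M
    by (rule LL_minimal[OF that(1)]) (use that(2) K1_facts(3,4) in auto)
  then show "galois_closure K1 LL" unfolding galois_closure_def using galois_over_Q_LL K1_LL by simp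
  have "LL \<subseteq> M" if "galois_over_Q M" "K2 \<subseteq> M" for M
    by (rule LL_minimal[OF that(1)]) (use that(2) K2_facts(3,4) in auto)
  then show "galois_closure K2 LL" unfolding galois_closure_def using galois_over_Q_LL K2_LL by simp
qed

subsection \<open>3-adic numbers\<close>

definition abs3_int :: "int \<Rightarrow> real" where
  "abs3_int a = (if a = 0 then 0 else (1/3) ^ multiplicity 3 a)"

definition abs3 :: "rat \<Rightarrow> real" where
  "abs3 x = abs3_int (fst (quotient_of x)) / abs3_int (snd (quotient_of x))"

lemma abs3_int_mult: "abs3_int (a * b) = abs3_int a * abs3_int b"
proof -
  have "prime_elem (3::int)" by simp
  then show ?thesis
    by (auto simp: abs3_int_def prime_elem_multiplicity_mult_distrib power_add)
qed

lemma abs3_int_le_iff: "abs3_int a \<le> (1/3) ^ k \<longleftrightarrow> 3 ^ k dvd a"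
proof (cases "a = 0")
  case False
  then have "3 ^ k dvd a \<longleftrightarrow> k \<le> multiplicity 3 a"
    by (intro power_dvd_iff_le_multiplicity) auto
  then show ?thesis using False by (simp add: abs3_int_def power_decreasing_iff)
qed (simp add: abs3_int_def)

lemma abs3_int_nonneg: "abs3_int a \<ge> 0" and abs3_int_zero_iff: "abs3_int a = 0 \<longleftrightarrow> a = 0"
  by (auto simp: abs3_int_def)

lemma abs3_int_values: "abs3_int 1 = 1" "abs3_int (- 1) = 1" "abs3_int 2 = 1" "abs3_int 3 = 1/3"
  by (auto simp: abs3_int_def not_dvd_imp_multiplicity_0)

text \<open>The larger of the two values is a power of 1/3, and divisibility by the corresponding
  power of 3 passes to the sum.\<close>

lemma abs3_int_add: "abs3_int (a + b) \<le> max (abs3_int a) (abs3_int b)"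
proof -
  have "\<exists>k. max (abs3_int a) (abs3_int b) = (1/3) ^ k" if "a \<noteq> 0 \<or> b \<noteq> 0"
  proof -
    have "\<not> (1/3::real) ^ m \<le> 0" for m by (simp add: not_le)
    then show ?thesis using that by (auto simp: max_def abs3_int_def)
  qed
  moreover have "abs3_int (a + b) \<le> max (abs3_int a) (abs3_int b)" if "max (abs3_int a) (abs3_int b) = (1/3) ^ k" for k
  proof -
    have "abs3_int a \<le> (1/3) ^ k" "abs3_int b \<le> (1/3) ^ k" using that by (metis max.cobounded1 max.cobounded2)+
    then have "abs3_int (a + b) \<le> (1/3) ^ k" unfolding abs3_int_le_iff by simp
    then show ?thesis using that by simp
  qed
  ultimately show ?thesis by (cases "a \<noteq> 0 \<or> b \<noteq> 0") (auto simp: abs3_int_def)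
qed

text \<open>Independence of the chosen fraction, so that later computations need not stay in lowest
  terms.\<close>

lemma abs3_fraction:
  assumes "b \<noteq> 0"
  shows "abs3 (of_int a / of_int b) = abs3_int a / abs3_int b"
proof -
  obtain c d where cd: "quotient_of (of_int a / of_int b :: rat) = (c, d)" by force
  have d: "d > 0" and eq: "(of_int a / of_int b :: rat) = of_int c / of_int d"
    using cd quotient_of_denom_pos quotient_of_div by blast+
  have "(of_int (a * d) :: rat) = of_int (c * b)"
    using eq d assms by (simp add: field_simps)
  then have "a * d = c * b" by (simp only: of_int_eq_iff)
  then have "abs3_int a * abs3_int d = abs3_int c * abs3_int b" by (simp flip: abs3_int_mult)
  then show ?thesis
    using d assms by (simp add: abs3_def cd abs3_int_zero_iff field_simps)
qed

lemma abs3_of_int: "abs3 (of_int a) = abs3_int a"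
  using abs3_fraction[of 1 a] by (simp add: abs3_int_values)

lemma rat_fraction:
  fixes x :: rat
  obtains a b :: int where "x = of_int a / of_int b" "b \<noteq> 0"
  by (metis quotient_of_div quotient_of_denom_pos less_irrefl prod.collapse)

lemma abs3_mult: "abs3 (x * y) = abs3 x * abs3 y"
proof -
  obtain a b where x: "x = of_int a / of_int b" "b \<noteq> 0" by (rule rat_fraction)
  obtain c d where y: "y = of_int c / of_int d" "d \<noteq> 0" by (rule rat_fraction)
  have xy: "x * y = of_int (a * c) / of_int (b * d)" by (simp add: x y)
  have "abs3 (x * y) = abs3_int (a * c) / abs3_int (b * d)"
    unfolding xy using x(2) y(2) by (intro abs3_fraction) simp
  then show ?thesis using x y by (simp add: abs3_int_mult abs3_fraction)
qed

lemma abs3_nonneg: "abs3 x \<ge> 0"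
  by (simp add: abs3_def abs3_int_nonneg)

lemma abs3_zero_iff [simp]: "abs3 x = 0 \<longleftrightarrow> x = 0"
proof -
  obtain a b where x: "x = of_int a / of_int b" "b \<noteq> 0" by (rule rat_fraction)
  then show ?thesis by (simp add: abs3_fraction abs3_int_zero_iff)
qed

lemma abs3_add_max: "abs3 (x + y) \<le> max (abs3 x) (abs3 y)"
proof -
  obtain a b where x: "x = of_int a / of_int b" "b \<noteq> 0" by (rule rat_fraction)
  obtain c d where y: "y = of_int c / of_int d" "d \<noteq> 0" by (rule rat_fraction)
  have xy: "x + y = of_int (a * d + c * b) / of_int (b * d)" using x y by (simp add: field_simps)
  have bd: "abs3_int (b * d) > 0" "b * d \<noteq> 0"
    using x y abs3_int_nonneg[of "b * d"] abs3_int_zero_iff[of "b * d"] by (auto simp: less_le)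
  have "abs3 (x + y) = abs3_int (a * d + c * b) / abs3_int (b * d)"
    unfolding xy using bd by (intro abs3_fraction)
  also have "\<dots> \<le> max (abs3_int (a * d)) (abs3_int (c * b)) / abs3_int (b * d)"
    using abs3_int_add bd by (intro divide_right_mono) auto
  also have "\<dots> = max (abs3_int (a * d) / abs3_int (b * d)) (abs3_int (c * b) / abs3_int (b * d))"
    using bd by (simp add: max_def divide_le_cancel)
  also have "abs3_int (a * d) / abs3_int (b * d) = abs3 x"
    using x y by (simp add: abs3_int_mult abs3_fraction abs3_int_zero_iff)
  also have "abs3_int (c * b) / abs3_int (b * d) = abs3 y"
    using x y by (simp add: abs3_int_mult abs3_fraction abs3_int_zero_iff)
  finally show ?thesis .
qed

lemma abs3_one [simp]: "abs3 0 = 0" "abs3 1 = 1" "abs3 (- x) = abs3 x"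
proof -
  show "abs3 0 = 0" by simp
  show 1: "abs3 1 = 1" using abs3_of_int[of 1] by (simp add: abs3_int_values)
  have "abs3 (- 1) = 1" using abs3_of_int[of "- 1"] by (simp add: abs3_int_values)
  then show "abs3 (- x) = abs3 x" using abs3_mult[of "- 1" x] by simp
qed

lemma abs3_diff_max: "abs3 (x - y) \<le> max (abs3 x) (abs3 y)"
  using abs3_add_max[of x "- y"] by simp

lemma abs3_minus_commute: "abs3 (x - y) = abs3 (y - x)"
  using abs3_one(3)[of "x - y"] by simp

lemma abs3_triangle: "abs3 (x + y) \<le> abs3 x + abs3 y"
  using abs3_add_max[of x y] abs3_nonneg[of x] abs3_nonneg[of y] by linarith

lemma abs3_reverse_triangle: "\<bar>abs3 x - abs3 y\<bar> \<le> abs3 (x - y)"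
  using abs3_triangle[of "x - y" y] abs3_triangle[of "y - x" x] abs3_minus_commute[of x y] by simp

lemma abs3_power: "abs3 (x ^ n) = abs3 x ^ n"
  by (induction n) (simp_all add: abs3_mult)

lemma abs3_2_3 [simp]: "abs3 2 = 1" "abs3 3 = 1/3"
  using abs3_of_int[of 2] abs3_of_int[of 3] by (simp_all add: abs3_int_values)

lemma abs3_int_le_one: "abs3 (of_int k) \<le> 1"
  using abs3_int_le_iff[of k 0] by (simp add: abs3_of_int)

section \<open>Cauchy sequences and null sequences of rationals\<close>

definition cauchy3 :: "(nat \<Rightarrow> rat) \<Rightarrow> bool" where
  "cauchy3 U \<longleftrightarrow> (\<forall>e>0. \<exists>N. \<forall>m\<ge>N. \<forall>n\<ge>N. abs3 (U m - U n) < e)"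

definition null3 :: "(nat \<Rightarrow> rat) \<Rightarrow> bool" where
  "null3 U \<longleftrightarrow> (\<lambda>n. abs3 (U n)) \<longlonglongrightarrow> 0"

lemma cauchy3_const: "cauchy3 (\<lambda>n. c)"
  by (simp add: cauchy3_def)

lemma cauchy3_add:
  assumes "cauchy3 U" "cauchy3 Y" shows "cauchy3 (\<lambda>n. U n + Y n)"
  unfolding cauchy3_def
proof (intro allI impI)
  fix e :: real assume "e > 0"
  then obtain M N where "\<forall>m\<ge>M. \<forall>n\<ge>M. abs3 (U m - U n) < e" "\<forall>m\<ge>N. \<forall>n\<ge>N. abs3 (Y m - Y n) < e"
    using assms unfolding cauchy3_def by meson
  moreover have "abs3 (U m + Y m - (U n + Y n)) \<le> max (abs3 (U m - U n)) (abs3 (Y m - Y n))" for m n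
    using abs3_add_max[of "U m - U n" "Y m - Y n"] by (simp add: algebra_simps)
  ultimately have "\<forall>m\<ge>max M N. \<forall>n\<ge>max M N. abs3 (U m + Y m - (U n + Y n)) < e"
    by (meson max.bounded_iff max_less_iff_conj le_less_trans)
  then show "\<exists>N. \<forall>m\<ge>N. \<forall>n\<ge>N. abs3 (U m + Y m - (U n + Y n)) < e" by blast
qed

lemma cauchy3_minus: "cauchy3 U \<Longrightarrow> cauchy3 (\<lambda>n. - U n)"
proof -
  have "abs3 (- U m - - U n) = abs3 (U m - U n)" for m n
    using abs3_minus_commute[of "U m" "U n"] by simp
  then show "cauchy3 U \<Longrightarrow> cauchy3 (\<lambda>n. - U n)" unfolding cauchy3_def by simp
qed

lemma cauchy3_convergent:
  assumes "cauchy3 U" shows "convergent (\<lambda>n. abs3 (U n))"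
proof -
  have "Cauchy (\<lambda>n. abs3 (U n))"
    unfolding Cauchy_def
  proof (intro allI impI)
    fix e :: real assume "e > 0"
    then obtain N where "\<forall>m\<ge>N. \<forall>n\<ge>N. abs3 (U m - U n) < e" using assms unfolding cauchy3_def by blast
    then show "\<exists>M. \<forall>m\<ge>M. \<forall>n\<ge>M. dist (abs3 (U m)) (abs3 (U n)) < e"
      using abs3_reverse_triangle by (metis dist_real_def le_less_trans)
  qed
  then show ?thesis by (rule real_Cauchy_convergent)
qed

lemma cauchy3_bounded:
  assumes "cauchy3 U" obtains B where "B > 0" "\<And>n. abs3 (U n) \<le> B"
proof -
  have "Bseq (\<lambda>n. abs3 (U n))"
    using cauchy3_convergent[OF assms] by (rule convergent_imp_Bseq)
  then obtain B where "B > 0" "\<And>n. norm (abs3 (U n)) \<le> B" by (auto simp: Bseq_def)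
  then show thesis using that by (metis abs3_nonneg abs_of_nonneg real_norm_def)
qed

lemma cauchy3_mult:
  assumes U: "cauchy3 U" and Y: "cauchy3 Y" shows "cauchy3 (\<lambda>n. U n * Y n)"
  unfolding cauchy3_def
proof (intro allI impI)
  fix e :: real assume e: "e > 0"
  obtain A where A: "A > 0" "\<And>n. abs3 (U n) \<le> A" using cauchy3_bounded[OF U] by blast
  obtain B where B: "B > 0" "\<And>n. abs3 (Y n) \<le> B" using cauchy3_bounded[OF Y] by blast
  have "e / B > 0" "e / A > 0" using e A B by auto
  then obtain M N where M: "\<forall>m\<ge>M. \<forall>n\<ge>M. abs3 (U m - U n) < e / B" and N: "\<forall>m\<ge>N. \<forall>n\<ge>N. abs3 (Y m - Y n) < e / A"
    using U Y unfolding cauchy3_def by meson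
  show "\<exists>N. \<forall>m\<ge>N. \<forall>n\<ge>N. abs3 (U m * Y m - U n * Y n) < e"
  proof (intro exI allI impI)
    fix m n assume mn: "m \<ge> max M N" "n \<ge> max M N"
    have "abs3 ((U m - U n) * Y m) \<le> abs3 (U m - U n) * B"
      unfolding abs3_mult using B by (intro mult_left_mono abs3_nonneg) auto
    also have "\<dots> < e" using M mn B by (simp add: pos_less_divide_eq)
    finally have 1: "abs3 ((U m - U n) * Y m) < e" .
    have "abs3 (U n * (Y m - Y n)) \<le> A * abs3 (Y m - Y n)"
      unfolding abs3_mult using A by (intro mult_right_mono abs3_nonneg) auto
    also have "\<dots> < e" using N mn A by (simp add: pos_less_divide_eq mult.commute)
    finally have 2: "abs3 (U n * (Y m - Y n)) < e" .
    have "U m * Y m - U n * Y n = (U m - U n) * Y m + U n * (Y m - Y n)" by (simp add: algebra_simps)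
    then show "abs3 (U m * Y m - U n * Y n) < e"
      using abs3_add_max[of "(U m - U n) * Y m" "U n * (Y m - Y n)"] 1 2 by simp
  qed
qed

lemma null3_zero [simp]: "null3 (\<lambda>n. 0)"
  by (simp add: null3_def)

lemma null3_add:
  assumes "null3 U" "null3 Y" shows "null3 (\<lambda>n. U n + Y n)"
  unfolding null3_def
proof (rule tendsto_sandwich[OF _ _ tendsto_const])
  show "(\<lambda>n. abs3 (U n) + abs3 (Y n)) \<longlonglongrightarrow> 0"
    using tendsto_add[OF assms[unfolded null3_def]] by simp
qed (auto simp: abs3_nonneg abs3_triangle)

lemma null3_minus: "null3 U \<Longrightarrow> null3 (\<lambda>n. - U n)"
  by (simp add: null3_def)

lemma null3_mult_bounded:
  assumes U: "null3 U" and Y: "cauchy3 Y" shows "null3 (\<lambda>n. U n * Y n)"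
proof -
  obtain B where B: "B > 0" "\<And>n. abs3 (Y n) \<le> B" using cauchy3_bounded[OF Y] by blast
  have "(\<lambda>n. abs3 (U n * Y n)) \<longlonglongrightarrow> 0"
  proof (rule tendsto_sandwich[OF _ _ tendsto_const])
    show "(\<lambda>n. abs3 (U n) * B) \<longlonglongrightarrow> 0"
      using tendsto_mult_right[OF U[unfolded null3_def], of B] by simp
    show "\<forall>\<^sub>F n in sequentially. abs3 (U n * Y n) \<le> abs3 (U n) * B"
      unfolding abs3_mult using B by (intro always_eventually allI mult_left_mono abs3_nonneg) auto
  qed (auto simp: abs3_nonneg)
  then show ?thesis by (simp add: null3_def)
qed

definition rel3 :: "(nat \<Rightarrow> rat) \<Rightarrow> (nat \<Rightarrow> rat) \<Rightarrow> bool" where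
  "rel3 U Y \<longleftrightarrow> cauchy3 U \<and> cauchy3 Y \<and> null3 (\<lambda>n. U n - Y n)"

lemma rel3_refl: "cauchy3 U \<Longrightarrow> rel3 U U"
  by (simp add: rel3_def)

lemma part_equivp_rel3: "part_equivp rel3"
proof (rule part_equivpI)
  show "\<exists>U. rel3 U U" using rel3_refl[OF cauchy3_const[of 0]] by blast
  show "symp rel3"
  proof (rule sympI)
    fix U Y assume "rel3 U Y"
    then show "rel3 Y U" using null3_minus[of "\<lambda>n. U n - Y n"] by (simp add: rel3_def)
  qed
  show "transp rel3"
  proof (rule transpI)
    fix U Y Z assume "rel3 U Y" "rel3 Y Z"
    then show "rel3 U Z"
      using null3_add[of "\<lambda>n. U n - Y n" "\<lambda>n. Y n - Z n"] by (simp add: rel3_def)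
  qed
qed

\<comment> \<open>The 3-adic numbers as Cauchy sequences modulo null sequences, the construction
  also behind \<open>completion_ring\<close>; it makes the rationals dense almost by definition. The
  quotient is partial because only Cauchy sequences represent elements. A commutative ring structure
  is what \<open>hom_on\<close> asks of its target.\<close>
quotient_type q3 = "nat \<Rightarrow> rat" / partial: rel3
  by (rule part_equivp_rel3)

instantiation q3 :: comm_ring_1
begin

lift_definition zero_q3 :: q3 is "\<lambda>n. 0"
  by (simp add: rel3_refl cauchy3_const)

lift_definition one_q3 :: q3 is "\<lambda>n. 1"
  by (simp add: rel3_refl cauchy3_const)

lift_definition plus_q3 :: "q3 \<Rightarrow> q3 \<Rightarrow> q3" is "\<lambda>U Y n. U n + Y n"
proof -
  fix U U' Y Y' assume "rel3 U U'" "rel3 Y Y'"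
  then show "rel3 (\<lambda>n. U n + Y n) (\<lambda>n. U' n + Y' n)"
    using null3_add[of "\<lambda>n. U n - U' n" "\<lambda>n. Y n - Y' n"]
    by (simp add: rel3_def cauchy3_add algebra_simps)
qed

lift_definition uminus_q3 :: "q3 \<Rightarrow> q3" is "\<lambda>U n. - U n"
proof -
  fix U U' assume "rel3 U U'"
  then show "rel3 (\<lambda>n. - U n) (\<lambda>n. - U' n)"
    using null3_minus[of "\<lambda>n. U n - U' n"] by (simp add: rel3_def cauchy3_minus)
qed

lift_definition times_q3 :: "q3 \<Rightarrow> q3 \<Rightarrow> q3" is "\<lambda>U Y n. U n * Y n"
proof -
  fix U U' Y Y' assume r: "rel3 U U'" "rel3 Y Y'"
  then have "null3 (\<lambda>n. (U n - U' n) * Y n + (Y n - Y' n) * U' n)"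
    by (intro null3_add null3_mult_bounded) (auto simp: rel3_def)
  then show "rel3 (\<lambda>n. U n * Y n) (\<lambda>n. U' n * Y' n)"
    using r by (simp add: rel3_def cauchy3_mult algebra_simps)
qed

definition minus_q3 :: "q3 \<Rightarrow> q3 \<Rightarrow> q3" where "minus_q3 x y = x + - y"

instance
proof
  fix a b c :: q3
  show "a * b * c = a * (b * c)" by transfer (simp add: rel3_def cauchy3_mult mult.assoc)
  show "a * b = b * a" by transfer (simp add: rel3_def cauchy3_mult mult.commute)
  show "1 * a = a" by transfer (simp add: rel3_refl)
  show "a + b + c = a + (b + c)" by transfer (simp add: rel3_def cauchy3_add add.assoc)
  show "a + b = b + a" by transfer (simp add: rel3_def cauchy3_add add.commute)
  show "0 + a = a" by transfer (simp add: rel3_refl)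
  show "- a + a = 0" by transfer (simp add: rel3_refl cauchy3_const)
  show "a - b = a + - b" by (simp add: minus_q3_def)
  show "(a + b) * c = a * c + b * c"
    by transfer (simp add: rel3_def cauchy3_mult cauchy3_add distrib_right)
  show "(0::q3) \<noteq> 1" by transfer (simp add: rel3_def null3_def LIMSEQ_const_iff)
qed

end

lemma lim_abs3:
  assumes "cauchy3 U" shows "(\<lambda>n. abs3 (U n)) \<longlonglongrightarrow> lim (\<lambda>n. abs3 (U n))"
  using cauchy3_convergent[OF assms] by (simp add: convergent_LIMSEQ_iff)

lemma rel3_lim:
  assumes r: "rel3 U Y" shows "lim (\<lambda>n. abs3 (U n)) = lim (\<lambda>n. abs3 (Y n))"
proof -
  have UY: "cauchy3 U" "cauchy3 Y" and null: "(\<lambda>n. abs3 (U n - Y n)) \<longlonglongrightarrow> 0"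
    using r by (simp_all add: rel3_def null3_def)
  have "(\<lambda>n. abs3 (U n) - abs3 (Y n)) \<longlonglongrightarrow> 0"
  proof (rule Lim_null_comparison[OF _ null])
    show "\<forall>\<^sub>F n in sequentially. norm (abs3 (U n) - abs3 (Y n)) \<le> abs3 (U n - Y n)"
      by (intro always_eventually allI) (simp add: abs3_reverse_triangle)
  qed
  from tendsto_diff[OF lim_abs3[OF UY(1)] this]
  have "(\<lambda>n. abs3 (Y n)) \<longlonglongrightarrow> lim (\<lambda>n. abs3 (U n))" by simp
  from limI[OF this] show ?thesis by simp
qed

section \<open>The norm on the 3-adic numbers\<close>

lift_definition norm3 :: "q3 \<Rightarrow> real" is "\<lambda>U. lim (\<lambda>n. abs3 (U n))"
  by (rule rel3_lim)

lemma norm3_nonneg: "norm3 x \<ge> 0"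
proof (transfer)
  fix U assume "rel3 U U"
  then have "cauchy3 U" by (simp add: rel3_def)
  from LIMSEQ_le_const[OF lim_abs3[OF this]] show "0 \<le> lim (\<lambda>n. abs3 (U n))"
    by (simp add: abs3_nonneg)
qed

lemma norm3_zero_iff: "norm3 x = 0 \<longleftrightarrow> x = 0"
proof (transfer)
  fix U assume "rel3 U U"
  then have U: "cauchy3 U" by (simp add: rel3_def)
  have "lim (\<lambda>n. abs3 (U n)) = 0 \<longleftrightarrow> (\<lambda>n. abs3 (U n)) \<longlonglongrightarrow> 0"
  proof
    assume "lim (\<lambda>n. abs3 (U n)) = 0"
    then show "(\<lambda>n. abs3 (U n)) \<longlonglongrightarrow> 0" using lim_abs3[OF U] by simp
  qed (rule limI)
  then show "lim (\<lambda>n. abs3 (U n)) = 0 \<longleftrightarrow> rel3 U (\<lambda>n. 0)"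
    using U by (simp add: rel3_def null3_def cauchy3_const)
qed

lemma norm3_mult: "norm3 (x * y) = norm3 x * norm3 y"
proof (transfer)
  fix U Y assume "rel3 U U" "rel3 Y Y"
  then have U: "cauchy3 U" "cauchy3 Y" by (simp_all add: rel3_def)
  show "lim (\<lambda>n. abs3 (U n * Y n)) = lim (\<lambda>n. abs3 (U n)) * lim (\<lambda>n. abs3 (Y n))"
    unfolding abs3_mult by (intro limI tendsto_mult lim_abs3 U)
qed

lemma norm3_add_max: "norm3 (x + y) \<le> max (norm3 x) (norm3 y)"
proof (transfer)
  fix U Y assume "rel3 U U" "rel3 Y Y"
  then have U: "cauchy3 U" "cauchy3 Y" by (simp_all add: rel3_def)
  show "lim (\<lambda>n. abs3 (U n + Y n)) \<le> max (lim (\<lambda>n. abs3 (U n))) (lim (\<lambda>n. abs3 (Y n)))"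
    by (rule LIMSEQ_le[OF lim_abs3[OF cauchy3_add[OF U]] tendsto_max[OF lim_abs3[OF U(1)] lim_abs3[OF U(2)]]])
      (simp add: abs3_add_max)
qed

lemma norm3_minus: "norm3 (- x) = norm3 x"
  by transfer simp

lift_definition of_rat3 :: "rat \<Rightarrow> q3" is "\<lambda>r n. r"
  by (simp add: rel3_refl cauchy3_const)

lemma norm3_of_rat3: "norm3 (of_rat3 r) = abs3 r"
  by transfer simp

lemma of_rat3_hom: "of_rat3 0 = 0" "of_rat3 1 = 1" "of_rat3 (a + b) = of_rat3 a + of_rat3 b"
  "of_rat3 (- a) = - of_rat3 a" "of_rat3 (a * b) = of_rat3 a * of_rat3 b" "of_rat3 (a - b) = of_rat3 a - of_rat3 b"
proof -
  show 1: "of_rat3 0 = 0" "of_rat3 1 = 1" "of_rat3 (a + b) = of_rat3 a + of_rat3 b"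
    "of_rat3 (- a) = - of_rat3 a" "of_rat3 (a * b) = of_rat3 a * of_rat3 b" for a b
    by (transfer; simp add: rel3_refl cauchy3_const)+
  show "of_rat3 (a - b) = of_rat3 a - of_rat3 b"
    using 1(3)[of a "- b"] by (simp add: 1(4))
qed

lemma q3_dense:
  assumes "e > 0" shows "\<exists>r. norm3 (x - of_rat3 r) < e"
proof -
  \<comment> \<open>Stated with addition because subtraction on \<open>q3\<close> is a plain
    definition through \<open>uminus\<close>, not a lifted operation.\<close>
  have "\<exists>r. norm3 (x + of_rat3 (- r)) < e"
  proof (transfer fixing: e)
    fix U assume "rel3 U U"
    then have U: "cauchy3 U" by (simp add: rel3_def)
    then obtain N where N: "\<And>m n. m \<ge> N \<Longrightarrow> n \<ge> N \<Longrightarrow> abs3 (U m - U n) < e / 2"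
      using assms unfolding cauchy3_def by (meson half_gt_zero)
    have "lim (\<lambda>n. abs3 (U n + - U N)) \<le> e / 2"
    proof (rule LIMSEQ_le_const2[OF lim_abs3[OF cauchy3_add[OF U cauchy3_const]]])
      show "\<exists>M. \<forall>n\<ge>M. abs3 (U n + - U N) \<le> e / 2" using N[of _ N] by (auto intro!: exI[of _ N] less_imp_le)
    qed
    then show "\<exists>r. lim (\<lambda>n. abs3 (U n + - r)) < e" using assms by (intro exI[of _ "U N"]) simp
  qed
  then show ?thesis by (simp add: of_rat3_hom)
qed

lemma norm3_triangle: "norm3 (x + y) \<le> norm3 x + norm3 y"
  using norm3_add_max[of x y] norm3_nonneg[of x] norm3_nonneg[of y] by linarith

lemma norm3_diff_max: "norm3 (x - y) \<le> max (norm3 x) (norm3 y)"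
  using norm3_add_max[of x "- y"] by (simp add: norm3_minus)

lemma norm3_diff_commute: "norm3 (x - y) = norm3 (y - x)"
  using norm3_minus[of "x - y"] by simp

lemma of_rat3_of_nat: "of_rat3 (of_nat n) = of_nat n"
  by (induction n) (simp_all add: of_rat3_hom)

lemma of_rat3_numeral: "of_rat3 (numeral n) = numeral n"
  using of_rat3_of_nat[of "numeral n"] by simp

lemma norm3_values [simp]: "norm3 0 = 0" "norm3 1 = 1" "norm3 2 = 1" "norm3 3 = 1/3"
  using norm3_of_rat3[of 0] norm3_of_rat3[of 1] norm3_of_rat3[of 2] norm3_of_rat3[of 3]
  by (simp_all add: of_rat3_hom of_rat3_numeral)

lemma norm3_of_nat_le: "norm3 (of_nat n) \<le> 1"
  using norm3_of_rat3[of "of_nat n"] abs3_int_le_one[of "int n"] by (simp add: of_rat3_of_nat)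

lemma norm3_numeral_le: "norm3 (numeral n) \<le> 1"
  using norm3_of_nat_le[of "numeral n"] by simp

lemma cauchy3_approx:
  assumes R: "cauchy3 R" and e: "e > 0"
  shows "\<exists>N. \<forall>n\<ge>N. norm3 (abs_q3 R - of_rat3 (R n)) \<le> e"
proof -
  obtain N where N: "\<And>m n. m \<ge> N \<Longrightarrow> n \<ge> N \<Longrightarrow> abs3 (R m - R n) < e"
    using R e unfolding cauchy3_def by meson
  have "norm3 (abs_q3 R - of_rat3 (R n)) \<le> e" if n: "n \<ge> N" for n
  proof -
    have c: "cauchy3 (\<lambda>m. R m + - R n)" by (rule cauchy3_add[OF R cauchy3_const])
    have "abs_q3 R - of_rat3 (R n) = abs_q3 R + of_rat3 (- R n)" by (simp add: of_rat3_hom)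
    also have "of_rat3 (- R n) = abs_q3 (\<lambda>_. - R n)" by (simp add: of_rat3.abs_eq)
    also have "abs_q3 R + abs_q3 (\<lambda>_. - R n) = abs_q3 (\<lambda>m. R m + - R n)"
      by (rule plus_q3.abs_eq) (simp_all add: rel3_refl R cauchy3_const)
    finally have "norm3 (abs_q3 R - of_rat3 (R n)) = lim (\<lambda>m. abs3 (R m + - R n))"
      using norm3.abs_eq[OF rel3_refl[OF c]] by simp
    also have "\<dots> \<le> e"
      by (rule LIMSEQ_le_const2[OF lim_abs3[OF c]]) (use N[OF _ n] in \<open>auto intro!: exI[of _ N] less_imp_le\<close>)
    finally show ?thesis .
  qed
  then show ?thesis by blast
qed

section \<open>Roots by fixed point iteration\<close>

lemma norm3_eq_zeroI:
  assumes "\<And>e. e > 0 \<Longrightarrow> norm3 x \<le> e" shows "x = 0"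
proof (rule ccontr)
  assume "x \<noteq> 0"
  then have "norm3 x > 0" using norm3_nonneg[of x] norm3_zero_iff[of x] by linarith
  then show False using assms[of "norm3 x / 2"] by simp
qed

text \<open>Hensel lifting in the form of Banach's fixed point theorem on the residue ball of 1.
  Completeness enters by hand: the iterates are replaced by rationals within
  \<open>(1/3) ^ n\<close>, and the sequence of these rationals represents the limit.\<close>

lemma contraction_fixed_point:
  fixes f :: "q3 \<Rightarrow> q3"
  assumes f1: "norm3 (f 1 - 1) \<le> 1/3"
    and contr: "\<And>x y. norm3 (x - 1) \<le> 1/3 \<Longrightarrow> norm3 (y - 1) \<le> 1/3 \<Longrightarrow> norm3 (f x - f y) \<le> norm3 (x - y) / 3"
  obtains y where "f y = y" "norm3 (y - 1) \<le> 1/3"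
proof -
  define s where "s n = (f ^^ n) 1" for n
  have s_Suc: "s (Suc n) = f (s n)" for n by (simp add: s_def)
  have s_ball: "norm3 (s n - 1) \<le> 1/3" for n
  proof (induction n)
    case (Suc n)
    have "norm3 (f (s n) - f 1) \<le> norm3 (s n - 1) / 3" by (rule contr) (use Suc in auto)
    then have "norm3 (f (s n) - f 1) \<le> 1/3" using Suc norm3_nonneg[of "s n - 1"] by simp
    then have "norm3 ((f (s n) - f 1) + (f 1 - 1)) \<le> 1/3"
      using norm3_add_max[of "f (s n) - f 1" "f 1 - 1"] f1 by simp
    then show ?case by (simp add: s_Suc)
  qed (simp add: s_def)
  have step: "norm3 (s (Suc n) - s n) \<le> (1/3) ^ n" for n
  proof (induction n)
    case 0
    then show ?case using f1 by (simp add: s_def)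
  next
    case (Suc n)
    have "norm3 (s (Suc (Suc n)) - s (Suc n)) \<le> norm3 (s (Suc n) - s n) / 3"
      unfolding s_Suc[of "Suc n"] using contr[OF s_ball s_ball, of "Suc n" n] by (simp add: s_Suc)
    then show ?case using Suc by simp
  qed
  have tail: "norm3 (s (n + k) - s n) \<le> (1/3) ^ n" for n k
  proof (induction k)
    case (Suc k)
    have "norm3 (s (Suc (n + k)) - s (n + k)) \<le> (1/3) ^ (n + k)" by (rule step)
    also have "\<dots> \<le> (1/3) ^ n" by (rule power_decreasing) auto
    finally show ?case
      using Suc norm3_add_max[of "s (Suc (n + k)) - s (n + k)" "s (n + k) - s n"] by simp
  qed simp
  have "\<forall>n. \<exists>r. norm3 (s n - of_rat3 r) < (1/3) ^ n"
    using q3_dense by simp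
  then obtain R where R: "\<And>n. norm3 (s n - of_rat3 (R n)) < (1/3) ^ n" by metis
  have RR: "abs3 (R m - R n) \<le> (1/3) ^ n" if "m \<ge> n" for m n
  proof -
    have e: "of_rat3 (R m - R n) = (of_rat3 (R m) - s m) + ((s m - s n) + (s n - of_rat3 (R n)))"
      by (simp add: of_rat3_hom)
    have "norm3 (of_rat3 (R m) - s m) \<le> (1/3) ^ m" using R[of m] norm3_diff_commute by (simp add: less_imp_le)
    also have "\<dots> \<le> (1/3) ^ n" using that by (intro power_decreasing) auto
    finally have 1: "norm3 (of_rat3 (R m) - s m) \<le> (1/3) ^ n" .
    have 2: "norm3 (s m - s n) \<le> (1/3) ^ n" using tail[of n "m - n"] that by simp
    have "norm3 ((s m - s n) + (s n - of_rat3 (R n))) \<le> (1/3) ^ n"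
      using norm3_add_max[of "s m - s n" "s n - of_rat3 (R n)"] 2 R[of n] by simp
    then have "norm3 (of_rat3 (R m - R n)) \<le> (1/3) ^ n"
      unfolding e using norm3_add_max[of "of_rat3 (R m) - s m" "(s m - s n) + (s n - of_rat3 (R n))"] 1 by simp
    then show ?thesis by (simp add: norm3_of_rat3)
  qed
  have small: "\<exists>N. \<forall>n\<ge>N. (1/3::real) ^ n < e" if e: "e > 0" for e
  proof -
    obtain N where N: "(1/3::real) ^ N < e" using real_arch_pow_inv[OF e, of "1/3"] by auto
    have "(1/3::real) ^ n < e" if "n \<ge> N" for n
      by (rule le_less_trans[OF power_decreasing[OF that] N]) auto
    then show ?thesis by blast
  qed
  have Rc: "cauchy3 R"
    unfolding cauchy3_def
  proof (intro allI impI)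
    fix e :: real assume "e > 0"
    then obtain N where N: "\<And>n. n \<ge> N \<Longrightarrow> (1/3::real) ^ n < e" using small by blast
    have "abs3 (R m - R n) < e" if "m \<ge> N" "n \<ge> N" for m n
    proof (cases "m \<ge> n")
      case True
      then show ?thesis using RR[of n m] N[of n] that by simp
    next
      case False
      then show ?thesis using RR[of m n] N[of m] that abs3_minus_commute[of "R m" "R n"] by simp
    qed
    then show "\<exists>N. \<forall>m\<ge>N. \<forall>n\<ge>N. abs3 (R m - R n) < e" by blast
  qed
  define y where "y = abs_q3 R"
  have lim: "\<exists>N. \<forall>n\<ge>N. norm3 (y - s n) \<le> e" if e: "e > 0" for e
  proof -
    obtain M where M: "\<And>n. n \<ge> M \<Longrightarrow> norm3 (y - of_rat3 (R n)) \<le> e"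
      using cauchy3_approx[OF Rc e] by (auto simp: y_def)
    obtain N where N: "\<And>n. n \<ge> N \<Longrightarrow> (1/3::real) ^ n < e" using small[OF e] by blast
    have "norm3 (y - s n) \<le> e" if "n \<ge> max M N" for n
    proof -
      have "norm3 (of_rat3 (R n) - s n) \<le> e"
        using R[of n] N[of n] that norm3_diff_commute[of "s n"] by simp
      then show ?thesis
        using norm3_add_max[of "y - of_rat3 (R n)" "of_rat3 (R n) - s n"] M[of n] that by simp
    qed
    then show ?thesis by blast
  qed
  have ball: "norm3 (y - 1) \<le> 1/3"
  proof -
    obtain n where "norm3 (y - s n) \<le> 1/3" using lim[of "1/3"] by auto
    then show ?thesis using norm3_add_max[of "y - s n" "s n - 1"] s_ball[of n] by simp
  qed
  have "f y - y = 0"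
  proof (rule norm3_eq_zeroI)
    fix e :: real assume "e > 0"
    then obtain n where n: "norm3 (y - s n) \<le> e" "norm3 (y - s (Suc n)) \<le> e"
      using lim[of e] by (meson le_SucI order_refl)
    have "norm3 (f y - f (s n)) \<le> norm3 (y - s n) / 3" by (rule contr[OF ball s_ball])
    then have "norm3 (f y - s (Suc n)) \<le> e"
      using n(1) norm3_nonneg[of "y - s n"] by (simp add: s_Suc)
    then show "norm3 (f y - y) \<le> e"
      using norm3_add_max[of "f y - s (Suc n)" "s (Suc n) - y"] n(2) norm3_diff_commute[of y] by simp
  qed
  then show thesis using that ball by simp
qed

lemma norm3_unit:
  assumes "norm3 (x - 1) \<le> 1/3" shows "norm3 x = 1"
proof -
  have "norm3 x \<le> 1" using norm3_add_max[of "x - 1" 1] assms by simp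
  moreover have "1 \<le> max (norm3 x) (norm3 (x - 1))" using norm3_diff_max[of x "x - 1"] by simp
  ultimately show ?thesis using assms by (auto simp: max_def split: if_splits)
qed

text \<open>Newton iteration with the derivative frozen at its value 2 in the point 1;
  \<open>h\<close> is 1/2. It contracts because \<open>2 - y - z\<close> is divisible by 3 on the
  residue ball of 1.\<close>

lemma q3_sqrt:
  assumes x: "norm3 (x - 1) \<le> 1/3"
  obtains y where "y ^ 2 = x" "norm3 (y - 1) \<le> 1/3"
proof -
  define h where "h = of_rat3 (1/2)"
  have h2: "h * 2 = 1"
    using of_rat3_hom(5)[of "1/2" 2] by (simp add: h_def of_rat3_numeral of_rat3_hom(2))
  have nh: "norm3 h = 1" using norm3_mult[of h 2] h2 by simp
  define f where "f y = y - h * (y ^ 2 - x)" for y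
  have "f 1 - 1 = h * (x - 1)" by (simp add: f_def algebra_simps)
  then have 1: "norm3 (f 1 - 1) \<le> 1/3" using x nh by (simp add: norm3_mult)
  have 2: "norm3 (f y - f z) \<le> norm3 (y - z) / 3" if "norm3 (y - 1) \<le> 1/3" "norm3 (z - 1) \<le> 1/3" for y z
  proof -
    have "f y - f z = (y - z) * (h * 2) - h * (y ^ 2 - z ^ 2)" by (simp add: h2 f_def algebra_simps)
    also have "\<dots> = (y - z) * (h * ((1 - y) - (z - 1)))" by (simp add: power2_eq_square algebra_simps)
    finally have eq: "f y - f z = (y - z) * (h * ((1 - y) - (z - 1)))" .
    have "norm3 ((1 - y) - (z - 1)) \<le> 1/3"
      using norm3_diff_max[of "1 - y" "z - 1"] that norm3_diff_commute[of 1 y] by simp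
    then have "norm3 (y - z) * norm3 ((1 - y) - (z - 1)) \<le> norm3 (y - z) * (1/3)"
      by (rule mult_left_mono) (rule norm3_nonneg)
    then show ?thesis unfolding eq norm3_mult nh by simp
  qed
  obtain y where y: "f y = y" "norm3 (y - 1) \<le> 1/3" by (rule contraction_fixed_point[OF 1 2])
  then have "h * (y ^ 2 - x) = 0" by (simp add: f_def)
  then have "(h * 2) * (y ^ 2 - x) = 0" by (metis mult.assoc mult.commute mult_zero_right)
  then have "y ^ 2 = x" by (simp add: h2)
  then show thesis using that y by blast
qed

text \<open>The quartic of \<open>theta\<close> at \<open>3 * T\<close>, divided by 3. Modulo 3 it
  is linear with root 1; solving for the linear term, with \<open>h\<close> = 1/8, gives a
  contraction.\<close>

lemma q3_theta:
  obtains T where "27 * T ^ 4 + 18 * T ^ 2 - 8 * T - 1 = 0" "norm3 (T - 1) \<le> 1/3"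
proof -
  define h where "h = of_rat3 (1/8)"
  have h8: "h * 8 = 1"
    using of_rat3_hom(5)[of "1/8" 8] by (simp add: h_def of_rat3_numeral of_rat3_hom(2))
  have "(8::q3) = 2 * 2 * 2" by simp
  then have "norm3 (8::q3) = 1" by (simp only: norm3_mult norm3_values mult_1)
  then have nh: "norm3 h = 1" using norm3_mult[of h 8] h8 by simp
  define f where "f T = h * (27 * T ^ 4 + 18 * T ^ 2 - 1)" for T :: q3
  have "f 1 - 1 = h * (27 + 18 - 1) - h * 8" by (simp add: f_def h8)
  also have "\<dots> = h * (3 * 12)" by (simp add: algebra_simps)
  finally have "norm3 (f 1 - 1) = norm3 h * (norm3 3 * norm3 12)" by (simp only: norm3_mult)
  then have 1: "norm3 (f 1 - 1) \<le> 1/3" using norm3_numeral_le[of "num.Bit0 (num.Bit0 (num.Bit1 num.One))"] nh by simp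
  have 2: "norm3 (f y - f z) \<le> norm3 (y - z) / 3" if "norm3 (y - 1) \<le> 1/3" "norm3 (z - 1) \<le> 1/3" for y z
  proof -
    \<comment> \<open>\<open>3 * c\<close> is the divided difference of
      \<open>27 * T ^ 4 + 18 * T ^ 2\<close>; its factor 3 is the contraction.\<close>
    define c where "c = 9 * ((y + z) * (y ^ 2 + z ^ 2)) + 6 * (y + z)"
    have eq: "f y - f z = (y - z) * (h * (3 * c))"
      by (simp add: f_def c_def eval_nat_numeral algebra_simps)
    have yz: "norm3 y = 1" "norm3 z = 1" using norm3_unit that by auto
    have 1: "norm3 (y + z) \<le> 1" "norm3 (y ^ 2 + z ^ 2) \<le> 1"
      using norm3_add_max[of y z] norm3_add_max[of "y ^ 2" "z ^ 2"] yz by (simp_all add: power2_eq_square norm3_mult)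
    have "norm3 (9 * ((y + z) * (y ^ 2 + z ^ 2))) \<le> 1" "norm3 (6 * (y + z)) \<le> 1"
      unfolding norm3_mult using 1 norm3_numeral_le norm3_nonneg by (meson mult_le_one mult_nonneg_nonneg)+
    then have "norm3 c \<le> 1" unfolding c_def using norm3_add_max by (meson max.bounded_iff order_trans)
    then show ?thesis
      unfolding eq norm3_mult nh norm3_values using norm3_nonneg[of "y - z"] norm3_nonneg[of c]
      by (simp add: mult_left_le)
  qed
  obtain T where T: "f T = T" "norm3 (T - 1) \<le> 1/3" by (rule contraction_fixed_point[OF 1 2])
  have "8 * f T = (h * 8) * (27 * T ^ 4 + 18 * T ^ 2 - 1)" by (simp add: f_def algebra_simps)
  then have "27 * T ^ 4 + 18 * T ^ 2 - 8 * T - 1 = 0" using T(1) h8 by (simp add: algebra_simps)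
  then show thesis using that T(2) by blast
qed

subsection \<open>A place of the first field with completion the 3-adic numbers\<close>

lemma notin_fixed:
  "(\<And>a. a \<in> F \<Longrightarrow> \<sigma> a = a) \<Longrightarrow> \<sigma> x = - x \<Longrightarrow> x \<noteq> 0 \<Longrightarrow> x \<notin> F" for x :: complex
  by force

lemma E_fixed:
  assumes \<sigma>: "\<sigma> \<in> carrier GG"
  shows "x \<in> \<rat> \<Longrightarrow> \<sigma> x = x" "\<sigma> sqrt_7 = sqrt_7 \<Longrightarrow> x \<in> E1 \<Longrightarrow> \<sigma> x = x"
    "\<sigma> sqrt_7 = sqrt_7 \<Longrightarrow> \<sigma> sqrt_19 = sqrt_19 \<Longrightarrow> x \<in> E2 \<Longrightarrow> \<sigma> x = x"
    "\<sigma> sqrt_7 = sqrt_7 \<Longrightarrow> \<sigma> sqrt_19 = sqrt_19 \<Longrightarrow> \<sigma> zz = zz \<Longrightarrow> x \<in> E3 \<Longrightarrow> \<sigma> x = x"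
proof -
  have sub: "E1 \<subseteq> LL" "E2 \<subseteq> LL" "E3 \<subseteq> LL" using E4_LL E4_facts(3) E3_facts(3) E2_facts(3) by auto
  show 0: "\<sigma> x = x" if "x \<in> \<rat>" for x using \<sigma> that by (auto simp: galois_group_carrier)
  show 1: "\<sigma> x = x" if "\<sigma> sqrt_7 = sqrt_7" "x \<in> E1" for x
    by (rule fixes_adjoin[OF csubfield_Rats E1_def E1_facts(2) sub(1) \<sigma> 0 that])
  show 2: "\<sigma> x = x" if "\<sigma> sqrt_7 = sqrt_7" "\<sigma> sqrt_19 = sqrt_19" "x \<in> E2" for x
    by (rule fixes_adjoin[OF E1_facts(2) E2_def E2_facts(2) sub(2) \<sigma> 1[OF that(1)] that(2,3)])
  show "\<sigma> x = x" if "\<sigma> sqrt_7 = sqrt_7" "\<sigma> sqrt_19 = sqrt_19" "\<sigma> zz = zz" "x \<in> E3" for x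
    by (rule fixes_adjoin[OF E2_facts(2) E3_def E3_facts(2) sub(3) \<sigma> 2[OF that(1,2)] that(3,4)])
qed

text \<open>Each of these generators is negated by an automorphism that fixes the smaller
  field.\<close>

lemma E_notin: "sqrt_7 \<notin> \<rat>" "sqrt_19 \<notin> E1" "zz \<notin> E2" "yy \<notin> E4"
proof -
  show "sqrt_7 \<notin> \<rat>"
    by (rule notin_fixed[of _ aut_u]) (use E_fixed(1)[OF aut_u(1)] aut_u other_nonzero in auto)
  show "sqrt_19 \<notin> E1"
    by (rule notin_fixed[of _ aut_w]) (use E_fixed(2)[OF aut_w(1,4)] aut_w other_nonzero in auto)
  show "zz \<notin> E2"
    by (rule notin_fixed[of _ aut_a]) (use E_fixed(3)[OF aut_a(1,4,5)] aut_a other_nonzero in auto)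
  show "yy \<notin> E4"
    by (rule notin_fixed[of _ aut_e]) (use fixes_E4[OF aut_e(1,4,5,10,13)] aut_e other_nonzero in auto)
qed

lemma sum4: "(\<Sum>i<(4::nat). f i) = f 0 + f 1 + f 2 + f 3"
  by (simp add: eval_nat_numeral)

lemma theta_relation:
  "theta ^ 4 = (\<Sum>i<4. (if i = 0 then 3 else if i = 1 then 8 else if i = 2 then - 6 else 0) * theta ^ i)"
  using theta_quartic by (simp add: sum4 algebra_simps)

lemma theta_conjugates_distinct:
  "card {theta, rad0 - rad1 - rad2, rad1 - rad0 - rad2, rad2 - rad0 - rad1} = 4"
proof -
  have opp: "a + b \<noteq> 0 \<and> a - b \<noteq> 0" if "a ^ 2 \<noteq> b ^ 2" for a b :: complex
    using that by (metis add_eq_0_iff2 eq_iff_diff_eq_0 power2_minus)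
  have om1: "omega \<noteq> 1" using omega_sum by auto
  have "cbrt2 \<noteq> 0" using cbrt2_cube by auto
  then have "rad0 ^ 2 \<noteq> rad1 ^ 2" "rad0 ^ 2 \<noteq> rad2 ^ 2" "rad1 ^ 2 \<noteq> rad2 ^ 2"
    using om1 omega_nonzero omega_cube unfolding sqrt_squares rad2_square
    by (auto simp: power2_eq_square power3_eq_cube)
  note ne = this[THEN opp]
  have "theta - (rad0 - rad1 - rad2) = 2 * (rad1 + rad2)" "theta - (rad1 - rad0 - rad2) = 2 * (rad0 + rad2)"
    "theta - (rad2 - rad0 - rad1) = 2 * (rad0 + rad1)"
    "(rad0 - rad1 - rad2) - (rad1 - rad0 - rad2) = 2 * (rad0 - rad1)"
    "(rad0 - rad1 - rad2) - (rad2 - rad0 - rad1) = 2 * (rad0 - rad2)"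
    "(rad1 - rad0 - rad2) - (rad2 - rad0 - rad1) = 2 * (rad1 - rad2)"
    by (simp_all add: theta_def)
  then have "theta \<noteq> rad0 - rad1 - rad2" "theta \<noteq> rad1 - rad0 - rad2" "theta \<noteq> rad2 - rad0 - rad1"
    "rad0 - rad1 - rad2 \<noteq> rad1 - rad0 - rad2" "rad0 - rad1 - rad2 \<noteq> rad2 - rad0 - rad1"
    "rad1 - rad0 - rad2 \<noteq> rad2 - rad0 - rad1"
    using ne by (metis eq_iff_diff_eq_0 mult_eq_0_iff zero_neq_numeral)+
  then show ?thesis by simp
qed

text \<open>A polynomial over \<open>E3\<close> that vanishes at \<open>theta\<close> also vanishes
  at its images under \<open>i\<close>, \<open>j\<close>, \<open>k\<close>: four distinct roots are
  too many for degree at most 3.\<close>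

lemma theta_independent:
  assumes b: "\<And>i. i < 4 \<Longrightarrow> b i \<in> E3" and 0: "(\<Sum>i<4. b i * theta ^ i) = 0" and i: "i < (4::nat)"
  shows "b i = 0"
proof -
  define p where "p = [:b 0, b 1, b 2, b 3:]"
  have pv: "poly p x = (\<Sum>i<4. b i * x ^ i)" for x
    by (simp add: p_def sum4 eval_nat_numeral algebra_simps)
  have "E3 \<subseteq> LL" using E4_LL E4_facts(3) by auto
  then have bL: "b i \<in> LL" if "i < 4" for i using b[OF that] by blast
  have root: "poly p (\<sigma> theta) = 0"
    if \<sigma>: "\<sigma> \<in> carrier GG" "\<sigma> sqrt_7 = sqrt_7" "\<sigma> sqrt_19 = sqrt_19" "\<sigma> zz = zz" for \<sigma>
  proof -
    have "\<sigma> (\<Sum>i<4. b i * theta ^ i) = (\<Sum>i<4. \<sigma> (b i * theta ^ i))"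
      using bL by (intro hom_on_sum[OF LL_facts(2) GG_hom[OF \<sigma>(1)]]) (auto simp: LL_closed)
    also have "\<dots> = (\<Sum>i<4. b i * \<sigma> theta ^ i)"
      using b bL E_fixed(4)[OF \<sigma>] by (intro sum.cong) (auto simp: GG_hom_simps[OF \<sigma>(1)] LL_closed)
    finally show ?thesis using 0 hom_on_zero[OF LL_facts(2) GG_hom[OF \<sigma>(1)]] by (simp add: pv)
  qed
  have "p = 0"
  proof (rule ccontr)
    assume p: "p \<noteq> 0"
    have "{theta, rad0 - rad1 - rad2, rad1 - rad0 - rad2, rad2 - rad0 - rad1} \<subseteq> {x. poly p x = 0}"
      using root[OF aut_i(1,4,5,10)] root[OF aut_j(1,4,5,10)] root[OF aut_k(1,4,5,10)] 0
      by (simp add: aut_i(13) aut_j(13) aut_k(13) pv)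
    then have "4 \<le> card {x. poly p x = 0}"
      using card_mono[OF poly_roots_finite[OF p]] theta_conjugates_distinct by metis
    also have "\<dots> \<le> Polynomial.degree p" by (rule card_poly_roots_bound[OF p])
    also have "\<dots> \<le> 3" by (simp add: p_def degree_pCons_eq_if)
    finally show False by simp
  qed
  moreover have "i = 0 \<or> i = 1 \<or> i = 2 \<or> i = 3" using i by auto
  ultimately show ?thesis by (auto simp: p_def)
qed

definition rat_to_q3 :: "complex \<Rightarrow> q3" where
  "rat_to_q3 x = of_rat3 (THE r. of_rat r = x)"

lemma rat_to_q3: "rat_to_q3 (of_rat r) = of_rat3 r"
  by (simp add: rat_to_q3_def)

lemma hom_on_rat_to_q3: "hom_on \<rat> rat_to_q3"
  unfolding hom_on_def
proof (intro conjI ballI)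
  show "rat_to_q3 1 = 1" using rat_to_q3[of 1] by (simp add: of_rat3_hom)
  fix x y :: complex assume "x \<in> \<rat>" "y \<in> \<rat>"
  then obtain a b where [simp]: "x = of_rat a" "y = of_rat b" by (auto elim!: Rats_cases)
  show "rat_to_q3 (x + y) = rat_to_q3 x + rat_to_q3 y" "rat_to_q3 (x * y) = rat_to_q3 x * rat_to_q3 y"
    by (simp_all add: rat_to_q3 of_rat3_hom flip: of_rat_add of_rat_mult)
qed

text \<open>Take \<open>s7\<close> congruent to -1 and \<open>s19\<close> congruent to 1 modulo 3.
  Then \<open>(s19 + 4) * s7\<close> is congruent to 1, and both \<open>s7 - 2\<close> and the root
  of the quartic are 3 times a unit congruent to 1, so their product is a square too. It matters
  that one sign of \<open>s7\<close> serves both radicands; this is what fails for the second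
  field.\<close>

lemma q3_roots:
  obtains s7 s19 z T y :: q3 where "s7 ^ 2 = 7" "s19 ^ 2 = 19" "z ^ 2 = (s19 + 4) * s7"
    "T ^ 4 + 6 * T ^ 2 - 8 * T - 3 = 0" "y ^ 2 = T * (s7 - 2)"
proof -
  have third: "norm3 (3 * n) \<le> 1/3" if "norm3 n \<le> 1" for n
    using that by (simp add: norm3_mult)
  have "norm3 (7 - 1) \<le> 1/3" "norm3 (19 - 1) \<le> 1/3"
    using third[of 2] third[of 6] norm3_numeral_le by simp_all
  note small = this
  obtain r7 where r7: "r7 ^ 2 = 7" "norm3 (r7 - 1) \<le> 1/3" by (rule q3_sqrt[OF small(1)])
  obtain s19 where s19: "s19 ^ 2 = 19" "norm3 (s19 - 1) \<le> 1/3" by (rule q3_sqrt[OF small(2)])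
  define s7 where "s7 = - r7"
  have s7: "s7 ^ 2 = 7" by (simp add: s7_def r7)
  have n7: "norm3 s7 = 1" using norm3_unit[OF r7(2)] by (simp add: s7_def norm3_minus)
  obtain T where T: "27 * T ^ 4 + 18 * T ^ 2 - 8 * T - 1 = 0" "norm3 (T - 1) \<le> 1/3" using q3_theta .
  have eq: "(s19 + 4) * s7 - 1 = (s19 - 1) * s7 + (5 * (- (r7 - 1)) - 3 * 2)"
    by (simp add: s7_def algebra_simps)
  have n1: "norm3 ((s19 - 1) * s7) \<le> 1/3" using s19 n7 by (simp add: norm3_mult)
  have n2: "norm3 (5 * (- (r7 - 1)) - 3 * 2) \<le> 1/3"
  proof -
    have "norm3 (5 * (- (r7 - 1))) \<le> 1 * (1/3)"
      unfolding norm3_mult norm3_minus by (intro mult_mono norm3_numeral_le r7 norm3_nonneg) auto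
    then show ?thesis using norm3_diff_max[of "5 * (- (r7 - 1))" "3 * 2"] third[of 2] by simp
  qed
  have *: "norm3 ((s19 + 4) * s7 - 1) \<le> 1/3"
    unfolding eq by (rule order_trans[OF norm3_add_max max.boundedI[OF n1 n2]])
  obtain z where z: "z ^ 2 = (s19 + 4) * s7" by (rule q3_sqrt[OF *])
  define h where "h = of_rat3 (1/3)"
  have h3: "3 * h = 1"
    using of_rat3_hom(5)[of "1/3" 3] by (simp add: h_def of_rat3_numeral of_rat3_hom(2) mult.commute)
  define m where "m = h * (s7 - 2)"
  have m3: "3 * m = s7 - 2" unfolding m_def mult.assoc[symmetric] h3 by simp
  \<comment> \<open>\<open>m\<close> is the inverse of \<open>s7 + 2\<close>, because
    \<open>(s7 - 2) * (s7 + 2) = 3\<close>.\<close>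
  have "m * (s7 + 2) = h * (s7 ^ 2 - 4)" by (simp add: m_def power2_eq_square algebra_simps)
  also have "\<dots> = 3 * h" by (simp add: s7)
  finally have m1: "m * (s7 + 2) = 1" using h3 by simp
  have u: "norm3 ((s7 + 2) - 1) \<le> 1/3" using r7(2) norm3_diff_commute[of r7 1] by (simp add: s7_def)
  have nm: "norm3 m = 1" using norm3_mult[of m "s7 + 2"] norm3_unit[OF u] m1 by simp
  have "m - 1 = m * (1 - (s7 + 2))" by (simp only: right_diff_distrib m1 mult_1_right)
  then have "norm3 (m - 1) \<le> 1/3" using u nm norm3_diff_commute[of 1 "s7 + 2"] by (simp add: norm3_mult)
  moreover have "norm3 ((T - 1) * m) \<le> 1/3" using T(2) nm by (simp add: norm3_mult)
  ultimately have "norm3 ((T - 1) * m + (m - 1)) \<le> 1/3"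
    using order_trans[OF norm3_add_max max.boundedI] by blast
  moreover have "T * m - 1 = (T - 1) * m + (m - 1)" by (simp add: algebra_simps)
  ultimately have **: "norm3 (T * m - 1) \<le> 1/3" by (simp only:)
  obtain w where w: "w ^ 2 = T * m" by (rule q3_sqrt[OF **])
  show thesis
  proof (rule that[OF s7 s19(1) z])
    have "(3 * T) ^ 4 + 6 * (3 * T) ^ 2 - 8 * (3 * T) - 3 = 3 * (27 * T ^ 4 + 18 * T ^ 2 - 8 * T - 1)"
      by (simp add: power_mult_distrib algebra_simps)
    then show "(3 * T) ^ 4 + 6 * (3 * T) ^ 2 - 8 * (3 * T) - 3 = 0" using T(1) by simp
    have "(3 * w) ^ 2 = (3 * T) * (3 * m)" by (simp add: power_mult_distrib w)
    then show "(3 * w) ^ 2 = (3 * T) * (s7 - 2)" by (simp add: m3)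
  qed
qed

lemma K1_embedding:
  obtains \<Phi> :: "complex \<Rightarrow> q3" where "hom_on K1 \<Phi>" "\<And>r. \<Phi> (of_rat r) = of_rat3 r"
proof -
  obtain s7 s19 z T y :: q3 where r: "s7 ^ 2 = 7" "s19 ^ 2 = 19" "z ^ 2 = (s19 + 4) * s7"
    "T ^ 4 + 6 * T ^ 2 - 8 * T - 3 = 0" "y ^ 2 = T * (s7 - 2)" using q3_roots .
  note h0 = hom_on_numeral[OF csubfield_Rats hom_on_rat_to_q3]
  obtain \<tau>1 where 1: "hom_on E1 \<tau>1" "\<And>a. a \<in> \<rat> \<Longrightarrow> \<tau>1 a = rat_to_q3 a" "\<tau>1 sqrt_7 = s7"
    by (rule hom_extend_sqrt[OF csubfield_Rats hom_on_rat_to_q3 _ E_notin(1), of s7])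
      (simp_all add: sqrt_squares r h0 E1_def)
  note h1 = hom_on_numeral[OF E1_facts(2) 1(1)]
  obtain \<tau>2 where 2: "hom_on E2 \<tau>2" "\<And>a. a \<in> E1 \<Longrightarrow> \<tau>2 a = \<tau>1 a" "\<tau>2 sqrt_19 = s19"
    by (rule hom_extend_sqrt[OF E1_facts(2) 1(1) _ E_notin(2), of s19])
      (simp_all add: sqrt_squares r h1 E2_def csubfield_closed[OF E1_facts(2)])
  have q2: "sqrt_7 \<in> E2" using E1_facts(4) E2_facts(3) by blast
  note h2 = hom_on_numeral[OF E2_facts(2) 2(1)] hom_on_mult[OF E2_facts(2) 2(1)] hom_on_add[OF E2_facts(2) 2(1)]
  have "zz ^ 2 \<in> E2" "\<tau>2 (zz ^ 2) = z ^ 2"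
    using q2 E2_facts(4) E1_facts(4) by (simp_all add: sqrt_squares lam_def r h2 1 2 csubfield_closed[OF E2_facts(2)])
  then obtain \<tau>3 where 3: "hom_on E3 \<tau>3" "\<And>a. a \<in> E2 \<Longrightarrow> \<tau>3 a = \<tau>2 a" "\<tau>3 zz = z"
    using hom_extend_sqrt[OF E2_facts(2) 2(1) _ E_notin(3), of z] unfolding E3_def by metis
  note h3 = hom_on_numeral[OF E3_facts(2) 3(1)] hom_on_minus[OF E3_facts(2) 3(1)] hom_on_zero[OF E3_facts(2) 3(1)]
  obtain \<tau>4 where 4: "hom_on E4 \<tau>4" "\<And>a. a \<in> E3 \<Longrightarrow> \<tau>4 a = \<tau>3 a" "\<tau>4 theta = T"
  proof (rule hom_extend_monic[OF E3_facts(2) 3(1) _ _ theta_relation, of T])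
    show "T ^ 4 = (\<Sum>i<4. \<tau>3 (if i = 0 then 3 else if i = 1 then 8 else if i = 2 then - 6 else 0) * T ^ i)"
      using r(4) by (simp add: sum4 h3 csubfield_closed[OF E3_facts(2)] algebra_simps)
  qed (use that theta_independent in \<open>auto simp: E4_def csubfield_closed[OF E3_facts(2)]\<close>)
  note h4 = hom_on_numeral[OF E4_facts(2) 4(1)] hom_on_mult[OF E4_facts(2) 4(1)] hom_on_diff[OF E4_facts(2) 4(1)]
  have q3: "sqrt_7 \<in> E3" using q2 E3_facts(3) by blast
  have "\<tau>4 sqrt_7 = s7" using q2 q3 E1_facts(4) by (simp add: 1 2 3 4)
  then have "yy ^ 2 \<in> E4" "\<tau>4 (yy ^ 2) = y ^ 2"
    using E4_mem by (simp_all add: sqrt_squares mu_def r h4 4 csubfield_closed[OF E4_facts(2)])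
  then obtain \<tau>5 where 5: "hom_on K1 \<tau>5" "\<And>a. a \<in> E4 \<Longrightarrow> \<tau>5 a = \<tau>4 a"
    using hom_extend_sqrt[OF E4_facts(2) 4(1) _ E_notin(4), of y] unfolding K1_def by metis
  have "\<tau>5 (of_rat r) = of_rat3 r" for r
  proof -
    have "(of_rat r :: complex) \<in> \<rat>" by simp
    moreover have "\<rat> \<subseteq> E1" "\<rat> \<subseteq> E2" "\<rat> \<subseteq> E3" "\<rat> \<subseteq> E4"
      using Rats_subset_csubfield E1_facts(2) E2_facts(2) E3_facts(2) E4_facts(2) by blast+
    ultimately show ?thesis by (simp add: 5 4 3 2 1 rat_to_q3 subset_iff)
  qed
  with 5(1) that show thesis by blast
qed

text \<open>The norm is pulled back along the embedding. Its values on the rationals together with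
  their density encode that the completion is the field of 3-adic numbers.\<close>

lemma K1_place:
  obtains v where "v \<in> nontrivial_absolute_values K1" "\<And>r. v (of_rat r) = abs3 r"
    "\<And>x e. x \<in> K1 \<Longrightarrow> e > 0 \<Longrightarrow> \<exists>r. v (x - of_rat r) < e"
proof -
  obtain \<Phi> :: "complex \<Rightarrow> q3" where \<Phi>: "hom_on K1 \<Phi>" "\<And>r. \<Phi> (of_rat r) = of_rat3 r"
    using K1_embedding by metis
  note F = K1_facts(2)
  define v where "v x = (if x \<in> K1 then norm3 (\<Phi> x) else 0)" for x
  have rat: "of_rat r \<in> K1" for r using Rats_subset_csubfield[OF F] by auto
  have zero: "v x = 0 \<longleftrightarrow> x = 0" if x: "x \<in> K1" for x
  proof
    assume "v x = 0"
    then have "\<Phi> x = 0" using x by (simp add: v_def norm3_zero_iff)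
    then have "\<Phi> (x * inverse x) = 0" using hom_on_mult[OF F \<Phi>(1) x csubfield_inverse[OF F x]] by simp
    then show "x = 0" using hom_on_one[OF F \<Phi>(1)] by (cases "x = 0") auto
  next
    assume "x = 0"
    then show "v x = 0" using hom_on_zero[OF F \<Phi>(1)] by (simp add: v_def)
  qed
  have "absolute_value K1 v"
    unfolding absolute_value_def
  proof (intro conjI ballI allI impI)
    fix x y assume xy: "x \<in> K1" "y \<in> K1"
    show "v (x * y) = v x * v y"
      using xy by (simp add: v_def csubfield_closed[OF F] hom_on_mult[OF F \<Phi>(1)] norm3_mult)
    show "v (x + y) \<le> v x + v y"
      using xy by (simp add: v_def csubfield_closed[OF F] hom_on_add[OF F \<Phi>(1)] norm3_triangle)
  qed (use zero in \<open>auto simp: v_def norm3_nonneg\<close>)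
  moreover have vr: "v (of_rat r) = abs3 r" for r
    using rat by (simp add: v_def \<Phi>(2) norm3_of_rat3)
  moreover have "\<exists>x\<in>K1. x \<noteq> 0 \<and> v x \<noteq> 1"
    using rat[of 3] vr[of 3] by (intro bexI[of _ "of_rat 3"]) auto
  ultimately have "v \<in> nontrivial_absolute_values K1"
    by (simp add: nontrivial_absolute_values_def)
  moreover have "\<exists>r. v (x - of_rat r) < e" if "x \<in> K1" "e > 0" for x e
    using q3_dense[OF that(2), of "\<Phi> x"] that(1) rat
    by (simp add: v_def csubfield_closed[OF F] hom_on_diff[OF F \<Phi>(1)] \<Phi>(2))
  ultimately show thesis using that vr by blast
qed

subsection \<open>Completions\<close>

context
  fixes K :: "complex set" and v :: "complex \<Rightarrow> real"
  assumes K: "csubfield K" and v: "absolute_value K v"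
begin

lemma abs_val_outside: "x \<notin> K \<Longrightarrow> v x = 0"
  and abs_val_zero_iff: "x \<in> K \<Longrightarrow> v x = 0 \<longleftrightarrow> x = 0"
  and abs_val_mult: "x \<in> K \<Longrightarrow> y \<in> K \<Longrightarrow> v (x * y) = v x * v y"
  and abs_val_add: "x \<in> K \<Longrightarrow> y \<in> K \<Longrightarrow> v (x + y) \<le> v x + v y"
  using v by (auto simp: absolute_value_def)

lemma abs_val_nonneg: "v x \<ge> 0"
  using v abs_val_outside[of x] by (cases "x \<in> K") (auto simp: absolute_value_def)

lemma abs_val_minus: "v (- x) = v x"
proof (cases "x \<in> K")
  case True
  have 1: "1 \<in> K" "- 1 \<in> K" using csubfield_basic[OF K] by auto
  have "v 1 * v 1 = v 1" "v 1 \<noteq> 0" using abs_val_mult[OF 1(1) 1(1)] abs_val_zero_iff[OF 1(1)] by auto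
  then have "v 1 = 1" by simp
  then have "v (- 1) * v (- 1) = 1" using abs_val_mult[OF 1(2) 1(2)] by simp
  then have "v (- 1) ^ 2 = 1 ^ 2" by (simp add: power2_eq_square)
  then have "v (- 1) = 1" by (rule power2_eq_imp_eq) (simp_all add: abs_val_nonneg)
  then show ?thesis using abs_val_mult[OF 1(2) True] by simp
next
  case False
  then have "- x \<notin> K" using csubfield_basic(3)[OF K, of "- x"] by auto
  with False show ?thesis by (simp add: abs_val_outside)
qed

lemma abs_val_diff_commute: "v (x - y) = v (y - x)"
  using abs_val_minus[of "x - y"] by simp

lemma Metric_space_abs_val: "Metric_space K (\<lambda>x y. v (x - y))"
proof
  show "0 \<le> v (x - y)" for x y by (rule abs_val_nonneg)
  show "v (x - y) = v (y - x)" for x y by (rule abs_val_diff_commute)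
  show "v (x - y) = 0 \<longleftrightarrow> x = y" if "x \<in> K" "y \<in> K" for x y
    using that abs_val_zero_iff[of "x - y"] by (simp add: csubfield_diff[OF K])
  show "v (x - z) \<le> v (x - y) + v (y - z)" if "x \<in> K" "y \<in> K" "z \<in> K" for x y z
    using that abs_val_add[of "x - y" "y - z"] by (simp add: csubfield_diff[OF K])
qed

lemma cauchy_carrier:
  "s \<in> carrier (cauchy_ring K v) \<longleftrightarrow>
    range s \<subseteq> K \<and> (\<forall>e>0. \<exists>N. \<forall>n n'. N \<le> n \<longrightarrow> N \<le> n' \<longrightarrow> v (s n - s n') < e)"
  by (simp add: cauchy_ring_def Metric_space.MCauchy_def[OF Metric_space_abs_val])

lemma cauchy_in_K: "s \<in> carrier (cauchy_ring K v) \<Longrightarrow> s n \<in> K"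
  by (auto simp: cauchy_carrier)

lemma convergent_cauchy:
  assumes s: "range s \<subseteq> K" and x: "x \<in> K" and lim: "(\<lambda>n. v (s n - x)) \<longlonglongrightarrow> 0"
  shows "s \<in> carrier (cauchy_ring K v)"
  unfolding cauchy_carrier
proof (intro conjI s allI impI)
  fix e :: real assume "e > 0"
  then have "\<forall>\<^sub>F n in sequentially. v (s n - x) < e / 2"
    using order_tendstoD(2)[OF lim, of "e / 2"] by simp
  then obtain N where N: "\<And>n. n \<ge> N \<Longrightarrow> v (s n - x) < e / 2" by (auto simp: eventually_sequentially)
  have "v (s n - s n') < e" if "N \<le> n" "N \<le> n'" for n n'
  proof -
    have "v ((s n - x) + (x - s n')) \<le> v (s n - x) + v (x - s n')"
      using s x by (intro abs_val_add csubfield_diff[OF K]) auto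
    then show ?thesis using N[OF that(1)] N[OF that(2)] abs_val_diff_commute[of x] by simp
  qed
  then show "\<exists>N. \<forall>n n'. N \<le> n \<longrightarrow> N \<le> n' \<longrightarrow> v (s n - s n') < e" by blast
qed

lemma cauchy_const: "x \<in> K \<Longrightarrow> (\<lambda>n. x) \<in> carrier (cauchy_ring K v)"
  using abs_val_zero_iff[of 0] csubfield_basic(1)[OF K] by (intro convergent_cauchy[of _ x]) auto

lemma null_iff: "z \<in> null_sequences K v \<longleftrightarrow> range z \<subseteq> K \<and> (\<lambda>n. v (z n)) \<longlonglongrightarrow> 0"
  using convergent_cauchy[of z 0] csubfield_basic(1)[OF K] cauchy_in_K[of z]
  by (auto simp: null_sequences_def)

lemma null_add:
  assumes "y \<in> null_sequences K v" "z \<in> null_sequences K v"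
  shows "(\<lambda>n. y n + z n) \<in> null_sequences K v"
proof -
  have yz: "y n \<in> K" "z n \<in> K" "(\<lambda>n. v (y n)) \<longlonglongrightarrow> 0" "(\<lambda>n. v (z n)) \<longlonglongrightarrow> 0" for n
    using assms by (auto simp: null_iff)
  have "(\<lambda>n. v (y n + z n)) \<longlonglongrightarrow> 0"
  proof (rule tendsto_sandwich[OF _ _ tendsto_const])
    show "(\<lambda>n. v (y n) + v (z n)) \<longlonglongrightarrow> 0" using tendsto_add[OF yz(3,4)] by simp
  qed (use yz abs_val_add abs_val_nonneg in auto)
  then show ?thesis using yz by (auto simp: null_iff csubfield_closed[OF K])
qed

lemma null_uminus: "z \<in> null_sequences K v \<Longrightarrow> (\<lambda>n. - z n) \<in> null_sequences K v"
  by (auto simp: null_iff abs_val_minus csubfield_closed[OF K])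

lemma completion_class_mem:
  "t \<in> completion_class K v s \<longleftrightarrow> (\<exists>z\<in>null_sequences K v. t = (\<lambda>n. z n + s n))"
  by (auto simp: completion_class_def a_r_coset_def r_coset_def cauchy_ring_def)

lemma completion_class_eq_iff:
  assumes "s \<in> carrier (cauchy_ring K v)" "t \<in> carrier (cauchy_ring K v)"
  shows "completion_class K v s = completion_class K v t \<longleftrightarrow> (\<lambda>n. v (s n - t n)) \<longlonglongrightarrow> 0"
proof
  assume eq: "completion_class K v s = completion_class K v t"
  have "(\<lambda>n. 0) \<in> null_sequences K v"
    using csubfield_basic(1)[OF K] abs_val_zero_iff[of 0] by (auto simp: null_iff)
  then have "s \<in> completion_class K v s" by (force simp: completion_class_mem)
  then obtain z where z: "z \<in> null_sequences K v" "s = (\<lambda>n. z n + t n)"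
    unfolding eq completion_class_mem by blast
  then show "(\<lambda>n. v (s n - t n)) \<longlonglongrightarrow> 0" by (simp add: null_iff)
next
  assume lim: "(\<lambda>n. v (s n - t n)) \<longlonglongrightarrow> 0"
  then have d: "(\<lambda>n. s n - t n) \<in> null_sequences K v"
    using assms cauchy_in_K by (auto simp: null_iff csubfield_diff[OF K])
  have "u \<in> completion_class K v t" if u: "u \<in> completion_class K v s" for u
  proof -
    obtain z where "z \<in> null_sequences K v" "u = (\<lambda>n. z n + s n)" using u unfolding completion_class_mem by blast
    then show ?thesis
      unfolding completion_class_mem
      by (intro bexI[OF _ null_add[OF _ d]]) (auto simp: algebra_simps)
  qed
  moreover have "u \<in> completion_class K v s" if u: "u \<in> completion_class K v t" for u
  proof -
    obtain z where "z \<in> null_sequences K v" "u = (\<lambda>n. z n + t n)" using u unfolding completion_class_mem by blast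
    then show ?thesis
      unfolding completion_class_mem
      by (intro bexI[OF _ null_add[OF _ null_uminus[OF d]]]) (auto simp: algebra_simps)
  qed
  ultimately show "completion_class K v s = completion_class K v t" by blast
qed

lemma completion_carrier:
  "A \<in> carrier (completion_ring K v) \<longleftrightarrow> (\<exists>s\<in>carrier (cauchy_ring K v). A = completion_class K v s)"
  by (auto simp: completion_ring_def FactRing_def A_RCOSETS_def RCOSETS_def completion_class_def
      a_r_coset_def)

lemma cauchy_perturb:
  assumes s: "s \<in> carrier (cauchy_ring K v)" and t: "range t \<subseteq> K" and lim: "(\<lambda>n. v (s n - t n)) \<longlonglongrightarrow> 0"
  shows "t \<in> carrier (cauchy_ring K v)"
  unfolding cauchy_carrier
proof (intro conjI t allI impI)
  fix e :: real assume "e > 0"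
  then have "\<forall>\<^sub>F n in sequentially. v (s n - t n) < e / 3"
    using order_tendstoD(2)[OF lim, of "e / 3"] by simp
  then obtain M where M: "\<And>n. n \<ge> M \<Longrightarrow> v (s n - t n) < e / 3" by (auto simp: eventually_sequentially)
  obtain N where N: "\<And>n n'. N \<le> n \<Longrightarrow> N \<le> n' \<Longrightarrow> v (s n - s n') < e / 3"
    using s \<open>e > 0\<close> unfolding cauchy_carrier by (meson divide_pos_pos zero_less_numeral)
  have "v (t n - t n') < e" if n: "max M N \<le> n" "max M N \<le> n'" for n n'
  proof -
    have m: "s k \<in> K" "t k \<in> K" for k using cauchy_in_K[OF s] t by auto
    have "v ((t n - s n) + ((s n - s n') + (s n' - t n'))) \<le> v (t n - s n) + v ((s n - s n') + (s n' - t n'))"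
      using m by (intro abs_val_add csubfield_closed[OF K])
    also have "v ((s n - s n') + (s n' - t n')) \<le> v (s n - s n') + v (s n' - t n')"
      using m by (intro abs_val_add csubfield_closed[OF K])
    finally show ?thesis
      using M[of n] M[of n'] N[of n n'] n abs_val_diff_commute[of "t n"] by simp
  qed
  then show "\<exists>N. \<forall>n n'. N \<le> n \<longrightarrow> N \<le> n' \<longrightarrow> v (t n - t n') < e" by blast
qed

text \<open>Limits that lie in \<open>K\<close> itself. Comparing elements of \<open>K\<close> with
  rational sequences in this way avoids arithmetic in the completion.\<close>

definition limit_in :: "(nat \<Rightarrow> complex) \<Rightarrow> complex \<Rightarrow> bool" where
  "limit_in s x \<longleftrightarrow> range s \<subseteq> K \<and> x \<in> K \<and> (\<lambda>n. v (s n - x)) \<longlonglongrightarrow> 0"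

lemma limit_in_const: "x \<in> K \<Longrightarrow> limit_in (\<lambda>n. x) x"
  using abs_val_zero_iff[of 0] csubfield_basic(1)[OF K] by (auto simp: limit_in_def)

lemma limit_in_add:
  assumes "limit_in s x" "limit_in t y" shows "limit_in (\<lambda>n. s n + t n) (x + y)"
proof -
  have "(\<lambda>n. (s n - x) + (t n - y)) \<in> null_sequences K v"
    by (rule null_add) (use assms in \<open>auto simp: null_iff limit_in_def csubfield_closed[OF K]\<close>)
  moreover have "s n \<in> K" "t n \<in> K" for n using assms by (auto simp: limit_in_def)
  ultimately show ?thesis
    using assms by (auto simp: null_iff limit_in_def csubfield_closed[OF K] algebra_simps)
qed

lemma limit_in_mult:
  assumes s: "limit_in s x" and t: "limit_in t y" shows "limit_in (\<lambda>n. s n * t n) (x * y)"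
proof -
  have K': "s n \<in> K" "t n \<in> K" "x \<in> K" "y \<in> K" for n using s t by (auto simp: limit_in_def)
  have l: "(\<lambda>n. v (s n - x)) \<longlonglongrightarrow> 0" "(\<lambda>n. v (t n - y)) \<longlonglongrightarrow> 0" using s t by (auto simp: limit_in_def)
  have "(\<lambda>n. (s n - x) * (t n - y) + ((s n - x) * y + x * (t n - y))) \<in> null_sequences K v"
  proof (intro null_add)
    show "(\<lambda>n. (s n - x) * (t n - y)) \<in> null_sequences K v"
      using K' tendsto_mult[OF l] by (auto simp: null_iff csubfield_closed[OF K] abs_val_mult)
    show "(\<lambda>n. (s n - x) * y) \<in> null_sequences K v"
      using K' tendsto_mult_right[OF l(1), of "v y"] by (auto simp: null_iff csubfield_closed[OF K] abs_val_mult)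
    show "(\<lambda>n. x * (t n - y)) \<in> null_sequences K v"
      using K' tendsto_mult_left[OF l(2), of "v x"] by (auto simp: null_iff csubfield_closed[OF K] abs_val_mult)
  qed
  moreover have "(s n - x) * (t n - y) + ((s n - x) * y + x * (t n - y)) = s n * t n - x * y" for n
    by (simp add: algebra_simps)
  ultimately show ?thesis using K' by (auto simp: null_iff limit_in_def csubfield_closed[OF K])
qed

end

section \<open>Transport of rational approximations along a local isomorphism\<close>

lemma powr_tendsto_0_D:
  fixes a :: "nat \<Rightarrow> real"
  assumes lim: "(\<lambda>n. a n powr s) \<longlonglongrightarrow> 0" and s: "s > 0" and a: "\<And>n. a n \<ge> 0"
  shows "a \<longlonglongrightarrow> 0"
proof (rule LIMSEQ_I)
  fix e :: real assume e: "e > 0"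
  then have "\<forall>\<^sub>F n in sequentially. a n powr s < e powr s"
    using order_tendstoD(2)[OF lim, of "e powr s"] by simp
  then obtain N where N: "\<And>n. n \<ge> N \<Longrightarrow> a n powr s < e powr s" by (auto simp: eventually_sequentially)
  have "norm (a n - 0) < e" if "n \<ge> N" for n
  proof (rule ccontr)
    assume "\<not> norm (a n - 0) < e"
    then have "e powr s \<le> a n powr s" using a[of n] e s by (intro powr_mono2) auto
    with N[OF that] show False by simp
  qed
  then show "\<exists>N. \<forall>n\<ge>N. norm (a n - 0) < e" by blast
qed

text \<open>An element of \<open>K'\<close> corresponds to an element of the completion of \<open>K\<close>, which is a limit of
  rational numbers because \<open>\<rat>\<close> is dense in \<open>K\<close>; the isomorphism sends the class of this rational
  sequence to its class in the completion of \<open>K'\<close>.\<close>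

lemma locally_isomorphic_rational_approximation:
  assumes K: "csubfield K" and K': "csubfield K'"
    and v: "v \<in> nontrivial_absolute_values K" "\<And>r. v (of_rat r) = abs3 r"
    and dense: "\<And>x e. x \<in> K \<Longrightarrow> e > 0 \<Longrightarrow> \<exists>r. v (x - of_rat r) < e"
    and iso: "locally_isomorphic K K'"
  obtains w where "absolute_value K' w"
    "\<And>x. x \<in> K' \<Longrightarrow> \<exists>R. limit_in K' w (\<lambda>n. of_rat (R n)) x"
    "\<And>Q. limit_in K' w (\<lambda>n. of_rat (Q n)) 0 \<Longrightarrow> (\<lambda>n. abs3 (Q n)) \<longlonglongrightarrow> 0"
proof -
  obtain \<phi> where \<phi>: "bij_betw \<phi> (places K) (places K')"
    "\<And>P. P \<in> places K \<Longrightarrow> \<exists>v\<in>P. \<exists>w\<in>\<phi> P. completions_isomorphic K v K' w"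
    using iso unfolding locally_isomorphic_def by blast
  define P where "P = equivalent_absolute_values K `` {v}"
  have P: "P \<in> places K" unfolding P_def places_def using v(1) by (rule quotientI)
  \<comment> \<open>The isomorphism may use another representative \<open>u\<close> of the place. It
    is a power of \<open>v\<close>, and the exponent \<open>s\<close> has to be undone
    below.\<close>
  then obtain u w where u: "u \<in> P" and w: "w \<in> \<phi> P" and ci: "completions_isomorphic K u K' w"
    using \<phi>(2) by blast
  have uv: "u \<in> nontrivial_absolute_values K" and "\<exists>s>0. \<forall>x\<in>K. u x = v x powr s"
    using u unfolding P_def equivalent_absolute_values_def by auto
  then obtain s where s: "s > 0" "\<And>x. x \<in> K \<Longrightarrow> u x = v x powr s" by blast
  have au: "absolute_value K u" using uv by (simp add: nontrivial_absolute_values_def)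
  have av: "absolute_value K v" using v(1) by (simp add: nontrivial_absolute_values_def)
  have "\<phi> P \<in> places K'" using \<phi>(1) P by (auto simp: bij_betw_def)
  then have "w \<in> nontrivial_absolute_values K'"
    using w unfolding places_def quotient_def equivalent_absolute_values_def by auto
  then have aw: "absolute_value K' w" by (simp add: nontrivial_absolute_values_def)
  obtain f where f: "f \<in> ring_iso (completion_ring K u) (completion_ring K' w)"
    and f_cauchy: "\<And>s. range s \<subseteq> \<rat> \<Longrightarrow> s \<in> carrier (cauchy_ring K u) \<longleftrightarrow> s \<in> carrier (cauchy_ring K' w)"
    and f_class: "\<And>s. s \<in> carrier (cauchy_ring K u) \<Longrightarrow> range s \<subseteq> \<rat> \<Longrightarrow>
        f (completion_class K u s) = completion_class K' w s"
    using ci unfolding completions_isomorphic_def by blast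
  have bij: "bij_betw f (carrier (completion_ring K u)) (carrier (completion_ring K' w))"
    using f by (simp add: ring_iso_def)
  have ratK: "of_rat r \<in> K" "of_rat r \<in> K'" for r
    using Rats_subset_csubfield[OF K] Rats_subset_csubfield[OF K'] by auto
  have approx: "\<exists>R. limit_in K' w (\<lambda>n. of_rat (R n)) x" if x: "x \<in> K'" for x
  proof -
    have cx: "(\<lambda>n. x) \<in> carrier (cauchy_ring K' w)" by (rule cauchy_const[OF K' aw x])
    then have "completion_class K' w (\<lambda>n. x) \<in> carrier (completion_ring K' w)"
      by (auto simp: completion_carrier[OF K' aw])
    then have "completion_class K' w (\<lambda>n. x) \<in> f ` carrier (completion_ring K u)"
      by (simp add: bij_betw_imp_surj_on[OF bij])
    then obtain A where A: "completion_class K' w (\<lambda>n. x) = f A" "A \<in> carrier (completion_ring K u)"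
      by (rule imageE)
    then obtain t where t: "t \<in> carrier (cauchy_ring K u)" "A = completion_class K u t"
      using A(2) by (auto simp: completion_carrier[OF K au])
    have tK: "t n \<in> K" for n by (rule cauchy_in_K[OF K au t(1)])
    \<comment> \<open>With the exponent \<open>1 / s\<close> the error becomes
      \<open>1 / (n + 1)\<close> after passing from \<open>v\<close> to \<open>u\<close>.\<close>
    have "\<forall>n. \<exists>r. v (t n - of_rat r) < (1 / real (Suc n)) powr (1 / s)"
      using dense tK by simp
    then obtain R where R: "\<And>n. v (t n - of_rat (R n)) < (1 / real (Suc n)) powr (1 / s)" by metis
    have "u (t n - of_rat (R n)) \<le> 1 / real (Suc n)" for n
    proof -
      have "u (t n - of_rat (R n)) = v (t n - of_rat (R n)) powr s"
        using tK ratK by (intro s(2) csubfield_diff[OF K])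
      also have "\<dots> \<le> ((1 / real (Suc n)) powr (1 / s)) powr s"
        using R[of n] s(1) abs_val_nonneg[OF K av] by (intro powr_mono2) auto
      also have "\<dots> = 1 / real (Suc n)" using s(1) by (simp add: powr_powr)
      finally show ?thesis .
    qed
    then have lim: "(\<lambda>n. u (t n - of_rat (R n))) \<longlonglongrightarrow> 0"
      by (intro tendsto_sandwich[OF _ _ tendsto_const LIMSEQ_inverse_real_of_nat])
        (auto simp: abs_val_nonneg[OF K au] inverse_eq_divide)
    let ?R = "\<lambda>n. of_rat (R n) :: complex"
    have Rc: "?R \<in> carrier (cauchy_ring K u)"
      by (rule cauchy_perturb[OF K au t(1) _ lim]) (use ratK in auto)
    have "completion_class K u ?R = A"
      unfolding t(2) using completion_class_eq_iff[OF K au t(1) Rc] lim by simp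
    then have "completion_class K' w ?R = completion_class K' w (\<lambda>n. x)"
      using f_class[OF Rc] A(1) by (simp add: image_subset_iff)
    moreover have "?R \<in> carrier (cauchy_ring K' w)" using f_cauchy[of ?R] Rc by (simp add: image_subset_iff)
    ultimately have "(\<lambda>n. w (?R n - x)) \<longlonglongrightarrow> 0"
      using completion_class_eq_iff[OF K' aw _ cx] by blast
    then show ?thesis using ratK x by (auto simp: limit_in_def[OF K' aw])
  qed
  \<comment> \<open>A rational sequence that is null for \<open>w\<close> has the class of 0;
    injectivity of \<open>f\<close> brings this back to \<open>u\<close>, hence to the 3-adic
    absolute value.\<close>
  have null: "(\<lambda>n. abs3 (Q n)) \<longlonglongrightarrow> 0" if Q: "limit_in K' w (\<lambda>n. of_rat (Q n)) 0" for Q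
  proof -
    let ?Q = "\<lambda>n. of_rat (Q n) :: complex" and ?Z = "\<lambda>n::nat. 0 :: complex"
    have l: "(\<lambda>n. w (?Q n - 0)) \<longlonglongrightarrow> 0" and r: "range ?Q \<subseteq> K'" using Q by (auto simp: limit_in_def[OF K' aw])
    have z: "0 \<in> K" "0 \<in> K'" using csubfield_basic(1) K K' by auto
    have Qc': "?Q \<in> carrier (cauchy_ring K' w)" by (rule convergent_cauchy[OF K' aw r z(2) l])
    then have Qc: "?Q \<in> carrier (cauchy_ring K u)" using f_cauchy[of ?Q] by (simp add: image_subset_iff)
    have c0: "?Z \<in> carrier (cauchy_ring K u)" "?Z \<in> carrier (cauchy_ring K' w)"
      using cauchy_const[OF K au z(1)] cauchy_const[OF K' aw z(2)] by auto
    have "completion_class K' w ?Q = completion_class K' w ?Z"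
      using completion_class_eq_iff[OF K' aw Qc' c0(2)] l by simp
    then have "f (completion_class K u ?Q) = f (completion_class K u ?Z)"
      using f_class[OF Qc] f_class[OF c0(1)] by (simp add: image_subset_iff)
    moreover have "completion_class K u t \<in> carrier (completion_ring K u)"
      if "t \<in> carrier (cauchy_ring K u)" for t
      using that by (auto simp only: completion_carrier[OF K au])
    ultimately have "completion_class K u ?Q = completion_class K u ?Z"
      using inj_onD[OF bij_betw_imp_inj_on[OF bij]] Qc c0(1) by blast
    then have "(\<lambda>n. u (?Q n)) \<longlonglongrightarrow> 0"
      using completion_class_eq_iff[OF K au Qc c0(1)] by simp
    then have "(\<lambda>n. abs3 (Q n) powr s) \<longlonglongrightarrow> 0" using s(2) ratK v(2) by simp
    then show ?thesis by (rule powr_tendsto_0_D[OF _ s(1) abs3_nonneg])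
  qed
  show thesis by (rule that[OF aw approx null])
qed

subsection \<open>An obstruction modulo 9\<close>

text \<open>\<open>A\<close> must be 3 modulo 9. Then \<open>3 * (- B - 2)\<close> can be a square
  modulo 9 only for \<open>B\<close> = 4, as \<open>B\<close> = 5 gives 6; but for \<open>B\<close>
  = 4 the value of \<open>(C + 4) * B\<close> is 2 or 3, neither a square. Working modulo 9 detects
  numbers that are divisible by 3 exactly once.\<close>

lemma mod_9_obstruction:
  fixes A B C D E :: int
  assumes B: "9 dvd B ^ 2 - 7" and C: "9 dvd C ^ 2 - 19" and A: "9 dvd A ^ 4 + 6 * A ^ 2 - 8 * A - 3"
    and D: "9 dvd D ^ 2 - A * (- B - 2)" and E: "9 dvd E ^ 2 - (C + 4) * B"
  shows False
proof -
  have residues: "x mod 9 \<in> {0, 1, 2, 3, 4, 5, 6, 7, 8}" for x :: int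
  proof -
    have "x mod 9 \<in> set [0..8]" by simp
    then show ?thesis by (simp add: upto.simps)
  qed
  have "r ^ 2 mod 9 \<in> {0, 1, 4, 7}" if "r \<in> {0, 1, 2, 3, 4, 5, 6, 7, 8}" for r :: int
    using that by (elim insertE emptyE; simp)
  from this[OF residues] have sq: "x ^ 2 mod 9 \<in> {0, 1, 4, 7}" for x :: int
    unfolding power_mod .
  have solutions:
    "9 dvd r ^ 2 - 7 \<Longrightarrow> r = 4 \<or> r = 5" "9 dvd r ^ 2 - 19 \<Longrightarrow> r = 1 \<or> r = 8"
    "9 dvd r ^ 4 + 6 * r ^ 2 - 8 * r - 3 \<Longrightarrow> r = 3"
    if "r \<in> {0, 1, 2, 3, 4, 5, 6, 7, 8}" for r :: int
    using that by (elim insertE emptyE; simp)+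
  have "(B ^ 2 - 7) mod 9 = ((B mod 9) ^ 2 - 7) mod 9"
    by (intro mod_diff_cong) (simp_all add: power_mod)
  then have B9: "B mod 9 = 4 \<or> B mod 9 = 5"
    using B by (intro solutions(1)[OF residues]) (simp only: dvd_eq_mod_eq_0)
  have "(C ^ 2 - 19) mod 9 = ((C mod 9) ^ 2 - 19) mod 9"
    by (intro mod_diff_cong) (simp_all add: power_mod)
  then have C9: "C mod 9 = 1 \<or> C mod 9 = 8"
    using C by (intro solutions(2)[OF residues]) (simp only: dvd_eq_mod_eq_0)
  have "(A ^ 4 + 6 * A ^ 2 - 8 * A - 3) mod 9 =
      ((A mod 9) ^ 4 + 6 * (A mod 9) ^ 2 - 8 * (A mod 9) - 3) mod 9"
    by (intro mod_diff_cong mod_add_cong mod_mult_cong) (simp_all add: power_mod)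
  then have A9: "A mod 9 = 3"
    using A by (intro solutions(3)[OF residues]) (simp only: dvd_eq_mod_eq_0)
  have "D ^ 2 mod 9 = (A * (- B - 2)) mod 9" using D by (simp only: mod_eq_dvd_iff)
  also have "\<dots> = ((A mod 9) * (- (B mod 9) - 2)) mod 9"
    by (intro mod_mult_cong mod_diff_cong mod_minus_cong) simp_all
  finally have D9: "D ^ 2 mod 9 = ((A mod 9) * (- (B mod 9) - 2)) mod 9" .
  have "E ^ 2 mod 9 = ((C + 4) * B) mod 9" using E by (simp only: mod_eq_dvd_iff)
  also have "\<dots> = ((C mod 9 + 4) * (B mod 9)) mod 9"
    by (intro mod_mult_cong mod_add_cong) simp_all
  finally have E9: "E ^ 2 mod 9 = ((C mod 9 + 4) * (B mod 9)) mod 9" .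
  show False
    using sq[of D] sq[of E] B9 C9 unfolding D9 E9 A9 by (elim disjE) simp_all
qed

text \<open>Replaces 3-integral rationals by integers, so that smallness of a polynomial expression
  in the approximations becomes divisibility by 9.\<close>

definition cong9 :: "rat \<Rightarrow> int \<Rightarrow> bool" where
  "cong9 x m \<longleftrightarrow> abs3 (x - of_int m) \<le> 1/9"

lemma cong9_of_int: "cong9 (of_int k) k"
  by (simp add: cong9_def)

lemma cong9_integral: assumes "cong9 x m" shows "abs3 x \<le> 1"
  using abs3_add_max[of "x - of_int m" "of_int m"] assms abs3_int_le_one[of m]
  by (simp add: cong9_def)

lemma cong9_add: assumes "cong9 x m" "cong9 y n" shows "cong9 (x + y) (m + n)"
proof -
  have "x + y - of_int (m + n) = (x - of_int m) + (y - of_int n)" by simp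
  then show ?thesis using abs3_add_max[of "x - of_int m" "y - of_int n"] assms
    unfolding cong9_def by (simp only:)
qed

lemma cong9_mult: assumes "cong9 x m" "cong9 y n" shows "cong9 (x * y) (m * n)"
proof -
  have eq: "x * y - of_int (m * n) = (x - of_int m) * y + of_int m * (y - of_int n)"
    by (simp add: algebra_simps)
  have "abs3 ((x - of_int m) * y) \<le> 1/9 * 1" "abs3 (of_int m * (y - of_int n)) \<le> 1 * (1/9)"
    unfolding abs3_mult using assms cong9_integral[OF assms(2)] abs3_int_le_one[of m]
    by (intro mult_mono; simp add: cong9_def abs3_nonneg)+
  then show ?thesis unfolding cong9_def eq
    using abs3_add_max[of "(x - of_int m) * y" "of_int m * (y - of_int n)"] by simp
qed

lemma cong9_power: "cong9 x m \<Longrightarrow> cong9 (x ^ k) (m ^ k)"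
  using cong9_of_int[of 1] by (induction k) (simp_all add: cong9_mult)

lemma cong9_diff: assumes "cong9 x m" "cong9 y n" shows "cong9 (x - y) (m - n)"
  using cong9_add[OF assms(1) cong9_mult[OF cong9_of_int[of "- 1"] assms(2)]] by simp

lemma cong9_numeral: "cong9 (numeral k) (numeral k)"
  using cong9_of_int[of "numeral k"] by simp

lemma cong9_dvd: assumes "cong9 x m" "abs3 x \<le> 1/9" shows "9 dvd m"
proof -
  have "abs3 (of_int m) \<le> 1/9"
    using abs3_diff_max[of x "x - of_int m"] assms by (simp add: cong9_def)
  then show ?thesis using abs3_int_le_iff[of m 2] by (simp add: abs3_of_int power2_eq_square)
qed

lemma cong9_exists:
  assumes "abs3 x \<le> 1" shows "\<exists>m. cong9 x m"
proof -
  obtain a b where ab: "quotient_of x = (a, b)" by force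
  then have x: "x = of_int a / of_int b" and b: "b > 0" and cop: "coprime a b"
    using quotient_of_div quotient_of_denom_pos quotient_of_coprime by blast+
  have pos: "abs3_int b > 0" using b abs3_int_nonneg[of b] abs3_int_zero_iff[of b] by linarith
  have le: "abs3_int a \<le> abs3_int b" using assms b pos by (simp add: x abs3_fraction divide_le_eq)
  have b3: "\<not> 3 dvd b"
  proof
    assume 3: "3 dvd b"
    then have "abs3_int b \<le> 1/3" using abs3_int_le_iff[of b 1] by simp
    then have "3 dvd a" using le abs3_int_le_iff[of a 1] by simp
    with 3 cop have "is_unit (3::int)" using coprime_common_divisor by blast
    then show False by simp
  qed
  then have unit: "abs3_int b = 1" using b by (simp add: abs3_int_def not_dvd_imp_multiplicity_0)
  have "coprime b 3" using b3 prime_imp_coprime[of 3 b] by (simp add: coprime_commute)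
  then have "coprime b (3 ^ 2)" by (auto simp only: coprime_power_right_iff)
  \<comment> \<open>\<open>c\<close> inverts the denominator modulo 9.\<close>
  then obtain c e where "c * b + e * 3 ^ 2 = 1" using bezout_int[of b "3 ^ 2"] by auto
  then have "1 - b * c = 3 ^ 2 * e" by (simp add: algebra_simps)
  then have dvd: "3 ^ 2 dvd a * (1 - b * c)" by simp
  have "x - of_int (a * c) = of_int (a * (1 - b * c)) / of_int b"
    using b by (simp add: x field_simps)
  then have "abs3 (x - of_int (a * c)) = abs3_int (a * (1 - b * c))"
    using abs3_fraction[of b "a * (1 - b * c)"] b unit by simp
  also have "\<dots> \<le> 1/9" using dvd abs3_int_le_iff[of "a * (1 - b * c)" 2] by (simp add: power2_eq_square)
  finally show ?thesis unfolding cong9_def by blast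
qed

section \<open>Integrality of approximate solutions\<close>

lemma abs3_square_le_one:
  assumes "abs3 (x ^ 2 - y) \<le> 1" "abs3 y \<le> 1" shows "abs3 x \<le> 1"
proof -
  have "abs3 x ^ 2 \<le> 1" using abs3_add_max[of "x ^ 2 - y" y] assms by (simp add: abs3_power)
  then show ?thesis using abs3_nonneg[of x] by (simp add: power_le_one_iff)
qed

text \<open>If \<open>x\<close> were not integral, its fourth power would have to be cancelled by
  terms of size at most \<open>abs3 x ^ 2\<close>.\<close>

lemma abs3_quartic_le_one:
  assumes "abs3 (x ^ 4 + 6 * x ^ 2 - 8 * x - 3) \<le> 1" shows "abs3 x \<le> 1"
proof (rule ccontr)
  assume "\<not> abs3 x \<le> 1"
  then have gt: "1 < abs3 x" by simp
  let ?f = "x ^ 4 + 6 * x ^ 2 - 8 * x - 3" and ?g = "8 * x + 3 - 6 * x ^ 2"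
  have le: "abs3 x \<le> abs3 x ^ 2" using gt by (simp add: power2_eq_square)
  have i: "abs3 (numeral k * z) \<le> abs3 z" for k z
    using abs3_int_le_one[of "numeral k"] abs3_nonneg[of z]
    by (simp add: abs3_mult mult_left_le_one_le abs3_nonneg)
  have "abs3 (8 * x) \<le> abs3 x ^ 2" using i[of _ x] le by (rule order_trans)
  moreover have "abs3 3 \<le> abs3 x ^ 2" using gt le by simp
  moreover have "abs3 (6 * x ^ 2) \<le> abs3 x ^ 2" using i[of _ "x ^ 2"] by (simp add: abs3_power)
  ultimately have "abs3 ?g \<le> abs3 x ^ 2"
    using abs3_add_max[of "8 * x" 3] abs3_diff_max[of "8 * x + 3" "6 * x ^ 2"] by linarith
  moreover have "x ^ 4 = ?f + ?g" by simp
  ultimately have "abs3 (x ^ 4) \<le> abs3 x ^ 2"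
    using abs3_add_max[of ?f ?g] assms gt le by (smt (verit))
  then have "abs3 x ^ 4 \<le> abs3 x ^ 2" by (simp add: abs3_power)
  then show False using gt power_strict_increasing[of 2 4 "abs3 x"] by simp
qed

text \<open>Inequalities take the place of equations because rational approximations satisfy the
  equations of the generators of \<open>K2\<close> only up to a small error. They first force
  integrality and then yield the congruences.\<close>

lemma no_3adic_solution:
  assumes B: "abs3 (b ^ 2 - 7) \<le> 1/9" and C: "abs3 (c ^ 2 - 19) \<le> 1/9"
    and A: "abs3 (a ^ 4 + 6 * a ^ 2 - 8 * a - 3) \<le> 1/9"
    and D: "abs3 (d ^ 2 - a * (- b - 2)) \<le> 1/9" and E: "abs3 (e ^ 2 - (c + 4) * b) \<le> 1/9"
  shows False
proof -
  have int: "abs3 (numeral k) \<le> 1" for k using abs3_int_le_one[of "numeral k"] by simp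
  have b1: "abs3 b \<le> 1" by (rule abs3_square_le_one[OF order_trans[OF B] int]) simp
  have c1: "abs3 c \<le> 1" by (rule abs3_square_le_one[OF order_trans[OF C] int]) simp
  have a1: "abs3 a \<le> 1" by (rule abs3_quartic_le_one[OF order_trans[OF A]]) simp
  obtain A' B' C' where abc: "cong9 a A'" "cong9 b B'" "cong9 c C'"
    using cong9_exists[OF a1] cong9_exists[OF b1] cong9_exists[OF c1] by blast
  have m1: "cong9 (- x) (- k)" if "cong9 x k" for x k
    using cong9_diff[OF cong9_of_int[of 0] that] by simp
  note cong9 = cong9_add cong9_mult cong9_diff cong9_power cong9_numeral m1 abc
  have ab: "cong9 (a * (- b - 2)) (A' * (- B' - 2))" and cb: "cong9 ((c + 4) * b) ((C' + 4) * B')"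
    by (intro cong9)+
  have d1: "abs3 d \<le> 1" by (rule abs3_square_le_one[OF order_trans[OF D] cong9_integral[OF ab]]) simp
  have e1: "abs3 e \<le> 1" by (rule abs3_square_le_one[OF order_trans[OF E] cong9_integral[OF cb]]) simp
  obtain D' E' where de: "cong9 d D'" "cong9 e E'"
    using cong9_exists[OF d1] cong9_exists[OF e1] by blast
  show False
  proof (rule mod_9_obstruction)
    show "9 dvd B' ^ 2 - 7" by (rule cong9_dvd[OF _ B]) (intro cong9)
    show "9 dvd C' ^ 2 - 19" by (rule cong9_dvd[OF _ C]) (intro cong9)
    show "9 dvd A' ^ 4 + 6 * A' ^ 2 - 8 * A' - 3" by (rule cong9_dvd[OF _ A]) (intro cong9)
    show "9 dvd D' ^ 2 - A' * (- B' - 2)" by (rule cong9_dvd[OF _ D]) (intro cong9 de ab)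
    show "9 dvd E' ^ 2 - (C' + 4) * B'" by (rule cong9_dvd[OF _ E]) (intro cong9 de cb)
  qed
qed

text \<open>Rational approximations to the generators of \<open>K2\<close> satisfy the defining
  equations up to sequences that are null 3-adically, hence with errors at most 1/9 from some index
  on.\<close>

lemma not_locally_isomorphic_K1_K2: "\<not> locally_isomorphic K1 K2"
proof
  assume iso: "locally_isomorphic K1 K2"
  obtain v where v: "v \<in> nontrivial_absolute_values K1" "\<And>r. v (of_rat r) = abs3 r"
    "\<And>x e. x \<in> K1 \<Longrightarrow> e > 0 \<Longrightarrow> \<exists>r. v (x - of_rat r) < e"
    using K1_place by metis
  note F = K2_facts(2)
  obtain w where aw: "absolute_value K2 w"
    and approx: "\<And>x. x \<in> K2 \<Longrightarrow> \<exists>R. limit_in K2 w (\<lambda>n. of_rat (R n)) x"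
    and null: "\<And>Q. limit_in K2 w (\<lambda>n. of_rat (Q n)) 0 \<Longrightarrow> (\<lambda>n. abs3 (Q n)) \<longlonglongrightarrow> 0"
    using locally_isomorphic_rational_approximation[OF K1_facts(2) F v iso] by metis
  have mem: "sqrt_7 \<in> K2" "sqrt_19 \<in> K2" "zz \<in> K2" "theta \<in> K2" "yb \<in> K2"
    using E4_mem K2_facts(3,4) by auto
  obtain a b c d e where
    a: "limit_in K2 w (\<lambda>n. of_rat (a n)) theta" and b: "limit_in K2 w (\<lambda>n. of_rat (b n)) sqrt_7" and
    c: "limit_in K2 w (\<lambda>n. of_rat (c n)) sqrt_19" and d: "limit_in K2 w (\<lambda>n. of_rat (d n)) yb" and
    e: "limit_in K2 w (\<lambda>n. of_rat (e n)) zz"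
    using approx[OF mem(1)] approx[OF mem(2)] approx[OF mem(3)] approx[OF mem(4)] approx[OF mem(5)]
    by blast
  have const: "limit_in K2 w (\<lambda>n. of_rat r) (of_rat r)" for r
    using Rats_subset_csubfield[OF F] by (intro limit_in_const[OF F aw]) auto
  note add = limit_in_add[OF F aw] and mult = limit_in_mult[OF F aw]
  have minus: "limit_in K2 w (\<lambda>n. of_rat (- R n)) (- x)"
    if "limit_in K2 w (\<lambda>n. of_rat (R n)) x" for R x
    using mult[OF const[of "- 1"] that] by (simp add: of_rat_minus)
  have plus: "limit_in K2 w (\<lambda>n. of_rat (R n + S n)) (x + y)"
    and times: "limit_in K2 w (\<lambda>n. of_rat (R n * S n)) (x * y)"
    if "limit_in K2 w (\<lambda>n. of_rat (R n)) x" "limit_in K2 w (\<lambda>n. of_rat (S n)) y" for R S x y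
    using add[OF that] mult[OF that] by (simp_all add: of_rat_add of_rat_mult)
  have diff: "limit_in K2 w (\<lambda>n. of_rat (R n - S n)) (x - y)"
    if "limit_in K2 w (\<lambda>n. of_rat (R n)) x" "limit_in K2 w (\<lambda>n. of_rat (S n)) y" for R S x y
    using plus[OF that(1) minus[OF that(2)]] by simp
  have power: "limit_in K2 w (\<lambda>n. of_rat (R n ^ k)) (x ^ k)"
    if "limit_in K2 w (\<lambda>n. of_rat (R n)) x" for R x k
    using const[of 1] by (induction k) (simp_all add: times[OF that])
  have num: "limit_in K2 w (\<lambda>n. of_rat (numeral k)) (numeral k)" for k
    using const[of "numeral k"] by simp
  have small: "\<forall>\<^sub>F n in sequentially. abs3 (Q n) \<le> 1/9"
    if "limit_in K2 w (\<lambda>n. of_rat (Q n)) x" "x = 0" for Q x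
    using order_tendstoD(2)[OF null, of Q "1/9"] that by (auto elim: eventually_mono)
  have "\<forall>\<^sub>F n in sequentially. abs3 (b n ^ 2 - 7) \<le> 1/9"
    by (rule small[OF diff[OF power[OF b] num]]) (simp add: sqrt_squares)
  moreover have "\<forall>\<^sub>F n in sequentially. abs3 (c n ^ 2 - 19) \<le> 1/9"
    by (rule small[OF diff[OF power[OF c] num]]) (simp add: sqrt_squares)
  moreover have "\<forall>\<^sub>F n in sequentially. abs3 (a n ^ 4 + 6 * a n ^ 2 - 8 * a n - 3) \<le> 1/9"
    by (rule small[OF diff[OF diff[OF plus[OF power[OF a] times[OF num power[OF a]]] times[OF num a]] num]]) (rule theta_quartic)
  moreover have "\<forall>\<^sub>F n in sequentially. abs3 (d n ^ 2 - a n * (- b n - 2)) \<le> 1/9"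
    by (rule small[OF diff[OF power[OF d] times[OF a diff[OF minus[OF b] num]]]]) (simp add: yb_square)
  moreover have "\<forall>\<^sub>F n in sequentially. abs3 (e n ^ 2 - (c n + 4) * b n) \<le> 1/9"
    by (rule small[OF diff[OF power[OF e] times[OF plus[OF c num] b]]]) (simp add: sqrt_squares lam_def)
  ultimately have "\<forall>\<^sub>F n in sequentially. False"
    by eventually_elim (rule no_3adic_solution)
  then show False by simp
qed

theorem mainTheorem3:
  shows "\<exists>K1 K2 L :: complex set.
    number_field K1 \<and> number_field K2 \<and>
    galois_closure K1 L \<and> galois_closure K2 L \<and>
    locally_integrally_equivalent (galois_group L \<rat>)
      (carrier (galois_group L K1)) (carrier (galois_group L K2)) \<and>
    \<not> locally_isomorphic K1 K2"
  using K1_facts(1) K2_facts(1) galois_closure_K locally_integrally_equivalent_H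
    not_locally_isomorphic_K1_K2
  by blast

end
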